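(* Let $\alpha,\beta,\gamma$ be nonzero real constants with $|\gamma|\neq 0,1$. Let $s_1=\frac12-$ and $s_2=1-$ with $s_2<2s_1$; that is, $s_1<\frac12$ is sufficiently close to $\frac12$, $\frac12<s_2<1$ is sufficiently close to $1$, and $s_2<2s_1$. Then the Schrödinger–Benjamin–Ono system $$i u_t+u_{xx}=\alpha vu,\qquad v_t+\gamma\mathcal{H}v_{xx}=\beta(|u|^2)_x,\qquad (u,v)|_{t=0}=(u_0,v_0),\qquad x\in\mathbb{T},$$ is locally well-posed in $\mathrm{H}^{s_1,s_2}(\mathbb{T})=H^{s_1,s_2}(\mathbb{T})\times H^{s_1-\frac12,\,s_2-\frac12}(\mathbb{T})$.
   Context: $\mathbb{T}=[0,2\pi)$ with periodic boundary conditions; $u$ is complex-valued, $v$ is real-valued. $\mathcal{H}$ is the Hilbert transform with Fourier multiplier $-i\,\mathrm{sgn}(n)$. $\langle\cdot\rangle=1+|\cdot|$. The space $H^{r_1,r_2}(\mathbb{T})$ is defined by the norm $\|\phi\|_{H^{r_1,r_2}}=\|\phi\|_{H^{r_1}}+\sup_{n\in\mathbb{Z}}\langle n\rangle^{r_2}|\widehat{\phi}(n)|$, where $H^{r_1}$ is the usual Sobolev space. Modified Bourgain spaces. For functions on $\mathbb{T}\times\mathbb{R}$ with space-time Fourier transform $\widehat{u}(n,\tau)$, $n\in\mathbb{Z}$, $\tau\in\mathbb{R}$: $$\|u\|_{X^{r_1,r_2,b}}=\|\langle n\rangle^{r_1}\langle\tau+n^2\rangle^b\widehat{u}\|_{L^2_{n,\tau}}+\|\langle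 n\rangle^{r_2}\langle\tau+n^2\rangle^b\widehat{u}\|_{L^\infty_nL^2_\tau},$$ $$\|v\|_{X_\gamma^{r_1,r_2,b}}=\|\langle n\rangle^{r_1}\langle\tau+\gamma|n|n\rangle^b\widehat{v}\|_{L^2_{n,\tau}}+\|\langle n\rangle^{r_2}\langle\tau+\gamma|n|n\rangle^b\widehat{v}\|_{L^\infty_nL^2_\tau}.$$ For $T>0$, the local-in-time versions on $[-T,T]$ are defined by taking the infimum of the norms of all extensions to $\mathbb{T}\times\mathbb{R}$. Locally well-posed in $\mathrm{H}^{s_1,s_2}(\mathbb{T})$ means, for $b>\frac12$ sufficiently close to $\frac12$: for every $(u_0,v_0)\in\mathrm{H}^{s_1,s_2}(\mathbb{T})$ there is $T>0$, depending only on $\|(u_0,v_0)\|_{\mathrm{H}^{s_1,s_2}}$ (and the fixed parameters), and a unique solution $(u,v)$ on $[-T,T]$ in the local-in-time space $X^{s_1,s_2,b}\times X_\gamma^{s_1-\frac12,s_2-\frac12,b}$ of the Duhamel equations $$u(t)=U(t)u_0-i\alpha\int_0^tU(t-t')(uv)(t')\,dt',\qquad v(t)=V(t)v_0+\beta\int_0^tV(t-t')\partial_x(|u|^2)(t')\,dt',$$ with $U(t)=e^{it\partial_x^2}$, $V(t)=e^{-\gamma t\mathcal{H}\partial_x^2}$, and the solution depends continuously in this space on $(u_0,v_0)$. For $b>\frac12$ the local-in-time norm controls $\sup_{|t|\le T}\|(u(t),v(t))\|_{\mathrm{H}^{s_1,s_2}}$. *)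

theory Defs
  imports "HOL-Analysis.Analysis"
begin

section \<open>Periodic distributions\<close>

definition vderiv :: "(real \<Rightarrow> complex) \<Rightarrow> real \<Rightarrow> complex" where
  "vderiv \<phi> = (\<lambda>x. vector_derivative \<phi> (at x))"

definition smooth_periodic :: "(real \<Rightarrow> complex) set" where
  "smooth_periodic = {\<phi>. (\<forall>x. \<phi> (x + 2 * pi) = \<phi> x) \<and>
     (\<forall>k x. (vderiv ^^ k) \<phi> differentiable (at x))}"

text \<open>The data \<open>v\<^sub>0\<close> has negative Sobolev regularity, so the elements of the function spaces on the
  circle are distributions: continuous (complex-)linear functionals on \<^const>\<open>smooth_periodic\<close>.
  A function \<open>f\<close> corresponds to \<open>\<phi> \<mapsto> \<integral> f \<phi>\<close> over one period (no conjugation). The last clause below is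
  continuity with respect to the sup norms of the derivatives of order at most \<open>N\<close>. Functionals are set to \<open>0\<close> outside
  the space of test functions, so that equality in the type is equality of distributions.\<close>

definition distribution :: "((real \<Rightarrow> complex) \<Rightarrow> complex) \<Rightarrow> bool" where
  "distribution D \<longleftrightarrow>
    (\<forall>\<phi>. \<phi> \<notin> smooth_periodic \<longrightarrow> D \<phi> = 0) \<and>
    (\<forall>\<phi>\<in>smooth_periodic. \<forall>\<psi>\<in>smooth_periodic. \<forall>c. D (\<lambda>x. c * \<phi> x + \<psi> x) = c * D \<phi> + D \<psi>) \<and>
    (\<exists>C N. \<forall>\<phi>\<in>smooth_periodic. \<forall>M.
       (\<forall>k\<le>N. \<forall>x. norm ((vderiv ^^ k) \<phi> x) \<le> M) \<longrightarrow> norm (D \<phi>) \<le> C * M)"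

typedef pdist = "{D. distribution D}"
  morphisms pairing Abs_pdist
  by (rule exI[of _ "\<lambda>_. 0"]) (auto simp: distribution_def intro: exI[of _ 0])

setup_lifting type_definition_pdist

instantiation pdist :: minus
begin

lift_definition minus_pdist :: "pdist \<Rightarrow> pdist \<Rightarrow> pdist" is "\<lambda>D E \<phi>. D \<phi> - E \<phi>"
proof -
  fix D E :: "(real \<Rightarrow> complex) \<Rightarrow> complex"
  assume D: "distribution D" and E: "distribution E"
  obtain C N where C: "\<And>\<phi> M. \<phi> \<in> smooth_periodic \<Longrightarrow>
      (\<forall>k\<le>N. \<forall>x. norm ((vderiv ^^ k) \<phi> x) \<le> M) \<Longrightarrow> norm (D \<phi>) \<le> C * M"
    using D unfolding distribution_def by blast
  obtain C' N' where C': "\<And>\<phi> M. \<phi> \<in> smooth_periodic \<Longrightarrow>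
      (\<forall>k\<le>N'. \<forall>x. norm ((vderiv ^^ k) \<phi> x) \<le> M) \<Longrightarrow> norm (E \<phi>) \<le> C' * M"
    using E unfolding distribution_def by blast
  have "norm (D \<phi> - E \<phi>) \<le> (C + C') * M" if "\<phi> \<in> smooth_periodic"
    and "\<forall>k\<le>max N N'. \<forall>x. norm ((vderiv ^^ k) \<phi> x) \<le> M" for \<phi> M
  proof -
    have "norm (D \<phi>) \<le> C * M" "norm (E \<phi>) \<le> C' * M"
      using that by (auto intro!: C C')
    then show ?thesis
      using norm_triangle_ineq4[of "D \<phi>" "E \<phi>"] by (simp add: distrib_right)
  qed
  then have "\<exists>C N. \<forall>\<phi>\<in>smooth_periodic. \<forall>M.
       (\<forall>k\<le>N. \<forall>x. norm ((vderiv ^^ k) \<phi> x) \<le> M) \<longrightarrow> norm (D \<phi> - E \<phi>) \<le> C * M"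
    by blast
  then show "distribution (\<lambda>\<phi>. D \<phi> - E \<phi>)"
    using D E by (simp add: distribution_def algebra_simps)
qed

instance ..

end

definition fcoeff :: "pdist \<Rightarrow> int \<Rightarrow> complex" where
  "fcoeff f n = pairing f (\<lambda>x. exp (- \<i> * of_int n * of_real x)) / (2 * of_real pi)"

definition real_valued :: "pdist \<Rightarrow> bool" where
  "real_valued f \<longleftrightarrow> (\<forall>\<phi>\<in>smooth_periodic. pairing f (\<lambda>x. cnj (\<phi> x)) = cnj (pairing f \<phi>))"


section \<open>Norms\<close>

text \<open>All norms take values in \<open>[0, \<infinity>]\<close>; membership in a space means that its norm is finite.\<close>

definition jb :: "real \<Rightarrow> real" where
  "jb x = 1 + \<bar>x\<bar>"

definition esqrt :: "ennreal \<Rightarrow> ennreal" where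
  "esqrt x = (if x = \<infinity> then \<infinity> else ennreal (sqrt (enn2real x)))"

definition H_norm :: "real \<Rightarrow> real \<Rightarrow> pdist \<Rightarrow> ennreal" where
  "H_norm r1 r2 f =
     esqrt (\<integral>\<^sup>+ n. ennreal ((jb (of_int n) powr r1 * norm (fcoeff f n))\<^sup>2) \<partial>count_space UNIV)
     + (SUP n. ennreal (jb (of_int n) powr r2 * norm (fcoeff f n)))"

definition data_norm :: "real \<Rightarrow> real \<Rightarrow> pdist \<Rightarrow> pdist \<Rightarrow> ennreal" where
  "data_norm s1 s2 u0 v0 = H_norm s1 s2 u0 + H_norm (s1 - 1/2) (s2 - 1/2) v0"

text \<open>A function (distribution) on the circle times the line is a family of periodic distributions
  indexed by time. The space-time Fourier transform is identified through the inversion formula in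
  time. Asking for an integrable transform loses nothing in the Bourgain spaces with \<open>b > 1/2\<close>: by
  Cauchy-Schwarz, finiteness of the weighted \<open>L\<^sup>2\<close> norm in \<open>\<tau>\<close> forces it. It also selects the
  representative that is continuous in time. The transform is unique almost everywhere.\<close>

definition has_spacetime_fourier :: "(real \<Rightarrow> pdist) \<Rightarrow> (int \<Rightarrow> real \<Rightarrow> complex) \<Rightarrow> bool" where
  "has_spacetime_fourier u F \<longleftrightarrow>
     (\<forall>n. integrable lborel (F n)) \<and>
     (\<forall>t n. fcoeff (u t) n =
        (LINT \<tau>|lborel. F n \<tau> * exp (\<i> * of_real (t * \<tau>))) / (2 * of_real pi))"

text \<open>\<open>\<omega>\<close> is the dispersion relation: the weight is \<open>\<langle>\<tau> + \<omega>(n)\<rangle>\<close>.\<close>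

definition weighted_norm ::
  "(int \<Rightarrow> real) \<Rightarrow> real \<Rightarrow> real \<Rightarrow> real \<Rightarrow> (int \<Rightarrow> real \<Rightarrow> complex) \<Rightarrow> ennreal" where
  "weighted_norm \<omega> r1 r2 b F =
     esqrt (\<integral>\<^sup>+ n. (\<integral>\<^sup>+ \<tau>. ennreal ((jb (of_int n) powr r1 * jb (\<tau> + \<omega> n) powr b * norm (F n \<tau>))\<^sup>2)
        \<partial>lborel) \<partial>count_space UNIV)
     + (SUP n. esqrt (\<integral>\<^sup>+ \<tau>. ennreal ((jb (of_int n) powr r2 * jb (\<tau> + \<omega> n) powr b * norm (F n \<tau>))\<^sup>2)
        \<partial>lborel))"

text \<open>Since the transform is unique almost everywhere, the infimum below runs over a single value,
  or over the empty set, in which case it is \<open>\<infinity>\<close>.\<close>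

definition bourgain_norm ::
  "(int \<Rightarrow> real) \<Rightarrow> real \<Rightarrow> real \<Rightarrow> real \<Rightarrow> (real \<Rightarrow> pdist) \<Rightarrow> ennreal" where
  "bourgain_norm \<omega> r1 r2 b u = (INF F\<in>{F. has_spacetime_fourier u F}. weighted_norm \<omega> r1 r2 b F)"

definition local_bourgain_norm ::
  "(int \<Rightarrow> real) \<Rightarrow> real \<Rightarrow> real \<Rightarrow> real \<Rightarrow> real \<Rightarrow> (real \<Rightarrow> pdist) \<Rightarrow> ennreal" where
  "local_bourgain_norm \<omega> r1 r2 b T u =
     (INF w\<in>{w. \<forall>t\<in>{-T..T}. w t = u t}. bourgain_norm \<omega> r1 r2 b w)"

definition XT_norm :: "real \<Rightarrow> real \<Rightarrow> real \<Rightarrow> real \<Rightarrow> (real \<Rightarrow> pdist) \<Rightarrow> ennreal" where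
  "XT_norm = local_bourgain_norm (\<lambda>n. (of_int n)\<^sup>2)"

definition XgT_norm :: "real \<Rightarrow> real \<Rightarrow> real \<Rightarrow> real \<Rightarrow> real \<Rightarrow> (real \<Rightarrow> pdist) \<Rightarrow> ennreal" where
  "XgT_norm \<gamma> = local_bourgain_norm (\<lambda>n. \<gamma> * \<bar>of_int n\<bar> * of_int n)"


section \<open>The Duhamel equations\<close>

definition dx_symbol :: "int \<Rightarrow> complex" where
  "dx_symbol n = \<i> * of_int n"

definition hilbert_symbol :: "int \<Rightarrow> complex" where
  "hilbert_symbol n = - \<i> * of_int (sgn n)"

definition U_symbol :: "real \<Rightarrow> int \<Rightarrow> complex" where
  "U_symbol t n = exp (\<i> * of_real t * (dx_symbol n)\<^sup>2)"

definition V_symbol :: "real \<Rightarrow> real \<Rightarrow> int \<Rightarrow> complex" where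
  "V_symbol \<gamma> t n = exp (- of_real \<gamma> * of_real t * hilbert_symbol n * (dx_symbol n)\<^sup>2)"

text \<open>Products of distributions are given by the convolution of Fourier coefficients whenever it
  converges absolutely. The coefficients of \<open>|u|\<^sup>2\<close> are those of the product of \<open>u\<close> and its complex
  conjugate, whose coefficient at \<open>k\<close> is the conjugate of that of \<open>u\<close> at \<open>-k\<close>.\<close>

definition conv_summable :: "(int \<Rightarrow> complex) \<Rightarrow> (int \<Rightarrow> complex) \<Rightarrow> bool" where
  "conv_summable a b \<longleftrightarrow> (\<forall>n. (\<lambda>k. norm (a (n - k) * b k)) summable_on UNIV)"

definition conv :: "(int \<Rightarrow> complex) \<Rightarrow> (int \<Rightarrow> complex) \<Rightarrow> int \<Rightarrow> complex" where
  "conv a b n = (\<Sum>\<^sub>\<infinity>k. a (n - k) * b k)"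

definition conj_coeff :: "(int \<Rightarrow> complex) \<Rightarrow> int \<Rightarrow> complex" where
  "conj_coeff a n = cnj (a (- n))"

definition duhamel_u ::
  "real \<Rightarrow> real \<Rightarrow> pdist \<Rightarrow> (real \<Rightarrow> pdist) \<Rightarrow> (real \<Rightarrow> pdist) \<Rightarrow> bool" where
  "duhamel_u \<alpha> T u0 u v \<longleftrightarrow>
     (\<forall>t\<in>{-T..T}. conv_summable (fcoeff (u t)) (fcoeff (v t))) \<and>
     (\<forall>t\<in>{-T..T}. \<forall>n.
        interval_lebesgue_integrable lborel (ereal 0) (ereal t)
          (\<lambda>t'. U_symbol (t - t') n * conv (fcoeff (u t')) (fcoeff (v t')) n) \<and>
        fcoeff (u t) n = U_symbol t n * fcoeff u0 n
          - \<i> * of_real \<alpha> * (LBINT t'=ereal 0..ereal t.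
              U_symbol (t - t') n * conv (fcoeff (u t')) (fcoeff (v t')) n))"

definition duhamel_v ::
  "real \<Rightarrow> real \<Rightarrow> real \<Rightarrow> pdist \<Rightarrow> (real \<Rightarrow> pdist) \<Rightarrow> (real \<Rightarrow> pdist) \<Rightarrow> bool" where
  "duhamel_v \<beta> \<gamma> T v0 u v \<longleftrightarrow>
     (\<forall>t\<in>{-T..T}. conv_summable (fcoeff (u t)) (conj_coeff (fcoeff (u t)))) \<and>
     (\<forall>t\<in>{-T..T}. \<forall>n.
        interval_lebesgue_integrable lborel (ereal 0) (ereal t)
          (\<lambda>t'. V_symbol \<gamma> (t - t') n *
             (dx_symbol n * conv (fcoeff (u t')) (conj_coeff (fcoeff (u t'))) n)) \<and>
        fcoeff (v t) n = V_symbol \<gamma> t n * fcoeff v0 n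
          + of_real \<beta> * (LBINT t'=ereal 0..ereal t.
              V_symbol \<gamma> (t - t') n *
                (dx_symbol n * conv (fcoeff (u t')) (conj_coeff (fcoeff (u t'))) n)))"


section \<open>Local well-posedness\<close>

text \<open>Only the values of \<open>u\<close> and \<open>v\<close> on \<open>[-T, T]\<close> are relevant.\<close>

definition SBO_solution :: "real \<Rightarrow> real \<Rightarrow> real \<Rightarrow> real \<Rightarrow> real \<Rightarrow> real \<Rightarrow> real \<Rightarrow>
    pdist \<Rightarrow> pdist \<Rightarrow> (real \<Rightarrow> pdist) \<Rightarrow> (real \<Rightarrow> pdist) \<Rightarrow> bool" where
  "SBO_solution \<alpha> \<beta> \<gamma> s1 s2 b T u0 v0 u v \<longleftrightarrow>
     XT_norm s1 s2 b T u < \<infinity> \<and>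
     XgT_norm \<gamma> (s1 - 1/2) (s2 - 1/2) b T v < \<infinity> \<and>
     (\<forall>t\<in>{-T..T}. real_valued (v t)) \<and>
     duhamel_u \<alpha> T u0 u v \<and>
     duhamel_v \<beta> \<gamma> T v0 u v"

text \<open>The existence time depends only on an upper bound \<open>R\<close> for the size of the data (and on the
  parameters). Continuity of the solution map at data of norm \<open>r\<close> is thus continuity in a full
  neighbourhood once \<open>R > r\<close>, with a common existence time.\<close>

definition SBO_locally_well_posed :: "real \<Rightarrow> real \<Rightarrow> real \<Rightarrow> real \<Rightarrow> real \<Rightarrow> bool" where
  "SBO_locally_well_posed \<alpha> \<beta> \<gamma> s1 s2 \<longleftrightarrow>
    (\<exists>b0>1/2. \<forall>b. 1/2 < b \<and> b < b0 \<longrightarrow> (\<forall>R>0. \<exists>T>0.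
      (\<forall>u0 v0. real_valued v0 \<and> data_norm s1 s2 u0 v0 \<le> ennreal R \<longrightarrow>
        (\<exists>u v. SBO_solution \<alpha> \<beta> \<gamma> s1 s2 b T u0 v0 u v \<and>
          (\<forall>u' v'. SBO_solution \<alpha> \<beta> \<gamma> s1 s2 b T u0 v0 u' v' \<longrightarrow>
            (\<forall>t\<in>{-T..T}. u' t = u t \<and> v' t = v t)))) \<and>
      (\<forall>u0 v0 u v. real_valued v0 \<and> data_norm s1 s2 u0 v0 \<le> ennreal R \<and>
          SBO_solution \<alpha> \<beta> \<gamma> s1 s2 b T u0 v0 u v \<longrightarrow>
        (\<forall>\<epsilon>>0. \<exists>\<delta>>0. \<forall>u0' v0' u' v'.
          real_valued v0' \<and> data_norm s1 s2 u0' v0' \<le> ennreal R \<and>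
          SBO_solution \<alpha> \<beta> \<gamma> s1 s2 b T u0' v0' u' v' \<and>
          data_norm s1 s2 (u0' - u0) (v0' - v0) < ennreal \<delta> \<longrightarrow>
          XT_norm s1 s2 b T (\<lambda>t. u' t - u t) +
            XgT_norm \<gamma> (s1 - 1/2) (s2 - 1/2) b T (\<lambda>t. v' t - v t) < ennreal \<epsilon>))))"

end

theory Submission
  imports Defs "HOL-Probability.Probability"
begin

text \<open>Undoing the free evolutions turns a pair of functions in the Bourgain spaces into a pair of
  profiles, for which both modulation weights become \<open>\<langle>\<tau>\<rangle>\<^sup>b\<close> and each Duhamel term becomes a bilinear
  oscillatory integral with the phase \<open>k (2 n - k - \<gamma> |k|)\<close> for \<open>u\<close> and
  \<open>n (\<gamma> |n| - n + 2 k)\<close> for \<open>v\<close>. The convolution of two profiles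
  costs nothing because \<open>b > 1/2\<close>, and the Duhamel integral, cut off at time \<open>T\<close>, gains
  the power \<open>-7/16\<close> of the phase and the factor \<open>T\<close> to the power \<open>9/16 - b\<close>. Since
  \<open>|\<gamma>| \<noteq> 1\<close>, the factors of the phases are comparable to the frequencies except near one resonant
  value of \<open>k\<close>. As the data have weight \<open>\<langle>n\<rangle>\<close> to a power close to \<open>1\<close> in the supremum part of the norm,
  this bounds the supremum part of the Duhamel terms with \<open>1/16\<close> of a derivative to spare; together with
  \<open>s\<^sub>1 < 1/2\<close> and \<open>s\<^sub>2\<close> close to \<open>1\<close> the spare power makes the square sum finite as well. A contraction
  argument gives existence and Lipschitz dependence. For uniqueness among solutions of any size,
  the difference of two solutions is halved repeatedly on short time intervals, which are
  moved along \<open>[-T, T]\<close> by translation in time.\<close>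

section \<open>Square norms\<close>

text \<open>The modulation estimate gains a power \<open>a < 1/2\<close> of the phase provided
  \<open>a + b \<le> 1\<close>. Since \<open>b > 1/2\<close>, the power \<open>1 - a - b\<close> of
  \<open>T\<close> stays positive only for \<open>a\<close> below \<open>1/2\<close>;
  \<open>a = 7/16\<close> leaves \<open>9/16 - b\<close>. The obstacle is resonance: there the phase
  is bounded and returns nothing for the derivative in the equation for \<open>v\<close>. However,
  both input frequencies are then at least comparable to the output frequency, so two decay rates of
  almost one full power each pay. Such pointwise decay is what the supremum part of the norm
  provides. Its price is that the output decays only like the power \<open>- s2 - 1/16\<close>,
  which is square summable against the weight \<open>s1\<close> just when \<open>s2\<close> is close
  enough to \<open>1\<close>. The zero mode of \<open>v\<close> has phase zero for every
  \<open>n\<close> and is treated apart: it multiplies \<open>u\<close> by a bounded factor and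
  needs no smoothing. Only the bilinear terms are cut off at time \<open>T\<close>; the free
  evolution is cut off at time \<open>1\<close>, so its bound does not depend on \<open>T\<close>
  and small \<open>T\<close> alone yields the contraction.\<close>

lemma esqrt_square [simp]: "esqrt (x\<^sup>2) = x"
proof (cases x)
  case (real r)
  then have "x\<^sup>2 = ennreal (r\<^sup>2)" by (simp add: ennreal_power)
  then show ?thesis using real by (simp add: esqrt_def)
next
  case top
  then show ?thesis by (simp add: esqrt_def)
qed

lemma square_esqrt [simp]: "(esqrt x)\<^sup>2 = x"
  by (cases x) (auto simp: esqrt_def ennreal_power)

lemma ennreal_le_iff_square_le: "(x :: ennreal) \<le> y \<longleftrightarrow> x\<^sup>2 \<le> y\<^sup>2"
proof
  assume "x\<^sup>2 \<le> y\<^sup>2"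
  show "x \<le> y"
  proof (rule ccontr)
    assume "\<not> x \<le> y"
    then have "y < x" by simp
    moreover from this have "y < top" using top.not_eq_extremum by fastforce
    ultimately have "y * y < x * x"
      by (cases x; cases y) (auto simp: ennreal_mult[symmetric] ennreal_less_iff ennreal_mult_less_top intro!: mult_strict_mono')
    with \<open>x\<^sup>2 \<le> y\<^sup>2\<close> show False by (simp add: power2_eq_square)
  qed
qed (simp add: power2_eq_square mult_mono)

lemma esqrt_le_iff: "esqrt x \<le> y \<longleftrightarrow> x \<le> y\<^sup>2"
  by (metis ennreal_le_iff_square_le square_esqrt)

lemma esqrt_mono: "x \<le> y \<Longrightarrow> esqrt x \<le> esqrt y"
  by (simp add: esqrt_le_iff)

lemma esqrt_mult: "esqrt (x * y) = esqrt x * esqrt y"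
proof -
  have "x * y = (esqrt x * esqrt y)\<^sup>2" by (simp add: power_mult_distrib)
  then show ?thesis by (metis esqrt_square)
qed

lemma esqrt_less_top_iff [simp]: "esqrt x < top \<longleftrightarrow> x < top"
  by (simp add: esqrt_def top.not_eq_extremum)

text \<open>Values in [0, \<infinity>] make every norm estimate meaningful before integrability is
  known. The measure will be \<open>lborel\<close> for the modulation and a counting measure for the
  frequency.\<close>

definition l2norm :: "'a measure \<Rightarrow> ('a \<Rightarrow> ennreal) \<Rightarrow> ennreal" where
  "l2norm M h = esqrt (\<integral>\<^sup>+x. (h x)\<^sup>2 \<partial>M)"

lemma l2norm_mono: "(\<And>x. x \<in> space M \<Longrightarrow> f x \<le> g x) \<Longrightarrow> l2norm M f \<le> l2norm M g"
  unfolding l2norm_def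
  by (intro esqrt_mono nn_integral_mono) (simp add: power2_eq_square mult_mono)

lemma l2norm_cong: "(\<And>x. x \<in> space M \<Longrightarrow> f x = g x) \<Longrightarrow> l2norm M f = l2norm M g"
  by (intro antisym l2norm_mono) auto

lemma l2norm_cmult:
  assumes "f \<in> borel_measurable M"
  shows "l2norm M (\<lambda>x. c * f x) = c * l2norm M f"
  using assms by (simp add: l2norm_def power_mult_distrib nn_integral_cmult esqrt_mult)

lemma l2norm_zero [simp]: "l2norm M (\<lambda>x. 0) = 0"
  by (simp add: l2norm_def esqrt_def)

lemma nn_integral_mult_le_l2norm:
  assumes "f \<in> borel_measurable M" "g \<in> borel_measurable M"
  shows "(\<integral>\<^sup>+x. f x * g x \<partial>M) \<le> l2norm M f * l2norm M g"
  using Cauchy_Schwarz_nn_integral[OF assms]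
  by (subst ennreal_le_iff_square_le) (simp add: l2norm_def power_mult_distrib)

text \<open>Minkowski's integral inequality. The square of the inner integral is expanded into a
  double integral over \<open>N\<close>, and Cauchy-Schwarz in \<open>M\<close> is applied to each
  pair of slices, so no possibly infinite norm has to be divided out.\<close>

lemma l2norm_nn_integral_le:
  assumes "sigma_finite_measure M" "sigma_finite_measure N"
    and [measurable]: "case_prod h \<in> borel_measurable (M \<Otimes>\<^sub>M N)"
  shows "l2norm M (\<lambda>x. \<integral>\<^sup>+y. h x y \<partial>N) \<le> (\<integral>\<^sup>+y. l2norm M (\<lambda>x. h x y) \<partial>N)"
proof -
  interpret M: sigma_finite_measure M by fact
  interpret N: sigma_finite_measure N by fact
  interpret pair_sigma_finite M N ..
  have h1: "h x \<in> borel_measurable N" if "x \<in> space M" for x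
    using measurable_Pair2[OF assms(3) that] by simp
  have h2: "(\<lambda>x. h x y) \<in> borel_measurable M" if "y \<in> space N" for y
    using measurable_Pair1[OF assms(3) that] by simp
  have L [measurable]: "(\<lambda>y. l2norm M (\<lambda>x. h x y)) \<in> borel_measurable N"
  proof -
    have "esqrt \<in> borel_measurable borel"
      by (simp add: esqrt_def[abs_def])
    then show ?thesis unfolding l2norm_def
      by (rule measurable_compose[rotated]) measurable
  qed
  let ?H = "\<lambda>x. \<integral>\<^sup>+y. h x y \<partial>N"
  have "(\<integral>\<^sup>+x. (?H x)\<^sup>2 \<partial>M) = (\<integral>\<^sup>+x. \<integral>\<^sup>+y. ?H x * h x y \<partial>N \<partial>M)"
    by (intro nn_integral_cong) (simp add: power2_eq_square h1 nn_integral_cmult)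
  also have "\<dots> = (\<integral>\<^sup>+y. \<integral>\<^sup>+x. ?H x * h x y \<partial>M \<partial>N)"
    by (rule Fubini'[symmetric]) measurable
  also have "\<dots> \<le> (\<integral>\<^sup>+y. (\<integral>\<^sup>+z. l2norm M (\<lambda>x. h x z) \<partial>N) * l2norm M (\<lambda>x. h x y) \<partial>N)"
  proof (intro nn_integral_mono)
    fix y assume y: "y \<in> space N"
    note [measurable] = h2[OF y]
    have "(\<integral>\<^sup>+x. ?H x * h x y \<partial>M) = (\<integral>\<^sup>+x. \<integral>\<^sup>+z. h x z * h x y \<partial>N \<partial>M)"
      by (intro nn_integral_cong) (simp add: h1 nn_integral_multc)
    also have "\<dots> = (\<integral>\<^sup>+z. \<integral>\<^sup>+x. h x z * h x y \<partial>M \<partial>N)"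
      by (rule Fubini'[symmetric]) measurable
    also have "\<dots> \<le> (\<integral>\<^sup>+z. l2norm M (\<lambda>x. h x z) * l2norm M (\<lambda>x. h x y) \<partial>N)"
      by (intro nn_integral_mono nn_integral_mult_le_l2norm h2 y)
    also have "\<dots> = (\<integral>\<^sup>+z. l2norm M (\<lambda>x. h x z) \<partial>N) * l2norm M (\<lambda>x. h x y)"
      by (simp add: nn_integral_multc)
    finally show "(\<integral>\<^sup>+x. ?H x * h x y \<partial>M) \<le> \<dots>" .
  qed
  also have "\<dots> = (\<integral>\<^sup>+y. l2norm M (\<lambda>x. h x y) \<partial>N)\<^sup>2"
    by (simp add: nn_integral_cmult power2_eq_square)
  finally show ?thesis
    by (simp add: l2norm_def esqrt_le_iff)
qed

lemma l2norm_add_le: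
  assumes [measurable]: "f \<in> borel_measurable M" "g \<in> borel_measurable M"
  shows "l2norm M (\<lambda>x. f x + g x) \<le> l2norm M f + l2norm M g"
proof -
  have "(\<integral>\<^sup>+x. (f x + g x)\<^sup>2 \<partial>M) = (\<integral>\<^sup>+x. (f x)\<^sup>2 + 2 * (f x * g x) + (g x)\<^sup>2 \<partial>M)"
    by (simp only: power2_sum ac_simps)
  also have "\<dots> = (\<integral>\<^sup>+x. (f x)\<^sup>2 \<partial>M) + 2 * (\<integral>\<^sup>+x. f x * g x \<partial>M) + (\<integral>\<^sup>+x. (g x)\<^sup>2 \<partial>M)"
    by (simp add: nn_integral_add nn_integral_cmult)
  also have "\<dots> \<le> (l2norm M f)\<^sup>2 + 2 * (l2norm M f * l2norm M g) + (l2norm M g)\<^sup>2"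
    by (intro add_mono mult_left_mono nn_integral_mult_le_l2norm) (auto simp: l2norm_def)
  also have "\<dots> = (l2norm M f + l2norm M g)\<^sup>2"
    by (simp only: power2_sum ac_simps)
  finally show ?thesis
    by (simp add: l2norm_def esqrt_le_iff)
qed

lemma l2norm_eq_0_iff:
  assumes [measurable]: "f \<in> borel_measurable M"
  shows "l2norm M f = 0 \<longleftrightarrow> (AE x in M. f x = 0)"
proof -
  have "l2norm M f = 0 \<longleftrightarrow> (\<integral>\<^sup>+x. (f x)\<^sup>2 \<partial>M) = 0"
    by (metis l2norm_def square_esqrt esqrt_square zero_power2)
  then show ?thesis by (simp add: nn_integral_0_iff_AE)
qed

lemma l2norm_translate:
  fixes f :: "real \<Rightarrow> ennreal"
  assumes [measurable]: "f \<in> borel_measurable borel"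
  shows "l2norm lborel (\<lambda>x. f (x + c)) = l2norm lborel f"
  using nn_integral_real_affine[of "\<lambda>x. (f x)\<^sup>2" 1 c] by (simp add: l2norm_def add.commute)

lemma l2norm_uminus:
  fixes f :: "real \<Rightarrow> ennreal"
  assumes [measurable]: "f \<in> borel_measurable borel"
  shows "l2norm lborel (\<lambda>x. f (- x)) = l2norm lborel f"
  using nn_integral_real_affine[of "\<lambda>x. (f x)\<^sup>2" "-1" 0] by (simp add: l2norm_def)

lemma l2norm_dilate:
  fixes f :: "real \<Rightarrow> ennreal"
  assumes [measurable]: "f \<in> borel_measurable borel" and "T > 0"
  shows "l2norm lborel (\<lambda>x. f (T * x)) = ennreal (T powr (-1/2)) * l2norm lborel f"
proof -
  have "(\<integral>\<^sup>+x. (f x)\<^sup>2 \<partial>lborel) = T * (\<integral>\<^sup>+x. (f (T * x))\<^sup>2 \<partial>lborel)"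
    using nn_integral_real_affine[of "\<lambda>x. (f x)\<^sup>2" T 0] assms by simp
  then have "ennreal (1 / T) * (\<integral>\<^sup>+x. (f x)\<^sup>2 \<partial>lborel) = (\<integral>\<^sup>+x. (f (T * x))\<^sup>2 \<partial>lborel)"
    using assms(2) by (simp add: mult.assoc[symmetric] ennreal_mult[symmetric])
  moreover have "esqrt (ennreal (1 / T)) = ennreal (T powr (-1/2))"
  proof -
    have "T powr (- (1/2)) = sqrt (1 / T)"
      using assms(2) by (simp only: powr_minus_divide powr_half_sqrt real_sqrt_divide real_sqrt_one less_imp_le)
    then show ?thesis using assms(2) by (simp add: esqrt_def)
  qed
  ultimately show ?thesis
    unfolding l2norm_def by (metis esqrt_mult)
qed

section \<open>Resonances\<close>

lemma jb_ge_1 [simp]: "1 \<le> jb x"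
  by (simp add: jb_def)

lemma jb_pos [simp]: "0 < jb x"
  by (simp add: jb_def add_pos_nonneg)

lemma jb_nonneg [simp]: "0 \<le> jb x"
  by (simp add: less_imp_le)

lemma jb_minus [simp]: "jb (- x) = jb x"
  by (simp add: jb_def)

text \<open>A multiplicative Peetre inequality: it survives taking powers, which is how weights are
  moved from one frequency or modulation to another.\<close>

lemma jb_add_le: "jb (x + y) \<le> jb x * jb y"
proof -
  have "jb x * jb y = 1 + (\<bar>x\<bar> + \<bar>y\<bar>) + \<bar>x\<bar> * \<bar>y\<bar>"
    by (simp add: jb_def algebra_simps)
  moreover have "0 \<le> \<bar>x\<bar> * \<bar>y\<bar>" by (rule mult_nonneg_nonneg) auto
  ultimately show ?thesis
    using abs_triangle_ineq[of x y] unfolding jb_def[of "x + y"] by linarith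
qed

lemma jb_diff_le: "jb (x - y) \<le> jb x * jb y"
  using jb_add_le[of x "- y"] by simp

lemma measurable_jb [measurable]: "jb \<in> borel_measurable borel"
  unfolding jb_def[abs_def] by measurable

lemma jb_powr_eq_exp: "jb x powr e = exp (e * ln (jb x))"
  by (simp add: powr_def less_imp_neq[symmetric])

lemma nn_integral_jb_powr_finite:
  assumes "s > 1"
  shows "(\<integral>\<^sup>+x. ennreal (jb x powr (- s)) \<partial>lborel) < \<infinity>"
proof -
  have half: "(\<integral>\<^sup>+x. ennreal ((1 + x) powr (- s)) * indicator {0..} x \<partial>lborel) = ennreal (0 - (1 + 0) powr (1 - s) / (1 - s))"
  proof (rule nn_integral_FTC_atLeast)
    fix x :: real assume "0 \<le> x"
    then show "((\<lambda>x. (1 + x) powr (1 - s) / (1 - s)) has_real_derivative (1 + x) powr (- s)) (at x)"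
      using assms by (auto intro!: derivative_eq_intros)
    show "0 \<le> (1 + x) powr (- s)" by simp
  next
    have "((\<lambda>x::real. (1 + x) powr (1 - s)) \<longlongrightarrow> 0) at_top"
      using assms by (intro tendsto_neg_powr filterlim_tendsto_add_at_top[OF tendsto_const] filterlim_ident) auto
    from tendsto_divide[OF this tendsto_const[of "1 - s"]]
    show "((\<lambda>x. (1 + x) powr (1 - s) / (1 - s)) \<longlongrightarrow> 0) at_top"
      using assms by simp
  qed measurable
  have "(\<integral>\<^sup>+x. ennreal (jb x powr (- s)) \<partial>lborel)
      \<le> (\<integral>\<^sup>+x. ennreal ((1 + x) powr (- s)) * indicator {0..} x + ennreal ((1 + (- x)) powr (- s)) * indicator {0..} (- x) \<partial>lborel)"
    by (intro nn_integral_mono) (auto simp: jb_def indicator_def)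
  also have "\<dots> = (\<integral>\<^sup>+x. ennreal ((1 + x) powr (- s)) * indicator {0..} x \<partial>lborel)
      + (\<integral>\<^sup>+x. ennreal ((1 + (- x)) powr (- s)) * indicator {0..} (- x) \<partial>lborel)"
    by (rule nn_integral_add) measurable
  also have "(\<integral>\<^sup>+x. ennreal ((1 + (- x)) powr (- s)) * indicator {0..} (- x) \<partial>lborel)
      = (\<integral>\<^sup>+x. ennreal ((1 + x) powr (- s)) * indicator {0..} x \<partial>lborel)"
    using nn_integral_real_affine[of "\<lambda>x. ennreal ((1 + x) powr (- s)) * indicator {0..} x" "-1" 0] by simp
  also have "(\<integral>\<^sup>+x. ennreal ((1 + x) powr (- s)) * indicator {0..} x \<partial>lborel)
      + (\<integral>\<^sup>+x. ennreal ((1 + x) powr (- s)) * indicator {0..} x \<partial>lborel) < \<infinity>"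
    by (simp only: half ennreal_add_eq_top) simp
  finally show ?thesis .
qed

lemma l2norm_jb_powr_finite:
  assumes "s > 1/2"
  shows "l2norm lborel (\<lambda>x. ennreal (jb x powr (- s))) < \<infinity>"
proof -
  have "(\<lambda>x. (ennreal (jb x powr (- s)))\<^sup>2) = (\<lambda>x. ennreal (jb x powr (- (2 * s))))"
    by (auto simp: ennreal_power powr_power less_imp_neq[symmetric])
  then show ?thesis
    using nn_integral_jb_powr_finite[of "2 * s"] assms by (simp add: l2norm_def)
qed

lemma nn_integral_int_jb_powr_finite:
  assumes "s > 1"
  shows "(\<integral>\<^sup>+n. ennreal (jb (of_int n) powr (- s)) \<partial>count_space (UNIV :: int set)) < \<infinity>"
proof -
  let ?g = "\<lambda>n :: int. ennreal (jb (of_int n) powr (- s))"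
  have summ: "summable (\<lambda>m :: nat. jb (of_nat m) powr (- s))"
  proof -
    have "summable (\<lambda>m. of_nat (Suc m) powr (- s) :: real)"
      using assms summable_real_powr_iff[of "- s"] by (subst summable_Suc_iff) simp
    then show ?thesis by (simp add: jb_def)
  qed
  have A: "(\<integral>\<^sup>+n. ?g n \<partial>count_space (range h)) = (\<integral>\<^sup>+m. ennreal (jb (of_nat m) powr (- s)) \<partial>count_space UNIV)"
    if "inj h" "\<And>m. \<bar>h m\<bar> = int m" for h :: "nat \<Rightarrow> int"
  proof -
    have "jb (of_int (h m)) = jb (of_nat m)" for m
      using that(2)[of m] by (simp add: jb_def flip: of_int_abs)
    then show ?thesis
      using that(1) by (subst nn_integral_bij_count_space[symmetric, of h UNIV]) (auto simp: bij_betw_def)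
  qed
  have fin: "(\<integral>\<^sup>+m. ennreal (jb (of_nat m) powr (- s)) \<partial>count_space (UNIV :: nat set)) < \<infinity>"
    using summ by (simp add: nn_integral_count_space_nat suminf_ennreal2 )
  have "(\<integral>\<^sup>+n. ?g n \<partial>count_space UNIV)
     \<le> (\<integral>\<^sup>+n. ?g n * indicator (range int) n + ?g n * indicator (range (\<lambda>m. - int m)) n \<partial>count_space UNIV)"
  proof (intro nn_integral_mono)
    fix n :: int
    have "n \<in> range int \<or> n \<in> range (\<lambda>m. - int m)"
      by (cases n rule: int_cases2) auto
    then show "?g n \<le> ?g n * indicator (range int) n + ?g n * indicator (range (\<lambda>m. - int m)) n"
      by (auto simp: indicator_def)
  qed
  also have "\<dots> = (\<integral>\<^sup>+n. ?g n \<partial>count_space (range int)) + (\<integral>\<^sup>+n. ?g n \<partial>count_space (range (\<lambda>m. - int m)))"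
    by (subst nn_integral_add) (auto simp: nn_integral_count_space_indicator)
  also have "\<dots> < \<infinity>"
    using fin by (subst (1 2) A) (auto simp: inj_on_def)
  finally show ?thesis .
qed

text \<open>The points \<open>x + \<rho> * k\<close> are equally spaced. Rounding
  \<open>x / \<rho>\<close> to an integer \<open>m\<close> makes them comparable to
  \<open>k + m\<close> with a constant independent of \<open>x\<close>, and the sum over
  \<open>k\<close> does not see the shift by \<open>m\<close>.\<close>

lemma nn_integral_affine_jb_powr_bounded:
  assumes "s > 1" and "\<rho> \<noteq> 0"
  obtains C where "C > 0"
    and "\<And>x. (\<integral>\<^sup>+k. ennreal (jb (x + \<rho> * of_int k) powr (- s)) \<partial>count_space (UNIV :: int set)) \<le> ennreal C"
proof -
  \<comment> \<open>The 2 absorbs the rounding error and the 1 inside the bracket, the quotient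
    absorbs the rescaling by \<rho>.\<close>
  define D where "D = 2 + 1 / \<bar>\<rho>\<bar>"
  define S where "S = (\<integral>\<^sup>+n. ennreal (jb (of_int n) powr (- s)) \<partial>count_space (UNIV :: int set))"
  have S: "S < \<infinity>" unfolding S_def by (rule nn_integral_int_jb_powr_finite) fact
  have D: "D > 0" using assms by (simp add: D_def add_pos_nonneg)
  have B: "(\<integral>\<^sup>+k. ennreal (jb (x + \<rho> * of_int k) powr (- s)) \<partial>count_space (UNIV :: int set)) \<le> ennreal (D powr s) * S" for x
  proof -
    define m where "m = \<lfloor>x / \<rho>\<rfloor>"
    have le: "jb (x + \<rho> * of_int k) powr (- s) \<le> D powr s * jb (of_int (k + m)) powr (- s)" for k :: int
    proof -
      have m: "\<bar>of_int m - x / \<rho>\<bar> \<le> 1" unfolding m_def by linarith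
      have "jb (of_int (k + m)) \<le> 2 + \<bar>x / \<rho> + of_int k\<bar>"
        using m by (auto simp: jb_def)
      also have "x / \<rho> + of_int k = (x + \<rho> * of_int k) / \<rho>" using assms by (simp add: field_simps)
      also have "2 + \<bar>(x + \<rho> * of_int k) / \<rho>\<bar> \<le> D * jb (x + \<rho> * of_int k)"
      proof -
        have "2 + t / r \<le> (2 + 1 / r) * (1 + t)" if "t \<ge> 0" "r > 0" for t r :: real
        proof -
          have "(2 + 1 / r) * (1 + t) = 2 + t / r + (2 * t + 1 / r)" by (simp add: ring_distribs)
          then show ?thesis using that by simp
        qed
        from this[of "\<bar>x + \<rho> * of_int k\<bar>" "\<bar>\<rho>\<bar>"] show ?thesis
          using assms by (simp add: D_def jb_def abs_divide)
      qed
      finally have "jb (of_int (k + m)) \<le> D * jb (x + \<rho> * of_int k)" .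
      then have "(D * jb (x + \<rho> * of_int k)) powr (- s) \<le> jb (of_int (k + m)) powr (- s)"
        using assms by (intro powr_mono2') auto
      then have "D powr s * (D powr (- s) * jb (x + \<rho> * of_int k) powr (- s)) \<le> D powr s * jb (of_int (k + m)) powr (- s)"
        using D by (intro mult_left_mono) (auto simp: powr_mult)
      then show ?thesis using D by (simp add: mult.assoc[symmetric] powr_add[symmetric])
    qed
    have "(\<integral>\<^sup>+k. ennreal (jb (x + \<rho> * of_int k) powr (- s)) \<partial>count_space (UNIV :: int set))
        \<le> (\<integral>\<^sup>+k. ennreal (D powr s) * ennreal (jb (of_int (k + m)) powr (- s)) \<partial>count_space (UNIV :: int set))"
      using le by (intro nn_integral_mono) (simp add: ennreal_mult[symmetric])
    also have "\<dots> = ennreal (D powr s) * (\<integral>\<^sup>+k. ennreal (jb (of_int (k + m)) powr (- s)) \<partial>count_space (UNIV :: int set))"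
      by (rule nn_integral_cmult) simp
    also have "(\<integral>\<^sup>+k. ennreal (jb (of_int (k + m)) powr (- s)) \<partial>count_space (UNIV :: int set)) = S"
      unfolding S_def
      by (rule nn_integral_bij_count_space) (rule bij_betwI[where g = "\<lambda>k. k - m"], auto)
    finally show ?thesis .
  qed
  have "ennreal (D powr s) * S \<le> ennreal (D powr s * enn2real S + 1)"
    using S by (cases S) (auto simp: ennreal_mult[symmetric])
  note * = order_trans[OF B this]
  have "0 < D powr s * enn2real S + 1"
    by (intro add_nonneg_pos mult_nonneg_nonneg) auto
  from that[OF this *] show ?thesis .
qed

section \<open>Comparison of frequencies on a logarithmic scale\<close>

lemma ln_jb_nonneg [simp]: "0 \<le> ln (jb x)"
  by simp

text \<open>For logarithms of brackets, comparability up to a factor is an inequality up to an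
  additive constant, and products of powers become linear forms. The case analysis of the resonances
  thereby reduces to linear arithmetic.\<close>

lemma ln_jb_le_max:
  assumes "\<bar>x\<bar> \<le> A * (\<bar>y\<bar> + \<bar>z\<bar>)" and "A \<ge> 1" and "ln (2 * A) \<le> K"
  shows "ln (jb x) \<le> K + ln (jb y) \<or> ln (jb x) \<le> K + ln (jb z)"
proof -
  have *: "ln (jb x) \<le> K + ln (jb w)" if "\<bar>y\<bar> \<le> \<bar>w\<bar>" "\<bar>z\<bar> \<le> \<bar>w\<bar>" for w
  proof -
    have "A * (\<bar>y\<bar> + \<bar>z\<bar>) \<le> A * (2 * \<bar>w\<bar>)"
      using that assms by (intro mult_left_mono) auto
    then have "jb x \<le> (2 * A) * jb w"
      using assms by (simp add: jb_def algebra_simps)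
    then have "ln (jb x) \<le> ln ((2 * A) * jb w)"
      using assms by (subst ln_le_cancel_iff) auto
    moreover have "ln ((2 * A) * jb w) = ln (2 * A) + ln (jb w)"
      using assms by (intro ln_mult_pos) auto
    ultimately show ?thesis using assms by linarith
  qed
  show ?thesis
  proof (cases "\<bar>y\<bar> \<le> \<bar>z\<bar>")
    case True
    with *[of z] show ?thesis by simp
  next
    case False
    with *[of y] show ?thesis by simp
  qed
qed

text \<open>The bracket of a product is comparable to the product of the brackets once both factors
  are at least 1 in modulus. A nonzero integer always is; the second alternative records that
  \<open>L\<close> is small, which is the resonant case.\<close>

lemma ln_jb_product:
  fixes k :: int
  assumes "k \<noteq> 0" and "ln 4 \<le> K"
  shows "ln (jb (of_int k)) + ln (jb L) \<le> K + ln (jb (of_int k * L)) \<or> ln (jb L) \<le> K"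
proof (cases "\<bar>L\<bar> \<le> 1")
  case True
  then have "ln (jb L) \<le> ln 4"
    by (subst ln_le_cancel_iff) (auto simp: jb_def)
  with assms show ?thesis by linarith
next
  case False
  have k: "\<bar>of_int k :: real\<bar> \<ge> 1" using assms by (simp flip: of_int_abs)
  have "(1 + x) * (1 + y) \<le> 4 * (1 + x * y)" if "x \<ge> 1" "y \<ge> 1" for x y :: real
  proof -
    have "0 \<le> (x - 1) * (y - 1) + 2 + 2 * (x * y)"
      using that by (intro add_nonneg_nonneg mult_nonneg_nonneg) auto
    then show ?thesis by (simp add: algebra_simps)
  qed
  from this[of "\<bar>of_int k\<bar>" "\<bar>L\<bar>"] False k
  have "jb (of_int k) * jb L \<le> 4 * jb (of_int k * L)"
    by (simp add: jb_def abs_mult)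
  then have "ln (jb (of_int k) * jb L) \<le> ln (4 * jb (of_int k * L))"
    by (subst ln_le_cancel_iff) auto
  moreover have "ln (jb (of_int k) * jb L) = ln (jb (of_int k)) + ln (jb L)"
    "ln (4 * jb (of_int k * L)) = ln 4 + ln (jb (of_int k * L))"
    by (intro ln_mult_pos; simp)+
  ultimately show ?thesis using assms by linarith
qed

text \<open>Decay in the smallest of three quantities is not summable in one fixed variable;
  bounding it by the sum of the three decays makes each piece summable in \<open>k\<close>.\<close>

lemma exp_neg_min_le:
  fixes s :: real
  assumes "E \<le> K - s * min Y (min Z W)" and "s \<ge> 0"
  shows "exp E \<le> exp K * (exp (- s * Y) + exp (- s * Z) + exp (- s * W))"
proof -
  have *: "exp E \<le> exp K * (exp (- s * Y) + exp (- s * Z) + exp (- s * W))"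
    if "E \<le> K - s * V" "V \<in> {Y, Z, W}" for V
  proof -
    have "exp E \<le> exp (K - s * V)" using that by simp
    also have "\<dots> = exp K * exp (- s * V)" by (simp add: exp_add[symmetric])
    also have "\<dots> \<le> exp K * (exp (- s * Y) + exp (- s * Z) + exp (- s * W))"
      using that(2) by (intro mult_left_mono) (auto simp: add_nonneg_nonneg)
    finally show ?thesis .
  qed
  have "min Y (min Z W) \<in> {Y, Z, W}" by (auto simp: min_def)
  from *[OF assms(1) this] show ?thesis .
qed

text \<open>\<open>n\<close> is the output frequency, \<open>k\<close> that of the second factor: \<open>v\<close>, respectively the conjugate of \<open>u\<close>.\<close>

definition phase_u :: "real \<Rightarrow> int \<Rightarrow> int \<Rightarrow> real" where
  "phase_u \<gamma> n k = of_int k * (2 * of_int n - of_int k - \<gamma> * \<bar>of_int k\<bar>)"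

definition phase_v :: "real \<Rightarrow> int \<Rightarrow> int \<Rightarrow> real" where
  "phase_v \<gamma> n k = of_int n * (\<gamma> * \<bar>of_int n\<bar> - of_int n + 2 * of_int k)"

text \<open>Depending on the sign of \<open>x\<close>, the right sides are multiples of
  \<open>x\<close> by \<open>1 - \<gamma>\<close> or \<open>1 + \<gamma>\<close>, and both factors
  have modulus at least the distance of the modulus of \<gamma> from 1.\<close>

lemma resonance_separation:
  fixes \<gamma> x :: real
  shows "\<bar>\<bar>\<gamma>\<bar> - 1\<bar> * \<bar>x\<bar> \<le> \<bar>x - \<gamma> * \<bar>x\<bar>\<bar>" "\<bar>\<bar>\<gamma>\<bar> - 1\<bar> * \<bar>x\<bar> \<le> \<bar>x + \<gamma> * \<bar>x\<bar>\<bar>"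
proof -
  have "\<bar>\<bar>\<gamma>\<bar> - 1\<bar> \<le> \<bar>1 - \<gamma>\<bar>" "\<bar>\<bar>\<gamma>\<bar> - 1\<bar> \<le> \<bar>1 + \<gamma>\<bar>" by auto
  from this[THEN mult_right_mono[of _ _ "\<bar>x\<bar>"]]
  have *: "\<bar>\<bar>\<gamma>\<bar> - 1\<bar> * \<bar>x\<bar> \<le> \<bar>(1 - \<gamma>) * x\<bar>" "\<bar>\<bar>\<gamma>\<bar> - 1\<bar> * \<bar>x\<bar> \<le> \<bar>(1 + \<gamma>) * x\<bar>"
    by (simp_all add: abs_mult)
  show "\<bar>\<bar>\<gamma>\<bar> - 1\<bar> * \<bar>x\<bar> \<le> \<bar>x - \<gamma> * \<bar>x\<bar>\<bar>" "\<bar>\<bar>\<gamma>\<bar> - 1\<bar> * \<bar>x\<bar> \<le> \<bar>x + \<gamma> * \<bar>x\<bar>\<bar>"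
    using * by (cases "x \<ge> 0"; simp add: algebra_simps abs_if split: if_splits)+
qed

text \<open>With \<open>L\<close> the second factor of the phase: \<open>L\<close> and
  \<open>k\<close> cannot both be much smaller than \<open>n\<close>, nor can \<open>k\<close> and
  \<open>n - k\<close>, and \<open>L\<close> and \<open>n - k\<close> cannot both be much smaller
  than \<open>k\<close>. Off resonance the phase gains the power 7/16 of both \<open>k\<close> and
  \<open>L\<close>. At resonance \<open>L\<close> is bounded, so its weight on the right is of order
  one and only the powers of \<open>n\<close> have to be balanced.\<close>

lemma phase_u_term_bound:
  fixes \<gamma> p :: real
  assumes \<gamma>: "\<bar>\<gamma>\<bar> \<noteq> 1" and p: "31/32 < p" "p < 1"
  obtains C where "C > 0" and "\<And>n k :: int. k \<noteq> 0 \<Longrightarrow>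
      jb (phase_u \<gamma> n k) powr (-(7/16)) * jb (of_int (n - k)) powr (- p) * jb (of_int k) powr (-(p - 1/2))
      \<le> C * jb (of_int n) powr (- p - 1/16) * (jb (of_int k) powr (-(9/8))
          + jb (2 * of_int n - of_int k - \<gamma> * \<bar>of_int k\<bar>) powr (-(9/8)) + jb (of_int (n - k)) powr (-(9/8)))"
proof -
  \<comment> \<open>One constant for all three comparisons below; the last quotient comes from
    dividing by the resonance gap.\<close>
  define A where "A = 2 + \<bar>\<gamma>\<bar> + 2 / \<bar>\<bar>\<gamma>\<bar> - 1\<bar>"
  have A1: "A \<ge> 1" by (simp add: A_def)
  define K where "K = max (ln (2 * A)) (ln 4)"
  have K: "ln (2 * A) \<le> K" "ln 4 \<le> K" by (auto simp: K_def)
  have "(0::real) \<le> ln 4" by simp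
  with K have K0: "K \<ge> 0" by linarith
  show ?thesis
  \<comment> \<open>Each comparison loses at most one additive \<open>K\<close>; 20 is a generous
    count of these losses.\<close>
  proof (rule that[of "exp (20 * K)"])
    fix n k :: int assume k: "k \<noteq> 0"
    define L where "L = 2 * of_int n - of_int k - \<gamma> * \<bar>of_int k :: real\<bar>"
    define X Y Z W P where "X = ln (jb (of_int n))" and "Y = ln (jb (of_int k))" and "Z = ln (jb L)"
      and "W = ln (jb (of_int (n - k)))" and "P = ln (jb (phase_u \<gamma> n k))"
    have nonneg: "X \<ge> 0" "Y \<ge> 0" "Z \<ge> 0" "W \<ge> 0" "P \<ge> 0"
      by (simp_all add: X_def Y_def Z_def W_def P_def)
    have "2 * \<bar>of_int n :: real\<bar> \<le> \<bar>L\<bar> + \<bar>of_int k\<bar> + \<bar>\<gamma> * \<bar>of_int k\<bar>\<bar>"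
      unfolding L_def by linarith
    also have "\<dots> \<le> A * (\<bar>L\<bar> + \<bar>of_int k\<bar>)"
    proof -
      have "1 * \<bar>L\<bar> \<le> A * \<bar>L\<bar>" "(1 + \<bar>\<gamma>\<bar>) * \<bar>of_int k :: real\<bar> \<le> A * \<bar>of_int k\<bar>"
        by (intro mult_right_mono; simp add: A_def)+
      then show ?thesis by (simp add: abs_mult algebra_simps)
    qed
    finally have a: "X \<le> K + Z \<or> X \<le> K + Y"
      unfolding X_def Y_def Z_def using A1 K by (intro ln_jb_le_max[where A = A]) auto
    have b: "X \<le> K + Y \<or> X \<le> K + W"
    proof -
      have "\<bar>of_int n :: real\<bar> \<le> 1 * (\<bar>of_int k\<bar> + \<bar>of_int (n - k)\<bar>)" by simp
      also have "\<dots> \<le> A * (\<bar>of_int k\<bar> + \<bar>of_int (n - k)\<bar>)"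
        using A1 by (intro mult_right_mono) auto
      finally show ?thesis
        unfolding X_def Y_def W_def using A1 K by (intro ln_jb_le_max[where A = A]) auto
    qed
    have c: "Y \<le> K + Z \<or> Y \<le> K + W"
    proof -
      have "\<bar>\<bar>\<gamma>\<bar> - 1\<bar> * \<bar>of_int k :: real\<bar> \<le> \<bar>of_int k - \<gamma> * \<bar>of_int k\<bar>\<bar>"
        by (rule resonance_separation)
      also have "\<dots> \<le> \<bar>L\<bar> + 2 * \<bar>of_int (n - k)\<bar>"
        unfolding L_def by (simp add: abs_if)
      also have "\<dots> \<le> 2 * (\<bar>L\<bar> + \<bar>of_int (n - k)\<bar>)" by simp
      finally have "\<bar>of_int k :: real\<bar> \<le> 2 / \<bar>\<bar>\<gamma>\<bar> - 1\<bar> * (\<bar>L\<bar> + \<bar>of_int (n - k)\<bar>)"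
        using \<gamma> by (simp add: field_simps)
      also have "\<dots> \<le> A * (\<bar>L\<bar> + \<bar>of_int (n - k)\<bar>)"
        by (intro mult_right_mono) (auto simp: A_def)
      finally show ?thesis
        unfolding Z_def Y_def W_def using A1 K by (intro ln_jb_le_max[where A = A]) auto
    qed
    \<comment> \<open>Either the phase is as large as the product of its factors, or it is resonant
      and \<open>L\<close> is bounded.\<close>
    have d: "Y + Z \<le> K + P \<or> Z \<le> K"
      using ln_jb_product[OF k K(2), of L] by (simp add: Y_def Z_def P_def phase_u_def L_def)
    have pY: "31/32 * Y \<le> p * Y" using p nonneg by (intro mult_right_mono) auto
    have pW: "31/32 * W \<le> p * W" using p nonneg by (intro mult_right_mono) auto
    have pX: "p * X \<le> X" using p nonneg by (intro mult_left_le_one_le) auto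
    have pXW: "p * X - p * W \<le> K" if "X \<le> K + W"
    proof -
      have "p * (X - W) \<le> p * K" using that p by (intro mult_left_mono) auto
      also have "\<dots> \<le> K" using p K0 by (intro mult_left_le_one_le) auto
      finally show ?thesis by (simp add: algebra_simps)
    qed
    have pXW': "p * X - p * W \<le> X - W" if "W \<le> X"
    proof -
      have "p * (X - W) \<le> X - W" using that p by (intro mult_left_le_one_le) auto
      then show ?thesis by (simp add: algebra_simps)
    qed
    have main: "- (7/16) * P - p * W - (p - 1/2) * Y \<le> 20 * K + (- p - 1/16) * X - 9/8 * min Y (min Z W)"
    proof -
      \<comment> \<open>The products with \<open>p\<close> become atoms, about which only linear
        facts are kept, so the remaining inequality is linear.\<close>
      define pY' pW' pX' where "pY' = p * Y" and "pW' = p * W" and "pX' = p * X"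
      have "- (7/16) * P - pW' - pY' + 1/2 * Y \<le> 20 * K - pX' - 1/16 * X - 9/8 * min Y (min Z W)"
      proof -
        define m where "m = min Y (min Z W)"
        have m: "m \<le> Y" "m \<le> Z" "m \<le> W" by (auto simp: m_def)
        note pW pX pY
        note f = this[folded pY'_def pW'_def pX'_def]
        have "- (7/16) * P - pW' - pY' + 1/2 * Y \<le> 20 * K - pX' - 1/16 * X - 9/8 * m"
        proof (cases "X \<le> K + W")
          case True
          note g = pXW[OF True, folded pW'_def pX'_def]
          from a d show ?thesis
            by (elim disjE) (use nonneg f g K0 m True in linarith)+
        next
          case False
          with K0 have "W \<le> X" by linarith
          note g = pXW'[OF this, folded pW'_def pX'_def]
          from False b have b': "X \<le> K + Y" by blast
          from c d show ?thesis
            by (elim disjE) (use nonneg f g K0 m False b' in linarith)+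
        qed
        then show ?thesis by (simp only: m_def)
      qed
      then show ?thesis by (simp add: pY'_def pW'_def pX'_def algebra_simps)
    qed
    have "jb (phase_u \<gamma> n k) powr (-(7/16)) * jb (of_int (n - k)) powr (- p) * jb (of_int k) powr (-(p - 1/2))
      = exp (- (7/16) * P - p * W - (p - 1/2) * Y)"
      unfolding jb_powr_eq_exp P_def W_def Y_def by (simp add: exp_add[symmetric] algebra_simps)
    also have "\<dots> \<le> exp (20 * K + (- p - 1/16) * X) * (exp (- (9/8) * Y) + exp (- (9/8) * Z) + exp (- (9/8) * W))"
      by (rule exp_neg_min_le[OF main]) simp
    also have "\<dots> = exp (20 * K) * jb (of_int n) powr (- p - 1/16) * (jb (of_int k) powr (-(9/8))
          + jb L powr (-(9/8)) + jb (of_int (n - k)) powr (-(9/8)))"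
      unfolding jb_powr_eq_exp X_def W_def Y_def Z_def by (simp add: exp_add)
    finally show "jb (phase_u \<gamma> n k) powr (-(7/16)) * jb (of_int (n - k)) powr (- p) * jb (of_int k) powr (-(p - 1/2))
      \<le> exp (20 * K) * jb (of_int n) powr (- p - 1/16) * (jb (of_int k) powr (-(9/8))
          + jb (2 * of_int n - of_int k - \<gamma> * \<bar>of_int k\<bar>) powr (-(9/8)) + jb (of_int (n - k)) powr (-(9/8)))"
      by (simp only: L_def)
  qed simp
qed

text \<open>The derivative and the output weight must be paid for. If \<open>L\<close>, the second
  factor of the phase, is much smaller than \<open>n\<close>, then both \<open>k\<close> and
  \<open>n - k\<close> are at least comparable to \<open>n\<close> and their two weights pay.
  Otherwise the phase \<open>n * L\<close> has size at least about \<open>n\<close> squared and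
  returns 7/8 of the derivative, while the larger of \<open>k\<close> and \<open>n - k\<close> pays
  for the output weight.\<close>

lemma phase_v_term_bound:
  fixes \<gamma> p :: real
  assumes \<gamma>: "\<bar>\<gamma>\<bar> \<noteq> 1" and p: "31/32 < p" "p < 1"
  obtains C where "C > 0" and "\<And>n k :: int.
      \<bar>of_int n\<bar> * jb (phase_v \<gamma> n k) powr (-(7/16)) * jb (of_int (n - k)) powr (- p) * jb (of_int k) powr (- p)
      \<le> C * jb (of_int n) powr (- (p - 1/2) - 1/16) * (jb (of_int k) powr (-(9/8))
          + jb (\<gamma> * \<bar>of_int n\<bar> - of_int n + 2 * of_int k) powr (-(9/8)) + jb (of_int (n - k)) powr (-(9/8)))"
proof -
  define A where "A = 2 + 2 / \<bar>\<bar>\<gamma>\<bar> - 1\<bar>"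
  have A1: "A \<ge> 1" by (simp add: A_def)
  define K where "K = max (ln (2 * A)) (ln 4)"
  have K: "ln (2 * A) \<le> K" "ln 4 \<le> K" by (auto simp: K_def)
  have "(0::real) \<le> ln 4" by simp
  with K have K0: "K \<ge> 0" by linarith
  show ?thesis
  proof (rule that[of "exp (20 * K)"])
    fix n k :: int
    define L where "L = \<gamma> * \<bar>of_int n\<bar> - of_int n + 2 * (of_int k :: real)"
    define X Y Z W P where "X = ln (jb (of_int n))" and "Y = ln (jb (of_int k))" and "Z = ln (jb L)"
      and "W = ln (jb (of_int (n - k)))" and "P = ln (jb (phase_v \<gamma> n k))"
    have nonneg: "X \<ge> 0" "Y \<ge> 0" "Z \<ge> 0" "W \<ge> 0" "P \<ge> 0"
      by (simp_all add: X_def Y_def Z_def W_def P_def)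
    have res: "X \<le> K + Z \<or> X \<le> K + ln (jb y)"
      if "\<bar>\<bar>\<gamma>\<bar> - 1\<bar> * \<bar>of_int n :: real\<bar> \<le> \<bar>L\<bar> + 2 * \<bar>y\<bar>" for y
    proof -
      have "\<bar>L\<bar> + 2 * \<bar>y\<bar> \<le> 2 * (\<bar>L\<bar> + \<bar>y\<bar>)" by simp
      with that have "\<bar>\<bar>\<gamma>\<bar> - 1\<bar> * \<bar>of_int n :: real\<bar> \<le> 2 * (\<bar>L\<bar> + \<bar>y\<bar>)" by linarith
      then have "\<bar>of_int n :: real\<bar> \<le> 2 / \<bar>\<bar>\<gamma>\<bar> - 1\<bar> * (\<bar>L\<bar> + \<bar>y\<bar>)"
        using \<gamma> by (simp add: field_simps)
      also have "\<dots> \<le> A * (\<bar>L\<bar> + \<bar>y\<bar>)"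
        by (intro mult_right_mono) (auto simp: A_def)
      finally show ?thesis
        unfolding X_def Z_def using A1 K by (intro ln_jb_le_max[where A = A]) auto
    qed
    have a: "X \<le> K + Z \<or> X \<le> K + Y"
      unfolding Y_def
      by (rule res, rule order_trans[OF resonance_separation(1)]) (simp add: L_def abs_if)
    have c: "X \<le> K + Z \<or> X \<le> K + W"
      unfolding W_def
      by (rule res, rule order_trans[OF resonance_separation(2)]) (simp add: L_def abs_if)
    have b: "X \<le> K + Y \<or> X \<le> K + W"
    proof -
      have "\<bar>of_int n :: real\<bar> \<le> 1 * (\<bar>of_int k\<bar> + \<bar>of_int (n - k)\<bar>)" by simp
      also have "\<dots> \<le> A * (\<bar>of_int k\<bar> + \<bar>of_int (n - k)\<bar>)"
        using A1 by (intro mult_right_mono) auto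
      finally show ?thesis
        unfolding X_def Y_def W_def using A1 K by (intro ln_jb_le_max[where A = A]) auto
    qed
    show "\<bar>of_int n\<bar> * jb (phase_v \<gamma> n k) powr (-(7/16)) * jb (of_int (n - k)) powr (- p) * jb (of_int k) powr (- p)
      \<le> exp (20 * K) * jb (of_int n) powr (- (p - 1/2) - 1/16) * (jb (of_int k) powr (-(9/8))
          + jb (\<gamma> * \<bar>of_int n\<bar> - of_int n + 2 * of_int k) powr (-(9/8)) + jb (of_int (n - k)) powr (-(9/8)))"
    \<comment> \<open>At \<open>n = 0\<close> the phase vanishes for every \<open>k\<close>, but so
      does the derivative factor.\<close>
    proof (cases "n = 0")
      case False
      have d: "X + Z \<le> K + P \<or> Z \<le> K"
        using ln_jb_product[OF False K(2), of L] by (simp add: X_def Z_def P_def phase_v_def L_def)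
      have pY: "31/32 * Y \<le> p * Y" using p nonneg by (intro mult_right_mono) auto
      have pW: "31/32 * W \<le> p * W" using p nonneg by (intro mult_right_mono) auto
      have pX: "31/32 * X \<le> p * X" using p nonneg by (intro mult_right_mono) auto
      have pXV: "p * X - p * V \<le> K" if "X \<le> K + V" for V
      proof -
        have "p * (X - V) \<le> p * K" using that p by (intro mult_left_mono) auto
        also have "\<dots> \<le> K" using p K0 by (intro mult_left_le_one_le) auto
        finally show ?thesis by (simp add: algebra_simps)
      qed
      have pXV': "31/32 * V - 31/32 * X \<le> p * V - p * X" if "X \<le> V" for V
      proof -
        have "31/32 * (V - X) \<le> p * (V - X)" using that p by (intro mult_right_mono) auto
        then show ?thesis by (simp only: right_diff_distrib)
      qed
      have main: "X - (7/16) * P - p * W - p * Y \<le> 20 * K + (- (p - 1/2) - 1/16) * X - 9/8 * min Y (min Z W)"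
      proof -
        define pY' pW' pX' where "pY' = p * Y" and "pW' = p * W" and "pX' = p * X"
        have "X - (7/16) * P - pW' - pY' \<le> 20 * K - pX' + 1/2 * X - 1/16 * X - 9/8 * min Y (min Z W)"
        proof -
          define m where "m = min Y (min Z W)"
          have m: "m \<le> Y" "m \<le> Z" "m \<le> W" by (auto simp: m_def)
          note pW pX pY
          note f = this[folded pY'_def pW'_def pX'_def]
          have "X - (7/16) * P - pW' - pY' \<le> 20 * K - pX' + 1/2 * X - 1/16 * X - 9/8 * m"
          proof (cases "X \<le> K + Z")
            case True
            \<comment> \<open>The sign of \<open>X - V\<close> decides whether \<open>p\<close> is
              replaced by its lower bound 31/32 or by its upper bound 1.\<close>
            have *: "pX' - pV \<le> K - 31/32 * V + 31/32 * X \<or> pX' - pV \<le> K \<and> V \<le> X" if "X \<le> K + V" "pV = p * V" for V pV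
              using pXV[OF that(1)] pXV'[of V] K0 unfolding pX'_def that(2) by linarith
            from b have "X \<le> K + Y \<and> pX' - pY' \<le> K - 31/32 * Y + 31/32 * X \<or> X \<le> K + Y \<and> pX' - pY' \<le> K \<and> Y \<le> X
                \<or> X \<le> K + W \<and> pX' - pW' \<le> K - 31/32 * W + 31/32 * X \<or> X \<le> K + W \<and> pX' - pW' \<le> K \<and> W \<le> X"
              using *[OF _ pY'_def] *[OF _ pW'_def] by blast
            with d show ?thesis
              by (elim disjE conjE) (use nonneg f K0 m True in linarith)+
          next
            case False
            with a c have ac: "X \<le> K + Y" "X \<le> K + W" by auto
            note g = pXV[OF ac(1), folded pX'_def pY'_def] pXV[OF ac(2), folded pX'_def pW'_def]
            from d show ?thesis
              by (elim disjE) (use nonneg f g K0 m False ac in linarith)+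
          qed
          then show ?thesis by (simp only: m_def)
        qed
        then show ?thesis by (simp add: pY'_def pW'_def pX'_def algebra_simps)
      qed
      have "\<bar>of_int n\<bar> * jb (phase_v \<gamma> n k) powr (-(7/16)) * jb (of_int (n - k)) powr (- p) * jb (of_int k) powr (- p)
        \<le> exp X * jb (phase_v \<gamma> n k) powr (-(7/16)) * jb (of_int (n - k)) powr (- p) * jb (of_int k) powr (- p)"
        by (intro mult_right_mono) (auto simp: X_def jb_def)
      also have "\<dots> = exp (X - (7/16) * P - p * W - p * Y)"
        unfolding jb_powr_eq_exp P_def W_def Y_def by (simp add: exp_add[symmetric] algebra_simps)
      also have "\<dots> \<le> exp (20 * K + (- (p - 1/2) - 1/16) * X) * (exp (- (9/8) * Y) + exp (- (9/8) * Z) + exp (- (9/8) * W))"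
        by (rule exp_neg_min_le[OF main]) simp
      also have "\<dots> = exp (20 * K) * jb (of_int n) powr (- (p - 1/2) - 1/16) * (jb (of_int k) powr (-(9/8))
          + jb L powr (-(9/8)) + jb (of_int (n - k)) powr (-(9/8)))"
        unfolding jb_powr_eq_exp X_def W_def Y_def Z_def by (simp add: exp_add)
      finally show ?thesis by (simp only: L_def)
    qed (simp add: mult_nonneg_nonneg)
  qed simp
qed

section \<open>The truncated Duhamel operator\<close>

lemma cmod_iexp_diff_le: "cmod (iexp x - iexp y) \<le> \<bar>x - y\<bar>"
proof -
  have "iexp x - iexp y = iexp y * (iexp (x - y) - 1)"
    by (simp add: algebra_simps exp_add[symmetric])
  then have "cmod (iexp x - iexp y) = cmod (iexp (x - y) - 1)"
    by (simp add: norm_mult)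
  also have "\<dots> \<le> \<bar>x - y\<bar>"
    using iexp_approx1[of "x - y" 0] by simp
  finally show ?thesis .
qed

lemma abs_cos_diff_le: "\<bar>cos x - cos y\<bar> \<le> \<bar>x - y\<bar>" for x y :: real
proof -
  have "\<bar>cos x - cos y\<bar> = \<bar>Re (iexp x - iexp y)\<bar>"
    by (simp add: Re_exp)
  also have "\<dots> \<le> cmod (iexp x - iexp y)"
    by (rule abs_Re_le_cmod)
  also note cmod_iexp_diff_le
  finally show ?thesis .
qed

lemma has_integral_sinc: "((\<lambda>s. cos (s * x)) has_integral sinc x) {0..1}"
proof (cases "x = 0")
  case True
  then show ?thesis using has_integral_const_real[of "1::real" 0 1] by simp
next
  case False
  have "((\<lambda>s. cos (s * x)) has_integral (sin (1 * x) / x - sin (0 * x) / x)) {0..1}"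
    by (intro fundamental_theorem_of_calculus)
       (auto simp: False has_real_derivative_iff_has_vector_derivative[symmetric] intro!: derivative_eq_intros)
  then show ?thesis using False by simp
qed

text \<open>\<open>sinc x\<close> is the average of \<open>cos (s * x)\<close> over \<open>s\<close>
  in [0, 1], so it inherits the Lipschitz constant of the cosine, and the removable singularity at 0
  needs no separate treatment.\<close>

lemma abs_sinc_diff_le: "\<bar>sinc x - sinc y\<bar> \<le> \<bar>x - y\<bar>"
proof -
  have "((\<lambda>s. cos (s * x) - cos (s * y)) has_integral (sinc x - sinc y)) {0..1}"
    by (intro has_integral_diff has_integral_sinc)
  then have int: "((\<lambda>s. cos (s * x) - cos (s * y)) has_integral (sinc x - sinc y)) (cbox 0 1)" by simp
  have "norm (cos (s * x) - cos (s * y)) \<le> \<bar>x - y\<bar>" if "s \<in> cbox 0 1" for s :: real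
  proof -
    have "\<bar>cos (s * x) - cos (s * y)\<bar> \<le> \<bar>s * x - s * y\<bar>" by (rule abs_cos_diff_le)
    also have "\<dots> = s * \<bar>x - y\<bar>" using that by (simp add: right_diff_distrib[symmetric] abs_mult)
    also have "\<dots> \<le> \<bar>x - y\<bar>" using that by (intro mult_left_le_one_le) auto
    finally show ?thesis by simp
  qed
  from has_integral_bound[OF _ int this] show ?thesis by simp
qed

lemma abs_sinc_le_1: "\<bar>sinc x\<bar> \<le> 1"
proof -
  have "\<bar>sin x\<bar> \<le> \<bar>x\<bar>" by (rule abs_sin_x_le_abs_x)
  then show ?thesis by (auto simp: abs_divide field_simps)
qed

text \<open>The inverse Fourier transform of a continuous cutoff that is \<open>1\<close> on \<open>[-1, 1]\<close> and equals
  \<open>exp (1 - |s|)\<close> outside: explicit, and decaying like \<open>s\<^sup>-\<^sup>2\<close>, which suffices for \<open>b < 1\<close>.\<close>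

definition chi :: "real \<Rightarrow> real" where
  "chi s = (sinc s + cos s) / (pi * (1 + s\<^sup>2))"

lemma measurable_chi [measurable]: "chi \<in> borel_measurable borel"
  unfolding chi_def[abs_def] by measurable

lemma inverse_le_jb_powr: "1 / (1 + x\<^sup>2) \<le> 2 * jb x powr (- 2)"
proof -
  have "(1 + \<bar>x\<bar>)\<^sup>2 \<le> 2 * (1 + x\<^sup>2)"
  proof -
    have "0 \<le> (1 - \<bar>x\<bar>)\<^sup>2" by simp
    then show ?thesis by (simp add: power2_eq_square algebra_simps flip: abs_mult)
  qed
  moreover have "jb x powr (- 2) = 1 / (1 + \<bar>x\<bar>)\<^sup>2"
    using powr_realpow[of "jb x" 2] by (simp add: jb_def powr_minus_divide)
  moreover have "0 < (1 + \<bar>x\<bar>)\<^sup>2" "0 < 1 + x\<^sup>2" by (auto simp: add_pos_nonneg intro!: zero_less_power)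
  moreover have "1 / d \<le> 2 * (1 / e)" if "e \<le> 2 * d" "0 < e" "0 < d" for d e :: real
    using that by (simp add: field_simps)
  ultimately show ?thesis by metis
qed

lemma abs_chi_le: "\<bar>chi x\<bar> \<le> 2 * jb x powr (- 2)"
proof -
  have "\<bar>sinc x + cos x\<bar> \<le> 2"
    using abs_sinc_le_1[of x] abs_cos_le_one[of x] by linarith
  moreover have pos: "1 + x\<^sup>2 > 0" by (simp add: add_pos_nonneg)
  ultimately have "\<bar>chi x\<bar> \<le> 2 / (pi * (1 + x\<^sup>2))"
    unfolding chi_def abs_divide by (intro frac_le) (auto simp: abs_mult)
  also have "\<dots> \<le> 1 / (1 + x\<^sup>2)"
  proof -
    have "2 * (1 + x\<^sup>2) \<le> pi * (1 + x\<^sup>2)"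
      using pi_ge_two pos by (intro mult_right_mono) auto
    then show ?thesis using pos by (simp add: field_simps)
  qed
  also note inverse_le_jb_powr
  finally show ?thesis .
qed

text \<open>The kernel \<open>KT\<close> divides by \<open>l\<close>, so for small \<open>y\<close>
  the difference has to vanish linearly in \<open>y\<close> without losing the quadratic decay. The
  numerator is Lipschitz and the denominator has a relative change of order
  \<open>y\<close>.\<close>

lemma abs_chi_diff_le:
  assumes "\<bar>y\<bar> \<le> 1"
  shows "\<bar>chi (x - y) - chi x\<bar> \<le> 4 * \<bar>y\<bar> * jb (x - y) powr (- 2)"
proof -
  define a a' where "a = sinc (x - y) + cos (x - y)" and "a' = sinc x + cos x"
  define d d' where "d = 1 + (x - y)\<^sup>2" and "d' = 1 + x\<^sup>2"
  have pos: "d > 0" "d' > 0" by (auto simp: d_def d'_def add_pos_nonneg)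
  have 1: "\<bar>a - a'\<bar> \<le> 2 * \<bar>y\<bar>"
    using abs_sinc_diff_le[of "x - y" x] abs_cos_diff_le[of "x - y" x] unfolding a_def a'_def by auto
  have 2: "\<bar>a'\<bar> \<le> 2"
    unfolding a'_def using abs_sinc_le_1[of x] abs_cos_le_one[of x] by linarith
  have 3: "\<bar>d' - d\<bar> \<le> 2 * \<bar>y\<bar> * d'"
  proof -
    have "d' - d = y * (2 * x - y)" by (simp add: d_def d'_def power2_eq_square algebra_simps)
    then have "\<bar>d' - d\<bar> = \<bar>y\<bar> * \<bar>2 * x - y\<bar>" by (simp add: abs_mult)
    also have "\<dots> \<le> \<bar>y\<bar> * (2 * d')"
    proof (intro mult_left_mono)
      have "0 \<le> (1 - \<bar>x\<bar>)\<^sup>2" by simp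
      then have "2 * \<bar>x\<bar> \<le> d'" by (simp add: d'_def power2_eq_square algebra_simps flip: abs_mult)
      moreover have "1 \<le> d'" by (simp add: d'_def)
      ultimately show "\<bar>2 * x - y\<bar> \<le> 2 * d'" using assms by linarith
    qed simp
    finally show ?thesis by (simp add: algebra_simps)
  qed
  have "chi (x - y) - chi x = (a / d - a' / d') / pi"
    by (simp add: chi_def a_def a'_def d_def d'_def diff_divide_distrib mult.commute)
  also have "a / d - a' / d' = ((a - a') + a' * (d' - d) / d') / d"
    using pos by (simp add: field_simps)
  finally have "\<bar>chi (x - y) - chi x\<bar> = \<bar>(a - a') + a' * (d' - d) / d'\<bar> / d / pi"
    using pos by (simp add: abs_divide)
  also have "\<dots> \<le> (6 * \<bar>y\<bar>) / d / pi"
  proof (intro divide_right_mono)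
    have "\<bar>a' * (d' - d) / d'\<bar> \<le> 2 * (2 * \<bar>y\<bar> * d') / d'"
      using pos 2 3 unfolding abs_divide abs_mult by (intro frac_le mult_mono) auto
    also have "\<dots> = 4 * \<bar>y\<bar>" using pos by simp
    finally show "\<bar>(a - a') + a' * (d' - d) / d'\<bar> \<le> 6 * \<bar>y\<bar>"
      using 1 by linarith
  qed (use pos in auto)
  also have "\<dots> \<le> (6 * \<bar>y\<bar>) / d / 3"
    using pos pi_gt3 by (intro divide_left_mono) auto
  also have "\<dots> = 2 * \<bar>y\<bar> * (1 / d)" by simp
  also have "\<dots> \<le> 2 * \<bar>y\<bar> * (2 * jb (x - y) powr (- 2))"
    unfolding d_def by (intro mult_left_mono inverse_le_jb_powr) auto
  finally show ?thesis by simp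
qed

text \<open>\<open>KT T s l\<close> is the inverse Fourier transform, at \<open>s\<close>, of the cutoff dilated to \<open>[-T, T]\<close>
  times \<open>\<integral>\<^sub>0\<^sup>t exp (i l t') dt'\<close>.\<close>

definition KT :: "real \<Rightarrow> real \<Rightarrow> real \<Rightarrow> complex" where
  "KT T s l = of_real (T * chi (T * (s - l)) - T * chi (T * s)) / (\<i> * of_real l)"

lemma measurable_KT [measurable (raw)]:
  assumes "f \<in> borel_measurable M" "g \<in> borel_measurable M"
  shows "(\<lambda>x. KT T (f x) (g x)) \<in> borel_measurable M"
  using assms unfolding KT_def by measurable

lemma abs_chi_diff_div_le:
  "\<bar>chi (x - y) - chi x\<bar> / \<bar>y\<bar> \<le> 8 * jb y powr (- 1) * (jb (x - y) powr (- 2) + jb x powr (- 2))"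
proof (cases "\<bar>y\<bar> \<le> 1")
  case True
  \<comment> \<open>Division by 0 gives 0, so at \<open>y = 0\<close> the quotient is 0 and not the
    derivative. The same convention governs \<open>KT\<close> at \<open>l = 0\<close>, where it
    affects only a null set of phases.\<close>
  show ?thesis
  proof (cases "y = 0")
    case False
    have "\<bar>chi (x - y) - chi x\<bar> / \<bar>y\<bar> \<le> 4 * jb (x - y) powr (- 2)"
      using abs_chi_diff_le[OF True, of x] False by (simp add: field_simps)
    also have "\<dots> \<le> 8 * jb y powr (- 1) * jb (x - y) powr (- 2)"
    proof (intro mult_right_mono)
      show "4 \<le> 8 * jb y powr (- 1)" using True by (simp add: jb_def powr_minus_divide field_simps)
    qed simp
    also have "\<dots> \<le> 8 * jb y powr (- 1) * (jb (x - y) powr (- 2) + jb x powr (- 2))"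
      by (intro mult_left_mono) auto
    finally show ?thesis .
  qed simp
next
  case False
  have "\<bar>chi (x - y) - chi x\<bar> / \<bar>y\<bar> \<le> 2 * (jb (x - y) powr (- 2) + jb x powr (- 2)) * (1 / \<bar>y\<bar>)"
    using abs_chi_le[of x] abs_chi_le[of "x - y"] False by (simp add: field_simps)
  also have "\<dots> \<le> 2 * (jb (x - y) powr (- 2) + jb x powr (- 2)) * (4 * jb y powr (- 1))"
    using False by (intro mult_left_mono) (auto simp: jb_def powr_minus_divide field_simps)
  finally show ?thesis by (simp add: mult_ac)
qed

lemma norm_KT_le:
  assumes "T > 0"
  shows "cmod (KT T s l) \<le> 8 * T\<^sup>2 * jb (T * l) powr (- 1) * (jb (T * (s - l)) powr (- 2) + jb (T * s) powr (- 2))"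
proof -
  have "cmod (KT T s l) = T * \<bar>chi (T * (s - l)) - chi (T * s)\<bar> / \<bar>l\<bar>"
    using assms by (simp add: KT_def norm_divide norm_mult abs_mult right_diff_distrib[symmetric] del: of_real_diff of_real_mult)
  also have "\<dots> = T\<^sup>2 * (\<bar>chi (T * s - T * l) - chi (T * s)\<bar> / \<bar>T * l\<bar>)"
    using assms by (simp add: abs_mult power2_eq_square right_diff_distrib)
  also have "\<dots> \<le> T\<^sup>2 * (8 * jb (T * l) powr (- 1) * (jb (T * s - T * l) powr (- 2) + jb (T * s) powr (- 2)))"
    by (intro mult_left_mono abs_chi_diff_div_le) auto
  finally show ?thesis by (simp only: right_diff_distrib mult_ac)
qed

lemma jb_dilate_le:
  assumes "0 < T" "T \<le> 1"
  shows "jb s \<le> 1 / T * jb (T * s)"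
  using assms by (simp add: jb_def abs_mult field_simps)

text \<open>The kernel scales with the square of \<open>T\<close>; undoing the dilation in the
  weights costs one factor \<open>1 / T\<close> per power, since \<open>T \<le> 1\<close>. In the
  term concentrated near \<open>s = l\<close>, the weight in \<open>s\<close> is shared between
  \<open>s - l\<close> and \<open>l\<close>.\<close>

lemma weighted_norm_KT_le:
  assumes T: "0 < T" "T \<le> 1" and ab: "0 \<le> a" "0 \<le> b" "a + b \<le> 1"
  shows "jb s powr b * cmod (KT T s l) * jb l powr a
    \<le> 8 * T powr (2 - a - b) * (jb (T * (s - l)) powr (b - 2) + jb (T * s) powr (b - 2) * jb (T * l) powr (a - 1))"
proof -
  define x y z where "x = jb (T * s)" and "y = jb (T * l)" and "z = jb (T * (s - l))"
  have pos: "x \<ge> 1" "y \<ge> 1" "z \<ge> 1" by (auto simp: x_def y_def z_def)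
  have xzy: "x \<le> z * y"
    using jb_add_le[of "T * (s - l)" "T * l"] by (simp add: x_def y_def z_def algebra_simps)
  have jb1: "jb s powr b \<le> T powr (- b) * x powr b"
  proof -
    have "jb s powr b \<le> (1 / T * x) powr b"
      using jb_dilate_le[OF T, of s] ab by (intro powr_mono2) (auto simp: x_def)
    then show ?thesis using T pos by (simp add: powr_mult powr_divide powr_minus_divide)
  qed
  have jb2: "jb l powr a \<le> T powr (- a) * y powr a"
  proof -
    have "jb l powr a \<le> (1 / T * y) powr a"
      using jb_dilate_le[OF T, of l] ab by (intro powr_mono2) (auto simp: y_def)
    then show ?thesis using T pos by (simp add: powr_mult powr_divide powr_minus_divide)
  qed
  have "jb s powr b * cmod (KT T s l) * jb l powr a
     \<le> (T powr (- b) * x powr b) * (8 * T\<^sup>2 * y powr (- 1) * (z powr (- 2) + x powr (- 2))) * (T powr (- a) * y powr a)"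
    using norm_KT_le[OF T(1), of s l] jb1 jb2 T(1)
    by (intro mult_mono) (auto simp: x_def y_def z_def)
  also have "\<dots> = 8 * T powr (2 - a - b) * (x powr b * y powr (a - 1) * z powr (- 2) + x powr (b - 2) * y powr (a - 1))"
  proof -
    have "T powr 2 = T\<^sup>2" using T powr_realpow[of T 2] by simp
    then have "T powr (2 - a - b) = T\<^sup>2 * T powr (- a) * T powr (- b)"
      by (simp only: diff_conv_add_uminus powr_add)
    moreover have "y powr (a - 1) = y powr a * y powr (- 1)" "x powr (b - 2) = x powr b * x powr (- 2)"
      by (simp_all only: diff_conv_add_uminus powr_add)
    ultimately show ?thesis by (simp only: ring_distribs mult_ac)
  qed
  also have "\<dots> \<le> 8 * T powr (2 - a - b) * (z powr (b - 2) + x powr (b - 2) * y powr (a - 1))"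
  proof (intro mult_left_mono add_right_mono)
    \<comment> \<open>After the weight is distributed, the power \<open>a + b - 1\<close> of
      \<open>y\<close> remains; it is not positive precisely because
      \<open>a + b \<le> 1\<close>.\<close>
    have "x powr b * y powr (a - 1) * z powr (- 2) \<le> (z * y) powr b * y powr (a - 1) * z powr (- 2)"
      using xzy pos ab by (intro mult_right_mono powr_mono2) auto
    also have "\<dots> = z powr (b - 2) * y powr (a + b - 1)"
    proof -
      have "(z * y) powr b = z powr b * y powr b" using pos by (simp add: powr_mult)
      moreover have "z powr (b - 2) = z powr b * z powr (- 2)" by (simp only: diff_conv_add_uminus powr_add)
      moreover have "y powr (a + b - 1) = y powr b * y powr (a - 1)"
        by (simp only: powr_add[symmetric]) (simp add: algebra_simps)
      ultimately show ?thesis by (simp only: mult_ac)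
    qed
    also have "\<dots> \<le> z powr (b - 2) * 1"
      using pos ab powr_mono[of "a + b - 1" 0 y] by (intro mult_left_mono) auto
    finally show "x powr b * y powr (a - 1) * z powr (- 2) \<le> z powr (b - 2)" by simp
  qed simp
  finally show ?thesis by (simp add: x_def y_def z_def)
qed

section \<open>Young's inequality and bounds for the truncated kernel\<close>

lemma l2norm_convolution_le:
  assumes [measurable]: "F \<in> borel_measurable borel" "G \<in> borel_measurable borel"
  shows "l2norm lborel (\<lambda>x :: real. \<integral>\<^sup>+y. F y * G (x - y) \<partial>lborel) \<le> (\<integral>\<^sup>+y. F y \<partial>lborel) * l2norm lborel G"
proof -
  have "l2norm lborel (\<lambda>x :: real. \<integral>\<^sup>+y. F y * G (x - y) \<partial>lborel)
      \<le> (\<integral>\<^sup>+y. l2norm lborel (\<lambda>x. F y * G (x - y)) \<partial>lborel)"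
    by (intro l2norm_nn_integral_le sigma_finite_lborel) measurable
  also have "\<dots> = (\<integral>\<^sup>+y. F y * l2norm lborel G \<partial>lborel)"
    using l2norm_translate[of G] by (intro nn_integral_cong) (simp add: l2norm_cmult flip: add_uminus_conv_diff)
  also have "\<dots> = (\<integral>\<^sup>+y. F y \<partial>lborel) * l2norm lborel G"
    by (simp add: nn_integral_multc)
  finally show ?thesis .
qed

lemma nn_integral_dilate:
  fixes f :: "real \<Rightarrow> ennreal"
  assumes [measurable]: "f \<in> borel_measurable borel" and "T > 0"
  shows "(\<integral>\<^sup>+x. f (T * x) \<partial>lborel) = ennreal (1 / T) * (\<integral>\<^sup>+x. f x \<partial>lborel)"
proof -
  have "(\<integral>\<^sup>+x. f x \<partial>lborel) = T * (\<integral>\<^sup>+x. f (T * x) \<partial>lborel)"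
    using nn_integral_real_affine[of f T 0] assms by simp
  then show ?thesis
    using assms(2) by (simp add: mult.assoc[symmetric] ennreal_mult[symmetric])
qed

lemma nn_integral_reflect:
  fixes f :: "real \<Rightarrow> ennreal"
  assumes [measurable]: "f \<in> borel_measurable borel"
  shows "(\<integral>\<^sup>+y. f (c - y) \<partial>lborel) = (\<integral>\<^sup>+y. f y \<partial>lborel)"
  using nn_integral_real_affine[of f "-1" c] by simp

lemma nn_integral_translate:
  fixes f :: "real \<Rightarrow> ennreal"
  assumes [measurable]: "f \<in> borel_measurable borel"
  shows "(\<integral>\<^sup>+y. f (y + c) \<partial>lborel) = (\<integral>\<^sup>+y. f y \<partial>lborel)"
  using nn_integral_real_affine[of f "1" c] by (simp add: add.commute)

lemma jb_neq_0 [simp]: "jb x \<noteq> 0"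
  using jb_pos[of x] by linarith

text \<open>The pointwise bound splits the operator in two. One part is a convolution with an
  integrable kernel, which needs \<open>b < 1\<close>. The other has rank one, and Cauchy-Schwarz in
  \<open>l\<close> needs the power \<open>a - 1\<close> to be square integrable, hence
  \<open>a < 1/2\<close>.\<close>

lemma l2norm_KT_le:
  assumes a: "0 \<le> a" "a < 1/2" and b: "0 \<le> b" "b < 1" and ab: "a + b \<le> 1"
  obtains C where "C > 0" and "\<And>T h. 0 < T \<Longrightarrow> T \<le> 1 \<Longrightarrow> h \<in> borel_measurable borel \<Longrightarrow>
    l2norm lborel (\<lambda>s. ennreal (jb s powr b) * (\<integral>\<^sup>+l. ennreal (cmod (KT T s l)) * h l \<partial>lborel))
      \<le> ennreal (C * T powr (1 - a - b)) * l2norm lborel (\<lambda>l. ennreal (jb l powr (- a)) * h l)"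
proof -
  define A B1 B2 where "A = (\<integral>\<^sup>+x. ennreal (jb x powr (b - 2)) \<partial>lborel)"
    and "B1 = l2norm lborel (\<lambda>x. ennreal (jb x powr (b - 2)))"
    and "B2 = l2norm lborel (\<lambda>x. ennreal (jb x powr (a - 1)))"
  have "A < \<infinity>" "B1 < \<infinity>" "B2 < \<infinity>"
    using nn_integral_jb_powr_finite[of "2 - b"] l2norm_jb_powr_finite[of "2 - b"] l2norm_jb_powr_finite[of "1 - a"] a b
    by (simp_all add: A_def B1_def B2_def)
  then obtain A' B1' B2' where fin: "A = ennreal A'" "A' \<ge> 0" "B1 = ennreal B1'" "B1' \<ge> 0" "B2 = ennreal B2'" "B2' \<ge> 0"
    by (metis infinity_ennreal_def less_top_ennreal)
  show ?thesis
  proof (rule that[of "8 * (A' + B1' * B2') + 1"])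
    show "0 < 8 * (A' + B1' * B2') + 1" using fin by (simp add: add_nonneg_pos)
    fix T :: real and h :: "real \<Rightarrow> ennreal"
    assume T: "0 < T" "T \<le> 1" and [measurable]: "h \<in> borel_measurable borel"
    define w where "w = (\<lambda>l. ennreal (jb l powr (- a)) * h l)"
    have [measurable]: "w \<in> borel_measurable borel" unfolding w_def by measurable
    define \<kappa>1 \<kappa>3 where "\<kappa>1 = (\<lambda>x. ennreal (jb (T * x) powr (b - 2)))"
      and "\<kappa>3 = (\<lambda>x. ennreal (jb (T * x) powr (a - 1)))"
    have [measurable]: "\<kappa>1 \<in> borel_measurable borel" "\<kappa>3 \<in> borel_measurable borel"
      unfolding \<kappa>1_def \<kappa>3_def by measurable
    have w_eq: "h l = ennreal (jb l powr a) * w l" for l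
      by (simp add: w_def mult.assoc[symmetric] ennreal_mult[symmetric] powr_add[symmetric])
    define c where "c = 8 * T powr (2 - a - b)"
    have pt: "ennreal (jb s powr b) * (\<integral>\<^sup>+l. ennreal (cmod (KT T s l)) * h l \<partial>lborel)
       \<le> ennreal c * ((\<integral>\<^sup>+l. \<kappa>1 l * w (s - l) \<partial>lborel) + \<kappa>1 s * (\<integral>\<^sup>+l. \<kappa>3 l * w l \<partial>lborel))" for s
    proof -
      have "ennreal (jb s powr b) * (\<integral>\<^sup>+l. ennreal (cmod (KT T s l)) * h l \<partial>lborel)
        = (\<integral>\<^sup>+l. ennreal (jb s powr b * cmod (KT T s l) * jb l powr a) * w l \<partial>lborel)"
        by (subst nn_integral_cmult[symmetric])
           (auto intro!: nn_integral_cong simp: w_eq ennreal_mult mult_ac)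
      also have "\<dots> \<le> (\<integral>\<^sup>+l. ennreal c * (\<kappa>1 (s - l) * w l + \<kappa>1 s * (\<kappa>3 l * w l)) \<partial>lborel)"
      proof (intro nn_integral_mono)
        fix l
        have "ennreal (jb s powr b * cmod (KT T s l) * jb l powr a)
            \<le> ennreal (c * (jb (T * (s - l)) powr (b - 2) + jb (T * s) powr (b - 2) * jb (T * l) powr (a - 1)))"
          unfolding c_def using a b by (intro ennreal_leI weighted_norm_KT_le T ab) auto
        also have "\<dots> = ennreal c * (\<kappa>1 (s - l) + \<kappa>1 s * \<kappa>3 l)"
          by (simp add: \<kappa>1_def \<kappa>3_def ennreal_mult ennreal_plus c_def)
        finally have "ennreal (jb s powr b * cmod (KT T s l) * jb l powr a) * w l
            \<le> ennreal c * (\<kappa>1 (s - l) + \<kappa>1 s * \<kappa>3 l) * w l"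
          by (intro mult_right_mono) auto
        then show "ennreal (jb s powr b * cmod (KT T s l) * jb l powr a) * w l
            \<le> ennreal c * (\<kappa>1 (s - l) * w l + \<kappa>1 s * (\<kappa>3 l * w l))"
          by (simp only: distrib_left distrib_right mult_ac)
      qed
      also have "\<dots> = ennreal c * ((\<integral>\<^sup>+l. \<kappa>1 (s - l) * w l \<partial>lborel) + \<kappa>1 s * (\<integral>\<^sup>+l. \<kappa>3 l * w l \<partial>lborel))"
        by (simp add: nn_integral_cmult nn_integral_add)
      also have "(\<integral>\<^sup>+l. \<kappa>1 (s - l) * w l \<partial>lborel) = (\<integral>\<^sup>+l. \<kappa>1 l * w (s - l) \<partial>lborel)"
        using nn_integral_reflect[of "\<lambda>l. \<kappa>1 l * w (s - l)" s] by simp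
      finally show ?thesis .
    qed
    have T1: "ennreal c * ennreal (1 / T) = ennreal (8 * T powr (1 - a - b))"
    proof -
      have "T powr (2 - a - b) = T powr (1 - a - b) * T"
      proof -
        have "T powr (1 - a - b + 1) = T powr (1 - a - b) * T powr 1" by (rule powr_add)
        then show ?thesis using T by (simp add: algebra_simps)
      qed
      then show ?thesis using T by (simp add: c_def ennreal_mult[symmetric])
    qed
    \<comment> \<open>The two dilated square norms of the rank one part cost \<open>T\<close> to the
      power -1/2 each, together as much as the dilated integral of the convolution kernel.\<close>
    have half: "ennreal (T powr (-1/2)) * ennreal (T powr (-1/2)) = ennreal (1 / T)"
      using T by (simp add: ennreal_mult[symmetric] powr_add[symmetric] powr_minus_divide)
    have "l2norm lborel (\<lambda>s. ennreal (jb s powr b) * (\<integral>\<^sup>+l. ennreal (cmod (KT T s l)) * h l \<partial>lborel))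
      \<le> l2norm lborel (\<lambda>s. ennreal c * ((\<integral>\<^sup>+l. \<kappa>1 l * w (s - l) \<partial>lborel) + \<kappa>1 s * (\<integral>\<^sup>+l. \<kappa>3 l * w l \<partial>lborel)))"
      by (intro l2norm_mono pt)
    also have "\<dots> = ennreal c * l2norm lborel (\<lambda>s. (\<integral>\<^sup>+l. \<kappa>1 l * w (s - l) \<partial>lborel) + \<kappa>1 s * (\<integral>\<^sup>+l. \<kappa>3 l * w l \<partial>lborel))"
      by (intro l2norm_cmult) measurable
    also have "\<dots> \<le> ennreal c * (l2norm lborel (\<lambda>s. \<integral>\<^sup>+l. \<kappa>1 l * w (s - l) \<partial>lborel) + l2norm lborel (\<lambda>s. \<kappa>1 s * (\<integral>\<^sup>+l. \<kappa>3 l * w l \<partial>lborel)))"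
      by (intro mult_left_mono l2norm_add_le) measurable
    also have "\<dots> \<le> ennreal c * ((ennreal (1 / T) * A) * l2norm lborel w
         + (ennreal (T powr (-1/2)) * B1) * ((ennreal (T powr (-1/2)) * B2) * l2norm lborel w))"
    proof (intro mult_left_mono add_mono)
      have "l2norm lborel (\<lambda>s. \<integral>\<^sup>+l. \<kappa>1 l * w (s - l) \<partial>lborel) \<le> (\<integral>\<^sup>+y. \<kappa>1 y \<partial>lborel) * l2norm lborel w"
        by (intro l2norm_convolution_le) measurable
      also have "(\<integral>\<^sup>+y. \<kappa>1 y \<partial>lborel) = ennreal (1 / T) * A"
        unfolding \<kappa>1_def A_def by (rule nn_integral_dilate[OF _ T(1), of "\<lambda>x. ennreal (jb x powr (b - 2))"]) measurable
      finally show "l2norm lborel (\<lambda>s. \<integral>\<^sup>+l. \<kappa>1 l * w (s - l) \<partial>lborel) \<le> (ennreal (1 / T) * A) * l2norm lborel w" .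
      have "(\<integral>\<^sup>+l. \<kappa>3 l * w l \<partial>lborel) \<le> l2norm lborel \<kappa>3 * l2norm lborel w"
        by (intro nn_integral_mult_le_l2norm) measurable
      also have "l2norm lborel \<kappa>3 = ennreal (T powr (-1/2)) * B2"
        unfolding \<kappa>3_def B2_def by (rule l2norm_dilate[OF _ T(1), of "\<lambda>x. ennreal (jb x powr (a - 1))"]) measurable
      finally have k3: "(\<integral>\<^sup>+l. \<kappa>3 l * w l \<partial>lborel) \<le> (ennreal (T powr (-1/2)) * B2) * l2norm lborel w" .
      have "l2norm lborel (\<lambda>s. \<kappa>1 s * (\<integral>\<^sup>+l. \<kappa>3 l * w l \<partial>lborel)) = l2norm lborel \<kappa>1 * (\<integral>\<^sup>+l. \<kappa>3 l * w l \<partial>lborel)"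
        using l2norm_cmult[of \<kappa>1 lborel "\<integral>\<^sup>+l. \<kappa>3 l * w l \<partial>lborel"] by (simp add: mult.commute)
      also have "l2norm lborel \<kappa>1 = ennreal (T powr (-1/2)) * B1"
        unfolding \<kappa>1_def B1_def by (rule l2norm_dilate[OF _ T(1), of "\<lambda>x. ennreal (jb x powr (b - 2))"]) measurable
      also have "ennreal (T powr (-1/2)) * B1 * (\<integral>\<^sup>+l. \<kappa>3 l * w l \<partial>lborel) \<le> (ennreal (T powr (-1/2)) * B1) * ((ennreal (T powr (-1/2)) * B2) * l2norm lborel w)"
        by (intro mult_left_mono k3) auto
      finally show "l2norm lborel (\<lambda>s. \<kappa>1 s * (\<integral>\<^sup>+l. \<kappa>3 l * w l \<partial>lborel)) \<le> \<dots>" .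
    qed auto
    also have "\<dots> = (ennreal c * ennreal (1 / T)) * (A + B1 * B2) * l2norm lborel w"
      unfolding half[symmetric] by (simp only: distrib_left distrib_right mult_ac)
    also have "\<dots> = ennreal (8 * T powr (1 - a - b) * (A' + B1' * B2')) * l2norm lborel w"
      unfolding T1 using fin by (simp add: ennreal_mult ennreal_plus)
    also have "\<dots> \<le> ennreal ((8 * (A' + B1' * B2') + 1) * T powr (1 - a - b)) * l2norm lborel w"
      by (intro mult_right_mono ennreal_leI) (simp_all add: algebra_simps)
    finally show "l2norm lborel (\<lambda>s. ennreal (jb s powr b) * (\<integral>\<^sup>+l. ennreal (cmod (KT T s l)) * h l \<partial>lborel))
      \<le> ennreal ((8 * (A' + B1' * B2') + 1) * T powr (1 - a - b)) * l2norm lborel (\<lambda>l. ennreal (jb l powr (- a)) * h l)"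
      unfolding w_def .
  qed
qed

definition Nb :: "real \<Rightarrow> (real \<Rightarrow> ennreal) \<Rightarrow> ennreal" where
  "Nb b h = l2norm lborel (\<lambda>t. ennreal (jb t powr b) * h t)"

text \<open>Cauchy-Schwarz against the power \<open>- b\<close> of the bracket, square integrable
  for \<open>b > 1/2\<close>. This is what makes profiles integrable and evaluation at a time
  continuous.\<close>

lemma nn_integral_le_Nb:
  assumes "b > 1/2"
  obtains C where "C > 0" and "\<And>h. h \<in> borel_measurable borel \<Longrightarrow> (\<integral>\<^sup>+x. h x \<partial>lborel) \<le> ennreal C * Nb b h"
proof -
  define B where "B = l2norm lborel (\<lambda>x. ennreal (jb x powr (- b)))"
  have "B < \<infinity>" unfolding B_def by (rule l2norm_jb_powr_finite) fact
  then obtain B' where B': "B = ennreal B'" "B' \<ge> 0"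
    by (metis infinity_ennreal_def less_top_ennreal)
  show ?thesis
  proof (rule that[of "B' + 1"])
    fix h :: "real \<Rightarrow> ennreal" assume [measurable]: "h \<in> borel_measurable borel"
    have "(\<integral>\<^sup>+x. h x \<partial>lborel) = (\<integral>\<^sup>+x. ennreal (jb x powr (- b)) * (ennreal (jb x powr b) * h x) \<partial>lborel)"
      by (simp add: mult.assoc[symmetric] ennreal_mult[symmetric] powr_add[symmetric])
    also have "\<dots> \<le> B * Nb b h"
      unfolding B_def Nb_def by (intro nn_integral_mult_le_l2norm) measurable
    also have "\<dots> \<le> ennreal (B' + 1) * Nb b h"
      unfolding B' by (intro mult_right_mono ennreal_leI) auto
    finally show "(\<integral>\<^sup>+x. h x \<partial>lborel) \<le> ennreal (B' + 1) * Nb b h" .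
  qed (use B' in auto)
qed

lemma Nb_mono_exponent: "a \<le> b \<Longrightarrow> Nb a h \<le> Nb b h"
  unfolding Nb_def by (intro l2norm_mono mult_right_mono ennreal_leI powr_mono) auto

text \<open>The bracket of \<open>x\<close> is at most twice that of \<open>y\<close> or twice that
  of \<open>x - y\<close>. The weight thus falls on one factor, while the other is integrable and
  acts as a convolution kernel.\<close>

lemma Nb_convolution_le:
  assumes a: "0 \<le> a" "a \<le> 1" "a \<le> b" and b: "b > 1/2"
  obtains C where "C > 0" and "\<And>f g. f \<in> borel_measurable borel \<Longrightarrow> g \<in> borel_measurable borel \<Longrightarrow>
    Nb a (\<lambda>x. \<integral>\<^sup>+y. f y * g (x - y) \<partial>lborel) \<le> ennreal C * Nb b f * Nb b g"
proof -
  obtain D where D: "D > 0" "\<And>h. h \<in> borel_measurable borel \<Longrightarrow> (\<integral>\<^sup>+x. h x \<partial>lborel) \<le> ennreal D * Nb b h"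
    using nn_integral_le_Nb[OF b] by blast
  show ?thesis
  proof (rule that[of "4 * D"])
    fix f g :: "real \<Rightarrow> ennreal"
    assume [measurable]: "f \<in> borel_measurable borel" "g \<in> borel_measurable borel"
    define fa ga where "fa = (\<lambda>x. ennreal (jb x powr a) * f x)" and "ga = (\<lambda>x. ennreal (jb x powr a) * g x)"
    have [measurable]: "fa \<in> borel_measurable borel" "ga \<in> borel_measurable borel"
      unfolding fa_def ga_def by measurable
    have w: "jb x powr a \<le> 2 * (jb y powr a + jb (x - y) powr a)" for x y
    proof -
      have m: "jb x powr a \<le> 2 * z powr a" if "jb x \<le> 2 * z" "z \<ge> 1" for z
      proof -
        have "jb x powr a \<le> (2 * z) powr a" using that a by (intro powr_mono2) auto
        also have "\<dots> = 2 powr a * z powr a" using that by (simp add: powr_mult)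
        also have "\<dots> \<le> 2 powr 1 * z powr a" using a by (intro mult_right_mono powr_mono) auto
        finally show ?thesis by simp
      qed
      have "jb x \<le> 2 * jb y \<or> jb x \<le> 2 * jb (x - y)"
        by (auto simp: jb_def abs_if)
      then show ?thesis
        using m[of "jb y"] m[of "jb (x - y)"] by (auto intro: add_increasing add_increasing2 simp: distrib_left)
    qed
    have pt: "ennreal (jb x powr a) * (\<integral>\<^sup>+y. f y * g (x - y) \<partial>lborel)
        \<le> 2 * ((\<integral>\<^sup>+y. g y * fa (x - y) \<partial>lborel) + (\<integral>\<^sup>+y. f y * ga (x - y) \<partial>lborel))" for x
    proof -
      have "ennreal (jb x powr a) * (\<integral>\<^sup>+y. f y * g (x - y) \<partial>lborel) = (\<integral>\<^sup>+y. ennreal (jb x powr a) * (f y * g (x - y)) \<partial>lborel)"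
        by (rule nn_integral_cmult[symmetric]) measurable
      also have "\<dots> \<le> (\<integral>\<^sup>+y. 2 * (fa y * g (x - y) + f y * ga (x - y)) \<partial>lborel)"
      proof (intro nn_integral_mono)
        fix y
        have "ennreal (jb x powr a) * (f y * g (x - y)) \<le> ennreal (2 * (jb y powr a + jb (x - y) powr a)) * (f y * g (x - y))"
          by (intro mult_right_mono ennreal_leI w) auto
        also have "\<dots> = 2 * (fa y * g (x - y) + f y * ga (x - y))"
          by (simp add: fa_def ga_def ennreal_mult ennreal_plus distrib_left distrib_right mult_ac)
        finally show "ennreal (jb x powr a) * (f y * g (x - y)) \<le> \<dots>" .
      qed
      also have "\<dots> = 2 * ((\<integral>\<^sup>+y. fa y * g (x - y) \<partial>lborel) + (\<integral>\<^sup>+y. f y * ga (x - y) \<partial>lborel))"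
        by (simp add: nn_integral_cmult nn_integral_add)
      also have "(\<integral>\<^sup>+y. fa y * g (x - y) \<partial>lborel) = (\<integral>\<^sup>+y. g y * fa (x - y) \<partial>lborel)"
        using nn_integral_reflect[of "\<lambda>y. g y * fa (x - y)" x] by (simp add: mult.commute)
      finally show ?thesis .
    qed
    have "Nb a (\<lambda>x. \<integral>\<^sup>+y. f y * g (x - y) \<partial>lborel)
      \<le> l2norm lborel (\<lambda>x. 2 * ((\<integral>\<^sup>+y. g y * fa (x - y) \<partial>lborel) + (\<integral>\<^sup>+y. f y * ga (x - y) \<partial>lborel)))"
      unfolding Nb_def by (intro l2norm_mono pt)
    also have "\<dots> = 2 * l2norm lborel (\<lambda>x. (\<integral>\<^sup>+y. g y * fa (x - y) \<partial>lborel) + (\<integral>\<^sup>+y. f y * ga (x - y) \<partial>lborel))"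
      by (intro l2norm_cmult) measurable
    also have "\<dots> \<le> 2 * (l2norm lborel (\<lambda>x. \<integral>\<^sup>+y. g y * fa (x - y) \<partial>lborel) + l2norm lborel (\<lambda>x. \<integral>\<^sup>+y. f y * ga (x - y) \<partial>lborel))"
      by (intro mult_left_mono l2norm_add_le) measurable
    also have "\<dots> \<le> 2 * ((\<integral>\<^sup>+y. g y \<partial>lborel) * Nb a f + (\<integral>\<^sup>+y. f y \<partial>lborel) * Nb a g)"
      unfolding Nb_def fa_def[symmetric] ga_def[symmetric]
      by (intro mult_left_mono add_mono l2norm_convolution_le) measurable
    also have "\<dots> \<le> 2 * ((ennreal D * Nb b g) * Nb b f + (ennreal D * Nb b f) * Nb b g)"
      by (intro mult_left_mono add_mono mult_mono D Nb_mono_exponent a) auto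
    also have "\<dots> = ennreal (4 * D) * Nb b f * Nb b g"
      using D(1) by (simp add: ennreal_mult distrib_left mult_ac mult_2[symmetric])
    finally show "Nb a (\<lambda>x. \<integral>\<^sup>+y. f y * g (x - y) \<partial>lborel) \<le> ennreal (4 * D) * Nb b f * Nb b g" .
  qed (use D in auto)
qed

text \<open>The gain \<open>jb \<Psi> powr (- a)\<close> comes from \<open>jb (x + \<Psi>) powr (- a) \<le> jb \<Psi> powr (- a) * jb x powr a\<close>.\<close>

lemma Nb_duhamel_le:
  assumes a: "0 \<le> a" "a < 1/2" and b: "1/2 < b" "b < 1" and ab: "a + b \<le> 1"
  obtains C where "C > 0" and "\<And>T \<Psi> f g. 0 < T \<Longrightarrow> T \<le> 1 \<Longrightarrow> f \<in> borel_measurable borel \<Longrightarrow> g \<in> borel_measurable borel \<Longrightarrow>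
    Nb b (\<lambda>s. \<integral>\<^sup>+x. (\<integral>\<^sup>+y. ennreal (cmod (KT T s (x + y + \<Psi>))) * (f x * g y) \<partial>lborel) \<partial>lborel)
      \<le> ennreal (C * T powr (1 - a - b) * jb \<Psi> powr (- a)) * Nb b f * Nb b g"
proof -
  have a1: "a \<le> 1" "a \<le> b" using a b by auto
  have b1: "0 \<le> b" using b by auto
  obtain C1 where C1: "C1 > 0" and K: "\<And>T h. 0 < T \<Longrightarrow> T \<le> 1 \<Longrightarrow> h \<in> borel_measurable borel \<Longrightarrow>
    l2norm lborel (\<lambda>s. ennreal (jb s powr b) * (\<integral>\<^sup>+l. ennreal (cmod (KT T s l)) * h l \<partial>lborel))
      \<le> ennreal (C1 * T powr (1 - a - b)) * l2norm lborel (\<lambda>l. ennreal (jb l powr (- a)) * h l)"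
    using l2norm_KT_le[OF a b1 b(2) ab] by blast
  obtain C2 where C2: "C2 > 0" and conv: "\<And>f g. f \<in> borel_measurable borel \<Longrightarrow> g \<in> borel_measurable borel \<Longrightarrow>
    Nb a (\<lambda>x. \<integral>\<^sup>+y. f y * g (x - y) \<partial>lborel) \<le> ennreal C2 * Nb b f * Nb b g"
    using Nb_convolution_le[OF a(1) a1 b(1)] by blast
  show ?thesis
  proof (rule that[of "C1 * C2"])
    fix T \<Psi> :: real and f g :: "real \<Rightarrow> ennreal"
    assume T: "0 < T" "T \<le> 1" and [measurable]: "f \<in> borel_measurable borel" "g \<in> borel_measurable borel"
    define p where "p = (\<lambda>x. \<integral>\<^sup>+y. f y * g (x - y) \<partial>lborel)"
    have [measurable]: "p \<in> borel_measurable borel" unfolding p_def by measurable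
    \<comment> \<open>The substitution \<open>l = x + y + \<Psi>\<close> turns the double integral
      into the operator of \<open>l2norm_KT_le\<close>, applied to the convolution of
      \<open>f\<close> and \<open>g\<close> translated by the phase.\<close>
    have eq: "(\<integral>\<^sup>+x. (\<integral>\<^sup>+y. ennreal (cmod (KT T s (x + y + \<Psi>))) * (f x * g y) \<partial>lborel) \<partial>lborel)
       = (\<integral>\<^sup>+l. ennreal (cmod (KT T s l)) * p (l - \<Psi>) \<partial>lborel)" for s
    proof -
      have "(\<integral>\<^sup>+x. (\<integral>\<^sup>+y. ennreal (cmod (KT T s (x + y + \<Psi>))) * (f x * g y) \<partial>lborel) \<partial>lborel)
         = (\<integral>\<^sup>+x. (\<integral>\<^sup>+l. ennreal (cmod (KT T s l)) * (f x * g (l - \<Psi> - x)) \<partial>lborel) \<partial>lborel)"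
      proof (rule nn_integral_cong)
        fix x
        show "(\<integral>\<^sup>+y. ennreal (cmod (KT T s (x + y + \<Psi>))) * (f x * g y) \<partial>lborel)
          = (\<integral>\<^sup>+l. ennreal (cmod (KT T s l)) * (f x * g (l - \<Psi> - x)) \<partial>lborel)"
          using nn_integral_translate[of "\<lambda>l. ennreal (cmod (KT T s l)) * (f x * g (l - \<Psi> - x))" "x + \<Psi>"]
          by (simp add: algebra_simps)
      qed
      also have "\<dots> = (\<integral>\<^sup>+l. (\<integral>\<^sup>+x. ennreal (cmod (KT T s l)) * (f x * g (l - \<Psi> - x)) \<partial>lborel) \<partial>lborel)"
        by (rule lborel_pair.Fubini') measurable
      also have "\<dots> = (\<integral>\<^sup>+l. ennreal (cmod (KT T s l)) * p (l - \<Psi>) \<partial>lborel)"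
        unfolding p_def by (intro nn_integral_cong nn_integral_cmult) measurable
      finally show ?thesis .
    qed
    have "Nb b (\<lambda>s. \<integral>\<^sup>+x. (\<integral>\<^sup>+y. ennreal (cmod (KT T s (x + y + \<Psi>))) * (f x * g y) \<partial>lborel) \<partial>lborel)
      \<le> ennreal (C1 * T powr (1 - a - b)) * l2norm lborel (\<lambda>l. ennreal (jb l powr (- a)) * p (l - \<Psi>))"
      unfolding Nb_def eq by (intro K T) measurable
    also have "l2norm lborel (\<lambda>l. ennreal (jb l powr (- a)) * p (l - \<Psi>))
       \<le> l2norm lborel (\<lambda>l. ennreal (jb \<Psi> powr (- a)) * (ennreal (jb (l + - \<Psi>) powr a) * p (l + - \<Psi>)))"
    proof (intro l2norm_mono)
      fix l
      have "jb l powr (- a) \<le> jb \<Psi> powr (- a) * jb (l - \<Psi>) powr a"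
      proof -
        have "jb \<Psi> \<le> jb l * jb (l - \<Psi>)" using jb_diff_le[of l "l - \<Psi>"] by simp
        then have "jb \<Psi> powr a \<le> jb l powr a * jb (l - \<Psi>) powr a"
          using a by (subst powr_mult[symmetric]) (auto intro!: powr_mono2)
        then show ?thesis by (simp add: powr_minus_divide field_simps)
      qed
      then show "ennreal (jb l powr (- a)) * p (l - \<Psi>) \<le> ennreal (jb \<Psi> powr (- a)) * (ennreal (jb (l + - \<Psi>) powr a) * p (l + - \<Psi>))"
        by (simp add: mult.assoc[symmetric] ennreal_mult[symmetric]) (intro mult_right_mono ennreal_leI; simp)
    qed
    also have "\<dots> = ennreal (jb \<Psi> powr (- a)) * Nb a p"
      unfolding Nb_def by (subst l2norm_cmult, measurable, subst l2norm_translate[of "\<lambda>l. ennreal (jb l powr a) * p l"]) auto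
    also have "Nb a p \<le> ennreal C2 * Nb b f * Nb b g"
      unfolding p_def by (rule conv) measurable
    finally have "Nb b (\<lambda>s. \<integral>\<^sup>+x. (\<integral>\<^sup>+y. ennreal (cmod (KT T s (x + y + \<Psi>))) * (f x * g y) \<partial>lborel) \<partial>lborel)
      \<le> ennreal (C1 * T powr (1 - a - b)) * (ennreal (jb \<Psi> powr (- a)) * (ennreal C2 * Nb b f * Nb b g))"
      by (simp add: mult_left_mono)
    also have "\<dots> = ennreal (C1 * C2 * T powr (1 - a - b) * jb \<Psi> powr (- a)) * Nb b f * Nb b g"
      using C1 C2 by (simp add: ennreal_mult mult_ac)
    finally show "Nb b (\<lambda>s. \<integral>\<^sup>+x. (\<integral>\<^sup>+y. ennreal (cmod (KT T s (x + y + \<Psi>))) * (f x * g y) \<partial>lborel) \<partial>lborel)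
      \<le> ennreal (C1 * C2 * T powr (1 - a - b) * jb \<Psi> powr (- a)) * Nb b f * Nb b g" .
  qed (use C1 C2 in auto)
qed

section \<open>Fourier inversion for the cutoff\<close>

lemma integrable_jb_powr:
  assumes "s > 1"
  shows "integrable lborel (\<lambda>x. jb x powr (- s))"
  using nn_integral_jb_powr_finite[OF assms] by (intro integrableI_nonneg) auto

lemma integrable_pair_product:
  fixes f :: "'a \<Rightarrow> 'c :: {banach, second_countable_topology, real_normed_div_algebra}"
  assumes "sigma_finite_measure M" "sigma_finite_measure N"
    and f: "integrable M f" and g: "integrable N g"
  shows "integrable (M \<Otimes>\<^sub>M N) (\<lambda>(x, y). f x * g y)"
proof (rule integrableI_bounded)
  interpret N: sigma_finite_measure N by fact
  note [measurable] = borel_measurable_integrable[OF f] borel_measurable_integrable[OF g]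
  show "(\<lambda>(x, y). f x * g y) \<in> borel_measurable (M \<Otimes>\<^sub>M N)" by measurable
  have "(\<integral>\<^sup>+z. ennreal (norm (case z of (x, y) \<Rightarrow> f x * g y)) \<partial>(M \<Otimes>\<^sub>M N))
      = (\<integral>\<^sup>+x. \<integral>\<^sup>+y. ennreal (norm (f x * g y)) \<partial>N \<partial>M)"
    by (subst N.nn_integral_fst[symmetric]) simp_all
  also have "\<dots> = (\<integral>\<^sup>+x. ennreal (norm (f x)) \<partial>M) * (\<integral>\<^sup>+y. ennreal (norm (g y)) \<partial>N)"
    by (simp add: norm_mult ennreal_mult nn_integral_cmult nn_integral_multc)
  also have "\<dots> < \<infinity>"
    using f g by (simp add: integrable_iff_bounded ennreal_mult_less_top)
  finally show "(\<integral>\<^sup>+z. ennreal (norm (case z of (x, y) \<Rightarrow> f x * g y)) \<partial>(M \<Otimes>\<^sub>M N)) < \<infinity>" .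
qed

text \<open>The cutoff on the time side, of which \<open>chi\<close> is the transform. Its kink
  where the modulus of \<open>s\<close> is 1 is what limits the decay of \<open>chi\<close> to
  second order.\<close>

definition psi :: "real \<Rightarrow> real" where
  "psi s = min 1 (exp (1 - \<bar>s\<bar>))"

lemma exp_le_jb: "exp (1 - \<bar>s\<bar>) \<le> 12 * jb s powr (- 2)"
proof -
  define x where "x = \<bar>s\<bar>"
  have x: "x \<ge> 0" by (simp add: x_def)
  \<comment> \<open>This 4, times the bound 3 for \<open>exp 1\<close>, is the constant 12.\<close>
  have "(1 + x)\<^sup>2 \<le> 4 * (exp (x / 2))\<^sup>2"
  proof -
    have "1 + x / 2 \<le> exp (x / 2)" by (rule exp_ge_add_one_self)
    then have "1 + x \<le> 2 * exp (x / 2)" using x by linarith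
    then have "(1 + x)\<^sup>2 \<le> (2 * exp (x / 2))\<^sup>2" using x by (intro power_mono) auto
    then show ?thesis by (simp add: power_mult_distrib)
  qed
  also have "(exp (x / 2))\<^sup>2 = exp x" by (simp add: exp_double[symmetric])
  finally have "exp 1 * (1 + x)\<^sup>2 \<le> 3 * (4 * exp x)"
    using exp_le x by (intro mult_mono) auto
  then have "exp 1 * (1 + x)\<^sup>2 / (exp x * (1 + x)\<^sup>2) \<le> 12 * exp x / (exp x * (1 + x)\<^sup>2)"
    using x by (intro divide_right_mono) auto
  then have "exp 1 / exp x \<le> 12 / (1 + x)\<^sup>2"
    using x by (simp add: add_nonneg_eq_0_iff)
  moreover have "jb s powr (- 2) = 1 / (1 + x)\<^sup>2"
    using powr_realpow[of "jb s" 2] by (simp add: jb_def powr_minus_divide x_def)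
  ultimately show ?thesis by (simp add: exp_diff x_def)
qed

lemma measurable_psi [measurable]: "psi \<in> borel_measurable borel"
  unfolding psi_def[abs_def] by measurable

lemma psi_bounds: "0 \<le> psi s" "psi s \<le> 1"
  by (auto simp: psi_def)

lemma psi_eq_1: "\<bar>s\<bar> \<le> 1 \<Longrightarrow> psi s = 1"
  by (simp add: psi_def)

lemma psi_even: "psi (- s) = psi s"
  by (simp add: psi_def)

lemma integrable_psi: "integrable lborel psi"
proof (rule Bochner_Integration.integrable_bound[where f = "\<lambda>x. 12 * jb x powr (- 2)"])
  show "integrable lborel (\<lambda>x. 12 * jb x powr (- 2))"
    using integrable_jb_powr[of 2] by simp
  show "AE x in lborel. norm (psi x) \<le> norm (12 * jb x powr (- 2))"
  proof (rule AE_I2)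
    fix x
    have "psi x \<le> exp (1 - \<bar>x\<bar>)" by (simp add: psi_def)
    also note exp_le_jb
    finally show "norm (psi x) \<le> norm (12 * jb x powr (- 2))" using psi_bounds[of x] by simp
  qed
qed simp

lemma integral_exp_tail:
  fixes x :: real
  shows "integrable lborel (\<lambda>s. indicator {1<..} s * (exp (1 - s) * cos (s * x)))"
  "(\<integral>s. indicator {1<..} s * (exp (1 - s) * cos (s * x)) \<partial>lborel) = (cos x - x * sin x) / (1 + x\<^sup>2)"
proof -
  define f where "f = (\<lambda>s :: real. exp (1 - s) * cos (s * x))"
  \<comment> \<open>An antiderivative: the real part of that of
    \<open>exp (1 - s + \<i> * s * x)\<close>.\<close>
  define F where "F = (\<lambda>s :: real. exp (1 - s) * (x * sin (s * x) - cos (s * x)) / (1 + x\<^sup>2))"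
  have pos: "1 + x\<^sup>2 \<noteq> 0" using zero_le_power2[of x] by (metis add_pos_nonneg less_irrefl zero_less_one)
  show int: "integrable lborel (\<lambda>s. indicator {1<..} s * (exp (1 - s) * cos (s * x)))"
  proof (rule Bochner_Integration.integrable_bound[OF integrable_psi])
    show "AE s in lborel. norm (indicator {1<..} s * (exp (1 - s) * cos (s * x))) \<le> norm (psi s)"
    proof (rule AE_I2)
      fix s
      have "exp (1 - s) * \<bar>cos (s * x)\<bar> \<le> exp (1 - s) * 1"
        by (intro mult_left_mono) auto
      then show "norm (indicator {1<..} s * (exp (1 - s) * cos (s * x))) \<le> norm (psi s)"
        by (auto simp: indicator_def psi_def abs_mult min_def)
    qed
  qed simp
  have set: "set_integrable lborel {1<..} f"
    using int by (simp add: set_integrable_def f_def)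
  have "(LBINT s=ereal 1..\<infinity>. f s) = 0 - F 1"
  proof (rule interval_integral_FTC_integrable)
    show "(F has_vector_derivative f s) (at s)" for s
    proof -
      have "(F has_real_derivative (- exp (1 - s) * (x * sin (s * x) - cos (s * x))
          + exp (1 - s) * (x * (cos (s * x) * x) + sin (s * x) * x)) / (1 + x\<^sup>2)) (at s)"
        unfolding F_def by (rule DERIV_cdivide) (auto intro!: derivative_eq_intros)
      also have "(- exp (1 - s) * (x * sin (s * x) - cos (s * x))
          + exp (1 - s) * (x * (cos (s * x) * x) + sin (s * x) * x)) = f s * (1 + x\<^sup>2)"
        by (simp add: f_def algebra_simps power2_eq_square)
      finally show ?thesis
        using pos by (simp add: has_real_derivative_iff_has_vector_derivative)
    qed
    show "isCont f s" for s unfolding f_def by (intro continuous_intros)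
    show "set_integrable lborel (einterval (ereal 1) \<infinity>) f" using set by simp
    have "isCont F 1" unfolding F_def by (intro continuous_intros) (use pos in auto)
    then have "(F \<longlongrightarrow> F 1) (at_right 1)"
      by (simp add: isCont_def filterlim_at_split)
    then show "((F \<circ> real_of_ereal) \<longlongrightarrow> F 1) (at_right (ereal 1))"
      by (simp add: ereal_tendsto_simps)
    have "(F \<longlongrightarrow> 0) at_top"
    proof (rule Lim_null_comparison[where g = "\<lambda>s. exp (1 - s) * ((\<bar>x\<bar> + 1) / (1 + x\<^sup>2))"])
      show "\<forall>\<^sub>F s in at_top. norm (F s) \<le> exp (1 - s) * ((\<bar>x\<bar> + 1) / (1 + x\<^sup>2))"
      proof (intro always_eventually allI)
        fix s
        have "\<bar>x * sin (s * x) - cos (s * x)\<bar> \<le> \<bar>x * sin (s * x)\<bar> + \<bar>cos (s * x)\<bar>" by linarith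
        also have "\<dots> \<le> \<bar>x\<bar> * 1 + 1"
          unfolding abs_mult by (intro add_mono mult_left_mono) auto
        finally show "norm (F s) \<le> exp (1 - s) * ((\<bar>x\<bar> + 1) / (1 + x\<^sup>2))"
          unfolding F_def by (simp add: abs_mult abs_divide) (intro divide_right_mono mult_left_mono; simp)
      qed
      have "((\<lambda>s::real. exp (1 - s)) \<longlongrightarrow> 0) at_top"
      proof -
        have "filterlim (\<lambda>s::real. - 1 + s) at_top at_top"
          by (intro filterlim_tendsto_add_at_top[OF tendsto_const] filterlim_ident)
        then have "filterlim (\<lambda>s::real. - (- 1 + s)) at_bot at_top"
          by (subst filterlim_uminus_at_top[symmetric])
        then have "filterlim (\<lambda>s::real. 1 - s) at_bot at_top" by simp
        then show ?thesis by (rule filterlim_compose[OF exp_at_bot])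
      qed
      then show "((\<lambda>s. exp (1 - s) * ((\<bar>x\<bar> + 1) / (1 + x\<^sup>2))) \<longlongrightarrow> 0) at_top"
        by (intro tendsto_mult_left_zero)
    qed
    then show "((F \<circ> real_of_ereal) \<longlongrightarrow> 0) (at_left \<infinity>)"
      by (simp add: ereal_tendsto_simps)
  qed simp
  also have "(LBINT s=ereal 1..\<infinity>. f s) = (\<integral>s. indicator {1<..} s * (exp (1 - s) * cos (s * x)) \<partial>lborel)"
    by (simp add: interval_integral_to_infinity_eq set_lebesgue_integral_def f_def)
  finally show "(\<integral>s. indicator {1<..} s * (exp (1 - s) * cos (s * x)) \<partial>lborel) = (cos x - x * sin x) / (1 + x\<^sup>2)"
    by (simp add: F_def diff_divide_distrib)
qed

lemma integral_cos_unit: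
  fixes x :: real
  shows "integrable lborel (\<lambda>s. indicator {-1..1} s * cos (s * x))"
  "(\<integral>s. indicator {-1..1} s * cos (s * x) \<partial>lborel) = 2 * sinc x"
proof -
  have "has_bochner_integral lborel (\<lambda>s. cos (s * x) * indicator {-1..1} s) (2 * sinc x)"
  proof (cases "x = 0")
    case True
    have "has_bochner_integral lborel (\<lambda>s::real. 1 * indicator {-1..1} s) ((1::real) - (-1))"
      using has_bochner_integral_FTC_Icc_real[of "-1" 1 "\<lambda>s. s" "\<lambda>s. 1"] by simp
    with True show ?thesis by simp
  next
    case False
    have "has_bochner_integral lborel (\<lambda>s. cos (s * x) * indicator {-1..1} s) (sin (1 * x) / x - sin ((-1) * x) / x)"
      using False by (intro has_bochner_integral_FTC_Icc_real[where F = "\<lambda>s. sin (s * x) / x"]) (auto intro!: derivative_eq_intros)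
    with False show ?thesis by simp
  qed
  then show "integrable lborel (\<lambda>s. indicator {-1..1} s * cos (s * x))"
    "(\<integral>s. indicator {-1..1} s * cos (s * x) \<partial>lborel) = 2 * sinc x"
    by (simp_all add: has_bochner_integral_iff mult.commute)
qed

lemma fourier_psi: "(\<integral>s. of_real (psi s) * iexp (s * x) \<partial>lborel) = of_real (2 * pi * chi x)"
proof -
  have re: "(\<integral>s. psi s * cos (s * x) \<partial>lborel) = 2 * pi * chi x"
  proof -
    let ?t = "\<lambda>s. indicator {1<..} s * (exp (1 - s) * cos (s * x))"
    have t': "integrable lborel (\<lambda>s. ?t (- s))" "(\<integral>s. ?t (- s) \<partial>lborel) = (\<integral>s. ?t s \<partial>lborel)"
      using lborel_integrable_real_affine[OF integral_exp_tail(1)[of x], of "-1" 0]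
        lborel_integral_real_affine[of "-1" ?t 0] by simp_all
    have "(\<integral>s. psi s * cos (s * x) \<partial>lborel) = (\<integral>s. (indicator {-1..1} s * cos (s * x) + ?t s) + ?t (- s) \<partial>lborel)"
      by (intro Bochner_Integration.integral_cong) (auto simp: psi_def indicator_def)
    also have "\<dots> = 2 * sinc x + (cos x - x * sin x) / (1 + x\<^sup>2) + (cos x - x * sin x) / (1 + x\<^sup>2)"
      using t' integral_exp_tail[of x] integral_cos_unit[of x]
      by (subst Bochner_Integration.integral_add; simp)+
    also have "\<dots> = 2 * pi * chi x"
    proof -
      have pos: "1 + x\<^sup>2 \<noteq> 0" using zero_le_power2[of x] by (metis add_pos_nonneg less_irrefl zero_less_one)
      \<comment> \<open>With \<open>sin x = x * S\<close> and \<open>d = 1 + x^2\<close>, the term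
        \<open>x * sin x\<close> equals \<open>d * S - S\<close>. The contribution
        \<open>2 * S\<close> of [-1, 1] cancels, leaving the numerator of
        \<open>chi\<close>.\<close>
      define S where "S = sinc x"
      define d where "d = 1 + x\<^sup>2"
      have d: "d \<noteq> 0" using pos by (simp add: d_def)
      have "sin x = x * S" by (simp add: S_def)
      then have eq: "x * sin x = d * S - S" by (simp add: d_def power2_eq_square algebra_simps)
      show ?thesis
        unfolding eq chi_def S_def[symmetric] d_def[symmetric] using d by (simp add: field_simps)
    qed
    finally show ?thesis .
  qed
  have int: "integrable lborel (\<lambda>s. psi s * cos (s * x))" "integrable lborel (\<lambda>s. psi s * sin (s * x))"
    by (rule Bochner_Integration.integrable_bound[OF integrable_psi];
        auto simp: abs_mult intro!: mult_left_le)+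
  have im: "(\<integral>s. psi s * sin (s * x) \<partial>lborel) = 0"
    using lborel_integral_real_affine[of "-1" "\<lambda>s. psi s * sin (s * x)" 0] by (simp add: psi_even)
  have "(\<integral>s. of_real (psi s) * iexp (s * x) \<partial>lborel)
      = (\<integral>s. of_real (psi s * cos (s * x)) + \<i> * of_real (psi s * sin (s * x)) \<partial>lborel)"
    by (intro Bochner_Integration.integral_cong) (auto simp: complex_eq_iff Re_exp Im_exp)
  also have "\<dots> = of_real (2 * pi * chi x)"
    using int re im by (subst Bochner_Integration.integral_add) (simp_all del: of_real_mult)
  finally show ?thesis .
qed

lemma integrable_chi: "integrable lborel chi"
proof (rule Bochner_Integration.integrable_bound[where f = "\<lambda>x. 2 * jb x powr (- 2)"])
  show "integrable lborel (\<lambda>x. 2 * jb x powr (- 2))"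
    using integrable_jb_powr[of 2] by simp
qed (use abs_chi_le in auto)

lemma fourier_std_normal:
  "(\<integral>x. iexp (t * x) * of_real (std_normal_density x) \<partial>lborel) = of_real (exp (- t\<^sup>2 / 2))"
proof -
  have "char std_normal_distribution t = (\<integral>x. std_normal_density x *\<^sub>R iexp (t * x) \<partial>lborel)"
    unfolding char_def by (subst integral_density) (auto simp: normal_density_nonneg)
  then show ?thesis by (simp add: char_std_normal_distribution scaleR_conv_of_real mult.commute)
qed

lemma integrable_std_normal: "integrable lborel std_normal_density"
  using integrable_normal_density[of 1 0] by simp

text \<open>The Gaussian factor makes the double integral over \<open>s\<close> and the time
  variable absolutely convergent, so that the order can be exchanged. The transform of a Gaussian
  being explicit, the outcome is \<open>psi\<close> mollified at scale \<open>e\<close>.\<close>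

lemma gaussian_mollified_chi:
  assumes e: "e > 0"
  shows "(\<integral>s. of_real (chi s) * iexp (t * s) * of_real (exp (- (e * s)\<^sup>2 / 2)) \<partial>lborel)
    = of_real (\<integral>z. psi (t - e * z) * std_normal_density z \<partial>lborel)"
proof -
  define g where "g = (\<lambda>s. exp (- (e * s)\<^sup>2 / 2))"
  have g: "g s = sqrt (2 * pi) * std_normal_density (e * s)" for s
    by (simp add: g_def std_normal_density_def)
  have intg: "integrable lborel g"
    unfolding g using lborel_integrable_real_affine[OF integrable_std_normal, of e 0] e by simp
  have gm [measurable]: "g \<in> borel_measurable borel" unfolding g_def by measurable
  \<comment> \<open>\<open>fourier_psi\<close> at \<open>- s\<close>, after the substitution
    \<open>u = t - y\<close>; since \<open>chi\<close> is even, this also represents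
    \<open>chi s\<close>.\<close>
  have chi_eq: "of_real (chi s) * iexp (t * s) = (\<integral>y. of_real (psi (t - y)) * iexp (y * s) \<partial>lborel) / of_real (2 * pi)" for s
  proof -
    have "of_real (2 * pi * chi (- s)) = (\<integral>u. of_real (psi u) * iexp (u * (- s)) \<partial>lborel)"
      by (rule fourier_psi[symmetric])
    also have "\<dots> = (\<integral>y. of_real (psi (t + (-1) * y)) * iexp ((t + (-1) * y) * (- s)) \<partial>lborel)"
      by (subst lborel_integral_real_affine[of "-1" _ t]) simp_all
    also have "\<dots> = (\<integral>y. (of_real (psi (t - y)) * iexp (y * s)) * exp (- \<i> * of_real (t * s)) \<partial>lborel)"
      by (intro Bochner_Integration.integral_cong) (auto simp: exp_add[symmetric] algebra_simps)
    also have "\<dots> = (\<integral>y. of_real (psi (t - y)) * iexp (y * s) \<partial>lborel) * exp (- \<i> * of_real (t * s))"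
      by (rule integral_mult_left_zero)
    finally have "of_real (2 * pi * chi (- s)) * iexp (t * s)
        = (\<integral>y. of_real (psi (t - y)) * iexp (y * s) \<partial>lborel) * (exp (- \<i> * of_real (t * s)) * iexp (t * s))"
      by simp
    also have "exp (- \<i> * of_real (t * s)) * iexp (t * s) = 1"
      by (simp add: exp_add[symmetric])
    finally have "of_real (2 * pi * chi (- s)) * iexp (t * s)
        = (\<integral>y. of_real (psi (t - y)) * iexp (y * s) \<partial>lborel)" by simp
    moreover have "chi (- s) = chi s" by (simp add: chi_def)
    ultimately show ?thesis by (simp add: field_simps)
  qed
  let ?h = "\<lambda>s y. of_real (psi (t - y) * g s) * iexp (y * s)"
  have inth: "integrable (lborel \<Otimes>\<^sub>M lborel) (\<lambda>(s, y). ?h s y)"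
  proof -
    have ip: "integrable lborel (\<lambda>y. psi (t - y))"
      using lborel_integrable_real_affine[OF integrable_psi, of "-1" t] by simp
    have "integrable (lborel \<Otimes>\<^sub>M lborel) (\<lambda>(s, y). g s * psi (t - y))"
      using integrable_pair_product[OF sigma_finite_lborel sigma_finite_lborel intg ip] by simp
    then show ?thesis
      by (rule Bochner_Integration.integrable_bound) (auto simp: norm_mult split_beta abs_mult)
  qed
  have "(\<integral>s. of_real (chi s) * iexp (t * s) * of_real (g s) \<partial>lborel)
      = (\<integral>s. (\<integral>y. ?h s y \<partial>lborel) \<partial>lborel) / of_real (2 * pi)"
  proof -
    have "of_real (chi s) * iexp (t * s) * of_real (g s) = (\<integral>y. ?h s y \<partial>lborel) / of_real (2 * pi)" for s
    proof -
      have "(\<integral>y. ?h s y \<partial>lborel) = (\<integral>y. (of_real (psi (t - y)) * iexp (y * s)) * of_real (g s) \<partial>lborel)"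
        by (intro Bochner_Integration.integral_cong) (auto simp: mult_ac)
      also have "\<dots> = (\<integral>y. of_real (psi (t - y)) * iexp (y * s) \<partial>lborel) * of_real (g s)"
        by (rule integral_mult_left_zero)
      finally show ?thesis by (simp only: chi_eq times_divide_eq_left)
    qed
    then show ?thesis by simp
  qed
  also have "(\<integral>s. (\<integral>y. ?h s y \<partial>lborel) \<partial>lborel) = (\<integral>y. (\<integral>s. ?h s y \<partial>lborel) \<partial>lborel)"
    by (rule lborel_pair.Fubini_integral[symmetric]) (rule inth)
  also have "\<dots> = (\<integral>y. of_real (2 * pi / e * (psi (t - y) * std_normal_density (y / e))) \<partial>lborel)"
  proof (intro Bochner_Integration.integral_cong refl)
    fix y
    have "(\<integral>s. ?h s y \<partial>lborel) = (\<integral>s. of_real (psi (t - y) * sqrt (2 * pi)) * (iexp (y / e * (e * s)) * of_real (std_normal_density (e * s))) \<partial>lborel)"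
      using e by (intro Bochner_Integration.integral_cong) (auto simp: g mult_ac)
    also have "\<dots> = of_real (psi (t - y) * sqrt (2 * pi)) * (\<integral>s. iexp (y / e * (e * s)) * of_real (std_normal_density (e * s)) \<partial>lborel)"
      by (rule integral_mult_right_zero)
    also have "(\<integral>s. iexp (y / e * (e * s)) * of_real (std_normal_density (e * s)) \<partial>lborel)
       = of_real (exp (- (y / e)\<^sup>2 / 2) / e)"
    proof -
      have "e \<noteq> 0" using e by simp
      from lborel_integral_real_affine[OF this, of "\<lambda>x. iexp (y / e * x) * of_real (std_normal_density x)" 0]
      have "of_real (exp (- (y / e)\<^sup>2 / 2)) = \<bar>e\<bar> *\<^sub>R (\<integral>s. iexp (y / e * (e * s)) * of_real (std_normal_density (e * s)) \<partial>lborel)"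
        by (simp only: fourier_std_normal add_0)
      then have "of_real (exp (- (y / e)\<^sup>2 / 2)) = of_real e * (\<integral>s. iexp (y / e * (e * s)) * of_real (std_normal_density (e * s)) \<partial>lborel)"
        using e by (simp only: scaleR_conv_of_real abs_of_pos)
      then show ?thesis using \<open>e \<noteq> 0\<close> by (simp only: of_real_divide) (simp add: field_simps)
    qed
    also have "of_real (psi (t - y) * sqrt (2 * pi)) * of_real (exp (- (y / e)\<^sup>2 / 2) / e)
        = (of_real (2 * pi / e * (psi (t - y) * std_normal_density (y / e))) :: complex)"
    proof -
      define r where "r = sqrt (2 * pi)"
      have r: "2 * pi = r * r" "r \<noteq> 0" by (simp_all add: r_def)
      have "psi (t - y) * r * (exp (- (y / e)\<^sup>2 / 2) / e)
          = r * r / e * (psi (t - y) * (1 / r * exp (- (y / e)\<^sup>2 / 2)))"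
        using r(2) e by simp
      then have "psi (t - y) * sqrt (2 * pi) * (exp (- (y / e)\<^sup>2 / 2) / e)
          = 2 * pi / e * (psi (t - y) * std_normal_density (y / e))"
        unfolding std_normal_density_def r_def[symmetric] r(1)[symmetric] .
      then show ?thesis by (metis of_real_mult)
    qed
    finally show "(\<integral>s. ?h s y \<partial>lborel) = of_real (2 * pi / e * (psi (t - y) * std_normal_density (y / e)))" .
  qed
  also have "\<dots> = of_real (\<integral>y. 2 * pi / e * (psi (t - y) * std_normal_density (y / e)) \<partial>lborel)"
    by (rule integral_complex_of_real)
  also have "(\<integral>y. 2 * pi / e * (psi (t - y) * std_normal_density (y / e)) \<partial>lborel)
     = 2 * pi / e * (\<integral>y. psi (t - y) * std_normal_density (y / e) \<partial>lborel)"
    by (rule integral_mult_right_zero)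
  also have "(\<integral>y. psi (t - y) * std_normal_density (y / e) \<partial>lborel) = e * (\<integral>z. psi (t - e * z) * std_normal_density z \<partial>lborel)"
    using lborel_integral_real_affine[of e "\<lambda>y. psi (t - y) * std_normal_density (y / e)" 0] e by simp
  finally show ?thesis using e by (simp add: g_def)
qed

text \<open>The mollification scale tends to 0. Dominated convergence applies on the left because
  \<open>chi\<close> is integrable, and on the right because \<open>psi\<close> is bounded and
  continuous.\<close>

lemma fourier_chi:
  assumes "\<bar>t\<bar> \<le> 1"
  shows "(\<integral>s. of_real (chi s) * iexp (t * s) \<partial>lborel) = 1"
proof -
  define e where "e = (\<lambda>n. inverse (real (Suc n)))"
  have e0: "e \<longlonglongrightarrow> 0" unfolding e_def by (rule LIMSEQ_inverse_real_of_nat)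
  have epos: "e n > 0" for n by (simp add: e_def)
  have lim1: "(\<lambda>n. \<integral>s. of_real (chi s) * iexp (t * s) * of_real (exp (- (e n * s)\<^sup>2 / 2)) \<partial>lborel)
     \<longlonglongrightarrow> (\<integral>s. of_real (chi s) * iexp (t * s) \<partial>lborel)"
  proof (rule integral_dominated_convergence[where w = "\<lambda>s. \<bar>chi s\<bar>"])
    show "integrable lborel (\<lambda>s. \<bar>chi s\<bar>)" using integrable_chi by simp
    show "AE s in lborel. (\<lambda>n. of_real (chi s) * iexp (t * s) * of_real (exp (- (e n * s)\<^sup>2 / 2)))
        \<longlonglongrightarrow> of_real (chi s) * iexp (t * s)"
    proof (rule AE_I2)
      fix s
      have "(\<lambda>n. of_real (chi s) * iexp (t * s) * of_real (exp (- (e n * s)\<^sup>2 / 2)))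
        \<longlonglongrightarrow> of_real (chi s) * iexp (t * s) * of_real (exp (- (0 * s)\<^sup>2 / 2))"
        by (intro tendsto_intros e0) auto
      then show "(\<lambda>n. of_real (chi s) * iexp (t * s) * of_real (exp (- (e n * s)\<^sup>2 / 2)))
        \<longlonglongrightarrow> of_real (chi s) * iexp (t * s)" by simp
    qed
  qed (auto simp: norm_mult intro!: mult_left_le)
  have lim2: "(\<lambda>n. \<integral>z. psi (t - e n * z) * std_normal_density z \<partial>lborel) \<longlonglongrightarrow> (\<integral>z. psi t * std_normal_density z \<partial>lborel)"
  proof (rule integral_dominated_convergence[where w = std_normal_density])
    show "AE z in lborel. (\<lambda>n. psi (t - e n * z) * std_normal_density z) \<longlonglongrightarrow> psi t * std_normal_density z"
    proof (rule AE_I2)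
      fix z
      have "(\<lambda>n. psi (t - e n * z) * std_normal_density z) \<longlonglongrightarrow> psi (t - 0 * z) * std_normal_density z"
        unfolding psi_def by (intro tendsto_intros e0)
      then show "(\<lambda>n. psi (t - e n * z) * std_normal_density z) \<longlonglongrightarrow> psi t * std_normal_density z" by simp
    qed
  qed (auto simp: integrable_std_normal abs_mult psi_bounds intro!: mult_left_le_one_le)
  have "(\<integral>z. psi t * std_normal_density z \<partial>lborel) = 1"
    using psi_eq_1[OF assms] integral_normal_density[of 1 0] by simp
  with lim2 have "(\<lambda>n. complex_of_real (\<integral>z. psi (t - e n * z) * std_normal_density z \<partial>lborel)) \<longlonglongrightarrow> of_real 1"
    by (intro tendsto_of_real) simp
  with lim1 show ?thesis
    unfolding gaussian_mollified_chi[OF epos] using LIMSEQ_unique by fastforce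
qed

section \<open>Profiles and their bilinear interaction\<close>

definition nb :: "real \<Rightarrow> (real \<Rightarrow> complex) \<Rightarrow> ennreal" where
  "nb b h = Nb b (\<lambda>t. ennreal (cmod (h t)))"

definition X :: "real \<Rightarrow> real \<Rightarrow> real \<Rightarrow> (int \<Rightarrow> real \<Rightarrow> complex) \<Rightarrow> ennreal" where
  "X r1 r2 b f = l2norm (count_space UNIV) (\<lambda>n. ennreal (jb (of_int n) powr r1) * nb b (f n))
     + (SUP n. ennreal (jb (of_int n) powr r2) * nb b (f n))"

text \<open>A profile \<open>f\<close> stands for the function with space-time Fourier transform \<open>2 \<pi> f n (\<tau> + \<omega> n)\<close>, where
  \<open>\<omega>\<close> is the dispersion relation; see the predicate \<open>realizes\<close> below. Thus \<open>X\<close> is a Bourgain norm for any \<open>\<omega>\<close>.\<close>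

definition profile :: "(int \<Rightarrow> real \<Rightarrow> complex) \<Rightarrow> bool" where
  "profile f \<longleftrightarrow> (\<forall>n. f n \<in> borel_measurable borel)"

lemma profile_borel: "profile f \<Longrightarrow> f n \<in> borel_measurable borel"
  by (simp add: profile_def)

lemma nb_minus_commute: "nb b (\<lambda>x. f x - g x) = nb b (\<lambda>x. g x - f x)"
  by (simp add: nb_def norm_minus_commute)

lemma X_minus_commute: "X r1 r2 b (\<lambda>n x. f n x - g n x) = X r1 r2 b (\<lambda>n x. g n x - f n x)"
  unfolding X_def by (subst (1 2) nb_minus_commute) (rule refl)

lemma nb_le_X: "nb b (f n) \<le> ennreal (jb (of_int n) powr (- r2)) * X r1 r2 b f"
proof -
  have "ennreal (jb (of_int n) powr r2) * nb b (f n) \<le> (SUP n. ennreal (jb (of_int n) powr r2) * nb b (f n))"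
    by (rule SUP_upper) simp
  also have "\<dots> \<le> X r1 r2 b f" by (simp add: X_def)
  finally have "ennreal (jb (of_int n) powr (- r2)) * (ennreal (jb (of_int n) powr r2) * nb b (f n)) \<le> ennreal (jb (of_int n) powr (- r2)) * X r1 r2 b f"
    by (rule mult_left_mono) simp
  then show ?thesis
    by (simp add: mult.assoc[symmetric] ennreal_mult[symmetric] powr_add[symmetric])
qed

text \<open>Separates two mechanisms: a part controlled by \<open>f\<close> at the same frequency,
  which keeps its norm without smoothing, and an explicit power that decays faster than the supremum
  weight by \<open>d\<close>. The supremum part of the latter contributes the 1, its square sum the
  other summand.\<close>

lemma X_le_pointwise:
  assumes h: "\<And>n. nb b (h n) \<le> c1 * nb b (f n) + c2 * ennreal (jb (of_int n) powr (- r2 - d))"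
    and d: "d \<ge> 0"
  shows "X r1 r2 b h \<le> c1 * X r1 r2 b f + c2 * (l2norm (count_space UNIV) (\<lambda>n :: int. ennreal (jb (of_int n) powr (r1 - r2 - d))) + 1)"
proof -
  have w: "ennreal (jb (of_int n) powr r) * nb b (h n) \<le> c1 * (ennreal (jb (of_int n) powr r) * nb b (f n)) + c2 * ennreal (jb (of_int n) powr (r - r2 - d))" for n r
  proof -
    have "ennreal (jb (of_int n) powr r) * nb b (h n) \<le> ennreal (jb (of_int n) powr r) * (c1 * nb b (f n) + c2 * ennreal (jb (of_int n) powr (- r2 - d)))"
      by (intro mult_left_mono h) simp
    also have "\<dots> = c1 * (ennreal (jb (of_int n) powr r) * nb b (f n)) + c2 * (ennreal (jb (of_int n) powr r) * ennreal (jb (of_int n) powr (- r2 - d)))"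
      by (simp add: distrib_left mult_ac)
    also have "ennreal (jb (of_int n) powr r) * ennreal (jb (of_int n) powr (- r2 - d)) = ennreal (jb (of_int n) powr (r - r2 - d))"
      by (simp add: ennreal_mult[symmetric] powr_add[symmetric] algebra_simps)
    finally show ?thesis .
  qed
  have 1: "l2norm (count_space UNIV) (\<lambda>n. ennreal (jb (of_int n) powr r1) * nb b (h n))
      \<le> c1 * l2norm (count_space UNIV) (\<lambda>n. ennreal (jb (of_int n) powr r1) * nb b (f n))
        + c2 * l2norm (count_space UNIV) (\<lambda>n :: int. ennreal (jb (of_int n) powr (r1 - r2 - d)))"
  proof -
    have "l2norm (count_space UNIV) (\<lambda>n. ennreal (jb (of_int n) powr r1) * nb b (h n))
      \<le> l2norm (count_space UNIV) (\<lambda>n. c1 * (ennreal (jb (of_int n) powr r1) * nb b (f n)) + c2 * ennreal (jb (of_int n) powr (r1 - r2 - d)))"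
      by (intro l2norm_mono w)
    also have "\<dots> \<le> l2norm (count_space UNIV) (\<lambda>n. c1 * (ennreal (jb (of_int n) powr r1) * nb b (f n)))
        + l2norm (count_space UNIV) (\<lambda>n :: int. c2 * ennreal (jb (of_int n) powr (r1 - r2 - d)))"
      by (intro l2norm_add_le) auto
    finally show ?thesis by (simp add: l2norm_cmult)
  qed
  have 2: "(SUP n. ennreal (jb (of_int n) powr r2) * nb b (h n)) \<le> c1 * (SUP n. ennreal (jb (of_int n) powr r2) * nb b (f n)) + c2 * 1"
  proof (rule SUP_least)
    fix n
    note w[of n r2]
    also have "c1 * (ennreal (jb (of_int n) powr r2) * nb b (f n)) + c2 * ennreal (jb (of_int n) powr (r2 - r2 - d))
      \<le> c1 * (SUP n. ennreal (jb (of_int n) powr r2) * nb b (f n)) + c2 * 1"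
    proof (intro add_mono mult_left_mono)
      show "ennreal (jb (of_int n) powr r2) * nb b (f n) \<le> (SUP n. ennreal (jb (of_int n) powr r2) * nb b (f n))"
        by (rule SUP_upper) simp
      have "jb (of_int n) powr (r2 - r2 - d) \<le> jb (of_int n) powr 0" using d by (intro powr_mono) auto
      then show "ennreal (jb (of_int n) powr (r2 - r2 - d)) \<le> 1" by simp
    qed auto
    finally show "ennreal (jb (of_int n) powr r2) * nb b (h n) \<le> c1 * (SUP n. ennreal (jb (of_int n) powr r2) * nb b (f n)) + c2 * 1" .
  qed
  have "X r1 r2 b h \<le> (c1 * l2norm (count_space UNIV) (\<lambda>n. ennreal (jb (of_int n) powr r1) * nb b (f n))
        + c2 * l2norm (count_space UNIV) (\<lambda>n :: int. ennreal (jb (of_int n) powr (r1 - r2 - d))))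
        + (c1 * (SUP n. ennreal (jb (of_int n) powr r2) * nb b (f n)) + c2 * 1)"
    unfolding X_def by (intro add_mono 1 2)
  also have "\<dots> = c1 * X r1 r2 b f + c2 * (l2norm (count_space UNIV) (\<lambda>n :: int. ennreal (jb (of_int n) powr (r1 - r2 - d))) + 1)"
    unfolding X_def by (simp only: distrib_left ac_simps)
  finally show ?thesis .
qed

lemma nb_triangle:
  assumes [measurable]: "f \<in> borel_measurable borel" "g \<in> borel_measurable borel"
  shows "nb b (\<lambda>x. f x + g x) \<le> nb b f + nb b g"
proof -
  have "nb b (\<lambda>x. f x + g x) \<le> l2norm lborel (\<lambda>t. ennreal (jb t powr b) * ennreal (cmod (f t)) + ennreal (jb t powr b) * ennreal (cmod (g t)))"
    unfolding nb_def Nb_def distrib_left[symmetric]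
    by (intro l2norm_mono mult_left_mono) (auto simp: ennreal_plus[symmetric] norm_triangle_ineq simp del: ennreal_plus)
  also have "\<dots> \<le> nb b f + nb b g"
    unfolding nb_def Nb_def by (intro l2norm_add_le) measurable
  finally show ?thesis .
qed

lemma X_triangle:
  assumes "profile f" "profile g" and h: "\<And>n x. h n x = f n x + g n x"
  shows "X r1 r2 b h \<le> X r1 r2 b f + X r1 r2 b g"
proof -
  have hb: "nb b (h n) \<le> nb b (f n) + nb b (g n)" for n
    unfolding h by (intro nb_triangle profile_borel assms)
  have 1: "l2norm (count_space UNIV) (\<lambda>n. ennreal (jb (of_int n) powr r1) * nb b (h n))
      \<le> l2norm (count_space UNIV) (\<lambda>n. ennreal (jb (of_int n) powr r1) * nb b (f n))
        + l2norm (count_space UNIV) (\<lambda>n. ennreal (jb (of_int n) powr r1) * nb b (g n))"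
    by (rule order_trans[OF l2norm_mono l2norm_add_le]) (auto simp: distrib_left[symmetric] intro!: mult_left_mono hb)
  have 2: "(SUP n. ennreal (jb (of_int n) powr r2) * nb b (h n))
     \<le> (SUP n. ennreal (jb (of_int n) powr r2) * nb b (f n)) + (SUP n. ennreal (jb (of_int n) powr r2) * nb b (g n))"
  proof (rule SUP_least)
    fix n
    have "ennreal (jb (of_int n) powr r2) * nb b (h n) \<le> ennreal (jb (of_int n) powr r2) * nb b (f n) + ennreal (jb (of_int n) powr r2) * nb b (g n)"
      unfolding distrib_left[symmetric] by (intro mult_left_mono hb) simp
    also have "\<dots> \<le> (SUP n. ennreal (jb (of_int n) powr r2) * nb b (f n)) + (SUP n. ennreal (jb (of_int n) powr r2) * nb b (g n))"
      by (intro add_mono SUP_upper) auto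
    finally show "ennreal (jb (of_int n) powr r2) * nb b (h n) \<le> \<dots>" .
  qed
  show ?thesis
    unfolding X_def using add_mono[OF 1 2] by (simp add: ac_simps)
qed

lemma X_eq_0_AE:
  assumes "X r1 r2 b f = 0" and "profile f"
  shows "AE x in lborel. f n x = 0"
proof -
  have [measurable]: "f n \<in> borel_measurable borel" using assms by (intro profile_borel)
  have "nb b (f n) \<le> 0" using nb_le_X[of b f n r2 r1] assms by simp
  then have "AE x in lborel. ennreal (jb x powr b) * ennreal (cmod (f n x)) = 0"
    unfolding nb_def Nb_def by (subst (asm) le_zero_eq, subst (asm) l2norm_eq_0_iff) measurable
  then show ?thesis by eventually_elim (auto simp: ennreal_eq_0_iff)
qed

section \<open>Integration over one frequency and two modulations\<close>

lemma measurable_pair_count_space_snd: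
  fixes h :: "'a \<Rightarrow> 'b :: countable \<Rightarrow> 'c"
  assumes "\<And>k. (\<lambda>x. h x k) \<in> measurable M N"
  shows "case_prod h \<in> measurable (M \<Otimes>\<^sub>M count_space UNIV) N"
proof -
  have "(\<lambda>(k, x). h x k) \<in> measurable (count_space UNIV \<Otimes>\<^sub>M M) N"
    by (rule measurable_pair_measure_countable1) (use assms in auto)
  from measurable_compose[OF measurable_pair_swap' this] show ?thesis
    by (simp add: case_prod_unfold)
qed

lemma sigma_finite_count_space_countable [simp, intro]:
  "sigma_finite_measure (count_space (UNIV :: 'b :: countable set))"
  by (rule sigma_finite_measure_count_space_countable) simp

text \<open>The frequency of the second factor and the modulations of both. As a single sigma-finite
  measure it lets Fubini and dominated convergence act on the sum over frequencies and on the
  integrals at once.\<close>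

abbreviation kxy :: "(int \<times> real \<times> real) measure" where
  "kxy \<equiv> count_space UNIV \<Otimes>\<^sub>M (lborel \<Otimes>\<^sub>M lborel)"

lemma sigma_finite_lborel_pair: "sigma_finite_measure (lborel \<Otimes>\<^sub>M lborel :: (real \<times> real) measure)"
  by (rule lborel_pair.sigma_finite_measure_axioms)

lemma sigma_finite_kxy: "sigma_finite_measure kxy"
proof -
  interpret pair_sigma_finite "count_space (UNIV :: int set)" "lborel \<Otimes>\<^sub>M lborel :: (real \<times> real) measure"
    unfolding pair_sigma_finite_def using sigma_finite_lborel_pair by auto
  show ?thesis by unfold_locales
qed

lemma measurable_kxy:
  assumes "\<And>k. (\<lambda>(x, y). h k x y) \<in> borel_measurable (lborel \<Otimes>\<^sub>M lborel)"
  shows "(\<lambda>(k, x, y). h k x y) \<in> borel_measurable kxy"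
  by (rule measurable_pair_measure_countable1) (use assms in auto)

lemma nn_integral_kxy:
  assumes h: "\<And>k. (\<lambda>(x, y). h k x y) \<in> borel_measurable (lborel \<Otimes>\<^sub>M lborel)"
  shows "(\<integral>\<^sup>+z. (case z of (k, x, y) \<Rightarrow> h k x y) \<partial>kxy) = (\<integral>\<^sup>+k. \<integral>\<^sup>+x. \<integral>\<^sup>+y. h k x y \<partial>lborel \<partial>lborel \<partial>count_space UNIV)"
proof -
  have "(\<integral>\<^sup>+z. (case z of (k, x, y) \<Rightarrow> h k x y) \<partial>kxy)
    = (\<integral>\<^sup>+k. \<integral>\<^sup>+z. (case z of (x, y) \<Rightarrow> h k x y) \<partial>(lborel \<Otimes>\<^sub>M lborel) \<partial>count_space UNIV)"
    by (subst sigma_finite_measure.nn_integral_fst[OF sigma_finite_lborel_pair, symmetric]) (use measurable_kxy[of h] h in auto)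
  also have "\<dots> = (\<integral>\<^sup>+k. \<integral>\<^sup>+x. \<integral>\<^sup>+y. h k x y \<partial>lborel \<partial>lborel \<partial>count_space UNIV)"
    by (intro nn_integral_cong) (use lborel.nn_integral_fst[OF h] in auto)
  finally show ?thesis .
qed

text \<open>Holds without integrability, since the integral is then 0 by convention. Hence the
  bounds for \<open>Bil\<close> require only measurability.\<close>

lemma ennreal_norm_integral_le:
  fixes f :: "'a \<Rightarrow> 'b :: {banach, second_countable_topology}"
  shows "ennreal (norm (integral\<^sup>L M f)) \<le> (\<integral>\<^sup>+x. ennreal (norm (f x)) \<partial>M)"
  by (cases "integrable M f") (auto simp: integral_norm_bound_ennreal not_integrable_integral_eq)

definition interaction :: "(int \<Rightarrow> real \<Rightarrow> complex) \<Rightarrow> (int \<Rightarrow> real \<Rightarrow> complex) \<Rightarrow> int \<Rightarrow> int \<times> real \<times> real \<Rightarrow> complex" where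
  "interaction f g n = (\<lambda>(k, x, y). f (n - k) x * g k y)"

text \<open>The truncated Duhamel integral in terms of profiles: once the free evolutions are
  undone, the product oscillates in time at the frequency \<open>x + y + \<Psi> n k\<close>, and
  \<open>KT\<close> integrates this oscillation. The factor \<open>c n\<close> collects the coupling
  constant and the derivative.\<close>

definition Bil :: "real \<Rightarrow> (int \<Rightarrow> complex) \<Rightarrow> (int \<Rightarrow> int \<Rightarrow> real) \<Rightarrow>
    (int \<Rightarrow> real \<Rightarrow> complex) \<Rightarrow> (int \<Rightarrow> real \<Rightarrow> complex) \<Rightarrow> int \<Rightarrow> real \<Rightarrow> complex" where
  "Bil T c \<Psi> f g n s = c n * (\<integral>z. KT T s (case z of (k, x, y) \<Rightarrow> x + y + \<Psi> n k) * interaction f g n z \<partial>kxy)"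

lemma measurable_interaction:
  assumes "profile f" "profile g"
  shows "interaction f g n \<in> borel_measurable kxy"
proof -
  note [measurable] = assms[THEN profile_borel]
  show ?thesis unfolding interaction_def by (rule measurable_kxy) measurable
qed

lemma measurable_phase [measurable]: "(\<lambda>z. case z of (k, x, y) \<Rightarrow> x + y + \<Psi> k) \<in> borel_measurable kxy"
  by (rule measurable_kxy) measurable

lemma profile_Bil:
  assumes "profile f" "profile g"
  shows "profile (Bil T c \<Psi> f g)"
proof -
  note [measurable] = measurable_interaction[OF assms]
  interpret K: sigma_finite_measure kxy by (rule sigma_finite_kxy)
  show ?thesis
    unfolding profile_def Bil_def[abs_def] by measurable
qed

text \<open>Minkowski's inequality moves the norm in the modulation inside the sum over
  \<open>k\<close>, where \<open>Nb_duhamel_le\<close> applies with the constant phase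
  \<open>\<Psi> n k\<close>.\<close>

lemma nb_Bil_le:
  assumes a: "0 \<le> a" "a < 1/2" and b: "1/2 < b" "b < 1" and ab: "a + b \<le> 1"
  obtains C where "C > 0" and "\<And>T c \<Psi> f g n. 0 < T \<Longrightarrow> T \<le> 1 \<Longrightarrow> profile f \<Longrightarrow> profile g \<Longrightarrow>
    nb b (Bil T c \<Psi> f g n) \<le> ennreal (C * T powr (1 - a - b) * cmod (c n)) *
      (\<integral>\<^sup>+k. ennreal (jb (\<Psi> n k) powr (- a)) * (nb b (f (n - k)) * nb b (g k)) \<partial>count_space UNIV)"
proof -
  obtain C where C: "C > 0" and D: "\<And>T \<Psi> f g. 0 < T \<Longrightarrow> T \<le> 1 \<Longrightarrow> f \<in> borel_measurable borel \<Longrightarrow> g \<in> borel_measurable borel \<Longrightarrow>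
    Nb b (\<lambda>s. \<integral>\<^sup>+x. (\<integral>\<^sup>+y. ennreal (cmod (KT T s (x + y + \<Psi>))) * (f x * g y) \<partial>lborel) \<partial>lborel)
      \<le> ennreal (C * T powr (1 - a - b) * jb \<Psi> powr (- a)) * Nb b f * Nb b g"
    using Nb_duhamel_le[OF a b ab] by blast
  show ?thesis
  proof (rule that[OF C])
    fix T :: real and c :: "int \<Rightarrow> complex" and \<Psi> :: "int \<Rightarrow> int \<Rightarrow> real" and f g :: "int \<Rightarrow> real \<Rightarrow> complex" and n :: int
    assume T: "0 < T" "T \<le> 1" and "profile f" "profile g"
    note [measurable] = this(3,4)[THEN profile_borel]
    let ?F = "\<lambda>k x. ennreal (cmod (f (n - k) x))" and ?G = "\<lambda>k y. ennreal (cmod (g k y))"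
    define h where "h = (\<lambda>s k. \<integral>\<^sup>+x. (\<integral>\<^sup>+y. ennreal (cmod (KT T s (x + y + \<Psi> n k))) * (?F k x * ?G k y) \<partial>lborel) \<partial>lborel)"
    have [measurable]: "(\<lambda>s. h s k) \<in> borel_measurable borel" for k
      unfolding h_def by measurable
    have pt: "ennreal (cmod (Bil T c \<Psi> f g n s)) \<le> ennreal (cmod (c n)) * (\<integral>\<^sup>+k. h s k \<partial>count_space UNIV)" for s
    proof -
      have "ennreal (cmod (Bil T c \<Psi> f g n s)) = ennreal (cmod (c n)) *
          ennreal (cmod (\<integral>z. KT T s (case z of (k, x, y) \<Rightarrow> x + y + \<Psi> n k) * interaction f g n z \<partial>kxy))"
        by (simp add: Bil_def norm_mult ennreal_mult)
      also have "\<dots> \<le> ennreal (cmod (c n)) *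
          (\<integral>\<^sup>+z. ennreal (cmod (KT T s (case z of (k, x, y) \<Rightarrow> x + y + \<Psi> n k) * interaction f g n z)) \<partial>kxy)"
        by (intro mult_left_mono ennreal_norm_integral_le) simp
      also have "(\<integral>\<^sup>+z. ennreal (cmod (KT T s (case z of (k, x, y) \<Rightarrow> x + y + \<Psi> n k) * interaction f g n z)) \<partial>kxy)
        = (\<integral>\<^sup>+z. (case z of (k, x, y) \<Rightarrow> ennreal (cmod (KT T s (x + y + \<Psi> n k))) * (?F k x * ?G k y)) \<partial>kxy)"
        by (intro nn_integral_cong) (auto simp: interaction_def norm_mult ennreal_mult split: prod.splits)
      also have "\<dots> = (\<integral>\<^sup>+k. h s k \<partial>count_space UNIV)"
        unfolding h_def by (rule nn_integral_kxy) measurable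
      finally show ?thesis .
    qed
    have "nb b (Bil T c \<Psi> f g n) \<le> l2norm lborel (\<lambda>s. ennreal (cmod (c n)) * (\<integral>\<^sup>+k. ennreal (jb s powr b) * h s k \<partial>count_space UNIV))"
      unfolding nb_def Nb_def
    proof (intro l2norm_mono)
      fix s
      have "ennreal (jb s powr b) * ennreal (cmod (Bil T c \<Psi> f g n s)) \<le> ennreal (jb s powr b) * (ennreal (cmod (c n)) * (\<integral>\<^sup>+k. h s k \<partial>count_space UNIV))"
        by (intro mult_left_mono pt) simp
      then show "ennreal (jb s powr b) * ennreal (cmod (Bil T c \<Psi> f g n s)) \<le> ennreal (cmod (c n)) * (\<integral>\<^sup>+k. ennreal (jb s powr b) * h s k \<partial>count_space UNIV)"
        by (subst nn_integral_cmult) (simp_all add: mult_ac)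
    qed
    also have "\<dots> = ennreal (cmod (c n)) * l2norm lborel (\<lambda>s. \<integral>\<^sup>+k. ennreal (jb s powr b) * h s k \<partial>count_space UNIV)"
    proof (rule l2norm_cmult)
      interpret sigma_finite_measure "count_space (UNIV :: int set)" by simp
      have "case_prod (\<lambda>s k. ennreal (jb s powr b) * h s k) \<in> borel_measurable (lborel \<Otimes>\<^sub>M count_space UNIV)"
        by (rule measurable_pair_count_space_snd) measurable
      then show "(\<lambda>s. \<integral>\<^sup>+k. ennreal (jb s powr b) * h s k \<partial>count_space UNIV) \<in> borel_measurable lborel"
        by (rule borel_measurable_nn_integral)
    qed
    also have "\<dots> \<le> ennreal (cmod (c n)) * (\<integral>\<^sup>+k. l2norm lborel (\<lambda>s. ennreal (jb s powr b) * h s k) \<partial>count_space UNIV)"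
      by (intro mult_left_mono l2norm_nn_integral_le sigma_finite_lborel sigma_finite_count_space_countable measurable_pair_count_space_snd) measurable
    also have "\<dots> \<le> ennreal (cmod (c n)) * (\<integral>\<^sup>+k. ennreal (C * T powr (1 - a - b)) * (ennreal (jb (\<Psi> n k) powr (- a)) * (nb b (f (n - k)) * nb b (g k))) \<partial>count_space UNIV)"
    proof (intro mult_left_mono nn_integral_mono)
      fix k
      have "l2norm lborel (\<lambda>s. ennreal (jb s powr b) * h s k) \<le> ennreal (C * T powr (1 - a - b) * jb (\<Psi> n k) powr (- a)) * nb b (f (n - k)) * nb b (g k)"
        using D[OF T, of "?F k" "?G k" "\<Psi> n k"] unfolding h_def nb_def Nb_def by simp
      also have "\<dots> = ennreal (C * T powr (1 - a - b)) * (ennreal (jb (\<Psi> n k) powr (- a)) * (nb b (f (n - k)) * nb b (g k)))"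
        using C by (simp add: ennreal_mult mult_ac)
      finally show "l2norm lborel (\<lambda>s. ennreal (jb s powr b) * h s k) \<le> \<dots>" .
    qed simp
    also have "\<dots> = ennreal (C * T powr (1 - a - b) * cmod (c n)) * (\<integral>\<^sup>+k. ennreal (jb (\<Psi> n k) powr (- a)) * (nb b (f (n - k)) * nb b (g k)) \<partial>count_space UNIV)"
      using C by (subst nn_integral_cmult) (simp_all add: ennreal_mult mult_ac)
    finally show "nb b (Bil T c \<Psi> f g n) \<le> \<dots>" .
  qed
qed

section \<open>Summation over the interacting frequencies\<close>

lemma bij_int_reflect: "bij (\<lambda>k :: int. n - k)"
  by (rule bij_betwI[where g = "\<lambda>k. n - k"]) auto

lemma nn_integral_int_reflect:
  "(\<integral>\<^sup>+k. f (n - k) \<partial>count_space (UNIV :: int set)) = (\<integral>\<^sup>+k. f k \<partial>count_space UNIV)"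
  by (rule nn_integral_bij_count_space[OF bij_int_reflect])

lemma sum_weights_bounded:
  assumes "\<And>n. (\<integral>\<^sup>+k. ennreal (jb (L n k) powr (-(9/8))) \<partial>count_space (UNIV :: int set)) \<le> ennreal D" "D \<ge> 0"
  obtains C where "C > 0" and "\<And>n :: int. (\<integral>\<^sup>+k. ennreal (jb (of_int k) powr (-(9/8)) + jb (L n k) powr (-(9/8))
      + jb (of_int (n - k)) powr (-(9/8))) \<partial>count_space (UNIV :: int set)) \<le> ennreal C"
proof -
  define S where "S = (\<integral>\<^sup>+n. ennreal (jb (of_int n) powr (-(9/8))) \<partial>count_space (UNIV :: int set))"
  have "S < \<infinity>" unfolding S_def by (rule nn_integral_int_jb_powr_finite) simp
  then obtain S' where S': "S = ennreal S'" "S' \<ge> 0"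
    by (metis infinity_ennreal_def less_top_ennreal)
  show ?thesis
  proof (rule that[of "S' + D + S' + 1"])
    fix n :: int
    have "(\<integral>\<^sup>+k. ennreal (jb (of_int k) powr (-(9/8)) + jb (L n k) powr (-(9/8)) + jb (of_int (n - k)) powr (-(9/8))) \<partial>count_space (UNIV :: int set))
      = S + (\<integral>\<^sup>+k. ennreal (jb (L n k) powr (-(9/8))) \<partial>count_space (UNIV :: int set)) + (\<integral>\<^sup>+k. ennreal (jb (of_int (n - k)) powr (-(9/8))) \<partial>count_space (UNIV :: int set))"
      by (simp add: nn_integral_add S_def ennreal_plus)
    also have "(\<integral>\<^sup>+k. ennreal (jb (of_int (n - k)) powr (-(9/8))) \<partial>count_space (UNIV :: int set)) = S"
      unfolding S_def by (rule nn_integral_int_reflect[of "\<lambda>k. ennreal (jb (of_int k) powr (-(9/8)))"])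
    also have "S + (\<integral>\<^sup>+k. ennreal (jb (L n k) powr (-(9/8))) \<partial>count_space (UNIV :: int set)) + S \<le> ennreal S' + ennreal D + ennreal S'"
      unfolding S' by (intro add_mono assms) auto
    also have "\<dots> = ennreal (S' + D + S')"
      using S' assms(2) by (simp only: ennreal_plus add_nonneg_nonneg)
    also have "\<dots> \<le> ennreal (S' + D + S' + 1)" by (intro ennreal_leI) simp
    finally show "(\<integral>\<^sup>+k. ennreal (jb (of_int k) powr (-(9/8)) + jb (L n k) powr (-(9/8)) + jb (of_int (n - k)) powr (-(9/8))) \<partial>count_space (UNIV :: int set)) \<le> \<dots>" .
  qed (use S' assms(2) in auto)
qed

text \<open>The frequency \<open>k = 0\<close> is left out because the phase vanishes there for
  every \<open>n\<close>.\<close>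

lemma sum_phase_u:
  fixes \<gamma> p :: real
  assumes \<gamma>: "\<bar>\<gamma>\<bar> \<noteq> 1" and p: "31/32 < p" "p < 1"
  obtains C where "C > 0" and "\<And>n :: int. (\<integral>\<^sup>+k. ennreal (jb (phase_u \<gamma> n k) powr (-(7/16)) * (jb (of_int (n - k)) powr (- p) * jb (of_int k) powr (-(p - 1/2))))
        * indicator (- {0}) k \<partial>count_space UNIV) \<le> ennreal (C * jb (of_int n) powr (- p - 1/16))"
proof -
  obtain C1 where C1: "C1 > 0" and B: "\<And>n k :: int. k \<noteq> 0 \<Longrightarrow>
      jb (phase_u \<gamma> n k) powr (-(7/16)) * jb (of_int (n - k)) powr (- p) * jb (of_int k) powr (-(p - 1/2))
      \<le> C1 * jb (of_int n) powr (- p - 1/16) * (jb (of_int k) powr (-(9/8))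
          + jb (2 * of_int n - of_int k - \<gamma> * \<bar>of_int k\<bar>) powr (-(9/8)) + jb (of_int (n - k)) powr (-(9/8)))"
    using phase_u_term_bound[OF \<gamma> p] by blast
  \<comment> \<open>The second factor of the phase is piecewise affine in \<open>k\<close>, with one
    slope on each half line; neither slope vanishes since the modulus of \<gamma> is not 1.\<close>
  have \<rho>: "- 1 - \<gamma> \<noteq> 0" "\<gamma> - 1 \<noteq> 0" and s: "9/8 > (1::real)" using \<gamma> by auto
  obtain D1 where D1: "D1 > 0" "\<And>x. (\<integral>\<^sup>+k. ennreal (jb (x + (- 1 - \<gamma>) * of_int k) powr (-(9/8))) \<partial>count_space (UNIV :: int set)) \<le> ennreal D1"
    using nn_integral_affine_jb_powr_bounded[OF s \<rho>(1)] by blast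
  obtain D2 where D2: "D2 > 0" "\<And>x. (\<integral>\<^sup>+k. ennreal (jb (x + (\<gamma> - 1) * of_int k) powr (-(9/8))) \<partial>count_space (UNIV :: int set)) \<le> ennreal D2"
    using nn_integral_affine_jb_powr_bounded[OF s \<rho>(2)] by blast
  have "(\<integral>\<^sup>+k. ennreal (jb (2 * of_int n - of_int k - \<gamma> * \<bar>of_int k\<bar>) powr (-(9/8))) \<partial>count_space (UNIV :: int set)) \<le> ennreal (D1 + D2)" for n :: int
  proof -
    have "(\<integral>\<^sup>+k. ennreal (jb (2 * of_int n - of_int k - \<gamma> * \<bar>of_int k\<bar>) powr (-(9/8))) \<partial>count_space (UNIV :: int set))
      \<le> (\<integral>\<^sup>+k. ennreal (jb (2 * of_int n + (- 1 - \<gamma>) * of_int k) powr (-(9/8))) + ennreal (jb (2 * of_int n + (\<gamma> - 1) * of_int k) powr (-(9/8))) \<partial>count_space (UNIV :: int set))"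
    proof (intro nn_integral_mono)
      fix k :: int
      have gen: "ennreal (jb l powr e) \<le> ennreal (jb x powr e) + ennreal (jb y powr e)" if "l \<in> {x, y}" for l x y e
        using that by auto
      have "2 * of_int n - of_int k - \<gamma> * \<bar>of_int k\<bar> \<in> {2 * of_int n + (- 1 - \<gamma>) * of_int k, 2 * of_int n + (\<gamma> - 1) * (of_int k :: real)}"
        by (cases "k \<ge> 0") (auto simp: algebra_simps)
      then show "ennreal (jb (2 * of_int n - of_int k - \<gamma> * \<bar>of_int k\<bar>) powr (-(9/8)))
        \<le> ennreal (jb (2 * of_int n + (- 1 - \<gamma>) * of_int k) powr (-(9/8))) + ennreal (jb (2 * of_int n + (\<gamma> - 1) * of_int k) powr (-(9/8)))"
        by (rule gen)
    qed
    also have "\<dots> \<le> ennreal D1 + ennreal D2"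
      by (subst nn_integral_add) (auto intro!: add_mono D1 D2)
    finally show ?thesis using D1 D2 by (simp add: ennreal_plus)
  qed
  note D = this
  have "0 \<le> D1 + D2" using D1 D2 by simp
  from sum_weights_bounded[of "\<lambda>n k. 2 * of_int n - of_int k - \<gamma> * \<bar>of_int k\<bar>", OF D this] obtain C2 where C2: "C2 > 0" "\<And>n :: int. (\<integral>\<^sup>+k. ennreal (jb (of_int k) powr (-(9/8)) + jb (2 * of_int n - of_int k - \<gamma> * \<bar>of_int k\<bar>) powr (-(9/8))
      + jb (of_int (n - k)) powr (-(9/8))) \<partial>count_space (UNIV :: int set)) \<le> ennreal C2"
    by blast
  show ?thesis
  proof (rule that[of "C1 * C2"])
    fix n :: int
    let ?W = "\<lambda>k. jb (of_int k) powr (-(9/8)) + jb (2 * of_int n - of_int k - \<gamma> * \<bar>of_int k\<bar>) powr (-(9/8)) + jb (of_int (n - k)) powr (-(9/8))"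
    have "(\<integral>\<^sup>+k. ennreal (jb (phase_u \<gamma> n k) powr (-(7/16)) * (jb (of_int (n - k)) powr (- p) * jb (of_int k) powr (-(p - 1/2)))) * indicator (- {0}) k \<partial>count_space UNIV)
      \<le> (\<integral>\<^sup>+k. ennreal (C1 * jb (of_int n) powr (- p - 1/16)) * ennreal (?W k) \<partial>count_space UNIV)"
    proof (intro nn_integral_mono)
      fix k
      show "ennreal (jb (phase_u \<gamma> n k) powr (-(7/16)) * (jb (of_int (n - k)) powr (- p) * jb (of_int k) powr (-(p - 1/2)))) * indicator (- {0}) k
        \<le> ennreal (C1 * jb (of_int n) powr (- p - 1/16)) * ennreal (?W k)"
      proof (cases "k = 0")
        case False
        then show ?thesis
          using B[OF False, of n] C1 by (subst ennreal_mult[symmetric]) (auto intro!: ennreal_leI simp: mult.assoc)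
      qed simp
    qed
    also have "\<dots> = ennreal (C1 * jb (of_int n) powr (- p - 1/16)) * (\<integral>\<^sup>+k. ennreal (?W k) \<partial>count_space UNIV)"
      by (rule nn_integral_cmult) simp
    also have "\<dots> \<le> ennreal (C1 * jb (of_int n) powr (- p - 1/16)) * ennreal C2"
      by (intro mult_left_mono C2) simp
    also have "\<dots> = ennreal (C1 * C2 * jb (of_int n) powr (- p - 1/16))"
      using C1 C2 by (simp add: ennreal_mult[symmetric] mult_ac)
    finally show "(\<integral>\<^sup>+k. ennreal (jb (phase_u \<gamma> n k) powr (-(7/16)) * (jb (of_int (n - k)) powr (- p) * jb (of_int k) powr (-(p - 1/2)))) * indicator (- {0}) k \<partial>count_space UNIV) \<le> \<dots>" .
  qed (use C1 C2 in auto)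
qed

lemma sum_phase_v:
  fixes \<gamma> p :: real
  assumes \<gamma>: "\<bar>\<gamma>\<bar> \<noteq> 1" and p: "31/32 < p" "p < 1"
  obtains C where "C > 0" and "\<And>n :: int. (\<integral>\<^sup>+k. ennreal (\<bar>of_int n\<bar> * (jb (phase_v \<gamma> n k) powr (-(7/16)) * (jb (of_int (n - k)) powr (- p) * jb (of_int k) powr (- p))))
        \<partial>count_space UNIV) \<le> ennreal (C * jb (of_int n) powr (- (p - 1/2) - 1/16))"
proof -
  obtain C1 where C1: "C1 > 0" and B: "\<And>n k :: int.
      \<bar>of_int n\<bar> * jb (phase_v \<gamma> n k) powr (-(7/16)) * jb (of_int (n - k)) powr (- p) * jb (of_int k) powr (- p)
      \<le> C1 * jb (of_int n) powr (- (p - 1/2) - 1/16) * (jb (of_int k) powr (-(9/8))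
          + jb (\<gamma> * \<bar>of_int n\<bar> - of_int n + 2 * of_int k) powr (-(9/8)) + jb (of_int (n - k)) powr (-(9/8)))"
    using phase_v_term_bound[OF \<gamma> p] by blast
  \<comment> \<open>Here the second factor is affine in \<open>k\<close> with slope 2.\<close>
  have \<rho>: "(2::real) \<noteq> 0" and s: "9/8 > (1::real)" by auto
  obtain D1 where D1: "D1 > 0" "\<And>x. (\<integral>\<^sup>+k. ennreal (jb (x + 2 * of_int k) powr (-(9/8))) \<partial>count_space (UNIV :: int set)) \<le> ennreal D1"
    using nn_integral_affine_jb_powr_bounded[OF s \<rho>] by blast
  from sum_weights_bounded[of "\<lambda>n k. \<gamma> * \<bar>of_int n\<bar> - of_int n + 2 * of_int k", OF D1(2) less_imp_le[OF D1(1)]]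
  obtain C2 where C2: "C2 > 0" "\<And>n :: int. (\<integral>\<^sup>+k. ennreal (jb (of_int k) powr (-(9/8)) + jb (\<gamma> * \<bar>of_int n\<bar> - of_int n + 2 * of_int k) powr (-(9/8))
      + jb (of_int (n - k)) powr (-(9/8))) \<partial>count_space (UNIV :: int set)) \<le> ennreal C2"
    by blast
  show ?thesis
  proof (rule that[of "C1 * C2"])
    fix n :: int
    let ?W = "\<lambda>k. jb (of_int k) powr (-(9/8)) + jb (\<gamma> * \<bar>of_int n\<bar> - of_int n + 2 * of_int k) powr (-(9/8)) + jb (of_int (n - k)) powr (-(9/8))"
    have "(\<integral>\<^sup>+k. ennreal (\<bar>of_int n\<bar> * (jb (phase_v \<gamma> n k) powr (-(7/16)) * (jb (of_int (n - k)) powr (- p) * jb (of_int k) powr (- p)))) \<partial>count_space UNIV)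
      \<le> (\<integral>\<^sup>+k. ennreal (C1 * jb (of_int n) powr (- (p - 1/2) - 1/16)) * ennreal (?W k) \<partial>count_space UNIV)"
      using B[of n] C1 by (intro nn_integral_mono, subst ennreal_mult[symmetric]) (auto intro!: ennreal_leI simp: mult.assoc)
    also have "\<dots> = ennreal (C1 * jb (of_int n) powr (- (p - 1/2) - 1/16)) * (\<integral>\<^sup>+k. ennreal (?W k) \<partial>count_space UNIV)"
      by (rule nn_integral_cmult) simp
    also have "\<dots> \<le> ennreal (C1 * jb (of_int n) powr (- (p - 1/2) - 1/16)) * ennreal C2"
      by (intro mult_left_mono C2) simp
    also have "\<dots> = ennreal (C1 * C2 * jb (of_int n) powr (- (p - 1/2) - 1/16))"
      using C1 C2 by (simp add: ennreal_mult[symmetric] mult_ac)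
    finally show "(\<integral>\<^sup>+k. ennreal (\<bar>of_int n\<bar> * (jb (phase_v \<gamma> n k) powr (-(7/16)) * (jb (of_int (n - k)) powr (- p) * jb (of_int k) powr (- p)))) \<partial>count_space UNIV) \<le> \<dots>" .
  qed (use C1 C2 in auto)
qed

lemma l2norm_int_jb_powr_finite:
  assumes "r < - (1/2)"
  shows "l2norm (count_space UNIV) (\<lambda>n :: int. ennreal (jb (of_int n) powr r)) < \<infinity>"
proof -
  have "(\<lambda>n :: int. (ennreal (jb (of_int n) powr r))\<^sup>2) = (\<lambda>n. ennreal (jb (of_int n) powr (- (- 2 * r))))"
    by (auto simp: ennreal_power powr_power)
  then show ?thesis
    using nn_integral_int_jb_powr_finite[of "- 2 * r"] assms by (simp add: l2norm_def)
qed

text \<open>Both inputs are measured by the supremum parts of their norms, whose weights supply the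
  powers summed in \<open>sum_phase_u\<close> and \<open>sum_phase_v\<close>.\<close>

lemma nb_mult_le_X:
  "nb b (f m) * nb b (g k) \<le> ennreal (jb (of_int m) powr (- p1) * jb (of_int k) powr (- p2)) * (X r1 p1 b f * X r2 p2 b g)"
proof -
  have "nb b (f m) * nb b (g k) \<le> (ennreal (jb (of_int m) powr (- p1)) * X r1 p1 b f) * (ennreal (jb (of_int k) powr (- p2)) * X r2 p2 b g)"
    by (intro mult_mono nb_le_X) auto
  then show ?thesis by (simp add: ennreal_mult mult_ac)
qed

text \<open>The term \<open>k = 0\<close> has no oscillation but only multiplies \<open>f n\<close>
  by a quantity bounded by the norm of \<open>g\<close>, so it preserves both parts of the norm. All
  other terms are smoothed by 1/16 of a derivative beyond the supremum weight.\<close>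

lemma X_Bil_u_le:
  fixes \<gamma> s1 s2 b :: real and c :: complex
  assumes \<gamma>: "\<bar>\<gamma>\<bar> \<noteq> 1" and s: "s1 < 1/2" "31/32 < s2" "s2 < 1" and b: "1/2 < b" "b < 9/16"
  obtains C where "C > 0" and "\<And>T f g. 0 < T \<Longrightarrow> T \<le> 1 \<Longrightarrow> profile f \<Longrightarrow> profile g \<Longrightarrow>
     X s1 s2 b (Bil T (\<lambda>_. c) (phase_u \<gamma>) f g) \<le> ennreal (C * T powr (9/16 - b)) * (X s1 s2 b f * X (s1 - 1/2) (s2 - 1/2) b g)"
proof -
  \<comment> \<open>The gain 7/16 is admissible in \<open>nb_Bil_le\<close> for \<open>b\<close> up
    to 9/16 and leaves the power \<open>1 - 7/16 - b\<close> of \<open>T\<close>.\<close>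
  have a: "(0::real) \<le> 7/16" "7/16 < (1/2::real)" and b1: "1/2 < b" "b < 1" and ab: "7/16 + b \<le> 1"
    using b by auto
  obtain C1 where C1: "C1 > 0" and N: "\<And>T c \<Psi> f g n. 0 < T \<Longrightarrow> T \<le> 1 \<Longrightarrow> profile f \<Longrightarrow> profile g \<Longrightarrow>
    nb b (Bil T c \<Psi> f g n) \<le> ennreal (C1 * T powr (1 - 7/16 - b) * cmod (c n)) *
      (\<integral>\<^sup>+k. ennreal (jb (\<Psi> n k) powr (- (7/16))) * (nb b (f (n - k)) * nb b (g k)) \<partial>count_space UNIV)"
    using nb_Bil_le[OF a b1] ab by blast
  obtain C2 where C2: "C2 > 0" and S: "\<And>n :: int. (\<integral>\<^sup>+k. ennreal (jb (phase_u \<gamma> n k) powr (-(7/16)) * (jb (of_int (n - k)) powr (- s2) * jb (of_int k) powr (-(s2 - 1/2))))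
        * indicator (- {0}) k \<partial>count_space UNIV) \<le> ennreal (C2 * jb (of_int n) powr (- s2 - 1/16))"
    using sum_phase_u[OF \<gamma> s(2,3)] by blast
  define Q where "Q = l2norm (count_space UNIV) (\<lambda>n :: int. ennreal (jb (of_int n) powr (s1 - s2 - 1/16)))"
  \<comment> \<open>Square summability: \<open>s1 - s2 - 1/16\<close> is below
    \<open>1/2 - 31/32 - 1/16\<close>, which is -17/32.\<close>
  have "Q < \<infinity>" unfolding Q_def by (rule l2norm_int_jb_powr_finite) (use s in auto)
  then obtain Q' where Q': "Q = ennreal Q'" "Q' \<ge> 0"
    by (metis infinity_ennreal_def less_top_ennreal)
  \<comment> \<open>The added 1 keeps the constant positive even for \<open>c = 0\<close>.\<close>
  define C where "C = (C1 * cmod c + 1) * (1 + C2 * (Q' + 1))"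
  show ?thesis
  proof (rule that[of C])
    show "C > 0" using C1 C2 Q' by (simp add: C_def add_nonneg_pos add_pos_nonneg mult_pos_pos)
    fix T :: real and f g :: "int \<Rightarrow> real \<Rightarrow> complex"
    assume T: "0 < T" "T \<le> 1" and fg: "profile f" "profile g"
    define A B where "A = X s1 s2 b f" and "B = X (s1 - 1/2) (s2 - 1/2) b g"
    define K where "K = C1 * T powr (9/16 - b) * cmod c"
    have K: "K \<ge> 0" using C1 by (simp add: K_def)
    have "nb b (Bil T (\<lambda>_. c) (phase_u \<gamma>) f g n)
      \<le> (ennreal K * B) * nb b (f n) + (ennreal K * ennreal C2 * (A * B)) * ennreal (jb (of_int n) powr (- s2 - 1/16))" for n
    proof -
      let ?t = "\<lambda>k. ennreal (jb (phase_u \<gamma> n k) powr (- (7/16))) * (nb b (f (n - k)) * nb b (g k))"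
      have "(\<integral>\<^sup>+k. ?t k \<partial>count_space UNIV) \<le> (\<integral>\<^sup>+k. (nb b (f n) * B) * indicator {0} k
          + ennreal (jb (phase_u \<gamma> n k) powr (-(7/16)) * (jb (of_int (n - k)) powr (- s2) * jb (of_int k) powr (-(s2 - 1/2)))) * indicator (- {0}) k * (A * B) \<partial>count_space UNIV)"
      proof (intro nn_integral_mono)
        fix k
        show "?t k \<le> (nb b (f n) * B) * indicator {0} k
          + ennreal (jb (phase_u \<gamma> n k) powr (-(7/16)) * (jb (of_int (n - k)) powr (- s2) * jb (of_int k) powr (-(s2 - 1/2)))) * indicator (- {0}) k * (A * B)"
        proof (cases "k = 0")
          case True
          have "nb b (g 0) \<le> B"
            using nb_le_X[of b g 0 "s2 - 1/2" "s1 - 1/2"] by (simp add: B_def jb_def)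
          then show ?thesis using True by (auto simp: phase_u_def jb_def intro!: mult_left_mono)
        next
          case False
          have "?t k \<le> ennreal (jb (phase_u \<gamma> n k) powr (- (7/16))) * (ennreal (jb (of_int (n - k)) powr (- s2) * jb (of_int k) powr (- (s2 - 1/2))) * (A * B))"
            unfolding A_def B_def by (intro mult_left_mono nb_mult_le_X) simp
          then show ?thesis using False by (simp add: ennreal_mult mult_ac)
        qed
      qed
      also have "\<dots> = nb b (f n) * B + (\<integral>\<^sup>+k. ennreal (jb (phase_u \<gamma> n k) powr (-(7/16)) * (jb (of_int (n - k)) powr (- s2) * jb (of_int k) powr (-(s2 - 1/2)))) * indicator (- {0}) k \<partial>count_space UNIV) * (A * B)"
        by (subst nn_integral_add) (simp_all add: nn_integral_multc nn_integral_cmult)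
      also have "\<dots> \<le> nb b (f n) * B + ennreal (C2 * jb (of_int n) powr (- s2 - 1/16)) * (A * B)"
        by (intro add_left_mono mult_right_mono S) simp
      finally have I: "(\<integral>\<^sup>+k. ?t k \<partial>count_space UNIV) \<le> nb b (f n) * B + ennreal (C2 * jb (of_int n) powr (- s2 - 1/16)) * (A * B)" .
      have "nb b (Bil T (\<lambda>_. c) (phase_u \<gamma>) f g n) \<le> ennreal K * (\<integral>\<^sup>+k. ?t k \<partial>count_space UNIV)"
        using N[OF T fg, of "\<lambda>_. c" "phase_u \<gamma>" n] by (simp add: K_def)
      also have "\<dots> \<le> ennreal K * (nb b (f n) * B + ennreal (C2 * jb (of_int n) powr (- s2 - 1/16)) * (A * B))"
        by (intro mult_left_mono I) simp
      also have "\<dots> = (ennreal K * B) * nb b (f n) + (ennreal K * ennreal C2 * (A * B)) * ennreal (jb (of_int n) powr (- s2 - 1/16))"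
        using C2 by (simp add: ennreal_mult distrib_left mult_ac)
      finally show ?thesis .
    qed
    from X_le_pointwise[of b "Bil T (\<lambda>_. c) (phase_u \<gamma>) f g" "ennreal K * B" f "ennreal K * ennreal C2 * (A * B)" s2 "1/16" s1, OF this]
    have "X s1 s2 b (Bil T (\<lambda>_. c) (phase_u \<gamma>) f g) \<le> ennreal K * B * A + ennreal K * ennreal C2 * (A * B) * (Q + 1)"
      by (simp add: A_def Q_def)
    also have "\<dots> = (ennreal K + ennreal K * ennreal C2 * (Q + 1)) * (A * B)"
      by (simp add: distrib_left distrib_right mult_ac)
    also have "ennreal K + ennreal K * ennreal C2 * (Q + 1) = ennreal (K + K * C2 * (Q' + 1))"
      using K C2 Q' by (simp add: ennreal_mult ennreal_plus)
    also have "\<dots> * (A * B) \<le> ennreal (C * T powr (9/16 - b)) * (A * B)"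
    proof (intro mult_right_mono ennreal_leI)
      have "K + K * C2 * (Q' + 1) = (C1 * cmod c) * (1 + C2 * (Q' + 1)) * T powr (9/16 - b)"
        by (simp add: K_def algebra_simps)
      also have "\<dots> \<le> C * T powr (9/16 - b)"
        unfolding C_def using C2 Q' by (intro mult_right_mono) auto
      finally show "K + K * C2 * (Q' + 1) \<le> C * T powr (9/16 - b)" .
    qed simp
    finally show "X s1 s2 b (Bil T (\<lambda>_. c) (phase_u \<gamma>) f g) \<le> ennreal (C * T powr (9/16 - b)) * (X s1 s2 b f * X (s1 - 1/2) (s2 - 1/2) b g)"
      by (simp add: A_def B_def)
  qed
qed

text \<open>The output frequency at which the phase vanishes for every \<open>k\<close> is
  \<open>n = 0\<close>, and there the derivative vanishes too. So every term is smoothed, and the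
  first coefficient in \<open>X_le_pointwise\<close> is 0.\<close>

lemma X_Bil_v_le:
  fixes \<gamma> s1 s2 b :: real and c :: complex
  assumes \<gamma>: "\<bar>\<gamma>\<bar> \<noteq> 1" and s: "s1 < 1/2" "31/32 < s2" "s2 < 1" and b: "1/2 < b" "b < 9/16"
  obtains C where "C > 0" and "\<And>T f g. 0 < T \<Longrightarrow> T \<le> 1 \<Longrightarrow> profile f \<Longrightarrow> profile g \<Longrightarrow>
     X (s1 - 1/2) (s2 - 1/2) b (Bil T (\<lambda>n. c * of_int n) (phase_v \<gamma>) f g) \<le> ennreal (C * T powr (9/16 - b)) * (X s1 s2 b f * X s1 s2 b g)"
proof -
  have a: "(0::real) \<le> 7/16" "7/16 < (1/2::real)" and b1: "1/2 < b" "b < 1" and ab: "7/16 + b \<le> 1"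
    using b by auto
  obtain C1 where C1: "C1 > 0" and N: "\<And>T c \<Psi> f g n. 0 < T \<Longrightarrow> T \<le> 1 \<Longrightarrow> profile f \<Longrightarrow> profile g \<Longrightarrow>
    nb b (Bil T c \<Psi> f g n) \<le> ennreal (C1 * T powr (1 - 7/16 - b) * cmod (c n)) *
      (\<integral>\<^sup>+k. ennreal (jb (\<Psi> n k) powr (- (7/16))) * (nb b (f (n - k)) * nb b (g k)) \<partial>count_space UNIV)"
    using nb_Bil_le[OF a b1] ab by blast
  obtain C2 where C2: "C2 > 0" and S: "\<And>n :: int. (\<integral>\<^sup>+k. ennreal (\<bar>of_int n\<bar> * (jb (phase_v \<gamma> n k) powr (-(7/16)) * (jb (of_int (n - k)) powr (- s2) * jb (of_int k) powr (- s2))))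
        \<partial>count_space UNIV) \<le> ennreal (C2 * jb (of_int n) powr (- (s2 - 1/2) - 1/16))"
    using sum_phase_v[OF \<gamma> s(2,3)] by blast
  define Q where "Q = l2norm (count_space UNIV) (\<lambda>n :: int. ennreal (jb (of_int n) powr (s1 - 1/2 - (s2 - 1/2) - 1/16)))"
  have "Q < \<infinity>" unfolding Q_def by (rule l2norm_int_jb_powr_finite) (use s in auto)
  then obtain Q' where Q': "Q = ennreal Q'" "Q' \<ge> 0"
    by (metis infinity_ennreal_def less_top_ennreal)
  define C where "C = (C1 * cmod c + 1) * (C2 * (Q' + 1))"
  show ?thesis
  proof (rule that[of C])
    show "C > 0" using C1 C2 Q' by (simp add: C_def add_nonneg_pos add_pos_nonneg mult_pos_pos)
    fix T :: real and f g :: "int \<Rightarrow> real \<Rightarrow> complex"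
    assume T: "0 < T" "T \<le> 1" and fg: "profile f" "profile g"
    define A B where "A = X s1 s2 b f" and "B = X s1 s2 b g"
    define K where "K = C1 * T powr (9/16 - b) * cmod c"
    have K: "K \<ge> 0" using C1 by (simp add: K_def)
    have "nb b (Bil T (\<lambda>n. c * of_int n) (phase_v \<gamma>) f g n)
      \<le> 0 * nb b (f n) + (ennreal K * ennreal C2 * (A * B)) * ennreal (jb (of_int n) powr (- (s2 - 1/2) - 1/16))" for n
    proof -
      let ?t = "\<lambda>k. ennreal (jb (phase_v \<gamma> n k) powr (- (7/16))) * (nb b (f (n - k)) * nb b (g k))"
      have "nb b (Bil T (\<lambda>n. c * of_int n) (phase_v \<gamma>) f g n) \<le> ennreal (K * \<bar>of_int n\<bar>) * (\<integral>\<^sup>+k. ?t k \<partial>count_space UNIV)"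
        using N[OF T fg, of "\<lambda>n. c * of_int n" "phase_v \<gamma>" n] by (simp add: K_def norm_mult mult.assoc)
      also have "\<dots> \<le> ennreal (K * \<bar>of_int n\<bar>) * (\<integral>\<^sup>+k. ennreal (jb (phase_v \<gamma> n k) powr (- (7/16))) *
          (ennreal (jb (of_int (n - k)) powr (- s2) * jb (of_int k) powr (- s2)) * (A * B)) \<partial>count_space UNIV)"
        unfolding A_def B_def by (intro mult_left_mono nn_integral_mono nb_mult_le_X) auto
      also have "\<dots> = ennreal K * (\<integral>\<^sup>+k. ennreal (\<bar>of_int n\<bar> * (jb (phase_v \<gamma> n k) powr (-(7/16)) * (jb (of_int (n - k)) powr (- s2) * jb (of_int k) powr (- s2)))) * (A * B) \<partial>count_space UNIV)"
      proof -
        have "ennreal (K * \<bar>of_int n\<bar>) * (\<integral>\<^sup>+k. ennreal (jb (phase_v \<gamma> n k) powr (- (7/16))) *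
          (ennreal (jb (of_int (n - k)) powr (- s2) * jb (of_int k) powr (- s2)) * (A * B)) \<partial>count_space UNIV)
          = ennreal K * (ennreal \<bar>of_int n\<bar> * (\<integral>\<^sup>+k. ennreal (jb (phase_v \<gamma> n k) powr (- (7/16))) *
          (ennreal (jb (of_int (n - k)) powr (- s2) * jb (of_int k) powr (- s2)) * (A * B)) \<partial>count_space UNIV))"
          using K by (simp add: ennreal_mult mult.assoc)
        also have "ennreal \<bar>of_int n\<bar> * (\<integral>\<^sup>+k. ennreal (jb (phase_v \<gamma> n k) powr (- (7/16))) *
          (ennreal (jb (of_int (n - k)) powr (- s2) * jb (of_int k) powr (- s2)) * (A * B)) \<partial>count_space UNIV)
           = (\<integral>\<^sup>+k. ennreal \<bar>of_int n\<bar> * (ennreal (jb (phase_v \<gamma> n k) powr (- (7/16))) *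
          (ennreal (jb (of_int (n - k)) powr (- s2) * jb (of_int k) powr (- s2)) * (A * B))) \<partial>count_space UNIV)"
          by (rule nn_integral_cmult[symmetric]) simp
        finally show ?thesis by (simp add: ennreal_mult mult.assoc)
      qed
      also have "\<dots> = ennreal K * ((\<integral>\<^sup>+k. ennreal (\<bar>of_int n\<bar> * (jb (phase_v \<gamma> n k) powr (-(7/16)) * (jb (of_int (n - k)) powr (- s2) * jb (of_int k) powr (- s2)))) \<partial>count_space UNIV) * (A * B))"
        by (subst nn_integral_multc) simp_all
      also have "\<dots> \<le> ennreal K * (ennreal (C2 * jb (of_int n) powr (- (s2 - 1/2) - 1/16)) * (A * B))"
        by (intro mult_left_mono mult_right_mono S) auto
      also have "\<dots> = 0 * nb b (f n) + (ennreal K * ennreal C2 * (A * B)) * ennreal (jb (of_int n) powr (- (s2 - 1/2) - 1/16))"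
        using C2 by (simp add: ennreal_mult mult_ac)
      finally show ?thesis .
    qed
    from X_le_pointwise[of b "Bil T (\<lambda>n. c * of_int n) (phase_v \<gamma>) f g" 0 f "ennreal K * ennreal C2 * (A * B)" "s2 - 1/2" "1/16" "s1 - 1/2", OF this]
    have "X (s1 - 1/2) (s2 - 1/2) b (Bil T (\<lambda>n. c * of_int n) (phase_v \<gamma>) f g) \<le> ennreal K * ennreal C2 * (A * B) * (Q + 1)"
      by (simp add: Q_def)
    also have "\<dots> = (ennreal K * ennreal C2 * (Q + 1)) * (A * B)"
      by (simp add: mult_ac)
    also have "ennreal K * ennreal C2 * (Q + 1) = ennreal (K * C2 * (Q' + 1))"
      using K C2 Q' by (simp add: ennreal_mult ennreal_plus)
    also have "\<dots> * (A * B) \<le> ennreal (C * T powr (9/16 - b)) * (A * B)"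
    proof (intro mult_right_mono ennreal_leI)
      have "K * C2 * (Q' + 1) = (C1 * cmod c) * (C2 * (Q' + 1)) * T powr (9/16 - b)"
        by (simp add: K_def algebra_simps)
      also have "\<dots> \<le> C * T powr (9/16 - b)"
        unfolding C_def using C2 Q' by (intro mult_right_mono) auto
      finally show "K * C2 * (Q' + 1) \<le> C * T powr (9/16 - b)" .
    qed simp
    finally show "X (s1 - 1/2) (s2 - 1/2) b (Bil T (\<lambda>n. c * of_int n) (phase_v \<gamma>) f g) \<le> ennreal (C * T powr (9/16 - b)) * (X s1 s2 b f * X s1 s2 b g)"
      by (simp add: A_def B_def)
  qed
qed

text \<open>The profile of the complex conjugate. Conjugation reverses both the frequency and the
  modulation, so the conjugate of \<open>u\<close> follows the negative of the dispersion relation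
  of \<open>u\<close>.\<close>

definition conj_profile :: "(int \<Rightarrow> real \<Rightarrow> complex) \<Rightarrow> int \<Rightarrow> real \<Rightarrow> complex" where
  "conj_profile f n x = cnj (f (- n) (- x))"

lemma profile_conj: "profile f \<Longrightarrow> profile (conj_profile f)"
proof -
  assume f: "profile f"
  note [measurable] = profile_borel[OF f]
  have [measurable]: "cnj \<in> borel_measurable borel"
    by (intro borel_measurable_continuous_onI continuous_intros)
  show ?thesis
    unfolding profile_def conj_profile_def[abs_def] by measurable
qed

lemma nb_conj_profile:
  assumes "profile f"
  shows "nb b (conj_profile f n) = nb b (f (- n))"
proof -
  note [measurable] = profile_borel[OF assms]
  show ?thesis
    using l2norm_uminus[of "\<lambda>t. ennreal (jb t powr b) * ennreal (cmod (f (- n) t))"]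
    by (simp add: nb_def Nb_def conj_profile_def)
qed

lemma X_conj_profile:
  assumes "profile f"
  shows "X r1 r2 b (conj_profile f) = X r1 r2 b f"
proof -
  have jbm: "jb (of_int n) = jb (of_int (- n))" for n by simp
  have "l2norm (count_space UNIV) (\<lambda>n. ennreal (jb (of_int n) powr r1) * nb b (f (- n)))
      = l2norm (count_space UNIV) (\<lambda>n. ennreal (jb (of_int n) powr r1) * nb b (f n))"
    unfolding l2norm_def
    using nn_integral_int_reflect[of "\<lambda>n. (ennreal (jb (of_int n) powr r1) * nb b (f n))\<^sup>2" 0] by simp
  moreover have "(SUP n. ennreal (jb (of_int n) powr r2) * nb b (f (- n))) = (SUP n. ennreal (jb (of_int n) powr r2) * nb b (f n))"
  proof -
    have "(SUP n. F (- n)) = (SUP n. F n)" for F :: "int \<Rightarrow> ennreal"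
      by (rule SUP_eq) (metis UNIV_I minus_minus order_refl)+
    from this[of "\<lambda>n. ennreal (jb (of_int n) powr r2) * nb b (f n)"] show ?thesis by simp
  qed
  ultimately show ?thesis
    by (simp add: X_def nb_conj_profile[OF assms])
qed

section \<open>Absolute convergence of the interaction\<close>

lemma sum_jb_convolution_finite:
  assumes "p1 \<ge> 0" "p1 + p2 > 1"
  shows "(\<integral>\<^sup>+k. ennreal (jb (of_int (n - k)) powr (- p1) * jb (of_int k) powr (- p2)) \<partial>count_space (UNIV :: int set)) < \<infinity>"
proof -
  have "(\<integral>\<^sup>+k. ennreal (jb (of_int (n - k)) powr (- p1) * jb (of_int k) powr (- p2)) \<partial>count_space (UNIV :: int set))
     \<le> (\<integral>\<^sup>+k. ennreal (jb (of_int n) powr p1) * ennreal (jb (of_int k) powr (- (p1 + p2))) \<partial>count_space (UNIV :: int set))"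
  proof (intro nn_integral_mono)
    fix k :: int
    \<comment> \<open>Finiteness for each \<open>n\<close> is all that is claimed, so the weight of
      \<open>n - k\<close> may be exchanged for that of \<open>k\<close> at the cost of a power of
      the bracket of \<open>n\<close>.\<close>
    have "jb (of_int k) \<le> jb (of_int n) * jb (of_int (n - k))"
      using jb_diff_le[of "of_int n" "of_int (n - k)"] by simp
    then have "jb (of_int k) powr p1 \<le> jb (of_int n) powr p1 * jb (of_int (n - k)) powr p1"
      using assms by (subst powr_mult[symmetric]) (auto intro!: powr_mono2)
    then have "jb (of_int (n - k)) powr (- p1) \<le> jb (of_int n) powr p1 * jb (of_int k) powr (- p1)"
      by (simp add: powr_minus_divide field_simps)
    then have "jb (of_int (n - k)) powr (- p1) * jb (of_int k) powr (- p2) \<le> jb (of_int n) powr p1 * jb (of_int k) powr (- p1) * jb (of_int k) powr (- p2)"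
      by (rule mult_right_mono) simp
    also have "\<dots> = jb (of_int n) powr p1 * jb (of_int k) powr (- (p1 + p2))"
      by (simp add: mult.assoc powr_add[symmetric])
    finally show "ennreal (jb (of_int (n - k)) powr (- p1) * jb (of_int k) powr (- p2)) \<le> ennreal (jb (of_int n) powr p1) * ennreal (jb (of_int k) powr (- (p1 + p2)))"
      by (simp add: ennreal_mult[symmetric] ennreal_leI)
  qed
  also have "\<dots> = ennreal (jb (of_int n) powr p1) * (\<integral>\<^sup>+k. ennreal (jb (of_int k) powr (- (p1 + p2))) \<partial>count_space (UNIV :: int set))"
    by (rule nn_integral_cmult) simp
  also have "\<dots> < \<infinity>"
    using nn_integral_int_jb_powr_finite[OF assms(2)] by (simp add: ennreal_mult_less_top)
  finally show ?thesis .
qed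

text \<open>Joint integrability in the frequency and both modulations is what every later exchange
  of sums and integrals rests on. The decay \<open>p1 + p2 > 1\<close> is met by \<open>s2\<close>
  with \<open>s2 - 1/2\<close> for the first equation and by \<open>s2\<close> twice for the
  second.\<close>

lemma integrable_interaction:
  assumes b: "b > 1/2" and p: "p1 \<ge> 0" "p1 + p2 > 1"
    and fg: "profile f" "profile g" "X r1 p1 b f < \<infinity>" "X r2 p2 b g < \<infinity>"
  shows "integrable kxy (interaction f g n)"
proof (rule integrableI_bounded)
  note [measurable] = fg(1,2)[THEN profile_borel]
  show "interaction f g n \<in> borel_measurable kxy" by (rule measurable_interaction) fact+
  obtain C where C: "C > 0" and I: "\<And>h. h \<in> borel_measurable borel \<Longrightarrow> (\<integral>\<^sup>+x. h x \<partial>lborel) \<le> ennreal C * Nb b h"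
    using nn_integral_le_Nb[OF b] by blast
  have "(\<integral>\<^sup>+z. ennreal (norm (interaction f g n z)) \<partial>kxy)
      = (\<integral>\<^sup>+z. (case z of (k, x, y) \<Rightarrow> ennreal (cmod (f (n - k) x)) * ennreal (cmod (g k y))) \<partial>kxy)"
    by (intro nn_integral_cong) (auto simp: interaction_def norm_mult ennreal_mult split: prod.splits)
  also have "\<dots> = (\<integral>\<^sup>+k. \<integral>\<^sup>+x. \<integral>\<^sup>+y. ennreal (cmod (f (n - k) x)) * ennreal (cmod (g k y)) \<partial>lborel \<partial>lborel \<partial>count_space UNIV)"
    by (rule nn_integral_kxy) measurable
  also have "\<dots> = (\<integral>\<^sup>+k. (\<integral>\<^sup>+x. ennreal (cmod (f (n - k) x)) \<partial>lborel) * (\<integral>\<^sup>+y. ennreal (cmod (g k y)) \<partial>lborel) \<partial>count_space UNIV)"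
    by (simp add: nn_integral_cmult nn_integral_multc)
  also have "\<dots> \<le> (\<integral>\<^sup>+k. (ennreal C * nb b (f (n - k))) * (ennreal C * nb b (g k)) \<partial>count_space UNIV)"
    unfolding nb_def by (intro nn_integral_mono mult_mono I) auto
  also have "\<dots> \<le> (\<integral>\<^sup>+k. (ennreal C * ennreal C * (X r1 p1 b f * X r2 p2 b g)) * ennreal (jb (of_int (n - k)) powr (- p1) * jb (of_int k) powr (- p2)) \<partial>count_space UNIV)"
  proof (intro nn_integral_mono)
    fix k
    have "(ennreal C * ennreal C) * (nb b (f (n - k)) * nb b (g k)) \<le> (ennreal C * ennreal C) * (ennreal (jb (of_int (n - k)) powr (- p1) * jb (of_int k) powr (- p2)) * (X r1 p1 b f * X r2 p2 b g))"
      by (intro mult_left_mono nb_mult_le_X) simp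
    then show "(ennreal C * nb b (f (n - k))) * (ennreal C * nb b (g k)) \<le> (ennreal C * ennreal C * (X r1 p1 b f * X r2 p2 b g)) * ennreal (jb (of_int (n - k)) powr (- p1) * jb (of_int k) powr (- p2))"
      by (simp only: mult_ac)
  qed
  also have "\<dots> = (ennreal C * ennreal C * (X r1 p1 b f * X r2 p2 b g)) * (\<integral>\<^sup>+k. ennreal (jb (of_int (n - k)) powr (- p1) * jb (of_int k) powr (- p2)) \<partial>count_space UNIV)"
    by (rule nn_integral_cmult) simp
  also have "\<dots> < \<infinity>"
    using fg sum_jb_convolution_finite[OF p, of n] by (simp add: ennreal_mult_less_top)
  finally show "(\<integral>\<^sup>+z. ennreal (norm (interaction f g n z)) \<partial>kxy) < \<infinity>" .
qed

lemma norm_KT_le_const: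
  assumes "T > 0"
  shows "cmod (KT T s l) \<le> 16 * T\<^sup>2"
proof -
  have 1: "jb x powr (- 2) \<le> 1" "jb x powr (- 1) \<le> 1" for x
    using powr_mono[of "- 2" 0 "jb x"] powr_mono[of "- 1" 0 "jb x"] by simp_all
  have "cmod (KT T s l) \<le> 8 * T\<^sup>2 * jb (T * l) powr (- 1) * (jb (T * (s - l)) powr (- 2) + jb (T * s) powr (- 2))"
    by (rule norm_KT_le) fact
  also have "\<dots> \<le> 8 * T\<^sup>2 * 1 * (1 + 1)"
    by (intro mult_mono add_mono 1) auto
  finally show ?thesis by simp
qed

lemma integrable_KT_interaction:
  assumes "T > 0" and int: "integrable kxy (interaction f g n)"
  shows "integrable kxy (\<lambda>z. KT T s (case z of (k, x, y) \<Rightarrow> x + y + \<Psi> k) * interaction f g n z)"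
proof (rule Bochner_Integration.integrable_bound)
  show "integrable kxy (\<lambda>z. of_real (16 * T\<^sup>2) * interaction f g n z)" using int by simp
  show "(\<lambda>z. KT T s (case z of (k, x, y) \<Rightarrow> x + y + \<Psi> k) * interaction f g n z) \<in> borel_measurable kxy"
    using borel_measurable_integrable[OF int] by measurable
  show "AE z in kxy. norm (KT T s (case z of (k, x, y) \<Rightarrow> x + y + \<Psi> k) * interaction f g n z) \<le> norm (of_real (16 * T\<^sup>2) * interaction f g n z)"
  proof (rule AE_I2)
    fix z
    have "norm (of_real (16 * T\<^sup>2) * interaction f g n z) = 16 * T\<^sup>2 * norm (interaction f g n z)"
      by (simp only: norm_mult norm_of_real) simp
    moreover have "norm (KT T s (case z of (k, x, y) \<Rightarrow> x + y + \<Psi> k) * interaction f g n z) \<le> 16 * T\<^sup>2 * norm (interaction f g n z)"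
      unfolding norm_mult by (intro mult_right_mono norm_KT_le_const assms) simp
    ultimately show "norm (KT T s (case z of (k, x, y) \<Rightarrow> x + y + \<Psi> k) * interaction f g n z) \<le> norm (of_real (16 * T\<^sup>2) * interaction f g n z)"
      by (simp only:)
  qed
qed

text \<open>Non-integrable functions have integral 0, so bilinearity holds only where the integrals
  exist. The splitting passes through the mixed pair of \<open>f'\<close> and \<open>g\<close>,
  which therefore has to be integrable as well.\<close>

lemma Bil_diff:
  assumes "T > 0"
    and int: "\<And>n. integrable kxy (interaction f g n)" "\<And>n. integrable kxy (interaction f' g' n)" "\<And>n. integrable kxy (interaction f' g n)"
  shows "Bil T c \<Psi> f g n s - Bil T c \<Psi> f' g' n s
    = Bil T c \<Psi> (\<lambda>n x. f n x - f' n x) g n s + Bil T c \<Psi> f' (\<lambda>n x. g n x - g' n x) n s"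
proof -
  let ?K = "\<lambda>z. KT T s (case z of (k, x, y) \<Rightarrow> x + y + \<Psi> n k)"
  note I = int[THEN integrable_KT_interaction[OF assms(1), where s = s and \<Psi> = "\<Psi> n" and n = n]]
  have "(\<integral>z. ?K z * interaction (\<lambda>n x. f n x - f' n x) g n z \<partial>kxy) = (\<integral>z. ?K z * interaction f g n z - ?K z * interaction f' g n z \<partial>kxy)"
    by (intro Bochner_Integration.integral_cong) (auto simp: interaction_def algebra_simps)
  also have "\<dots> = (\<integral>z. ?K z * interaction f g n z \<partial>kxy) - (\<integral>z. ?K z * interaction f' g n z \<partial>kxy)"
    by (intro Bochner_Integration.integral_diff I)
  finally have 1: "(\<integral>z. ?K z * interaction (\<lambda>n x. f n x - f' n x) g n z \<partial>kxy) = \<dots>" .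
  have "(\<integral>z. ?K z * interaction f' (\<lambda>n x. g n x - g' n x) n z \<partial>kxy) = (\<integral>z. ?K z * interaction f' g n z - ?K z * interaction f' g' n z \<partial>kxy)"
    by (intro Bochner_Integration.integral_cong) (auto simp: interaction_def algebra_simps)
  also have "\<dots> = (\<integral>z. ?K z * interaction f' g n z \<partial>kxy) - (\<integral>z. ?K z * interaction f' g' n z \<partial>kxy)"
    by (intro Bochner_Integration.integral_diff I)
  finally have 2: "(\<integral>z. ?K z * interaction f' (\<lambda>n x. g n x - g' n x) n z \<partial>kxy) = \<dots>" .
  show ?thesis
    unfolding Bil_def 1 2 by (simp add: algebra_simps)
qed

section \<open>Profiles as functions of time\<close>

lemma cmod_iexp [simp]: "cmod (iexp x) = 1"
  by (simp add: norm_exp_i_times)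

lemma integrable_of_nb:
  assumes "b > 1/2" and [measurable]: "h \<in> borel_measurable borel" and "nb b h < \<infinity>"
  shows "integrable lborel h"
proof (rule integrableI_bounded)
  obtain C where C: "C > 0" and I: "\<And>h. h \<in> borel_measurable borel \<Longrightarrow> (\<integral>\<^sup>+x. h x \<partial>lborel) \<le> ennreal C * Nb b h"
    using nn_integral_le_Nb[OF assms(1)] by blast
  have "(\<integral>\<^sup>+x. ennreal (norm (h x)) \<partial>lborel) \<le> ennreal C * nb b h"
    unfolding nb_def by (intro I) measurable
  also have "\<dots> < \<infinity>" using assms(3) by (simp add: ennreal_mult_less_top)
  finally show "(\<integral>\<^sup>+x. ennreal (norm (h x)) \<partial>lborel) < \<infinity>" .
qed simp

lemma nb_finite: "X r1 r2 b f < \<infinity> \<Longrightarrow> nb b (f n) < \<infinity>"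
  by (rule le_less_trans[OF nb_le_X[of b f n r2 r1]]) (simp add: ennreal_mult_less_top)

text \<open>The Fourier coefficient at time \<open>t\<close> of the represented function after the
  free evolution has been undone; it is constant in time for a free solution.\<close>

definition tf :: "(int \<Rightarrow> real \<Rightarrow> complex) \<Rightarrow> real \<Rightarrow> int \<Rightarrow> complex" where
  "tf f t n = (\<integral>x. f n x * iexp (t * x) \<partial>lborel)"

lemma integrable_mult_iexp:
  assumes "integrable lborel h"
  shows "integrable lborel (\<lambda>x. h x * iexp (t * x))"
proof (rule Bochner_Integration.integrable_bound[OF assms])
  note [measurable] = borel_measurable_integrable[OF assms]
  show "(\<lambda>x. h x * iexp (t * x)) \<in> borel_measurable lborel" by measurable
qed (simp add: norm_mult)

text \<open>Evaluation at a time is bounded by the profile norm, uniformly in time, because the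
  modulation weight with \<open>b > 1/2\<close> controls the integral of the profile.\<close>

lemma tf_bound:
  assumes "b > 1/2"
  obtains C where "C > 0" and "\<And>f r1 r2 t n. profile f \<Longrightarrow> ennreal (cmod (tf f t n)) \<le> ennreal (C * jb (of_int n) powr (- r2)) * X r1 r2 b f"
proof -
  obtain C where C: "C > 0" and I: "\<And>h. h \<in> borel_measurable borel \<Longrightarrow> (\<integral>\<^sup>+x. h x \<partial>lborel) \<le> ennreal C * Nb b h"
    using nn_integral_le_Nb[OF assms(1)] by blast
  show ?thesis
  proof (rule that[OF C])
    fix f :: "int \<Rightarrow> real \<Rightarrow> complex" and r1 r2 t and n
    assume "profile f"
    note [measurable] = profile_borel[OF this]
    have "ennreal (cmod (tf f t n)) \<le> (\<integral>\<^sup>+x. ennreal (cmod (f n x)) \<partial>lborel)"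
      unfolding tf_def by (rule order_trans[OF ennreal_norm_integral_le]) (simp add: norm_mult)
    also have "\<dots> \<le> ennreal C * nb b (f n)"
      unfolding nb_def by (intro I) measurable
    also have "\<dots> \<le> ennreal C * (ennreal (jb (of_int n) powr (- r2)) * X r1 r2 b f)"
      by (intro mult_left_mono nb_le_X) simp
    also have "\<dots> = ennreal (C * jb (of_int n) powr (- r2)) * X r1 r2 b f"
      using C by (simp add: ennreal_mult mult_ac)
    finally show "ennreal (cmod (tf f t n)) \<le> \<dots>" .
  qed
qed

lemma tf_diff:
  assumes "integrable lborel (f n)" "integrable lborel (g n)"
  shows "tf (\<lambda>n x. f n x - g n x) t n = tf f t n - tf g t n"
  unfolding tf_def left_diff_distrib
  by (intro Bochner_Integration.integral_diff integrable_mult_iexp assms)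

lemma tf_add:
  assumes "integrable lborel (f n)" "integrable lborel (g n)"
  shows "tf (\<lambda>n x. f n x + g n x) t n = tf f t n + tf g t n"
  unfolding tf_def distrib_right
  by (intro Bochner_Integration.integral_add integrable_mult_iexp assms)

text \<open>For times in [-T, T] the dilated cutoff equals 1, so the truncation leaves no trace and
  the exact antiderivative of the oscillation is recovered.\<close>

lemma fourier_KT:
  assumes T: "T > 0" "\<bar>t\<bar> \<le> T" and l: "l \<noteq> 0"
  shows "(\<integral>s. KT T s l * iexp (t * s) \<partial>lborel) = (iexp (t * l) - 1) / (\<i> * of_real l)"
proof -
  have "\<bar>t / T\<bar> \<le> 1" using T by (simp add: abs_divide)
  note F = fourier_chi[OF this]
  have int0: "integrable lborel (\<lambda>s. of_real (T * chi (T * s)) :: complex)"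
    using lborel_integrable_real_affine[OF integrable_chi, of T 0] T by simp
  have int1: "integrable lborel (\<lambda>s. of_real (T * chi (T * (s - l))) :: complex)"
    using lborel_integrable_real_affine[OF int0, of 1 "- l"] by (simp add: algebra_simps)
  have e0: "(\<integral>s. of_real (T * chi (T * s)) * iexp (t * s) \<partial>lborel) = 1"
  proof -
    have "T \<noteq> 0" using T by simp
    have "1 = \<bar>T\<bar> *\<^sub>R (\<integral>s. of_real (chi (0 + T * s)) * iexp (t / T * (0 + T * s)) \<partial>lborel)"
      unfolding F[symmetric] by (rule lborel_integral_real_affine) fact
    also have "\<dots> = (\<integral>s. T *\<^sub>R (of_real (chi (T * s)) * iexp (t * s)) \<partial>lborel)"
      using T by simp
    also have "\<dots> = (\<integral>s. of_real (T * chi (T * s)) * iexp (t * s) \<partial>lborel)"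
      by (intro Bochner_Integration.integral_cong) (auto simp: scaleR_conv_of_real)
    finally show ?thesis by simp
  qed
  have e1: "(\<integral>s. of_real (T * chi (T * (s - l))) * iexp (t * s) \<partial>lborel) = iexp (t * l)"
  proof -
    have "(\<integral>s. of_real (T * chi (T * (s - l))) * iexp (t * s) \<partial>lborel)
       = (\<integral>s. of_real (T * chi (T * s)) * iexp (t * (l + s)) \<partial>lborel)"
      using lborel_integral_real_affine[of 1 "\<lambda>s. of_real (T * chi (T * (s - l))) * iexp (t * s)" l] by simp
    also have "\<dots> = (\<integral>s. iexp (t * l) * (of_real (T * chi (T * s)) * iexp (t * s)) \<partial>lborel)"
      by (intro Bochner_Integration.integral_cong) (auto simp: distrib_left exp_add mult_ac)
    also have "\<dots> = iexp (t * l) * 1"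
      unfolding e0[symmetric] by (rule integral_mult_right_zero)
    finally show ?thesis by simp
  qed
  have "(\<integral>s. KT T s l * iexp (t * s) \<partial>lborel)
     = (\<integral>s. (of_real (T * chi (T * (s - l))) * iexp (t * s) - of_real (T * chi (T * s)) * iexp (t * s)) / (\<i> * of_real l) \<partial>lborel)"
    by (intro Bochner_Integration.integral_cong) (auto simp: KT_def left_diff_distrib)
  also have "\<dots> = (\<integral>s. of_real (T * chi (T * (s - l))) * iexp (t * s) - of_real (T * chi (T * s)) * iexp (t * s) \<partial>lborel) / (\<i> * of_real l)"
    by (rule integral_divide_zero)
  also have "(\<integral>s. of_real (T * chi (T * (s - l))) * iexp (t * s) - of_real (T * chi (T * s)) * iexp (t * s) \<partial>lborel)
     = iexp (t * l) - 1"
    unfolding e0[symmetric] e1[symmetric]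
    by (intro Bochner_Integration.integral_diff integrable_mult_iexp int0 int1)
  finally show ?thesis .
qed

lemma nn_integral_KT_bounded:
  assumes "T > 0"
  obtains C where "C \<ge> 0" and "\<And>l. (\<integral>\<^sup>+s. ennreal (cmod (KT T s l)) \<partial>lborel) \<le> ennreal C"
proof -
  define S where "S = (\<integral>\<^sup>+x. ennreal (jb (T * x) powr (- 2)) \<partial>lborel)"
  have "S = ennreal (1 / T) * (\<integral>\<^sup>+x. ennreal (jb x powr (- 2)) \<partial>lborel)"
    unfolding S_def by (rule nn_integral_dilate[OF _ assms, of "\<lambda>x. ennreal (jb x powr (- 2))"]) measurable
  also have "\<dots> < \<infinity>"
    using nn_integral_jb_powr_finite[of 2] by (simp add: ennreal_mult_less_top)
  finally obtain S' where S': "S = ennreal S'" "S' \<ge> 0"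
    by (metis infinity_ennreal_def less_top_ennreal)
  show ?thesis
  proof (rule that[of "8 * T\<^sup>2 * (S' + S')"])
    fix l
    have j: "jb (T * l) powr (- 1) \<le> 1" using powr_mono[of "- 1" 0 "jb (T * l)"] by simp
    have "(\<integral>\<^sup>+s. ennreal (cmod (KT T s l)) \<partial>lborel)
       \<le> (\<integral>\<^sup>+s. ennreal (8 * T\<^sup>2) * (ennreal (jb (T * (s + - l)) powr (- 2)) + ennreal (jb (T * s) powr (- 2))) \<partial>lborel)"
    proof (intro nn_integral_mono)
      fix s
      have "cmod (KT T s l) \<le> 8 * T\<^sup>2 * jb (T * l) powr (- 1) * (jb (T * (s - l)) powr (- 2) + jb (T * s) powr (- 2))"
        by (rule norm_KT_le) fact
      also have "\<dots> \<le> 8 * T\<^sup>2 * 1 * (jb (T * (s - l)) powr (- 2) + jb (T * s) powr (- 2))"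
        by (intro mult_right_mono mult_left_mono j) auto
      finally have "ennreal (cmod (KT T s l)) \<le> ennreal (8 * T\<^sup>2 * (jb (T * (s - l)) powr (- 2) + jb (T * s) powr (- 2)))"
        by (intro ennreal_leI) simp
      then show "ennreal (cmod (KT T s l)) \<le> ennreal (8 * T\<^sup>2) * (ennreal (jb (T * (s + - l)) powr (- 2)) + ennreal (jb (T * s) powr (- 2)))"
        by (simp add: ennreal_mult ennreal_plus)
    qed
    also have "\<dots> = ennreal (8 * T\<^sup>2) * ((\<integral>\<^sup>+s. ennreal (jb (T * (s + - l)) powr (- 2)) \<partial>lborel) + S)"
      unfolding S_def by (subst nn_integral_cmult, measurable, subst nn_integral_add) auto
    also have "(\<integral>\<^sup>+s. ennreal (jb (T * (s + - l)) powr (- 2)) \<partial>lborel) = S"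
      unfolding S_def by (rule nn_integral_translate[of "\<lambda>s. ennreal (jb (T * s) powr (- 2))"]) measurable
    also have "ennreal (8 * T\<^sup>2) * (S + S) = ennreal (8 * T\<^sup>2 * (S' + S'))"
      using S' by (simp only: ennreal_mult ennreal_plus add_nonneg_nonneg mult_nonneg_nonneg zero_le_numeral zero_le_power2)
    finally show "(\<integral>\<^sup>+s. ennreal (cmod (KT T s l)) \<partial>lborel) \<le> ennreal (8 * T\<^sup>2 * (S' + S'))" .
  qed (use S' in auto)
qed

text \<open>For fixed \<open>k\<close> and \<open>x\<close> a single value of \<open>y\<close> makes
  the phase vanish. The conventional value of \<open>KT\<close> at phase 0 is therefore immaterial
  under the integral.\<close>

lemma AE_phase_nonzero: "AE z in kxy. (case z of (k, x, y) \<Rightarrow> x + y + \<Psi> k) \<noteq> 0"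
proof -
  let ?N = "{z \<in> space kxy. \<not> (case z of (k, x, y) \<Rightarrow> x + y + \<Psi> k) \<noteq> 0}"
  have "emeasure kxy ?N = (\<integral>\<^sup>+z. indicator ?N z \<partial>kxy)"
  proof -
    have "?N \<in> sets kxy" using measurable_phase[of \<Psi>] by measurable
    then show ?thesis by simp
  qed
  also have "\<dots> = (\<integral>\<^sup>+z. (case z of (k, x, y) \<Rightarrow> indicator {- x - \<Psi> k} y) \<partial>kxy)"
    by (intro nn_integral_cong) (auto simp: indicator_def space_pair_measure split: prod.splits)
  also have "\<dots> = (\<integral>\<^sup>+k. \<integral>\<^sup>+x. \<integral>\<^sup>+y. indicator {- x - \<Psi> k} y \<partial>lborel \<partial>lborel \<partial>count_space UNIV)"
  proof (rule nn_integral_kxy)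
    fix k
    have "(\<lambda>(x, y). indicator {- x - \<Psi> k} y :: ennreal) = (\<lambda>(x, y). if x + y + \<Psi> k = 0 then 1 else 0)"
      by (auto simp: indicator_def fun_eq_iff)
    then show "(\<lambda>(x, y). indicator {- x - \<Psi> k} y :: ennreal) \<in> borel_measurable (lborel \<Otimes>\<^sub>M lborel)"
      by simp
  qed
  also have "\<dots> = 0" by simp
  finally have "emeasure kxy ?N = 0" .
  moreover have "?N \<in> sets kxy" using measurable_phase[of \<Psi>] by measurable
  ultimately show ?thesis
    by (intro AE_I[of _ _ ?N]) auto
qed

text \<open>The coefficient of the product at time \<open>s\<close>, again with the free evolution
  of the output undone; \<open>conv_profiles\<close> makes this precise. It is the integrand of the
  Duhamel formula for profiles.\<close>

definition osc :: "(int \<Rightarrow> int \<Rightarrow> real) \<Rightarrow> (int \<Rightarrow> real \<Rightarrow> complex) \<Rightarrow> (int \<Rightarrow> real \<Rightarrow> complex) \<Rightarrow> int \<Rightarrow> real \<Rightarrow> complex" where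
  "osc \<Psi> f g n s = (\<integral>z. iexp (s * (case z of (k, x, y) \<Rightarrow> x + y + \<Psi> n k)) * interaction f g n z \<partial>kxy)"

lemma continuous_osc:
  assumes int: "integrable kxy (interaction f g n)"
  shows "continuous_on A (osc \<Psi> f g n)"
proof -
  note [measurable] = borel_measurable_integrable[OF int] measurable_phase
  have "isCont (osc \<Psi> f g n) s" for s
    unfolding continuous_at_sequentially comp_def osc_def
  proof (intro allI impI)
    fix S :: "nat \<Rightarrow> real" assume S: "S \<longlonglongrightarrow> s"
    show "(\<lambda>i. \<integral>z. iexp (S i * (case z of (k, x, y) \<Rightarrow> x + y + \<Psi> n k)) * interaction f g n z \<partial>kxy)
       \<longlonglongrightarrow> (\<integral>z. iexp (s * (case z of (k, x, y) \<Rightarrow> x + y + \<Psi> n k)) * interaction f g n z \<partial>kxy)"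
    proof (rule integral_dominated_convergence[where w = "\<lambda>z. norm (interaction f g n z)"])
      show "AE z in kxy. (\<lambda>i. iexp (S i * (case z of (k, x, y) \<Rightarrow> x + y + \<Psi> n k)) * interaction f g n z)
         \<longlonglongrightarrow> iexp (s * (case z of (k, x, y) \<Rightarrow> x + y + \<Psi> n k)) * interaction f g n z"
        by (intro AE_I2 tendsto_intros S)
      show "integrable kxy (\<lambda>z. norm (interaction f g n z))" using int by simp
    qed (measurable, auto simp: norm_mult)
  qed
  then show ?thesis by (simp add: continuous_at_imp_continuous_on)
qed

text \<open>Writes the oriented integral for either sign of \<open>t\<close> as an integral over the
  whole line against a signed indicator, so that Fubini applies to product measures without a case
  distinction.\<close>

lemma interval_integral_as_lborel:
  "\<exists>(e :: complex) A. A \<in> sets borel \<and> emeasure lborel A < \<infinity> \<and>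
     (\<forall>h :: real \<Rightarrow> complex. (LBINT s=ereal 0..ereal t. h s) = e * (\<integral>s. of_real (indicator A s) * h s \<partial>lborel))"
proof (cases "0 \<le> t")
  case True
  then show ?thesis
    by (intro exI[of _ 1] exI[of _ "{0<..<t}"])
       (auto simp: interval_lebesgue_integral_def set_lebesgue_integral_def scaleR_conv_of_real)
next
  case False
  then show ?thesis
    by (intro exI[of _ "- 1"] exI[of _ "{t<..<0}"])
       (auto simp: interval_lebesgue_integral_def set_lebesgue_integral_def scaleR_conv_of_real)
qed

text \<open>Fubini is used twice. First the modulation integral is moved inside, where
  \<open>fourier_KT\<close> turns the kernel into a time integral of the oscillation; then this time
  integral is moved outside, where the remaining integral is \<open>osc\<close>.\<close>

lemma tf_Bil:
  assumes T: "T > 0" "\<bar>t\<bar> \<le> T" and int: "integrable kxy (interaction f g n)"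
  shows "tf (Bil T c \<Psi> f g) t n = c n * (LBINT s=ereal 0..ereal t. osc \<Psi> f g n s)"
proof -
  interpret K: sigma_finite_measure kxy by (rule sigma_finite_kxy)
  interpret P: pair_sigma_finite lborel kxy ..
  let ?l = "\<lambda>z. case z of (k, x, y) \<Rightarrow> x + y + \<Psi> n k"
  let ?I = "interaction f g n"
  note [measurable] = borel_measurable_integrable[OF int] measurable_phase[of "\<Psi> n"]
  obtain C where C: "C \<ge> 0" "\<And>l. (\<integral>\<^sup>+s. ennreal (cmod (KT T s l)) \<partial>lborel) \<le> ennreal C"
    using nn_integral_KT_bounded[OF T(1)] by blast
  \<comment> \<open>The integral of the kernel over the output modulation is bounded uniformly in
    the phase, so integrability of the interaction suffices.\<close>
  have J: "integrable (lborel \<Otimes>\<^sub>M kxy) (\<lambda>(s, z). KT T s (?l z) * ?I z * iexp (t * s))"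
  proof (rule integrableI_bounded)
    show "(\<lambda>(s, z). KT T s (?l z) * ?I z * iexp (t * s)) \<in> borel_measurable (lborel \<Otimes>\<^sub>M kxy)"
      by measurable
    have "(\<integral>\<^sup>+w. ennreal (norm (case w of (s, z) \<Rightarrow> KT T s (?l z) * ?I z * iexp (t * s))) \<partial>(lborel \<Otimes>\<^sub>M kxy))
      = (\<integral>\<^sup>+z. \<integral>\<^sup>+s. ennreal (norm (KT T s (?l z) * ?I z * iexp (t * s))) \<partial>lborel \<partial>kxy)"
      by (subst P.nn_integral_snd[symmetric]) simp_all
    also have "\<dots> = (\<integral>\<^sup>+z. (\<integral>\<^sup>+s. ennreal (cmod (KT T s (?l z))) \<partial>lborel) * ennreal (cmod (?I z)) \<partial>kxy)"
      by (intro nn_integral_cong) (simp add: norm_mult ennreal_mult nn_integral_multc)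
    also have "\<dots> \<le> (\<integral>\<^sup>+z. ennreal C * ennreal (cmod (?I z)) \<partial>kxy)"
      by (intro nn_integral_mono mult_right_mono C) simp
    also have "\<dots> = ennreal C * (\<integral>\<^sup>+z. ennreal (cmod (?I z)) \<partial>kxy)"
      by (rule nn_integral_cmult) simp
    also have "\<dots> < \<infinity>"
      using int by (simp add: integrable_iff_bounded ennreal_mult_less_top)
    finally show "(\<integral>\<^sup>+w. ennreal (norm (case w of (s, z) \<Rightarrow> KT T s (?l z) * ?I z * iexp (t * s))) \<partial>(lborel \<Otimes>\<^sub>M kxy)) < \<infinity>" .
  qed
  obtain e A where A: "A \<in> sets borel" "emeasure lborel A < \<infinity>"
    and eA: "\<And>h :: real \<Rightarrow> complex. (LBINT s=ereal 0..ereal t. h s) = e * (\<integral>s. of_real (indicator A s) * h s \<partial>lborel)"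
    using interval_integral_as_lborel[of t] by blast
  have intA: "integrable lborel (\<lambda>s. of_real (indicator A s) :: complex)"
    using A by simp
  have J2: "integrable (lborel \<Otimes>\<^sub>M kxy) (\<lambda>(s, z). of_real (indicator A s) * (iexp (s * ?l z) * ?I z))"
  proof (rule Bochner_Integration.integrable_bound[OF integrable_pair_product[OF sigma_finite_lborel sigma_finite_kxy intA int]])
    show "(\<lambda>(s, z). of_real (indicator A s) * (iexp (s * ?l z) * ?I z)) \<in> borel_measurable (lborel \<Otimes>\<^sub>M kxy)"
      using A(1) by measurable
  qed (auto simp: norm_mult simp del: of_real_mult)
  have D: "(iexp (t * l) - 1) / (\<i> * of_real l) = (LBINT s=ereal 0..ereal t. iexp (s * l))" if "l \<noteq> 0" for l
  proof -
    have "(LBINT s=ereal 0..ereal t. iexp (s * l)) = iexp (t * l) / (\<i> * of_real l) - iexp (0 * l) / (\<i> * of_real l)"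
    proof (rule interval_integral_FTC_finite)
      show "continuous_on {min 0 t..max 0 t} (\<lambda>s. iexp (s * l))"
        by (intro continuous_intros)
      fix x
      have "((\<lambda>s. exp (\<i> * of_real s * of_real l) / (\<i> * of_real l)) has_vector_derivative (\<i> * of_real l * exp (\<i> * of_real x * of_real l)) / (\<i> * of_real l)) (at x within {min 0 t..max 0 t})"
        by (intro has_vector_derivative_real_field) (auto intro!: derivative_eq_intros simp: that)
      then show "((\<lambda>s. iexp (s * l) / (\<i> * of_real l)) has_vector_derivative iexp (x * l)) (at x within {min 0 t..max 0 t})"
        using that by (simp add: mult_ac)
    qed
    then show ?thesis by (simp add: diff_divide_distrib)
  qed
  have "tf (Bil T c \<Psi> f g) t n = (\<integral>s. c n * (\<integral>z. KT T s (?l z) * ?I z * iexp (t * s) \<partial>kxy) \<partial>lborel)"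
    unfolding tf_def Bil_def by (intro Bochner_Integration.integral_cong refl) (simp only: mult.assoc[of "c n"] integral_mult_left_zero)
  also have "\<dots> = c n * (\<integral>s. (\<integral>z. KT T s (?l z) * ?I z * iexp (t * s) \<partial>kxy) \<partial>lborel)"
    by (rule integral_mult_right_zero)
  also have "(\<integral>s. (\<integral>z. KT T s (?l z) * ?I z * iexp (t * s) \<partial>kxy) \<partial>lborel)
     = (\<integral>z. (\<integral>s. KT T s (?l z) * ?I z * iexp (t * s) \<partial>lborel) \<partial>kxy)"
    by (rule P.Fubini_integral[OF J, symmetric])
  also have "\<dots> = (\<integral>z. e * (\<integral>s. of_real (indicator A s) * (iexp (s * ?l z) * ?I z) \<partial>lborel) \<partial>kxy)"
  proof (rule integral_cong_AE)
    show "(\<lambda>z. \<integral>s. KT T s (?l z) * ?I z * iexp (t * s) \<partial>lborel) \<in> borel_measurable kxy"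
      by measurable
    show "(\<lambda>z. e * (\<integral>s. of_real (indicator A s) * (iexp (s * ?l z) * ?I z) \<partial>lborel)) \<in> borel_measurable kxy"
      using A(1) by measurable
    show "AE z in kxy. (\<integral>s. KT T s (?l z) * ?I z * iexp (t * s) \<partial>lborel)
        = e * (\<integral>s. of_real (indicator A s) * (iexp (s * ?l z) * ?I z) \<partial>lborel)"
      using AE_phase_nonzero[of "\<Psi> n"]
    proof eventually_elim
      fix z assume l: "?l z \<noteq> 0"
      have "(\<integral>s. KT T s (?l z) * ?I z * iexp (t * s) \<partial>lborel) = (\<integral>s. (KT T s (?l z) * iexp (t * s)) * ?I z \<partial>lborel)"
        by (intro Bochner_Integration.integral_cong) (auto simp: mult_ac)
      also have "\<dots> = (\<integral>s. KT T s (?l z) * iexp (t * s) \<partial>lborel) * ?I z"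
        by (rule integral_mult_left_zero)
      also have "\<dots> = e * (\<integral>s. of_real (indicator A s) * iexp (s * ?l z) \<partial>lborel) * ?I z"
        unfolding fourier_KT[OF T l] D[OF l] eA ..
      also have "\<dots> = e * (\<integral>s. of_real (indicator A s) * iexp (s * ?l z) * ?I z \<partial>lborel)"
        by (simp only: mult.assoc[of e] integral_mult_left_zero)
      finally show "(\<integral>s. KT T s (?l z) * ?I z * iexp (t * s) \<partial>lborel)
        = e * (\<integral>s. of_real (indicator A s) * (iexp (s * ?l z) * ?I z) \<partial>lborel)"
        by (simp only: mult.assoc)
    qed
  qed
  also have "\<dots> = e * (\<integral>z. (\<integral>s. of_real (indicator A s) * (iexp (s * ?l z) * ?I z) \<partial>lborel) \<partial>kxy)"
    by (rule integral_mult_right_zero)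
  also have "(\<integral>z. (\<integral>s. of_real (indicator A s) * (iexp (s * ?l z) * ?I z) \<partial>lborel) \<partial>kxy)
    = (\<integral>s. (\<integral>z. of_real (indicator A s) * (iexp (s * ?l z) * ?I z) \<partial>kxy) \<partial>lborel)"
    by (rule P.Fubini_integral[OF J2])
  also have "\<dots> = (\<integral>s. of_real (indicator A s) * osc \<Psi> f g n s \<partial>lborel)"
    unfolding osc_def by (intro Bochner_Integration.integral_cong refl) (rule integral_mult_right_zero)
  also have "e * \<dots> = (LBINT s=ereal 0..ereal t. osc \<Psi> f g n s)"
    by (rule eA[symmetric])
  finally show ?thesis .
qed

text \<open>The phases of the two factors at \<open>n - k\<close> and \<open>k\<close> combine to
  the phase of the output at \<open>n\<close> times the oscillation \<open>\<Psi> n k\<close>.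
  Integrating out both modulations first leaves an absolutely convergent sum over \<open>k\<close>,
  the convolution.\<close>

lemma
  assumes int: "integrable kxy (interaction f g n)"
    and fg: "\<And>m. integrable lborel (f m)" "\<And>m. integrable lborel (g m)"
    and \<Psi>: "\<And>k. \<Psi> n k = \<omega> n - \<omega>1 (n - k) - \<omega>2 k"
  shows conv_profiles_summable: "(\<lambda>k. norm ((iexp (- s * \<omega>1 (n - k)) * tf f s (n - k)) * (iexp (- s * \<omega>2 k) * tf g s k))) summable_on UNIV"
    and conv_profiles: "conv (\<lambda>m. iexp (- s * \<omega>1 m) * tf f s m) (\<lambda>m. iexp (- s * \<omega>2 m) * tf g s m) n
       = iexp (- s * \<omega> n) * osc \<Psi> f g n s"
proof -
  interpret P: pair_sigma_finite "count_space (UNIV :: int set)" "lborel \<Otimes>\<^sub>M lborel :: (real \<times> real) measure"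
    unfolding pair_sigma_finite_def using sigma_finite_lborel_pair by auto
  note [measurable] = borel_measurable_integrable[OF int] measurable_phase[of "\<Psi> n"]
  let ?h = "\<lambda>z. iexp (s * (case z of (k, x, y) \<Rightarrow> x + y + \<Psi> n k)) * interaction f g n z"
  have J: "integrable kxy ?h"
    by (rule Bochner_Integration.integrable_bound[OF int]) (measurable, auto simp: norm_mult simp del: of_real_mult)
  have inner: "(\<integral>w. ?h (k, w) \<partial>(lborel \<Otimes>\<^sub>M lborel)) = iexp (s * \<Psi> n k) * (tf f s (n - k) * tf g s k)" for k
  proof -
    have "(\<integral>w. ?h (k, w) \<partial>(lborel \<Otimes>\<^sub>M lborel))
      = (\<integral>w. iexp (s * \<Psi> n k) * (case w of (x, y) \<Rightarrow> (f (n - k) x * iexp (s * x)) * (g k y * iexp (s * y))) \<partial>(lborel \<Otimes>\<^sub>M lborel))"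
      by (intro Bochner_Integration.integral_cong) (auto simp: interaction_def distrib_left exp_add mult_ac split: prod.splits)
    also have "\<dots> = iexp (s * \<Psi> n k) * (\<integral>w. (case w of (x, y) \<Rightarrow> (f (n - k) x * iexp (s * x)) * (g k y * iexp (s * y))) \<partial>(lborel \<Otimes>\<^sub>M lborel))"
      by (rule integral_mult_right_zero)
    also have "(\<integral>w. (case w of (x, y) \<Rightarrow> (f (n - k) x * iexp (s * x)) * (g k y * iexp (s * y))) \<partial>(lborel \<Otimes>\<^sub>M lborel))
      = (\<integral>x. \<integral>y. (f (n - k) x * iexp (s * x)) * (g k y * iexp (s * y)) \<partial>lborel \<partial>lborel)"
      by (rule lborel_pair.integral_fst[symmetric])
         (rule integrable_pair_product[OF sigma_finite_lborel sigma_finite_lborel integrable_mult_iexp[OF fg(1)] integrable_mult_iexp[OF fg(2)]])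
    also have "\<dots> = tf f s (n - k) * tf g s k"
      unfolding tf_def by (simp only: integral_mult_right_zero integral_mult_left_zero)
    finally show ?thesis .
  qed
  have ik: "integrable (count_space UNIV) (\<lambda>k. iexp (s * \<Psi> n k) * (tf f s (n - k) * tf g s k))"
    using P.integrable_fst'[OF J] unfolding inner .
  have osc: "osc \<Psi> f g n s = (\<integral>k. iexp (s * \<Psi> n k) * (tf f s (n - k) * tf g s k) \<partial>count_space UNIV)"
    unfolding osc_def P.integral_fst'[OF J, symmetric] inner ..
  have prod_eq: "(iexp (- s * \<omega>1 (n - k)) * tf f s (n - k)) * (iexp (- s * \<omega>2 k) * tf g s k)
     = iexp (- s * \<omega> n) * (iexp (s * \<Psi> n k) * (tf f s (n - k) * tf g s k))" for k
  proof -
    have "iexp (- s * \<omega>1 (n - k)) * iexp (- s * \<omega>2 k) = iexp (- s * \<omega> n) * iexp (s * \<Psi> n k)"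
      unfolding exp_add[symmetric] \<Psi> by (simp add: algebra_simps)
    note eq = this
    have gen: "(p * q) * (p' * q') = (p * p') * (q * q')" for p q p' q' :: complex
      by (simp only: mult_ac)
    show ?thesis by (subst gen, subst eq, rule mult.assoc)
  qed
  have "integrable (count_space UNIV) (\<lambda>k. (iexp (- s * \<omega>1 (n - k)) * tf f s (n - k)) * (iexp (- s * \<omega>2 k) * tf g s k))"
    unfolding prod_eq using ik by simp
  then have abs: "Infinite_Set_Sum.abs_summable_on (\<lambda>k. (iexp (- s * \<omega>1 (n - k)) * tf f s (n - k)) * (iexp (- s * \<omega>2 k) * tf g s k)) UNIV"
    by (simp add: abs_summable_on_def)
  then show "(\<lambda>k. norm ((iexp (- s * \<omega>1 (n - k)) * tf f s (n - k)) * (iexp (- s * \<omega>2 k) * tf g s k))) summable_on UNIV"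
    by (simp only: abs_summable_equivalent[symmetric])
  have "conv (\<lambda>m. iexp (- s * \<omega>1 m) * tf f s m) (\<lambda>m. iexp (- s * \<omega>2 m) * tf g s m) n
    = (\<integral>k. (iexp (- s * \<omega>1 (n - k)) * tf f s (n - k)) * (iexp (- s * \<omega>2 k) * tf g s k) \<partial>count_space UNIV)"
    unfolding conv_def infsetsum_infsum[OF abs, symmetric] infsetsum_def ..
  also have "\<dots> = iexp (- s * \<omega> n) * osc \<Psi> f g n s"
    unfolding prod_eq osc by (rule integral_mult_right_zero)
  finally show "conv (\<lambda>m. iexp (- s * \<omega>1 m) * tf f s m) (\<lambda>m. iexp (- s * \<omega>2 m) * tf g s m) n
       = iexp (- s * \<omega> n) * osc \<Psi> f g n s" .
qed

section \<open>Completeness of the profile norm\<close>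

lemma X_le_nn_integral:
  assumes "\<And>n. nb b (h n) \<le> (\<integral>\<^sup>+i. nb b (d i n) \<partial>count_space (UNIV :: nat set))"
  shows "X r1 r2 b h \<le> (\<integral>\<^sup>+i. X r1 r2 b (d i) \<partial>count_space UNIV)"
proof -
  have w: "ennreal (jb (of_int n) powr r) * nb b (h n) \<le> (\<integral>\<^sup>+i. ennreal (jb (of_int n) powr r) * nb b (d i n) \<partial>count_space UNIV)" for n r
    by (subst nn_integral_cmult) (auto intro!: mult_left_mono assms)
  have "l2norm (count_space UNIV) (\<lambda>n. ennreal (jb (of_int n) powr r1) * nb b (h n))
     \<le> l2norm (count_space UNIV) (\<lambda>n. \<integral>\<^sup>+i. ennreal (jb (of_int n) powr r1) * nb b (d i n) \<partial>count_space UNIV)"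
    by (intro l2norm_mono w)
  also have "\<dots> \<le> (\<integral>\<^sup>+i. l2norm (count_space UNIV) (\<lambda>n. ennreal (jb (of_int n) powr r1) * nb b (d i n)) \<partial>count_space UNIV)"
    by (intro l2norm_nn_integral_le sigma_finite_count_space_countable measurable_pair_count_space_snd) simp
  finally have 1: "l2norm (count_space UNIV) (\<lambda>n. ennreal (jb (of_int n) powr r1) * nb b (h n)) \<le> \<dots>" .
  have 2: "(SUP n. ennreal (jb (of_int n) powr r2) * nb b (h n)) \<le> (\<integral>\<^sup>+i. (SUP n. ennreal (jb (of_int n) powr r2) * nb b (d i n)) \<partial>count_space UNIV)"
  proof (rule SUP_least)
    fix n
    note w[of n r2]
    also have "(\<integral>\<^sup>+i. ennreal (jb (of_int n) powr r2) * nb b (d i n) \<partial>count_space UNIV)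
       \<le> (\<integral>\<^sup>+i. (SUP n. ennreal (jb (of_int n) powr r2) * nb b (d i n)) \<partial>count_space UNIV)"
      by (intro nn_integral_mono SUP_upper) simp
    finally show "ennreal (jb (of_int n) powr r2) * nb b (h n) \<le> \<dots>" .
  qed
  show ?thesis
    unfolding X_def by (subst nn_integral_add) (auto intro!: add_mono 1 2)
qed

lemma nn_integral_geometric:
  assumes "K \<ge> 0"
  shows "(\<integral>\<^sup>+i. ennreal (K * (1/2) ^ (m + i)) \<partial>count_space UNIV) = ennreal (2 * K * (1/2) ^ m)"
proof -
  have "(\<lambda>i. (K * (1/2) ^ m) * (1/2 :: real) ^ i) sums ((K * (1/2) ^ m) * 2)"
    using geometric_sums[of "1/2 :: real"] by (intro sums_mult) simp
  then have "(\<Sum>i. ennreal (K * (1/2) ^ m * (1/2) ^ i)) = ennreal ((K * (1/2) ^ m) * 2)"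
    using assms by (intro suminf_ennreal_eq) auto
  then show ?thesis
    by (simp add: nn_integral_count_space_nat power_add mult_ac)
qed

abbreviation pdiff :: "(int \<Rightarrow> real \<Rightarrow> complex) \<Rightarrow> (int \<Rightarrow> real \<Rightarrow> complex) \<Rightarrow> int \<Rightarrow> real \<Rightarrow> complex" where
  "pdiff f g \<equiv> \<lambda>n x. f n x - g n x"

lemma profile_pdiff: "profile f \<Longrightarrow> profile g \<Longrightarrow> profile (pdiff f g)"
  unfolding profile_def by (auto intro: borel_measurable_diff)

lemma X_pdiff_triangle:
  assumes "profile f" "profile g" "profile h"
  shows "X r1 r2 b (pdiff f h) \<le> X r1 r2 b (pdiff f g) + X r1 r2 b (pdiff g h)"
  by (rule X_triangle) (auto intro: profile_pdiff assms)

lemma X_le_pdiff: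
  assumes "profile f" "profile g"
  shows "X r1 r2 b f \<le> X r1 r2 b (pdiff f g) + X r1 r2 b g"
  by (rule X_triangle) (auto intro: profile_pdiff assms)

lemma X_pdiff_le:
  assumes "profile f" "profile g"
  shows "X r1 r2 b (pdiff f g) \<le> X r1 r2 b f + X r1 r2 b g"
proof -
  have "nb b (\<lambda>x. - g n x) = nb b (g n)" for n by (simp add: nb_def)
  then have "X r1 r2 b (\<lambda>n x. - g n x) = X r1 r2 b g" by (simp add: X_def)
  moreover have "profile (\<lambda>n x. - g n x)" using assms(2) by (auto simp: profile_def)
  ultimately show ?thesis
    using X_triangle[of f "\<lambda>n x. - g n x" "pdiff f g" r1 r2 b] assms(1) by simp
qed

text \<open>Pointwise the differences may fail to be summable, but then the bound by the sum of their
  absolute values, taken in \<open>[0, \<infinity>]\<close>, holds trivially.\<close>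

lemma X_complete:
  assumes f: "\<And>j :: nat. profile (f j)" and K: "K \<ge> 0"
    and d: "\<And>j. X r1 r2 b (pdiff (f (Suc j)) (f j)) \<le> ennreal (K * (1/2) ^ j)"
  shows "X r1 r2 b (pdiff (\<lambda>n x. lim (\<lambda>j. f j n x)) (f m)) \<le> ennreal (2 * K * (1/2) ^ m)"
proof -
  note [measurable] = profile_borel[OF f]
  define g where "g = (\<lambda>n x. lim (\<lambda>j. f j n x))"
  define D where "D = (\<lambda>i n x. f (Suc (m + i)) n x - f (m + i) n x)"
  have pt: "ennreal (cmod (g n x - f m n x)) \<le> (\<integral>\<^sup>+i. ennreal (cmod (D i n x)) \<partial>count_space UNIV)" for n x
  proof (cases "(\<integral>\<^sup>+i. ennreal (cmod (D i n x)) \<partial>count_space UNIV) = \<infinity>")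
    case False
    then have "(\<Sum>i. ennreal (cmod (D i n x))) \<noteq> \<infinity>" by (simp add: nn_integral_count_space_nat)
    then have s: "summable (\<lambda>i. cmod (D i n x))"
      by (intro summable_suminf_not_top) auto
    have tel: "(\<Sum>i<k. D i n x) = f (m + k) n x - f m n x" for k
      by (induction k) (auto simp: D_def)
    have "(\<lambda>k. f (m + k) n x - f m n x) \<longlonglongrightarrow> (\<Sum>i. D i n x)"
      unfolding tel[symmetric] by (intro summable_LIMSEQ summable_norm_cancel[OF s])
    then have "(\<lambda>k. (f (m + k) n x - f m n x) + f m n x) \<longlonglongrightarrow> (\<Sum>i. D i n x) + f m n x"
      by (intro tendsto_add tendsto_const)
    then have "(\<lambda>k. f (k + m) n x) \<longlonglongrightarrow> (\<Sum>i. D i n x) + f m n x"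
      by (simp add: add.commute)
    then have "(\<lambda>j. f j n x) \<longlonglongrightarrow> (\<Sum>i. D i n x) + f m n x"
      by (rule LIMSEQ_offset)
    then have "g n x = (\<Sum>i. D i n x) + f m n x"
      unfolding g_def by (rule limI)
    then have "cmod (g n x - f m n x) \<le> (\<Sum>i. cmod (D i n x))"
      using summable_norm[OF s] by simp
    then have "ennreal (cmod (g n x - f m n x)) \<le> ennreal (\<Sum>i. cmod (D i n x))"
      by (rule ennreal_leI)
    also have "\<dots> = (\<Sum>i. ennreal (cmod (D i n x)))"
      using s by (intro suminf_ennreal2[symmetric]) auto
    finally show ?thesis by (simp add: nn_integral_count_space_nat)
  qed simp
  have "X r1 r2 b (pdiff g (f m)) \<le> (\<integral>\<^sup>+i. X r1 r2 b (D i) \<partial>count_space UNIV)"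
  proof (rule X_le_nn_integral)
    fix n
    have "nb b (pdiff g (f m) n) \<le> l2norm lborel (\<lambda>x. \<integral>\<^sup>+i. ennreal (jb x powr b) * ennreal (cmod (D i n x)) \<partial>count_space UNIV)"
      unfolding nb_def Nb_def
      by (intro l2norm_mono, subst nn_integral_cmult) (auto intro!: mult_left_mono pt)
    also have "\<dots> \<le> (\<integral>\<^sup>+i. l2norm lborel (\<lambda>x. ennreal (jb x powr b) * ennreal (cmod (D i n x))) \<partial>count_space UNIV)"
      unfolding D_def
      by (intro l2norm_nn_integral_le sigma_finite_lborel sigma_finite_count_space_countable measurable_pair_count_space_snd) measurable
    finally show "nb b (pdiff g (f m) n) \<le> (\<integral>\<^sup>+i. nb b (D i n) \<partial>count_space UNIV)"
      by (simp add: nb_def Nb_def)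
  qed
  also have "\<dots> \<le> (\<integral>\<^sup>+i. ennreal (K * (1/2) ^ (m + i)) \<partial>count_space UNIV)"
    unfolding D_def using d by (intro nn_integral_mono) simp
  also have "\<dots> = ennreal (2 * K * (1/2) ^ m)"
    by (rule nn_integral_geometric) fact
  finally show ?thesis unfolding g_def .
qed

lemma profile_lim:
  assumes "\<And>j :: nat. profile (f j)"
  shows "profile (\<lambda>n x. lim (\<lambda>j. f j n x))"
  unfolding profile_def by (intro allI borel_measurable_lim_metric profile_borel assms)

lemma ennreal_le_geometric:
  assumes "\<And>m. x \<le> ennreal (r + c * (1/2) ^ m)"
  shows "x \<le> ennreal r"
proof -
  have "(\<lambda>m. r + c * (1/2 :: real) ^ m) \<longlonglongrightarrow> r + c * 0"
    by (intro tendsto_intros LIMSEQ_power_zero) auto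
  then have "(\<lambda>m. ennreal (r + c * (1/2) ^ m)) \<longlonglongrightarrow> ennreal r"
    by (intro tendsto_ennrealI) simp
  then show ?thesis
    by (rule LIMSEQ_le_const) (use assms in auto)
qed

section \<open>The free evolution as a profile\<close>

definition Hn :: "real \<Rightarrow> real \<Rightarrow> (int \<Rightarrow> complex) \<Rightarrow> ennreal" where
  "Hn r1 r2 a = l2norm (count_space UNIV) (\<lambda>n. ennreal (jb (of_int n) powr r1) * ennreal (cmod (a n)))
     + (SUP n. ennreal (jb (of_int n) powr r2) * ennreal (cmod (a n)))"

text \<open>A free solution has constant coefficients once its evolution is undone, so its profile
  is the data times the transform of a cutoff. The cutoff lives at scale 1 and not \<open>T\<close>,
  which keeps the linear estimate free of \<open>T\<close>.\<close>

definition lin :: "(int \<Rightarrow> complex) \<Rightarrow> int \<Rightarrow> real \<Rightarrow> complex" where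
  "lin a n x = of_real (chi x) * a n"

lemma profile_lin: "profile (lin a)"
  unfolding profile_def lin_def[abs_def] by measurable

text \<open>By the second order decay of \<open>chi\<close> the weighted cutoff decays with the
  power \<open>b - 2\<close>, which is square integrable exactly for \<open>b < 3/2\<close>.\<close>

lemma X_lin_le:
  assumes "b < 3/2"
  obtains L where "L > 0" and "\<And>r1 r2 a. X r1 r2 b (lin a) \<le> ennreal L * Hn r1 r2 a"
proof -
  define N where "N = l2norm lborel (\<lambda>x. ennreal (jb x powr b) * ennreal \<bar>chi x\<bar>)"
  have "N \<le> l2norm lborel (\<lambda>x. 2 * ennreal (jb x powr (- (2 - b))))"
    unfolding N_def
  proof (intro l2norm_mono)
    fix x
    have "jb x powr b * \<bar>chi x\<bar> \<le> jb x powr b * (2 * jb x powr (- 2))"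
      by (intro mult_left_mono abs_chi_le) simp
    also have "\<dots> = 2 * jb x powr (- (2 - b))"
      by (simp add: powr_add[symmetric])
    finally show "ennreal (jb x powr b) * ennreal \<bar>chi x\<bar> \<le> 2 * ennreal (jb x powr (- (2 - b)))"
      by (subst ennreal_mult[symmetric]) (auto simp: ennreal_mult[symmetric] ennreal_numeral[symmetric] simp del: ennreal_numeral intro!: ennreal_leI)
  qed
  also have "\<dots> = 2 * l2norm lborel (\<lambda>x. ennreal (jb x powr (- (2 - b))))"
    by (rule l2norm_cmult) measurable
  also have "\<dots> < \<infinity>"
    using l2norm_jb_powr_finite[of "2 - b"] assms by (simp add: ennreal_mult_less_top)
  finally obtain N' where N': "N = ennreal N'" "N' \<ge> 0"
    by (metis infinity_ennreal_def less_top_ennreal)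
  show ?thesis
  proof (rule that[of "N' + 1"])
    fix r1 r2 and a :: "int \<Rightarrow> complex"
    have nb: "nb b (lin a n) = N * ennreal (cmod (a n))" for n
    proof -
      have "nb b (lin a n) = l2norm lborel (\<lambda>x. ennreal (cmod (a n)) * (ennreal (jb x powr b) * ennreal \<bar>chi x\<bar>))"
        unfolding nb_def Nb_def lin_def by (intro l2norm_cong) (simp add: norm_mult ennreal_mult mult_ac)
      also have "\<dots> = ennreal (cmod (a n)) * N"
        unfolding N_def by (rule l2norm_cmult) measurable
      finally show ?thesis by (simp add: mult.commute)
    qed
    have "X r1 r2 b (lin a) = N * Hn r1 r2 a"
    proof -
      have "l2norm (count_space UNIV) (\<lambda>n. N * (ennreal (jb (of_int n) powr r1) * ennreal (cmod (a n))))
         = N * l2norm (count_space UNIV) (\<lambda>n. ennreal (jb (of_int n) powr r1) * ennreal (cmod (a n)))"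
        by (rule l2norm_cmult) simp
      then show ?thesis
        unfolding X_def Hn_def nb by (simp add: distrib_left SUP_mult_left_ennreal mult_ac)
    qed
    also have "\<dots> \<le> ennreal (N' + 1) * Hn r1 r2 a"
      unfolding N' by (intro mult_right_mono ennreal_leI) auto
    finally show "X r1 r2 b (lin a) \<le> \<dots>" .
  qed (use N' in auto)
qed

lemma integrable_lin: "integrable lborel (lin a n)"
  unfolding lin_def[abs_def] using integrable_chi by simp

lemma tf_lin:
  assumes "\<bar>t\<bar> \<le> 1"
  shows "tf (lin a) t n = a n"
proof -
  have "tf (lin a) t n = (\<integral>x. a n * (of_real (chi x) * iexp (t * x)) \<partial>lborel)"
    unfolding tf_def lin_def by (intro Bochner_Integration.integral_cong) (auto simp: mult_ac)
  also have "\<dots> = a n * (\<integral>x. of_real (chi x) * iexp (t * x) \<partial>lborel)"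
    by (rule integral_mult_right_zero)
  finally show ?thesis using fourier_chi[OF assms] by simp
qed

section \<open>The fixed point\<close>

definition omega_u :: "int \<Rightarrow> real" where "omega_u n = (of_int n)\<^sup>2"

definition omega_v :: "real \<Rightarrow> int \<Rightarrow> real" where "omega_v \<gamma> n = \<gamma> * \<bar>of_int n\<bar> * of_int n"

lemma phase_u_eq: "phase_u \<gamma> n k = omega_u n - omega_u (n - k) - omega_v \<gamma> k"
  by (simp add: phase_u_def omega_u_def omega_v_def power2_eq_square algebra_simps)

text \<open>The double negation is deliberate: the second factor is the conjugate of
  \<open>u\<close>, with dispersion relation \<open>- omega_u\<close>.\<close>

lemma phase_v_eq: "phase_v \<gamma> n k = omega_v \<gamma> n - omega_u (n - k) - (- omega_u k)"
  by (simp add: phase_v_def omega_u_def omega_v_def power2_eq_square algebra_simps)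

lemma conj_profile_pdiff: "conj_profile (pdiff f g) = pdiff (conj_profile f) (conj_profile g)"
  by (simp add: conj_profile_def fun_eq_iff)

lemma tf_conj_profile: "tf (conj_profile f) t n = cnj (tf f t (- n))"
proof -
  have "tf (conj_profile f) t n = (\<integral>x. conj_profile f n (0 + (-1) * x) * iexp (t * (0 + (-1) * x)) \<partial>lborel)"
    unfolding tf_def by (subst lborel_integral_real_affine[of "-1" _ 0]) simp_all
  also have "\<dots> = (\<integral>x. cnj (f (- n) x * iexp (t * x)) \<partial>lborel)"
    by (intro Bochner_Integration.integral_cong) (auto simp: conj_profile_def exp_cnj)
  finally show ?thesis by (simp add: tf_def del: complex_cnj_mult)
qed

section \<open>The product at a fixed time\<close>

lemma integrable_osc_integrand:
  assumes int: "integrable kxy (interaction f g n)"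
  shows "integrable kxy (\<lambda>z. iexp (s * (case z of (k, x, y) \<Rightarrow> x + y + \<Psi> n k)) * interaction f g n z)"
proof -
  note [measurable] = borel_measurable_integrable[OF int] measurable_phase[of "\<Psi> n"]
  show ?thesis
    by (rule Bochner_Integration.integrable_bound[OF int]) (measurable, auto simp: norm_mult simp del: of_real_mult)
qed

lemma osc_pdiff_left:
  assumes "integrable kxy (interaction f g n)" "integrable kxy (interaction f' g n)"
  shows "osc \<Psi> (pdiff f f') g n s = osc \<Psi> f g n s - osc \<Psi> f' g n s"
proof -
  have "osc \<Psi> (pdiff f f') g n s = (\<integral>z. iexp (s * (case z of (k, x, y) \<Rightarrow> x + y + \<Psi> n k)) * interaction f g n z
      - iexp (s * (case z of (k, x, y) \<Rightarrow> x + y + \<Psi> n k)) * interaction f' g n z \<partial>kxy)"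
    unfolding osc_def by (intro Bochner_Integration.integral_cong) (auto simp: interaction_def algebra_simps simp del: of_real_mult of_real_add)
  also have "\<dots> = osc \<Psi> f g n s - osc \<Psi> f' g n s"
    unfolding osc_def by (intro Bochner_Integration.integral_diff integrable_osc_integrand assms)
  finally show ?thesis .
qed

lemma osc_pdiff_right:
  assumes "integrable kxy (interaction f g n)" "integrable kxy (interaction f g' n)"
  shows "osc \<Psi> f (pdiff g g') n s = osc \<Psi> f g n s - osc \<Psi> f g' n s"
proof -
  have "osc \<Psi> f (pdiff g g') n s = (\<integral>z. iexp (s * (case z of (k, x, y) \<Rightarrow> x + y + \<Psi> n k)) * interaction f g n z
      - iexp (s * (case z of (k, x, y) \<Rightarrow> x + y + \<Psi> n k)) * interaction f g' n z \<partial>kxy)"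
    unfolding osc_def by (intro Bochner_Integration.integral_cong) (auto simp: interaction_def algebra_simps simp del: of_real_mult of_real_add)
  also have "\<dots> = osc \<Psi> f g n s - osc \<Psi> f g' n s"
    unfolding osc_def by (intro Bochner_Integration.integral_diff integrable_osc_integrand assms)
  finally show ?thesis .
qed

text \<open>Although \<open>osc\<close> is an integral over entire profiles, it equals a convolution
  of their values at the single time \<open>s\<close>. This locality in time makes profiles that
  agree only on an interval interchangeable there. The offset \<open>c\<close> serves the
  translation of solutions in time.\<close>

lemma osc_cong_shift:
  assumes int: "integrable kxy (interaction f g n)" "integrable kxy (interaction f' g' n)"
    and fg: "\<And>m. integrable lborel (f m)" "\<And>m. integrable lborel (g m)" "\<And>m. integrable lborel (f' m)" "\<And>m. integrable lborel (g' m)"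
    and \<Psi>: "\<And>k. \<Psi> n k = \<omega> n - \<omega>1 (n - k) - \<omega>2 k"
    and eq: "\<And>m. tf f' s m = iexp (- c * \<omega>1 m) * tf f (s + c) m"
            "\<And>m. tf g' s m = iexp (- c * \<omega>2 m) * tf g (s + c) m"
  shows "osc \<Psi> f' g' n s = iexp (- c * \<omega> n) * osc \<Psi> f g n (s + c)"
proof -
  have e: "iexp (- s * w) * (iexp (- c * w) * x) = iexp (- (s + c) * w) * x" for w :: real and x :: complex
    unfolding mult.assoc[symmetric] exp_add[symmetric] by (simp add: algebra_simps)
  have "iexp (- s * \<omega> n) * osc \<Psi> f' g' n s
     = conv (\<lambda>m. iexp (- s * \<omega>1 m) * tf f' s m) (\<lambda>m. iexp (- s * \<omega>2 m) * tf g' s m) n"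
    by (rule conv_profiles[OF int(2) fg(3,4), symmetric]) (rule \<Psi>)
  also have "\<dots> = conv (\<lambda>m. iexp (- (s + c) * \<omega>1 m) * tf f (s + c) m) (\<lambda>m. iexp (- (s + c) * \<omega>2 m) * tf g (s + c) m) n"
    unfolding eq e ..
  also have "\<dots> = iexp (- (s + c) * \<omega> n) * osc \<Psi> f g n (s + c)"
    by (rule conv_profiles[OF int(1) fg(1,2)]) (rule \<Psi>)
  also have "\<dots> = iexp (- s * \<omega> n) * (iexp (- c * \<omega> n) * osc \<Psi> f g n (s + c))"
    by (rule e[symmetric])
  finally show ?thesis by simp
qed

lemma osc_cong:
  assumes int: "integrable kxy (interaction f g n)" "integrable kxy (interaction f' g' n)"
    and fg: "\<And>m. integrable lborel (f m)" "\<And>m. integrable lborel (g m)" "\<And>m. integrable lborel (f' m)" "\<And>m. integrable lborel (g' m)"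
    and \<Psi>: "\<And>k. \<Psi> n k = \<omega> n - \<omega>1 (n - k) - \<omega>2 k"
    and eq: "\<And>m. tf f' s m = tf f s m" "\<And>m. tf g' s m = tf g s m"
  shows "osc \<Psi> f' g' n s = osc \<Psi> f g n s"
  using osc_cong_shift[OF int fg, of \<Psi> \<omega> \<omega>1 \<omega>2 s 0] \<Psi> eq by simp

lemma interval_integrable_continuous:
  fixes h :: "real \<Rightarrow> complex"
  assumes "continuous_on UNIV h"
  shows "interval_lebesgue_integrable lborel (ereal a) (ereal c) h"
  using assms by (intro interval_integrable_isCont) (simp add: continuous_on_eq_continuous_at)

text \<open>Absorption into the left side; in [0, \<infinity>] it requires that the absorbed
  quantity is finite.\<close>

lemma ennreal_le_half_self:
  fixes D x :: ennreal
  assumes "D \<le> x + ennreal (1/2) * D" "D < \<infinity>"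
  shows "D \<le> 2 * x"
proof (cases x)
  case (real x')
  obtain D' where D': "D = ennreal D'" "D' \<ge> 0"
    using assms(2) by (metis infinity_ennreal_def less_top_ennreal)
  have "ennreal D' \<le> ennreal (x' + 1/2 * D')"
  proof -
    have "ennreal (x' + 1/2 * D') = ennreal x' + ennreal (1/2 * D')"
      using real D' by (intro ennreal_plus) auto
    also have "ennreal (1/2 * D') = ennreal (1/2) * ennreal D'"
      using D' by (intro ennreal_mult) auto
    finally show ?thesis using assms(1) by (simp only: real D')
  qed
  then have "D' \<le> 2 * x'" using real D' by (subst (asm) ennreal_le_iff) auto
  then have "ennreal D' \<le> ennreal (2 * x')" by (rule ennreal_leI)
  also have "\<dots> = 2 * ennreal x'" using real by (simp add: ennreal_mult)
  finally show ?thesis using real D' by simp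
qed (simp add: ennreal_mult_top)

text \<open>The bound 9/16 is \<open>1 - 7/16\<close>, the value of \<open>b\<close> at which the
  power of \<open>T\<close> gained by the Duhamel integral would vanish. The bound 31/32 is what the
  resonance estimates and the square summation of the smoothed terms are calibrated to.\<close>

locale sbo =
  fixes \<alpha> \<beta> \<gamma> s1 s2 b :: real
  assumes gam: "\<bar>\<gamma>\<bar> \<noteq> 1" and s1: "s1 < 1/2" and s2: "31/32 < s2" "s2 < 1" and b: "1/2 < b" "b < 9/16"
begin

abbreviation "XU \<equiv> X s1 s2 b"
abbreviation "XV \<equiv> X (s1 - 1/2) (s2 - 1/2) b"
abbreviation "BU T \<equiv> Bil T (\<lambda>_. - \<i> * of_real \<alpha>) (phase_u \<gamma>)"
abbreviation "BV T f g \<equiv> Bil T (\<lambda>n. (of_real \<beta> * \<i>) * of_int n) (phase_v \<gamma>) f (conj_profile g)"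

text \<open>One constant for both bilinear estimates, chosen once so that it depends only on the
  fixed parameters and the existence time can be expressed through it.\<close>

definition CB :: real where
  "CB = (SOME C. C > 0 \<and> (\<forall>T f g. 0 < T \<longrightarrow> T \<le> 1 \<longrightarrow> profile f \<longrightarrow> profile g \<longrightarrow>
     XU (BU T f g) \<le> ennreal (C * T powr (9/16 - b)) * (XU f * XV g) \<and>
     XV (BV T f g) \<le> ennreal (C * T powr (9/16 - b)) * (XU f * XU g)))"

lemma CB: "CB > 0"
  "0 < T \<Longrightarrow> T \<le> 1 \<Longrightarrow> profile f \<Longrightarrow> profile g \<Longrightarrow> XU (BU T f g) \<le> ennreal (CB * T powr (9/16 - b)) * (XU f * XV g)"
  "0 < T \<Longrightarrow> T \<le> 1 \<Longrightarrow> profile f \<Longrightarrow> profile g \<Longrightarrow> XV (BV T f g) \<le> ennreal (CB * T powr (9/16 - b)) * (XU f * XU g)"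
proof -
  obtain C1 where C1: "C1 > 0" "\<And>T f g. 0 < T \<Longrightarrow> T \<le> 1 \<Longrightarrow> profile f \<Longrightarrow> profile g \<Longrightarrow>
     XU (BU T f g) \<le> ennreal (C1 * T powr (9/16 - b)) * (XU f * XV g)"
    using X_Bil_u_le[OF gam s1 s2 b, of "- \<i> * of_real \<alpha>"] by blast
  obtain C2 where C2: "C2 > 0" "\<And>T f g. 0 < T \<Longrightarrow> T \<le> 1 \<Longrightarrow> profile f \<Longrightarrow> profile g \<Longrightarrow>
     XV (Bil T (\<lambda>n. (of_real \<beta> * \<i>) * of_int n) (phase_v \<gamma>) f g) \<le> ennreal (C2 * T powr (9/16 - b)) * (XU f * XU g)"
    using X_Bil_v_le[OF gam s1 s2 b, of "of_real \<beta> * \<i>"] by blast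
  have "\<exists>C. C > 0 \<and> (\<forall>T f g. 0 < T \<longrightarrow> T \<le> 1 \<longrightarrow> profile f \<longrightarrow> profile g \<longrightarrow>
     XU (BU T f g) \<le> ennreal (C * T powr (9/16 - b)) * (XU f * XV g) \<and>
     XV (BV T f g) \<le> ennreal (C * T powr (9/16 - b)) * (XU f * XU g))"
  proof (intro exI[of _ "C1 + C2"] conjI allI impI)
    fix T :: real and f g :: "int \<Rightarrow> real \<Rightarrow> complex"
    assume T: "0 < T" "T \<le> 1" and fg: "profile f" "profile g"
    note C1(2)[OF T fg]
    also have "ennreal (C1 * T powr (9/16 - b)) * (XU f * XV g) \<le> ennreal ((C1 + C2) * T powr (9/16 - b)) * (XU f * XV g)"
      using C1(1) C2(1) by (intro mult_right_mono ennreal_leI) auto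
    finally show "XU (BU T f g) \<le> ennreal ((C1 + C2) * T powr (9/16 - b)) * (XU f * XV g)" .
    have "XV (BV T f g) \<le> ennreal (C2 * T powr (9/16 - b)) * (XU f * XU g)"
      using C2(2)[OF T fg(1) profile_conj[OF fg(2)]] X_conj_profile[OF fg(2)] by simp
    also have "\<dots> \<le> ennreal ((C1 + C2) * T powr (9/16 - b)) * (XU f * XU g)"
      using C1(1) C2(1) by (intro mult_right_mono ennreal_leI) auto
    finally show "XV (BV T f g) \<le> ennreal ((C1 + C2) * T powr (9/16 - b)) * (XU f * XU g)" .
  qed (use C1(1) C2(1) in auto)
  from someI_ex[OF this, folded CB_def]
  show "CB > 0"
    "0 < T \<Longrightarrow> T \<le> 1 \<Longrightarrow> profile f \<Longrightarrow> profile g \<Longrightarrow> XU (BU T f g) \<le> ennreal (CB * T powr (9/16 - b)) * (XU f * XV g)"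
    "0 < T \<Longrightarrow> T \<le> 1 \<Longrightarrow> profile f \<Longrightarrow> profile g \<Longrightarrow> XV (BV T f g) \<le> ennreal (CB * T powr (9/16 - b)) * (XU f * XU g)"
    by auto
qed

text \<open>The power \<open>9/16 - b\<close> of \<open>T\<close> is positive, so it becomes as
  small as desired. The factor 6 leaves room: the contraction and the halving of differences need 4,
  the invariance of the ball needs 2.\<close>

lemma small_time:
  assumes "M > 0"
  obtains T0 where "0 < T0" "T0 \<le> 1" "\<And>T. 0 < T \<Longrightarrow> T \<le> T0 \<Longrightarrow> 6 * (CB * T powr (9/16 - b)) * M \<le> 1"
proof -
  define e where "e = 9/16 - b"
  have e: "e > 0" using b by (simp add: e_def)
  define K where "K = 1 / (6 * CB * M)"
  have K: "K > 0" using assms CB(1) by (simp add: K_def)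
  show ?thesis
  proof (rule that[of "min 1 (K powr (1 / e))"])
    fix T assume T: "0 < T" "T \<le> min 1 (K powr (1 / e))"
    have "T powr e \<le> (K powr (1 / e)) powr e" using T e by (intro powr_mono2) auto
    also have "\<dots> = K" using e K by (simp add: powr_powr)
    finally have "6 * (CB * T powr e) * M \<le> 6 * (CB * K) * M"
      using assms CB(1) by (intro mult_right_mono mult_left_mono) auto
    also have "\<dots> = 1" using assms CB(1) by (simp add: K_def)
    finally show "6 * (CB * T powr (9/16 - b)) * M \<le> 1" by (simp add: e_def)
  qed (use K in auto)
qed

lemma interaction_u:
  assumes "profile f" "profile g" "XU f < \<infinity>" "XV g < \<infinity>"
  shows "integrable kxy (interaction f g n)"
  by (rule integrable_interaction[OF b(1) _ _ assms]) (use s2 in auto)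

lemma interaction_v:
  assumes "profile f" "profile g" "XU f < \<infinity>" "XU g < \<infinity>"
  shows "integrable kxy (interaction f (conj_profile g) n)"
  by (rule integrable_interaction[OF b(1), of s2 s2 _ _ s1 s1])
     (use s2 assms in \<open>auto simp: X_conj_profile intro: profile_conj\<close>)

lemma integrable_of_X:
  assumes "profile f" "X r1 r2 b f < \<infinity>"
  shows "integrable lborel (f n)"
  by (rule integrable_of_nb[OF b(1) profile_borel[OF assms(1)] nb_finite[OF assms(2)]])

lemma XU_BU_diff:
  assumes T: "0 < T" "T \<le> 1" and p: "profile f" "profile g" "profile f'" "profile g'"
    and fin: "XU f < \<infinity>" "XV g < \<infinity>" "XU f' < \<infinity>" "XV g' < \<infinity>"
  shows "XU (pdiff (BU T f g) (BU T f' g')) \<le> ennreal (CB * T powr (9/16 - b)) * (XU (pdiff f f') * XV g + XU f' * XV (pdiff g g'))"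
proof -
  have "XU (pdiff (BU T f g) (BU T f' g')) \<le> XU (BU T (pdiff f f') g) + XU (BU T f' (pdiff g g'))"
    by (rule X_triangle) (auto intro!: profile_Bil profile_pdiff p Bil_diff[OF T(1)] interaction_u fin)
  also have "\<dots> \<le> ennreal (CB * T powr (9/16 - b)) * (XU (pdiff f f') * XV g) + ennreal (CB * T powr (9/16 - b)) * (XU f' * XV (pdiff g g'))"
    by (intro add_mono CB T p profile_pdiff)
  finally show ?thesis by (simp add: distrib_left)
qed

lemma XV_BV_diff:
  assumes T: "0 < T" "T \<le> 1" and p: "profile f" "profile g" "profile f'" "profile g'"
    and fin: "XU f < \<infinity>" "XU g < \<infinity>" "XU f' < \<infinity>" "XU g' < \<infinity>"
  shows "XV (pdiff (BV T f g) (BV T f' g')) \<le> ennreal (CB * T powr (9/16 - b)) * (XU (pdiff f f') * XU g + XU f' * XU (pdiff g g'))"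
proof -
  have "XV (pdiff (BV T f g) (BV T f' g')) \<le> XV (BV T (pdiff f f') g) + XV (BV T f' (pdiff g g'))"
    unfolding conj_profile_pdiff
    by (rule X_triangle) (auto intro!: profile_Bil profile_pdiff profile_conj p Bil_diff[OF T(1)] interaction_v fin)
  also have "\<dots> \<le> ennreal (CB * T powr (9/16 - b)) * (XU (pdiff f f') * XU g) + ennreal (CB * T powr (9/16 - b)) * (XU f' * XU (pdiff g g'))"
    by (intro add_mono CB T p profile_pdiff)
  finally show ?thesis by (simp add: distrib_left)
qed

definition LL :: real where
  "LL = (SOME L. L > 0 \<and> (\<forall>r1 r2 a. X r1 r2 b (lin a) \<le> ennreal L * Hn r1 r2 a))"

lemma LL: "LL > 0" "X r1 r2 b (lin a) \<le> ennreal LL * Hn r1 r2 a"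
proof -
  have "\<exists>L>0. \<forall>r1 r2 a. X r1 r2 b (lin a) \<le> ennreal L * Hn r1 r2 a"
  proof -
    have "b < 3/2" using b by linarith
    then obtain L where "L > 0" "\<And>r1 r2 a. X r1 r2 b (lin a) \<le> ennreal L * Hn r1 r2 a"
      using X_lin_le by blast
    then show ?thesis by blast
  qed
  from someI_ex[OF this, folded LL_def] show "LL > 0" "X r1 r2 b (lin a) \<le> ennreal LL * Hn r1 r2 a" by auto
qed

definition PU where "PU T a f g n x = lin a n x + BU T f g n x"
definition PV where "PV T c f n x = lin c n x + BV T f f n x"

lemma profile_PU: "profile f \<Longrightarrow> profile g \<Longrightarrow> profile (PU T a f g)"
  unfolding profile_def PU_def[abs_def]
  by (intro allI borel_measurable_add profile_borel profile_lin profile_Bil) (simp_all add: profile_def)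

lemma profile_PV: "profile f \<Longrightarrow> profile (PV T c f)"
  using profile_Bil[OF _ profile_conj, of f f] profile_lin[of c]
  unfolding profile_def PV_def[abs_def] by (auto intro!: borel_measurable_add)

abbreviation "HU \<equiv> Hn s1 s2"
abbreviation "HV \<equiv> Hn (s1 - 1/2) (s2 - 1/2)"

text \<open>Half of the radius is reserved for the data; small \<open>T\<close> keeps the quadratic
  terms within the other half. Both of these contain the factor \<open>XU f\<close>, so together
  they are at most a multiple of the square of the radius.\<close>

lemma Phi_bound:
  assumes T: "0 < T" "T \<le> 1" and p: "profile f" "profile g" and \<rho>: "\<rho> > 0" "6 * (CB * T powr (9/16 - b)) * \<rho> \<le> 1"
    and z: "XU f + XV g \<le> ennreal \<rho>" and data: "ennreal LL * (HU a + HV c) \<le> ennreal (\<rho> / 2)"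
  shows "XU (PU T a f g) + XV (PV T c f) \<le> ennreal \<rho>"
proof -
  define \<kappa> where "\<kappa> = CB * T powr (9/16 - b)"
  have \<kappa>: "\<kappa> \<ge> 0" using CB(1) by (simp add: \<kappa>_def)
  have "XU (PU T a f g) \<le> ennreal LL * HU a + ennreal \<kappa> * (XU f * XV g)"
    unfolding \<kappa>_def
    by (rule order_trans[OF X_triangle[OF profile_lin profile_Bil[OF p] PU_def] add_mono[OF LL(2) CB(2)[OF T p]]])
  moreover have "XV (PV T c f) \<le> ennreal LL * HV c + ennreal \<kappa> * (XU f * XU f)"
    unfolding \<kappa>_def
    by (rule order_trans[OF X_triangle[OF profile_lin profile_Bil[OF p(1) profile_conj[OF p(1)]] PV_def] add_mono[OF LL(2) CB(3)[OF T p(1) p(1)]]])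
  ultimately have "XU (PU T a f g) + XV (PV T c f) \<le> (ennreal LL * HU a + ennreal \<kappa> * (XU f * XV g)) + (ennreal LL * HV c + ennreal \<kappa> * (XU f * XU f))"
    by (rule add_mono)
  also have "\<dots> = ennreal LL * (HU a + HV c) + ennreal \<kappa> * (XU f * (XU f + XV g))"
    by (simp add: distrib_left ac_simps)
  also have "\<dots> \<le> ennreal (\<rho> / 2) + ennreal \<kappa> * (ennreal \<rho> * ennreal \<rho>)"
  proof (intro add_mono data mult_left_mono mult_mono z)
    show "XU f \<le> ennreal \<rho>" using z by (rule order_trans[rotated]) simp
  qed auto
  also have "\<dots> = ennreal (\<rho> / 2 + \<kappa> * (\<rho> * \<rho>))"
    using \<kappa> \<rho> by (simp add: ennreal_plus ennreal_mult)
  also have "\<dots> \<le> ennreal \<rho>"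
  proof (rule ennreal_leI)
    have "(6 * \<kappa> * \<rho>) * \<rho> \<le> 1 * \<rho>" using \<rho> by (intro mult_right_mono) (auto simp: \<kappa>_def)
    moreover have "6 * (\<kappa> * (\<rho> * \<rho>)) = (6 * \<kappa> * \<rho>) * \<rho>" by simp
    ultimately show "\<rho> / 2 + \<kappa> * (\<rho> * \<rho>) \<le> \<rho>" using \<rho>(1) by linarith
  qed
  finally show ?thesis .
qed

lemma Phi_contraction:
  assumes T: "0 < T" "T \<le> 1" and p: "profile f" "profile g" "profile f'" "profile g'"
    and \<rho>: "\<rho> > 0" "6 * (CB * T powr (9/16 - b)) * \<rho> \<le> 1"
    and z: "XU f + XV g \<le> ennreal \<rho>" "XU f' + XV g' \<le> ennreal \<rho>"
  shows "XU (pdiff (BU T f g) (BU T f' g')) + XV (pdiff (BV T f f) (BV T f' f'))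
    \<le> ennreal (1/2) * (XU (pdiff f f') + XV (pdiff g g'))"
proof -
  define \<kappa> where "\<kappa> = CB * T powr (9/16 - b)"
  have \<kappa>: "\<kappa> \<ge> 0" using CB(1) by (simp add: \<kappa>_def)
  have le: "XU f' \<le> ennreal \<rho>"
    using z(2) by (rule order_trans[rotated]) simp
  have fin: "XU f < \<infinity>" "XV g < \<infinity>" "XU f' < \<infinity>" "XV g' < \<infinity>"
    using z[THEN le_less_trans[OF _ ennreal_less_top]] by auto
  define d e where "d = XU (pdiff f f')" and "e = XV (pdiff g g')"
  have "XU (pdiff (BU T f g) (BU T f' g')) + XV (pdiff (BV T f f) (BV T f' f'))
     \<le> ennreal \<kappa> * (d * XV g + XU f' * e) + ennreal \<kappa> * (d * XU f + XU f' * d)"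
    unfolding \<kappa>_def d_def e_def by (intro add_mono XU_BU_diff XV_BV_diff T p fin)
  also have "\<dots> = ennreal \<kappa> * (d * (XU f + XV g) + XU f' * (d + e))"
    by (simp only: distrib_left distrib_right mult_ac add_ac)
  also have "\<dots> \<le> ennreal \<kappa> * ((d + e) * ennreal \<rho> + ennreal \<rho> * (d + e))"
    by (intro mult_left_mono add_mono mult_mono z le) auto
  also have "\<dots> = ennreal (2 * \<kappa> * \<rho>) * (d + e)"
    using \<kappa> \<rho> by (simp add: ennreal_mult mult_ac distrib_left mult_2[symmetric])
  also have "\<dots> \<le> ennreal (1/2) * (d + e)"
    using \<rho> by (intro mult_right_mono ennreal_leI) (auto simp: \<kappa>_def)
  finally show ?thesis by (simp add: d_def e_def)
qed

text \<open>Picard iteration from 0. Profiles that agree almost everywhere have distance 0, so the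
  limit is a fixed point only in the sense that its distance to its image vanishes.\<close>

lemma fixed_point:
  assumes T: "0 < T" "T \<le> 1" and \<rho>: "\<rho> > 0" "6 * (CB * T powr (9/16 - b)) * \<rho> \<le> 1"
    and data: "ennreal LL * (HU a + HV c) \<le> ennreal (\<rho> / 2)"
  obtains f g where "profile f" "profile g" "XU f + XV g \<le> ennreal \<rho>"
    "XU (pdiff (PU T a f g) f) = 0" "XV (pdiff (PV T c f) g) = 0"
proof -
  define z where "z = (\<lambda>j. ((\<lambda>(f, g). (PU T a f g, PV T c f)) ^^ j) (\<lambda>_ _. 0, \<lambda>_ _. 0))"
  define F G where "F = (\<lambda>j. fst (z j))" and "G = (\<lambda>j. snd (z j))"
  have F0: "F 0 = (\<lambda>_ _. 0)" "G 0 = (\<lambda>_ _. 0)" by (simp_all add: F_def G_def z_def)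
  have FS: "F (Suc j) = PU T a (F j) (G j)" "G (Suc j) = PV T c (F j)" for j
    by (simp_all add: F_def G_def z_def split_beta)
  have X0: "X r1 r2 b (\<lambda>_ _. 0) = 0" for r1 r2
    by (simp add: X_def nb_def Nb_def)
  have prof: "profile (F j) \<and> profile (G j)" for j
    by (induction j) (auto simp: F0 FS intro: profile_PU profile_PV, auto simp: profile_def)
  then have pF: "profile (F j)" and pG: "profile (G j)" for j by auto
  have ball: "XU (F j) + XV (G j) \<le> ennreal \<rho>" for j
  proof (induction j)
    case (Suc j)
    then show ?case unfolding FS by (intro Phi_bound T pF pG \<rho> data)
  qed (simp add: F0 X0)
  have PU_diff: "pdiff (PU T a f g) (PU T a f' g') = pdiff (BU T f g) (BU T f' g')" for f g f' g'
    by (simp add: PU_def fun_eq_iff)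
  have PV_diff: "pdiff (PV T c f) (PV T c f') = pdiff (BV T f f) (BV T f' f')" for f f'
    by (simp add: PV_def fun_eq_iff)
  have step: "XU (pdiff (F (Suc j)) (F j)) + XV (pdiff (G (Suc j)) (G j)) \<le> ennreal (\<rho> * (1/2) ^ j)" for j
  proof (induction j)
    case 0
    have "pdiff (F (Suc 0)) (F 0) = F (Suc 0)" "pdiff (G (Suc 0)) (G 0) = G (Suc 0)" by (simp_all add: F0)
    then show ?case using ball[of "Suc 0"] by simp
  next
    case (Suc j)
    have "XU (pdiff (F (Suc (Suc j))) (F (Suc j))) + XV (pdiff (G (Suc (Suc j))) (G (Suc j)))
       \<le> ennreal (1/2) * (XU (pdiff (F (Suc j)) (F j)) + XV (pdiff (G (Suc j)) (G j)))"
      unfolding PU_diff[of "F (Suc j)" "G (Suc j)" "F j" "G j", folded FS] PV_diff[of "F (Suc j)" "F j", folded FS]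
      by (rule Phi_contraction[OF T pF pG pF pG \<rho> ball ball])
    also have "\<dots> \<le> ennreal (1/2) * ennreal (\<rho> * (1/2) ^ j)"
      by (intro mult_left_mono Suc) simp
    also have "\<dots> = ennreal (\<rho> * (1/2) ^ Suc j)"
      using \<rho> by (subst ennreal_mult[symmetric]) (auto simp: mult_ac)
    finally show ?case .
  qed
  define f g where "f = (\<lambda>n x. lim (\<lambda>j. F j n x))" and "g = (\<lambda>n x. lim (\<lambda>j. G j n x))"
  have pf: "profile f" "profile g" unfolding f_def g_def by (intro profile_lim pF pG)+
  have limF: "XU (pdiff f (F m)) \<le> ennreal (2 * \<rho> * (1/2) ^ m)" for m
    unfolding f_def by (rule X_complete[OF pF]) (use \<rho> in simp, rule order_trans[OF _ step], simp)
  have limG: "XV (pdiff g (G m)) \<le> ennreal (2 * \<rho> * (1/2) ^ m)" for m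
    unfolding g_def by (rule X_complete[OF pG]) (use \<rho> in simp, rule order_trans[OF _ step], simp)
  have ball': "XU f + XV g \<le> ennreal \<rho>"
  \<comment> \<open>Each of the two components is within \<open>2 * \<rho> * (1/2) ^ m\<close> of
    its iterate.\<close>
  proof (rule ennreal_le_geometric[where c = "4 * \<rho>"])
    fix m
    have "XU f + XV g \<le> (XU (pdiff f (F m)) + XU (F m)) + (XV (pdiff g (G m)) + XV (G m))"
      by (intro add_mono X_le_pdiff pf pF pG)
    also have "\<dots> = (XU (F m) + XV (G m)) + (XU (pdiff f (F m)) + XV (pdiff g (G m)))" by (simp add: ac_simps)
    also have "\<dots> \<le> ennreal \<rho> + (ennreal (2 * \<rho> * (1/2) ^ m) + ennreal (2 * \<rho> * (1/2) ^ m))"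
      by (intro add_mono ball limF limG)
    also have "\<dots> = ennreal (\<rho> + 4 * \<rho> * (1/2) ^ m)"
      using \<rho> by (simp add: ennreal_plus[symmetric] del: ennreal_plus)
    finally show "XU f + XV g \<le> \<dots>" .
  qed
  have fix_le: "XU (pdiff (PU T a f g) f) + XV (pdiff (PV T c f) g) \<le> ennreal 0"
  proof (rule ennreal_le_geometric[where c = "4 * \<rho>"])
    fix m
    have "XU (pdiff (PU T a f g) f) + XV (pdiff (PV T c f) g)
      \<le> (XU (pdiff (PU T a f g) (F (Suc m))) + XU (pdiff (F (Suc m)) f)) + (XV (pdiff (PV T c f) (G (Suc m))) + XV (pdiff (G (Suc m)) g))"
      by (intro add_mono X_pdiff_triangle pf pF pG profile_PU profile_PV)
    also have "\<dots> = (XU (pdiff (BU T f g) (BU T (F m) (G m))) + XV (pdiff (BV T f f) (BV T (F m) (F m)))) + (XU (pdiff f (F (Suc m))) + XV (pdiff g (G (Suc m))))"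
      unfolding FS PU_diff PV_diff X_minus_commute[of _ _ _ f] X_minus_commute[of _ _ _ g] by (simp add: ac_simps)
    also have "\<dots> \<le> ennreal (1/2) * (XU (pdiff f (F m)) + XV (pdiff g (G m))) + (XU (pdiff f (F (Suc m))) + XV (pdiff g (G (Suc m))))"
      by (intro add_right_mono Phi_contraction[OF T pf pF pG \<rho> ball' ball])
    also have "\<dots> \<le> ennreal (1/2) * (ennreal (2 * \<rho> * (1/2) ^ m) + ennreal (2 * \<rho> * (1/2) ^ m)) + (ennreal (2 * \<rho> * (1/2) ^ Suc m) + ennreal (2 * \<rho> * (1/2) ^ Suc m))"
      by (intro add_mono mult_left_mono limF limG) simp
    also have "\<dots> = ennreal (0 + 4 * \<rho> * (1/2) ^ m)"
    proof -
      define q where "q = 2 * \<rho> * (1/2) ^ m"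
      have q: "q \<ge> 0" "2 * \<rho> * (1/2) ^ Suc m = q / 2" "0 + 4 * \<rho> * (1/2) ^ m = q + (q / 2 + q / 2)"
        using \<rho> by (simp_all add: q_def)
      have "ennreal (1/2 * (q + q)) = ennreal (1/2) * ennreal (q + q)" using q by (intro ennreal_mult) auto
      also have "ennreal (q + q) = ennreal q + ennreal q" using q by (intro ennreal_plus) auto
      finally have "ennreal (1/2) * (ennreal q + ennreal q) = ennreal q" by simp
      then show ?thesis
        unfolding q(2,3) q_def[symmetric] using q(1) by (simp only: ennreal_plus add_nonneg_nonneg divide_nonneg_nonneg zero_le_numeral)
    qed
    finally show "XU (pdiff (PU T a f g) f) + XV (pdiff (PV T c f) g) \<le> \<dots>" .
  qed
  then show ?thesis
    by (intro that[OF pf ball']) auto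
qed

text \<open>The data enter through \<open>lin\<close> alone. By the contraction estimate the
  bilinear terms contribute at most half of the left side, which is finite and can be
  absorbed.\<close>

lemma fixed_point_lipschitz:
  assumes T: "0 < T" "T \<le> 1" and \<rho>: "\<rho> > 0" "6 * (CB * T powr (9/16 - b)) * \<rho> \<le> 1"
    and p: "profile f" "profile g" "profile f'" "profile g'"
    and z: "XU f + XV g \<le> ennreal \<rho>" "XU f' + XV g' \<le> ennreal \<rho>"
    and f1: "XU (pdiff (PU T a f g) f) = 0" "XV (pdiff (PV T c f) g) = 0"
    and f2: "XU (pdiff (PU T a' f' g') f') = 0" "XV (pdiff (PV T c' f') g') = 0"
  shows "XU (pdiff f f') + XV (pdiff g g') \<le> 2 * (ennreal LL * (HU (\<lambda>n. a n - a' n) + HV (\<lambda>n. c n - c' n)))"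
proof (rule ennreal_le_half_self)
  have fin: "XU f < \<infinity>" "XV g < \<infinity>" "XU f' < \<infinity>" "XV g' < \<infinity>"
    using z[THEN le_less_trans[OF _ ennreal_less_top]] by auto
  have "XU (pdiff f f') + XV (pdiff g g') \<le> (XU f + XU f') + (XV g + XV g')"
    by (intro add_mono X_pdiff_le p)
  also have "\<dots> < \<infinity>" using fin by simp
  finally show "XU (pdiff f f') + XV (pdiff g g') < \<infinity>" .
  have 1: "XU (pdiff f f') \<le> XU (pdiff (PU T a f g) (PU T a' f' g'))"
  proof -
    have "XU (pdiff f f') \<le> XU (pdiff f (PU T a f g)) + XU (pdiff (PU T a f g) f')"
      by (intro X_pdiff_triangle p profile_PU)
    also have "\<dots> \<le> XU (pdiff f (PU T a f g)) + (XU (pdiff (PU T a f g) (PU T a' f' g')) + XU (pdiff (PU T a' f' g') f'))"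
      by (intro add_left_mono X_pdiff_triangle p profile_PU)
    finally show ?thesis using f1(1) f2(1) by (simp add: X_minus_commute[of _ _ _ f])
  qed
  have 2: "XV (pdiff g g') \<le> XV (pdiff (PV T c f) (PV T c' f'))"
  proof -
    have "XV (pdiff g g') \<le> XV (pdiff g (PV T c f)) + XV (pdiff (PV T c f) g')"
      by (intro X_pdiff_triangle p profile_PV)
    also have "\<dots> \<le> XV (pdiff g (PV T c f)) + (XV (pdiff (PV T c f) (PV T c' f')) + XV (pdiff (PV T c' f') g'))"
      by (intro add_left_mono X_pdiff_triangle p profile_PV)
    finally show ?thesis using f1(2) f2(2) by (simp add: X_minus_commute[of _ _ _ g])
  qed
  have 3: "XU (pdiff (PU T a f g) (PU T a' f' g')) \<le> XU (lin (\<lambda>n. a n - a' n)) + XU (pdiff (BU T f g) (BU T f' g'))"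
    by (rule X_triangle) (auto simp: PU_def lin_def algebra_simps intro!: profile_lin profile_pdiff profile_Bil p)
  have 4: "XV (pdiff (PV T c f) (PV T c' f')) \<le> XV (lin (\<lambda>n. c n - c' n)) + XV (pdiff (BV T f f) (BV T f' f'))"
    by (rule X_triangle) (auto simp: PV_def lin_def algebra_simps intro!: profile_lin profile_pdiff profile_Bil profile_conj p)
  have "XU (pdiff f f') + XV (pdiff g g') \<le> (XU (lin (\<lambda>n. a n - a' n)) + XU (pdiff (BU T f g) (BU T f' g')))
       + (XV (lin (\<lambda>n. c n - c' n)) + XV (pdiff (BV T f f) (BV T f' f')))"
    by (intro add_mono order_trans[OF 1 3] order_trans[OF 2 4])
  also have "\<dots> = (XU (lin (\<lambda>n. a n - a' n)) + XV (lin (\<lambda>n. c n - c' n)))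
       + (XU (pdiff (BU T f g) (BU T f' g')) + XV (pdiff (BV T f f) (BV T f' f')))"
    by (simp add: ac_simps)
  also have "\<dots> \<le> (ennreal LL * HU (\<lambda>n. a n - a' n) + ennreal LL * HV (\<lambda>n. c n - c' n)) + ennreal (1/2) * (XU (pdiff f f') + XV (pdiff g g'))"
    by (intro add_mono LL Phi_contraction[OF T p \<rho> z])
  finally show "XU (pdiff f f') + XV (pdiff g g') \<le> ennreal LL * (HU (\<lambda>n. a n - a' n) + HV (\<lambda>n. c n - c' n)) + ennreal (1/2) * (XU (pdiff f f') + XV (pdiff g g'))"
    by (simp add: distrib_left)
qed

end

section \<open>Uniqueness\<close>

text \<open>Translation by \<open>c\<close> in time. The factor \<open>iexp (c * x)\<close> moves
  the time variable, and the factor in \<omega> lets the free evolution be undone from the new time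
  origin. Both are unimodular, so all norms are preserved.\<close>

definition shift :: "(int \<Rightarrow> real) \<Rightarrow> real \<Rightarrow> (int \<Rightarrow> real \<Rightarrow> complex) \<Rightarrow> int \<Rightarrow> real \<Rightarrow> complex" where
  "shift \<omega> c f n x = iexp (- c * \<omega> n) * (f n x * iexp (c * x))"

lemmas osc_cong_u = osc_cong[where \<Psi> = "phase_u \<gamma>" and \<omega> = omega_u and ?\<omega>1.0 = omega_u and ?\<omega>2.0 = "omega_v \<gamma>",
    OF _ _ _ _ _ _ phase_u_eq] for \<gamma>
lemmas osc_cong_v = osc_cong[where \<Psi> = "phase_v \<gamma>" and \<omega> = "omega_v \<gamma>" and ?\<omega>1.0 = omega_u and ?\<omega>2.0 = "\<lambda>k. - omega_u k",
    OF _ _ _ _ _ _ phase_v_eq] for \<gamma>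
lemmas osc_cong_shift_u = osc_cong_shift[where \<Psi> = "phase_u \<gamma>" and \<omega> = omega_u and ?\<omega>1.0 = omega_u and ?\<omega>2.0 = "omega_v \<gamma>",
    OF _ _ _ _ _ _ phase_u_eq] for \<gamma>
lemmas osc_cong_shift_v = osc_cong_shift[where \<Psi> = "phase_v \<gamma>" and \<omega> = "omega_v \<gamma>" and ?\<omega>1.0 = omega_u and ?\<omega>2.0 = "\<lambda>k. - omega_u k",
    OF _ _ _ _ _ _ phase_v_eq] for \<gamma>

lemma interval_integral_cong_Icc:
  assumes "\<And>s. s \<in> {-T..T} \<Longrightarrow> h s = (k s :: complex)" "t \<in> {-T..T}"
  shows "(LBINT s=ereal 0..ereal t. h s) = (LBINT s=ereal 0..ereal t. k s)"
  by (rule interval_integral_cong) (use assms in \<open>auto simp: einterval_iff min_def max_def split: if_splits\<close>)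

lemma profile_shift:
  assumes "profile f"
  shows "profile (shift \<omega> c f)"
proof -
  note [measurable] = profile_borel[OF assms]
  show ?thesis unfolding profile_def shift_def[abs_def] by measurable
qed

lemma X_shift: "X r1 r2 b (shift \<omega> c f) = X r1 r2 b f"
proof -
  have "nb b (shift \<omega> c f n) = nb b (f n)" for n
    by (simp add: nb_def shift_def norm_mult del: of_real_mult of_real_minus)
  then show ?thesis by (simp add: X_def)
qed

lemma tf_shift: "tf (shift \<omega> c f) t n = iexp (- c * \<omega> n) * tf f (t + c) n"
proof -
  have "tf (shift \<omega> c f) t n = (\<integral>x. iexp (- c * \<omega> n) * (f n x * iexp ((t + c) * x)) \<partial>lborel)"
    unfolding tf_def shift_def
    by (intro Bochner_Integration.integral_cong) (auto simp: distrib_right distrib_left exp_add mult_ac)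
  also have "\<dots> = iexp (- c * \<omega> n) * tf f (t + c) n"
    unfolding tf_def by (rule integral_mult_right_zero)
  finally show ?thesis .
qed

lemma conj_profile_shift: "conj_profile (shift omega_u c f) = shift (\<lambda>k. - omega_u k) c (conj_profile f)"
  by (simp add: fun_eq_iff conj_profile_def shift_def exp_cnj omega_u_def)

text \<open>Splits a Duhamel integral at the new time origin: the part up to \<open>c\<close> joins
  the data, the rest is the Duhamel integral of the translated solution.\<close>

lemma interval_integral_translate:
  fixes h :: "real \<Rightarrow> complex"
  assumes "continuous_on UNIV h"
  shows "(LBINT s=ereal 0..ereal (t + c). h s) = (LBINT s=ereal 0..ereal c. h s) + (LBINT s=ereal 0..ereal t. h (s + c))"
proof -
  have sub: "(LBINT s=ereal x..ereal y. h (s + c)) = (LBINT s=ereal (x + c)..ereal (y + c). h s)" if "x \<le> y" for x y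
  proof -
    have "(LBINT s=ereal x..ereal y. 1 *\<^sub>R h (s + c)) = (LBINT s=ereal (x + c)..ereal (y + c). h s)"
      using that by (intro interval_integral_substitution_finite)
        (auto intro!: derivative_eq_intros continuous_on_subset[OF assms])
    then show ?thesis by simp
  qed
  have "(LBINT s=ereal c..ereal (t + c). h s) = (LBINT s=ereal 0..ereal t. h (s + c))"
  proof (cases "0 \<le> t")
    case True
    show ?thesis using sub[OF True] by simp
  next
    case False
    then have "t \<le> 0" by simp
    from sub[OF this] show ?thesis
      using interval_integral_endpoints_reverse[of "ereal c" "ereal (t + c)" h]
        interval_integral_endpoints_reverse[of "ereal 0" "ereal t" "\<lambda>s. h (s + c)"] by simp
  qed
  moreover have "(LBINT s=ereal 0..ereal c. h s) + (LBINT s=ereal c..ereal (t + c). h s) = (LBINT s=ereal 0..ereal (t + c). h s)"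
  proof (rule interval_integral_sum)
    have "min (ereal 0) (min (ereal c) (ereal (t + c))) = ereal (min 0 (min c (t + c)))"
      "max (ereal 0) (max (ereal c) (ereal (t + c))) = ereal (max 0 (max c (t + c)))"
      by (auto simp: min_def max_def)
    then show "interval_lebesgue_integrable lborel (min (ereal 0) (min (ereal c) (ereal (t + c)))) (max (ereal 0) (max (ereal c) (ereal (t + c)))) h"
      using interval_integrable_continuous[OF assms] by (simp only:)
  qed
  ultimately show ?thesis by simp
qed

context sbo
begin

text \<open>The Duhamel equations with the free evolutions removed. The data are arbitrary
  coefficient sequences, so that the state of a solution at a later time can serve as data
  again.\<close>

definition psol :: "real \<Rightarrow> (int \<Rightarrow> complex) \<Rightarrow> (int \<Rightarrow> complex) \<Rightarrow>
    (int \<Rightarrow> real \<Rightarrow> complex) \<Rightarrow> (int \<Rightarrow> real \<Rightarrow> complex) \<Rightarrow> bool" where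
  "psol T a c f g \<longleftrightarrow> profile f \<and> profile g \<and> XU f < \<infinity> \<and> XV g < \<infinity> \<and>
    (\<forall>t\<in>{-T..T}. \<forall>n.
      tf f t n = a n + (- \<i> * of_real \<alpha>) * (LBINT s=ereal 0..ereal t. osc (phase_u \<gamma>) f g n s) \<and>
      tf g t n = c n + ((of_real \<beta> * \<i>) * of_int n) * (LBINT s=ereal 0..ereal t. osc (phase_v \<gamma>) f (conj_profile f) n s))"

lemma psolD:
  assumes "psol T a c f g"
  shows "profile f" "profile g" "XU f < \<infinity>" "XV g < \<infinity>"
    "t \<in> {-T..T} \<Longrightarrow> tf f t n = a n + (- \<i> * of_real \<alpha>) * (LBINT s=ereal 0..ereal t. osc (phase_u \<gamma>) f g n s)"
    "t \<in> {-T..T} \<Longrightarrow> tf g t n = c n + ((of_real \<beta> * \<i>) * of_int n) * (LBINT s=ereal 0..ereal t. osc (phase_v \<gamma>) f (conj_profile f) n s)"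
  using assms unfolding psol_def by auto

text \<open>Distance 0 only gives equality almost everywhere, which suffices because
  \<open>tf\<close> is an integral. For times in [-T, T] both cutoffs equal 1, so the truncated
  equation is the exact one.\<close>

lemma fixed_point_psol:
  assumes T: "0 < T" "T \<le> 1" and p: "profile f" "profile g" and fin: "XU f < \<infinity>" "XV g < \<infinity>"
    and f1: "XU (pdiff (PU T a f g) f) = 0" "XV (pdiff (PV T c f) g) = 0"
  shows "psol T a c f g"
proof -
  have XB: "XU (BU T f g) < \<infinity>" "XV (BV T f f) < \<infinity>"
    using le_less_trans[OF CB(2)[OF T p]] le_less_trans[OF CB(3)[OF T p(1) p(1)]] fin
    by (auto simp: ennreal_mult_less_top)
  have pB: "profile (BU T f g)" "profile (BV T f f)"
    by (intro profile_Bil profile_conj p)+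
  have eqU: "tf f t n = tf (PU T a f g) t n" for t n
    unfolding tf_def
  proof (rule integral_cong_AE)
    have "AE x in lborel. pdiff (PU T a f g) f n x = 0"
      by (rule X_eq_0_AE[OF f1(1)]) (intro profile_pdiff profile_PU p)
    then show "AE x in lborel. f n x * iexp (t * x) = PU T a f g n x * iexp (t * x)"
      by eventually_elim simp
    note [measurable] = profile_borel[OF p(1)] profile_borel[OF profile_PU[OF p]]
    show "(\<lambda>x. f n x * iexp (t * x)) \<in> borel_measurable lborel"
      "(\<lambda>x. PU T a f g n x * iexp (t * x)) \<in> borel_measurable lborel" by measurable
  qed
  have eqV: "tf g t n = tf (PV T c f) t n" for t n
    unfolding tf_def
  proof (rule integral_cong_AE)
    have "AE x in lborel. pdiff (PV T c f) g n x = 0"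
      by (rule X_eq_0_AE[OF f1(2)]) (intro profile_pdiff profile_PV p)
    then show "AE x in lborel. g n x * iexp (t * x) = PV T c f n x * iexp (t * x)"
      by eventually_elim simp
    note [measurable] = profile_borel[OF p(2)] profile_borel[OF profile_PV[OF p(1)]]
    show "(\<lambda>x. g n x * iexp (t * x)) \<in> borel_measurable lborel"
      "(\<lambda>x. PV T c f n x * iexp (t * x)) \<in> borel_measurable lborel" by measurable
  qed
  have "tf f t n = a n + (- \<i> * of_real \<alpha>) * (LBINT s=ereal 0..ereal t. osc (phase_u \<gamma>) f g n s) \<and>
      tf g t n = c n + ((of_real \<beta> * \<i>) * of_int n) * (LBINT s=ereal 0..ereal t. osc (phase_v \<gamma>) f (conj_profile f) n s)"
    if t: "t \<in> {-T..T}" for t n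
  proof
    have t': "\<bar>t\<bar> \<le> T" "\<bar>t\<bar> \<le> 1" using t T by auto
    have "tf (PU T a f g) t n = tf (lin a) t n + tf (BU T f g) t n"
      unfolding PU_def[abs_def] by (rule tf_add[OF integrable_lin integrable_of_X[OF pB(1) XB(1)]])
    also have "\<dots> = a n + (- \<i> * of_real \<alpha>) * (LBINT s=ereal 0..ereal t. osc (phase_u \<gamma>) f g n s)"
      by (simp only: tf_lin[OF t'(2)] tf_Bil[OF T(1) t'(1) interaction_u[OF p fin]])
    finally show "tf f t n = \<dots>" unfolding eqU .
    have "tf (PV T c f) t n = tf (lin c) t n + tf (BV T f f) t n"
      unfolding PV_def[abs_def] by (rule tf_add[OF integrable_lin integrable_of_X[OF pB(2) XB(2)]])
    also have "\<dots> = c n + ((of_real \<beta> * \<i>) * of_int n) * (LBINT s=ereal 0..ereal t. osc (phase_v \<gamma>) f (conj_profile f) n s)"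
      by (simp only: tf_lin[OF t'(2)] tf_Bil[OF T(1) t'(1) interaction_v[OF p(1) p(1) fin(1) fin(1)]])
    finally show "tf g t n = \<dots>" unfolding eqV .
  qed
  then show ?thesis unfolding psol_def using p fin by blast
qed

text \<open>Any pair of profiles that represents the difference of the two solutions on \<open>[-\<delta>, \<delta>]\<close> can be replaced,
  by the Duhamel formula, with one of half the norm; hence the difference vanishes there.\<close>

lemma difference_halving:
  assumes d: "0 < \<delta>" "\<delta> \<le> 1" and M: "M > 0" "6 * (CB * \<delta> powr (9/16 - b)) * M \<le> 1"
    and s: "psol \<delta> a c f g" "psol \<delta> a c f' g'"
    and z: "XU f + XV g \<le> ennreal M" "XU f' + XV g' \<le> ennreal M"
    and hl: "profile h" "profile l" "XU h + XV l \<le> ennreal K"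
      "\<And>t n. t \<in> {-\<delta>..\<delta>} \<Longrightarrow> tf h t n = tf f t n - tf f' t n"
      "\<And>t n. t \<in> {-\<delta>..\<delta>} \<Longrightarrow> tf l t n = tf g t n - tf g' t n" and K: "K \<ge> 0"
  obtains h' l' where "profile h'" "profile l'" "XU h' + XV l' \<le> ennreal (K / 2)"
      "\<And>t n. t \<in> {-\<delta>..\<delta>} \<Longrightarrow> tf h' t n = tf f t n - tf f' t n"
      "\<And>t n. t \<in> {-\<delta>..\<delta>} \<Longrightarrow> tf l' t n = tf g t n - tf g' t n"
proof -
  note P = psolD[OF s(1)] and P' = psolD[OF s(2)]
  have finh: "XU h < \<infinity>" "XV l < \<infinity>"
    using hl(3)[THEN le_less_trans[OF _ ennreal_less_top]] by auto
  define \<kappa> where "\<kappa> = CB * \<delta> powr (9/16 - b)"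
  have \<kappa>: "\<kappa> \<ge> 0" using CB(1) by (simp add: \<kappa>_def)
  have pd: "profile (pdiff f f')" "profile (pdiff g g')"
    by (intro profile_pdiff P P')+
  have Xd: "XU (pdiff f f') < \<infinity>" "XV (pdiff g g') < \<infinity>"
    using le_less_trans[OF X_pdiff_le[OF P(1) P'(1), of s1 s2 b]] le_less_trans[OF X_pdiff_le[OF P(2) P'(2), of "s1 - 1/2" "s2 - 1/2" b]] P P' by auto
  have I: "\<And>n. integrable lborel (f n)" "\<And>n. integrable lborel (g n)" "\<And>n. integrable lborel (f' n)" "\<And>n. integrable lborel (g' n)"
     "\<And>n. integrable lborel (h n)" "\<And>n. integrable lborel (l n)" "\<And>n. integrable lborel (pdiff f f' n)" "\<And>n. integrable lborel (pdiff g g' n)"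
    using integrable_of_X[OF P(1,3)] integrable_of_X[OF P(2,4)] integrable_of_X[OF P'(1,3)] integrable_of_X[OF P'(2,4)]
      integrable_of_X[OF hl(1) finh(1)] integrable_of_X[OF hl(2) finh(2)] integrable_of_X[OF pd(1) Xd(1)] integrable_of_X[OF pd(2) Xd(2)] by auto
  have Ic: "\<And>n. integrable lborel (conj_profile k n)" if "profile k" "XU k < \<infinity>" for k
    by (rule integrable_of_X[OF profile_conj[OF that(1)]]) (use that in \<open>auto simp: X_conj_profile\<close>)
  have tfd: "tf (pdiff f f') s m = tf h s m" "tf (pdiff g g') s m = tf l s m" if "s \<in> {-\<delta>..\<delta>}" for s m
    using hl(4,5)[OF that] by (simp_all add: tf_diff I)
  \<comment> \<open>The difference of two products, split bilinearly, with \<open>h\<close> and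
    \<open>l\<close> in place of the true differences. This is legitimate on [-\<delta>, \<delta>]
    since \<open>osc\<close> depends only on the values of its arguments at the time in
    question.\<close>
  define h' where "h' = (\<lambda>n x. BU \<delta> h g n x + BU \<delta> f' l n x)"
  define l' where "l' = (\<lambda>n x. BV \<delta> h f n x + BV \<delta> f' h n x)"
  have pB: "profile (BU \<delta> h g)" "profile (BU \<delta> f' l)" "profile (BV \<delta> h f)" "profile (BV \<delta> f' h)"
    by (intro profile_Bil profile_conj P P' hl)+
  have XB: "XU (BU \<delta> h g) < \<infinity>" "XU (BU \<delta> f' l) < \<infinity>" "XV (BV \<delta> h f) < \<infinity>" "XV (BV \<delta> f' h) < \<infinity>"
    using le_less_trans[OF CB(2)[OF d hl(1) P(2)]] le_less_trans[OF CB(2)[OF d P'(1) hl(2)]]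
      le_less_trans[OF CB(3)[OF d hl(1) P(1)]] le_less_trans[OF CB(3)[OF d P'(1) hl(1)]] P P' finh
    by (auto simp: ennreal_mult_less_top)
  show ?thesis
  proof (rule that[of h' l'])
    show "profile h'" "profile l'"
      using pB unfolding h'_def l'_def profile_def by (auto intro: borel_measurable_add)
    have "XU h' \<le> ennreal \<kappa> * (XU h * XV g) + ennreal \<kappa> * (XU f' * XV l)"
      unfolding \<kappa>_def
      by (rule order_trans[OF X_triangle[OF pB(1,2)] add_mono[OF CB(2)[OF d hl(1) P(2)] CB(2)[OF d P'(1) hl(2)]]]) (simp only: h'_def)
    moreover have "XV l' \<le> ennreal \<kappa> * (XU h * XU f) + ennreal \<kappa> * (XU f' * XU h)"
      unfolding \<kappa>_def
      by (rule order_trans[OF X_triangle[OF pB(3,4)] add_mono[OF CB(3)[OF d hl(1) P(1)] CB(3)[OF d P'(1) hl(1)]]]) (simp only: l'_def)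
    ultimately have "XU h' + XV l' \<le> (ennreal \<kappa> * (XU h * XV g) + ennreal \<kappa> * (XU f' * XV l)) + (ennreal \<kappa> * (XU h * XU f) + ennreal \<kappa> * (XU f' * XU h))"
      by (rule add_mono)
    also have "\<dots> = ennreal \<kappa> * (XU h * (XU f + XV g) + XU f' * (XU h + XV l))"
      by (simp only: distrib_left distrib_right mult_ac add_ac)
    also have "\<dots> \<le> ennreal \<kappa> * (ennreal K * ennreal M + ennreal M * ennreal K)"
    proof (intro mult_left_mono add_mono mult_mono z hl(3))
      show "XU h \<le> ennreal K" using hl(3) by (rule order_trans[rotated]) simp
      show "XU f' \<le> ennreal M" using z(2) by (rule order_trans[rotated]) simp
    qed auto
    also have "\<dots> = ennreal (\<kappa> * (K * M + M * K))"
      using \<kappa> K M(1) by (simp only: ennreal_mult ennreal_plus mult_nonneg_nonneg add_nonneg_nonneg less_imp_le)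
    also have "\<dots> \<le> ennreal (K / 2)"
    proof (rule ennreal_leI)
      have "(6 * \<kappa> * M) * K \<le> 1 * K" using K M by (intro mult_right_mono) (auto simp: \<kappa>_def)
      moreover have "\<kappa> * (K * M + M * K) * 3 = (6 * \<kappa> * M) * K" by simp
      ultimately show "\<kappa> * (K * M + M * K) \<le> K / 2" using K by linarith
    qed
    finally show "XU h' + XV l' \<le> ennreal (K / 2)" .
  next
    fix t n assume t: "t \<in> {-\<delta>..\<delta>}"
    then have t': "\<bar>t\<bar> \<le> \<delta>" by auto
    have J: "integrable kxy (interaction h g n)" "integrable kxy (interaction f' l n)" "integrable kxy (interaction f g n)"
      "integrable kxy (interaction f' g n)" "integrable kxy (interaction f' g' n)" "integrable kxy (interaction (pdiff f f') g n)"
      "integrable kxy (interaction f' (pdiff g g') n)"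
      by (intro interaction_u P P' hl finh pd Xd)+
    have eq: "osc (phase_u \<gamma>) h g n s + osc (phase_u \<gamma>) f' l n s = osc (phase_u \<gamma>) f g n s - osc (phase_u \<gamma>) f' g' n s" if s: "s \<in> {-\<delta>..\<delta>}" for s
    proof -
      have "osc (phase_u \<gamma>) h g n s = osc (phase_u \<gamma>) (pdiff f f') g n s"
        by (rule osc_cong_u[OF J(6) J(1) I(7) I(2) I(5) I(2)]) (simp_all add: tfd[OF s])
      moreover have "osc (phase_u \<gamma>) f' l n s = osc (phase_u \<gamma>) f' (pdiff g g') n s"
        by (rule osc_cong_u[OF J(7) J(2) I(3) I(8) I(3) I(6)]) (simp_all add: tfd[OF s])
      ultimately show ?thesis
        by (simp add: osc_pdiff_left[OF J(3,4)] osc_pdiff_right[OF J(4,5)])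
    qed
    note C = interval_integrable_continuous[OF continuous_osc]
    have "tf h' t n = tf (BU \<delta> h g) t n + tf (BU \<delta> f' l) t n"
      unfolding h'_def by (rule tf_add[OF integrable_of_X[OF pB(1) XB(1)] integrable_of_X[OF pB(2) XB(2)]])
    also have "\<dots> = (- \<i> * of_real \<alpha>) * ((LBINT s=ereal 0..ereal t. osc (phase_u \<gamma>) h g n s) + (LBINT s=ereal 0..ereal t. osc (phase_u \<gamma>) f' l n s))"
      by (simp only: tf_Bil[OF d(1) t' J(1)] tf_Bil[OF d(1) t' J(2)] distrib_left)
    also have "(LBINT s=ereal 0..ereal t. osc (phase_u \<gamma>) h g n s) + (LBINT s=ereal 0..ereal t. osc (phase_u \<gamma>) f' l n s)
       = (LBINT s=ereal 0..ereal t. osc (phase_u \<gamma>) h g n s + osc (phase_u \<gamma>) f' l n s)"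
      by (rule interval_lebesgue_integral_add(2)[symmetric]) (intro C J)+
    also have "\<dots> = (LBINT s=ereal 0..ereal t. osc (phase_u \<gamma>) f g n s - osc (phase_u \<gamma>) f' g' n s)"
      by (rule interval_integral_cong_Icc[OF eq t])
    also have "\<dots> = (LBINT s=ereal 0..ereal t. osc (phase_u \<gamma>) f g n s) - (LBINT s=ereal 0..ereal t. osc (phase_u \<gamma>) f' g' n s)"
      by (rule interval_lebesgue_integral_diff(2)) (intro C J)+
    finally show "tf h' t n = tf f t n - tf f' t n"
      using P(5)[OF t, of n] P'(5)[OF t, of n] by (simp only: right_diff_distrib) simp
  next
    fix t n assume t: "t \<in> {-\<delta>..\<delta>}"
    then have t': "\<bar>t\<bar> \<le> \<delta>" by auto
    have J: "integrable kxy (interaction h (conj_profile f) n)" "integrable kxy (interaction f' (conj_profile h) n)" "integrable kxy (interaction f (conj_profile f) n)"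
      "integrable kxy (interaction f' (conj_profile f) n)" "integrable kxy (interaction f' (conj_profile f') n)" "integrable kxy (interaction (pdiff f f') (conj_profile f) n)"
      "integrable kxy (interaction f' (conj_profile (pdiff f f')) n)"
      by (intro interaction_v P P' hl finh pd Xd)+
    note Icf = Ic[OF P(1,3)] and Ich = Ic[OF hl(1) finh(1)] and Icd = Ic[OF pd(1) Xd(1)]
    have eq: "osc (phase_v \<gamma>) h (conj_profile f) n s + osc (phase_v \<gamma>) f' (conj_profile h) n s
       = osc (phase_v \<gamma>) f (conj_profile f) n s - osc (phase_v \<gamma>) f' (conj_profile f') n s" if s: "s \<in> {-\<delta>..\<delta>}" for s
    proof -
      have "osc (phase_v \<gamma>) h (conj_profile f) n s = osc (phase_v \<gamma>) (pdiff f f') (conj_profile f) n s"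
        by (rule osc_cong_v[OF J(6) J(1) I(7) Icf I(5) Icf]) (simp_all add: tfd[OF s])
      moreover have "osc (phase_v \<gamma>) f' (conj_profile h) n s = osc (phase_v \<gamma>) f' (conj_profile (pdiff f f')) n s"
        by (rule osc_cong_v[OF J(7) J(2) I(3) Icd I(3) Ich]) (simp_all add: tf_conj_profile tfd[OF s])
      ultimately show ?thesis
        by (simp add: osc_pdiff_left[OF J(3,4)] osc_pdiff_right[OF J(4,5)] conj_profile_pdiff)
    qed
    note C = interval_integrable_continuous[OF continuous_osc]
    have "tf l' t n = tf (BV \<delta> h f) t n + tf (BV \<delta> f' h) t n"
      unfolding l'_def by (rule tf_add[OF integrable_of_X[OF pB(3) XB(3)] integrable_of_X[OF pB(4) XB(4)]])
    also have "\<dots> = ((of_real \<beta> * \<i>) * of_int n) * ((LBINT s=ereal 0..ereal t. osc (phase_v \<gamma>) h (conj_profile f) n s) + (LBINT s=ereal 0..ereal t. osc (phase_v \<gamma>) f' (conj_profile h) n s))"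
      by (simp only: tf_Bil[OF d(1) t' J(1)] tf_Bil[OF d(1) t' J(2)] distrib_left)
    also have "(LBINT s=ereal 0..ereal t. osc (phase_v \<gamma>) h (conj_profile f) n s) + (LBINT s=ereal 0..ereal t. osc (phase_v \<gamma>) f' (conj_profile h) n s)
       = (LBINT s=ereal 0..ereal t. osc (phase_v \<gamma>) h (conj_profile f) n s + osc (phase_v \<gamma>) f' (conj_profile h) n s)"
      by (rule interval_lebesgue_integral_add(2)[symmetric]) (intro C J)+
    also have "\<dots> = (LBINT s=ereal 0..ereal t. osc (phase_v \<gamma>) f (conj_profile f) n s - osc (phase_v \<gamma>) f' (conj_profile f') n s)"
      by (rule interval_integral_cong_Icc[OF eq t])
    also have "\<dots> = (LBINT s=ereal 0..ereal t. osc (phase_v \<gamma>) f (conj_profile f) n s) - (LBINT s=ereal 0..ereal t. osc (phase_v \<gamma>) f' (conj_profile f') n s)"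
      by (rule interval_lebesgue_integral_diff(2)) (intro C J)+
    finally show "tf l' t n = tf g t n - tf g' t n"
      using P(6)[OF t, of n] P'(6)[OF t, of n] by (simp only: right_diff_distrib) simp
  qed
qed

text \<open>The value at a time is bounded by the norm of any profile representing it, so
  representatives of arbitrarily small norm force the value 0.\<close>

lemma tf_eq_0_of_small:
  assumes h: "\<And>j :: nat. \<exists>h. profile h \<and> X r1 r2 b h \<le> ennreal (K * (1/2) ^ j) \<and> tf h t n = w"
  shows "w = 0"
proof -
  obtain C where C: "C > 0" "\<And>f r1 r2 t n. profile f \<Longrightarrow> ennreal (cmod (tf f t n)) \<le> ennreal (C * jb (of_int n) powr (- r2)) * X r1 r2 b f"
    using tf_bound[OF b(1)] by blast
  have "ennreal (cmod w) \<le> ennreal 0"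
  proof (rule ennreal_le_geometric[where c = "C * jb (of_int n) powr (- r2) * K"])
    fix j
    obtain h where h': "profile h" "X r1 r2 b h \<le> ennreal (K * (1/2) ^ j)" "tf h t n = w" using h by blast
    have "ennreal (cmod w) \<le> ennreal (C * jb (of_int n) powr (- r2)) * X r1 r2 b h"
      using C(2)[OF h'(1), of t n r2 r1] h'(3) by simp
    also have "\<dots> \<le> ennreal (C * jb (of_int n) powr (- r2)) * ennreal (K * (1/2) ^ j)"
      by (intro mult_left_mono h') simp
    also have "\<dots> = ennreal (0 + C * jb (of_int n) powr (- r2) * K * (1/2) ^ j)"
      using C(1) by (subst ennreal_mult'[symmetric]) (auto simp: mult_ac)
    finally show "ennreal (cmod w) \<le> \<dots>" .
  qed
  then show ?thesis by simp
qed

lemma local_uniqueness: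
  assumes d: "0 < \<delta>" "\<delta> \<le> 1" and M: "M > 0" "6 * (CB * \<delta> powr (9/16 - b)) * M \<le> 1"
    and s: "psol \<delta> a c f g" "psol \<delta> a c f' g'"
    and z: "XU f + XV g \<le> ennreal M" "XU f' + XV g' \<le> ennreal M"
    and t: "t \<in> {-\<delta>..\<delta>}"
  shows "tf f t n = tf f' t n \<and> tf g t n = tf g' t n"
proof -
  note P = psolD[OF s(1)] and P' = psolD[OF s(2)]
  have ex: "\<exists>h l. profile h \<and> profile l \<and> XU h + XV l \<le> ennreal (2 * M * (1/2) ^ j) \<and>
     (\<forall>t n. t \<in> {-\<delta>..\<delta>} \<longrightarrow> tf h t n = tf f t n - tf f' t n) \<and>
     (\<forall>t n. t \<in> {-\<delta>..\<delta>} \<longrightarrow> tf l t n = tf g t n - tf g' t n)" for j :: nat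
  proof (induction j)
    case 0
    \<comment> \<open>The first representative is the true difference, of norm at most
      \<open>2 * M\<close>.\<close>
    have "XU (pdiff f f') + XV (pdiff g g') \<le> (XU f + XU f') + (XV g + XV g')"
      by (intro add_mono X_pdiff_le P P')
    also have "\<dots> = (XU f + XV g) + (XU f' + XV g')" by (simp add: ac_simps)
    also have "\<dots> \<le> ennreal M + ennreal M" by (intro add_mono z)
    also have "\<dots> = ennreal (2 * M * (1/2) ^ 0)" using M by (simp add: ennreal_plus[symmetric] del: ennreal_plus)
    finally show ?case
      by (intro exI[of _ "pdiff f f'"] exI[of _ "pdiff g g'"] conjI profile_pdiff P P')
         (auto simp: tf_diff integrable_of_X[OF P(1,3)] integrable_of_X[OF P(2,4)] integrable_of_X[OF P'(1,3)] integrable_of_X[OF P'(2,4)])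
  next
    case (Suc j)
    then obtain h l where hl: "profile h" "profile l" "XU h + XV l \<le> ennreal (2 * M * (1/2) ^ j)"
      "\<And>t n. t \<in> {-\<delta>..\<delta>} \<Longrightarrow> tf h t n = tf f t n - tf f' t n"
      "\<And>t n. t \<in> {-\<delta>..\<delta>} \<Longrightarrow> tf l t n = tf g t n - tf g' t n" by blast
    have K: "0 \<le> 2 * M * (1/2) ^ j" using M by simp
    obtain h' l' where "profile h'" "profile l'" "XU h' + XV l' \<le> ennreal (2 * M * (1/2) ^ j / 2)"
      "\<And>t n. t \<in> {-\<delta>..\<delta>} \<Longrightarrow> tf h' t n = tf f t n - tf f' t n"
      "\<And>t n. t \<in> {-\<delta>..\<delta>} \<Longrightarrow> tf l' t n = tf g t n - tf g' t n"
      using difference_halving[OF d M s z hl K] by blast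
    moreover have "2 * M * (1/2) ^ j / 2 = 2 * M * (1/2) ^ Suc j" by simp
    ultimately show ?case by metis
  qed
  have "tf f t n - tf f' t n = 0"
  proof (rule tf_eq_0_of_small[of s1 s2 "2 * M"])
    fix j
    obtain h l where "profile h" "profile l" "XU h + XV l \<le> ennreal (2 * M * (1/2) ^ j)" "tf h t n = tf f t n - tf f' t n"
      using ex[of j] t by blast
    moreover have "XU h \<le> XU h + XV l" by simp
    ultimately show "\<exists>h. profile h \<and> XU h \<le> ennreal (2 * M * (1/2) ^ j) \<and> tf h t n = tf f t n - tf f' t n"
      by (meson order_trans)
  qed
  moreover have "tf g t n - tf g' t n = 0"
  proof (rule tf_eq_0_of_small[of "s1 - 1/2" "s2 - 1/2" "2 * M"])
    fix j
    obtain h l where "profile h" "profile l" "XU h + XV l \<le> ennreal (2 * M * (1/2) ^ j)" "tf l t n = tf g t n - tf g' t n"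
      using ex[of j] t by blast
    moreover have "XV l \<le> XU h + XV l" by simp
    ultimately show "\<exists>h. profile h \<and> XV h \<le> ennreal (2 * M * (1/2) ^ j) \<and> tf h t n = tf g t n - tf g' t n"
      by (meson order_trans)
  qed
  ultimately show ?thesis by simp
qed

text \<open>The equations are autonomous, so the translated pair solves them with its own values at
  time 0 as data, as long as the translated interval stays inside [-T, T].\<close>

lemma psol_shift:
  assumes s: "psol T a c f g" and d: "\<delta> > 0" "\<bar>c0\<bar> + \<delta> \<le> T"
  shows "psol \<delta> (tf (shift omega_u c0 f) 0) (tf (shift (omega_v \<gamma>) c0 g) 0) (shift omega_u c0 f) (shift (omega_v \<gamma>) c0 g)"
proof -
  note P = psolD[OF s]
  have p: "profile (shift omega_u c0 f)" "profile (shift (omega_v \<gamma>) c0 g)" by (intro profile_shift P)+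
  have Xs: "XU (shift omega_u c0 f) < \<infinity>" "XV (shift (omega_v \<gamma>) c0 g) < \<infinity>" using P by (simp_all add: X_shift)
  have I: "\<And>n. integrable lborel (f n)" "\<And>n. integrable lborel (g n)" "\<And>n. integrable lborel (conj_profile f n)"
    "\<And>n. integrable lborel (shift omega_u c0 f n)" "\<And>n. integrable lborel (shift (omega_v \<gamma>) c0 g n)" "\<And>n. integrable lborel (conj_profile (shift omega_u c0 f) n)"
    using integrable_of_X[OF P(1,3)] integrable_of_X[OF P(2,4)] integrable_of_X[OF profile_conj[OF P(1)], of s1 s2]
      integrable_of_X[OF p(1) Xs(1)] integrable_of_X[OF p(2) Xs(2)] integrable_of_X[OF profile_conj[OF p(1)], of s1 s2] P(1,3) p(1) Xs(1)
    by (auto simp: X_conj_profile)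
  have J: "integrable kxy (interaction f g n)" "integrable kxy (interaction f (conj_profile f) n)"
    "integrable kxy (interaction (shift omega_u c0 f) (shift (omega_v \<gamma>) c0 g) n)"
    "integrable kxy (interaction (shift omega_u c0 f) (conj_profile (shift omega_u c0 f)) n)" for n
    by (intro interaction_u interaction_v P p Xs)+
  \<comment> \<open>With \<open>y\<close> the integral up to \<open>c0\<close> and \<open>z\<close>
    the remaining one, \<open>E * (x + A * y)\<close> is the new initial value.\<close>
  have eq: "E * (x + A * (y + z)) = E * (x + A * y) + A * (E * z)" for E x A y z :: complex
    by (simp add: algebra_simps)
  have "tf (shift omega_u c0 f) t n = tf (shift omega_u c0 f) 0 n + (- \<i> * of_real \<alpha>) * (LBINT s=ereal 0..ereal t. osc (phase_u \<gamma>) (shift omega_u c0 f) (shift (omega_v \<gamma>) c0 g) n s) \<and>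
    tf (shift (omega_v \<gamma>) c0 g) t n = tf (shift (omega_v \<gamma>) c0 g) 0 n + ((of_real \<beta> * \<i>) * of_int n) *
       (LBINT s=ereal 0..ereal t. osc (phase_v \<gamma>) (shift omega_u c0 f) (conj_profile (shift omega_u c0 f)) n s)"
    if t: "t \<in> {-\<delta>..\<delta>}" for t n
  proof
    have t': "t + c0 \<in> {-T..T}" "0 + c0 \<in> {-T..T}" using t d by auto
    have o1: "osc (phase_u \<gamma>) (shift omega_u c0 f) (shift (omega_v \<gamma>) c0 g) n s = iexp (- c0 * omega_u n) * osc (phase_u \<gamma>) f g n (s + c0)" for s
      by (rule osc_cong_shift_u[OF J(1) J(3) I(1,2,4,5)]) (rule tf_shift)+
    have o2: "osc (phase_v \<gamma>) (shift omega_u c0 f) (conj_profile (shift omega_u c0 f)) n s = iexp (- c0 * omega_v \<gamma> n) * osc (phase_v \<gamma>) f (conj_profile f) n (s + c0)" for s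
    proof (rule osc_cong_shift_v[OF J(2) J(4) I(1,3,4,6)])
      show "tf (conj_profile (shift omega_u c0 f)) s m = iexp (- c0 * - omega_u m) * tf (conj_profile f) (s + c0) m" for m
        unfolding conj_profile_shift by (rule tf_shift)
    qed (rule tf_shift)
    show "tf (shift omega_u c0 f) t n = tf (shift omega_u c0 f) 0 n + (- \<i> * of_real \<alpha>) * (LBINT s=ereal 0..ereal t. osc (phase_u \<gamma>) (shift omega_u c0 f) (shift (omega_v \<gamma>) c0 g) n s)"
      unfolding tf_shift o1 P(5)[OF t'(1)] P(5)[OF t'(2)] interval_integral_translate[OF continuous_osc[OF J(1)]] eq
      by (simp add: interval_lebesgue_integral_mult_right)
    show "tf (shift (omega_v \<gamma>) c0 g) t n = tf (shift (omega_v \<gamma>) c0 g) 0 n + ((of_real \<beta> * \<i>) * of_int n) *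
       (LBINT s=ereal 0..ereal t. osc (phase_v \<gamma>) (shift omega_u c0 f) (conj_profile (shift omega_u c0 f)) n s)"
      unfolding tf_shift o2 P(6)[OF t'(1)] P(6)[OF t'(2)] interval_integral_translate[OF continuous_osc[OF J(2)]] eq
      by (simp add: interval_lebesgue_integral_mult_right)
  qed
  then show ?thesis unfolding psol_def using p Xs by blast
qed

text \<open>The admissible step depends only on the norms of the two solutions, which translation
  preserves, so one step length serves along all of [-T, T].\<close>

theorem global_uniqueness:
  assumes T: "T > 0" and s: "psol T a c f g" "psol T a c f' g'" and t: "t \<in> {-T..T}"
  shows "tf f t n = tf f' t n \<and> tf g t n = tf g' t n"
proof -
  note P = psolD[OF s(1)] and P' = psolD[OF s(2)]
  have "XU f + XV g + (XU f' + XV g') < \<infinity>" using P P' by simp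
  then obtain M0 where M0: "XU f + XV g + (XU f' + XV g') = ennreal M0" "M0 \<ge> 0"
    by (metis infinity_ennreal_def less_top_ennreal)
  define M where "M = M0 + 1"
  have M: "M > 0" using M0 by (simp add: M_def)
  have "XU f + XV g + (XU f' + XV g') \<le> ennreal M" unfolding M0 M_def by (intro ennreal_leI) simp
  then have z: "XU f + XV g \<le> ennreal M" "XU f' + XV g' \<le> ennreal M"
    using order_trans[OF add_increasing2[OF zero_le order_refl]] order_trans[OF add_increasing[OF zero_le order_refl]] by blast+
  obtain T0 where T0: "0 < T0" "T0 \<le> 1" "\<And>T. 0 < T \<Longrightarrow> T \<le> T0 \<Longrightarrow> 6 * (CB * T powr (9/16 - b)) * M \<le> 1"
    using small_time[OF M] by blast
  obtain N :: nat where N: "T / T0 < of_nat N" using reals_Archimedean2 by blast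
  have "0 < T / T0" using T T0 by simp
  with N have Npos: "real N > 0" by linarith
  \<comment> \<open>Dividing \<open>T\<close> exactly lets the last step end at \<open>T\<close> and
    keeps every translated interval inside [-T, T].\<close>
  define \<delta> where "\<delta> = T / N"
  have d: "0 < \<delta>" "\<delta> \<le> T0" "N * \<delta> = T" "\<delta> \<le> 1"
  proof -
    show "0 < \<delta>" "N * \<delta> = T" using T Npos by (simp_all add: \<delta>_def)
    show le: "\<delta> \<le> T0" using N T0(1) Npos by (simp add: \<delta>_def field_simps)
    show "\<delta> \<le> 1" using le T0 by simp
  qed
  \<comment> \<open>Agreement at the single time \<open>c0\<close> spreads to the interval of radius
    \<delta> around it.\<close>
  have local: "tf f t n = tf f' t n \<and> tf g t n = tf g' t n"
    if c0: "\<bar>c0\<bar> + \<delta> \<le> T" "\<And>n. tf f c0 n = tf f' c0 n \<and> tf g c0 n = tf g' c0 n" and t: "\<bar>t - c0\<bar> \<le> \<delta>" for c0 t n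
  proof -
    have e: "tf (shift omega_u c0 f) 0 = tf (shift omega_u c0 f') 0" "tf (shift (omega_v \<gamma>) c0 g) 0 = tf (shift (omega_v \<gamma>) c0 g') 0"
      using c0(2) by (simp_all add: fun_eq_iff tf_shift)
    have "t - c0 \<in> {-\<delta>..\<delta>}" using t by auto
    note local_uniqueness[OF d(1,4) M T0(3)[OF d(1,2)] psol_shift[OF s(1) d(1) c0(1)] psol_shift[OF s(2) d(1) c0(1), folded e] _ _ this, unfolded X_shift, OF z, of n]
    then show ?thesis by (simp add: tf_shift)
  qed
  have "\<forall>t n. \<bar>t\<bar> \<le> j * \<delta> \<longrightarrow> tf f t n = tf f' t n \<and> tf g t n = tf g' t n" if "j \<le> N" for j :: nat
    using that
  proof (induction j)
    case 0
    have "0 \<in> {-T..T}" using T by simp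
    then show ?case using P(5,6)[of 0] P'(5,6)[of 0] by (auto simp: zero_ereal_def[symmetric])
  next
    case (Suc j)
    then have IH: "\<And>t n. \<bar>t\<bar> \<le> j * \<delta> \<Longrightarrow> tf f t n = tf f' t n \<and> tf g t n = tf g' t n" by simp
    have "Suc j * \<delta> \<le> N * \<delta>" using Suc.prems d by (intro mult_right_mono) auto
    then have jT: "j * \<delta> + \<delta> \<le> T" using d(3) by (simp add: algebra_simps)
    have j0: "j * \<delta> \<ge> 0" using d by simp
    show ?case
    proof (intro allI impI)
      fix t n assume t: "\<bar>t\<bar> \<le> Suc j * \<delta>"
      then have t': "\<bar>t\<bar> \<le> j * \<delta> + \<delta>" by (simp add: algebra_simps)
      consider "\<bar>t\<bar> \<le> j * \<delta>" | "t > j * \<delta>" | "t < - (j * \<delta>)" by linarith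
      then show "tf f t n = tf f' t n \<and> tf g t n = tf g' t n"
      proof cases
        case 1
        then show ?thesis by (rule IH)
      next
        case 2
        show ?thesis
          by (rule local[of "j * \<delta>"]) (use jT j0 IH 2 t' in auto)
      next
        case 3
        show ?thesis
          by (rule local[of "- (j * \<delta>)"]) (use jT j0 IH 3 t' in auto)
      qed
    qed
  qed
  from this[of N] t show ?thesis using d(3) by auto
qed

end

section \<open>Fourier series of periodic distributions\<close>

definition EE :: "int \<Rightarrow> real \<Rightarrow> complex" where
  "EE n x = exp (\<i> * of_int n * of_real x)"

lemma EE_0: "EE 0 x = 1" by (simp add: EE_def)

lemma EE_nonzero [simp]: "EE n x \<noteq> 0" by (simp add: EE_def)

lemma smooth_periodic_period: "\<phi> \<in> smooth_periodic \<Longrightarrow> \<phi> (x + 2 * pi) = \<phi> x"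
  by (simp add: smooth_periodic_def)

lemma smooth_periodic_deriv:
  assumes "\<phi> \<in> smooth_periodic"
  shows "(\<phi> has_vector_derivative vderiv \<phi> x) (at x)"
proof -
  have "(vderiv ^^ 0) \<phi> differentiable (at x)"
    using assms unfolding smooth_periodic_def by blast
  then show ?thesis by (simp add: vderiv_def vector_derivative_works)
qed

lemma vderiv_eqI: "(\<And>x. (\<phi> has_vector_derivative \<psi> x) (at x)) \<Longrightarrow> vderiv \<phi> = \<psi>"
  unfolding vderiv_def by (rule ext) (rule vector_derivative_at)

lemma smooth_periodic_vderiv:
  assumes "\<phi> \<in> smooth_periodic"
  shows "vderiv \<phi> \<in> smooth_periodic"
  unfolding smooth_periodic_def
proof (intro CollectI conjI allI)
  fix x
  have "((\<lambda>y. \<phi> (y + 2 * pi)) has_vector_derivative vderiv \<phi> (x + 2 * pi)) (at x)"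
  proof -
    have "((\<phi> \<circ> (\<lambda>y. y + 2 * pi)) has_vector_derivative 1 *\<^sub>R vderiv \<phi> (x + 2 * pi)) (at x)"
      by (rule vector_diff_chain_at) (auto intro!: derivative_eq_intros smooth_periodic_deriv[OF assms])
    then show ?thesis by (simp add: comp_def)
  qed
  then have "(\<phi> has_vector_derivative vderiv \<phi> (x + 2 * pi)) (at x)"
    by (simp add: smooth_periodic_period[OF assms])
  then show "vderiv \<phi> (x + 2 * pi) = vderiv \<phi> x"
    using smooth_periodic_deriv[OF assms, of x] vector_derivative_unique_at by blast
next
  fix k x
  have "(vderiv ^^ Suc k) \<phi> differentiable (at x)"
    using assms unfolding smooth_periodic_def by blast
  then show "(vderiv ^^ k) (vderiv \<phi>) differentiable (at x)"
    by (simp only: funpow_Suc_right comp_apply)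
qed

lemma smooth_periodic_vderivs: "\<phi> \<in> smooth_periodic \<Longrightarrow> (vderiv ^^ k) \<phi> \<in> smooth_periodic"
  by (induction k) (auto intro: smooth_periodic_vderiv)

lemma smooth_periodicI:
  assumes "\<And>x. \<phi> (x + 2 * pi) = \<phi> x" and "\<And>k x. ((vderiv ^^ k) \<phi> has_vector_derivative \<psi> k x) (at x)"
  shows "\<phi> \<in> smooth_periodic"
  unfolding smooth_periodic_def using assms(1) differentiableI_vector[OF assms(2)] by blast

lemma vderivs_lincomb:
  assumes "\<phi> \<in> smooth_periodic" "\<psi> \<in> smooth_periodic"
  shows "(vderiv ^^ k) (\<lambda>x. c * \<phi> x + \<psi> x) = (\<lambda>x. c * (vderiv ^^ k) \<phi> x + (vderiv ^^ k) \<psi> x)"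
proof (induction k)
  case (Suc k)
  have "((\<lambda>x. c * (vderiv ^^ k) \<phi> x + (vderiv ^^ k) \<psi> x) has_vector_derivative
      c * vderiv ((vderiv ^^ k) \<phi>) x + vderiv ((vderiv ^^ k) \<psi>) x) (at x)" for x
    by (intro derivative_intros has_vector_derivative_mult_right smooth_periodic_deriv smooth_periodic_vderivs assms)
  then show ?case using Suc by (auto intro: vderiv_eqI)
qed simp

lemma smooth_periodic_lincomb:
  assumes "\<phi> \<in> smooth_periodic" "\<psi> \<in> smooth_periodic"
  shows "(\<lambda>x. c * \<phi> x + \<psi> x) \<in> smooth_periodic"
proof (rule smooth_periodicI)
  show "((vderiv ^^ k) (\<lambda>x. c * \<phi> x + \<psi> x) has_vector_derivative
      c * vderiv ((vderiv ^^ k) \<phi>) x + vderiv ((vderiv ^^ k) \<psi>) x) (at x)" for k x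
    unfolding vderivs_lincomb[OF assms]
    by (intro derivative_intros has_vector_derivative_mult_right smooth_periodic_deriv smooth_periodic_vderivs assms)
qed (simp add: smooth_periodic_period assms)

lemma has_vector_derivative_EE:
  "((\<lambda>x. c * EE n x) has_vector_derivative (c * (\<i> * of_int n)) * EE n x) (at x)"
proof -
  have "((\<lambda>z. c * exp (\<i> * of_int n * z)) has_field_derivative c * (exp (\<i> * of_int n * of_real x) * (\<i> * of_int n))) (at (of_real x))"
    by (auto intro!: derivative_eq_intros)
  from has_vector_derivative_real_field[OF this] show ?thesis by (simp add: EE_def mult_ac)
qed

lemma vderivs_EE: "(vderiv ^^ k) (EE n) = (\<lambda>x. (\<i> * of_int n) ^ k * EE n x)"
proof (induction k)
  case (Suc k)
  have "vderiv (\<lambda>x. (\<i> * of_int n) ^ k * EE n x) = (\<lambda>x. ((\<i> * of_int n) ^ k * (\<i> * of_int n)) * EE n x)"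
    by (rule vderiv_eqI) (rule has_vector_derivative_EE)
  then show ?case using Suc by (simp add: mult.commute)
qed simp

lemma EE_period: "EE n (x + 2 * pi) = EE n x"
proof -
  have "EE n (x + 2 * pi) = EE n x * exp (2 * of_int n * of_real pi * \<i>)"
    by (simp add: EE_def exp_add[symmetric] algebra_simps)
  moreover have "exp (2 * of_int n * of_real pi * \<i>) = 1"
    using exp_integer_2pi[of "of_int n"] by simp
  ultimately show ?thesis by simp
qed

lemma smooth_periodic_EE: "EE n \<in> smooth_periodic"
proof (rule smooth_periodicI)
  show "((vderiv ^^ k) (EE n) has_vector_derivative ((\<i> * of_int n) ^ k * (\<i> * of_int n)) * EE n x) (at x)" for k x
    unfolding vderivs_EE by (rule has_vector_derivative_EE)
qed (rule EE_period)

lemma EE_mult: "EE m x * EE n x = EE (m + n) x"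
  by (simp only: EE_def mult_exp_exp of_int_add distrib_left distrib_right)

lemma norm_EE [simp]: "cmod (EE n x) = 1"
  using norm_exp_i_times[of "of_int n * x"] by (simp add: EE_def mult.assoc)

lemma continuous_EE [continuous_intros]: "continuous_on A (EE n)"
  unfolding EE_def[abs_def] by (intro continuous_intros)

lemma cnj_EE: "cnj (EE n x) = EE (- n) x"
  by (simp add: EE_def exp_cnj)

section \<open>Fourier coefficients of test functions\<close>

definition Fc :: "(real \<Rightarrow> complex) \<Rightarrow> int \<Rightarrow> complex" where
  "Fc \<phi> n = integral {0..2 * pi} (\<lambda>x. \<phi> x * EE (- n) x) / (2 * pi)"

lemma integral_Fc: "integral {0..2 * pi} (\<lambda>x. \<phi> x * EE (- n) x) = complex_of_real (2 * pi) * Fc \<phi> n"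
  by (simp add: Fc_def)

lemma integrable_Fc: "continuous_on UNIV \<phi> \<Longrightarrow> (\<lambda>x. \<phi> x * EE n x) integrable_on {0..2 * pi}"
  by (rule integrable_continuous_interval, rule continuous_on_mult, erule continuous_on_subset, simp, rule continuous_EE)

lemma integral_EE: "integral {0..2 * pi} (EE n) = (if n = 0 then 2 * pi else 0)"
proof (cases "n = 0")
  case False
  have "((\<lambda>x. (1 / (\<i> * of_int n) * (\<i> * of_int n)) * EE n x) has_integral (1 / (\<i> * of_int n)) * EE n (2 * pi) - (1 / (\<i> * of_int n)) * EE n 0) {0..2 * pi}"
    by (rule fundamental_theorem_of_calculus, simp, rule has_vector_derivative_at_within, rule has_vector_derivative_EE)
  moreover have "EE n (2 * pi) = EE n 0" using EE_period[of n 0] by simp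
  ultimately have "(EE n has_integral 0) {0..2 * pi}" using False by simp
  then show ?thesis using False by (simp add: integral_unique)
next
  case True
  have "EE 0 = (\<lambda>_. 1)" by (simp add: fun_eq_iff EE_0)
  with True show ?thesis by (simp add: scaleR_conv_of_real)
qed

lemma Fc_EE: "Fc (EE m) n = (if n = m then 1 else 0)"
  unfolding Fc_def EE_mult integral_EE by auto

lemma continuous_smooth_periodic: "\<phi> \<in> smooth_periodic \<Longrightarrow> continuous_on A \<phi>"
  by (intro continuous_at_imp_continuous_on ballI has_vector_derivative_continuous) (rule smooth_periodic_deriv)

lemma Fc_vderiv:
  assumes "\<phi> \<in> smooth_periodic"
  shows "Fc (vderiv \<phi>) n = \<i> * of_int n * Fc \<phi> n"
proof -
  have d: "((\<lambda>x. \<phi> x * EE (- n) x) has_vector_derivative \<phi> x * ((\<i> * of_int (- n)) * EE (- n) x) + vderiv \<phi> x * EE (- n) x) (at x)" for x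
    using has_vector_derivative_mult[OF smooth_periodic_deriv[OF assms, of x] has_vector_derivative_EE[of 1 "- n" x]] by simp
  have "((\<lambda>x. \<phi> x * ((\<i> * of_int (- n)) * EE (- n) x) + vderiv \<phi> x * EE (- n) x) has_integral
      \<phi> (2 * pi) * EE (- n) (2 * pi) - \<phi> 0 * EE (- n) 0) {0..2 * pi}"
    by (rule fundamental_theorem_of_calculus, simp, rule has_vector_derivative_at_within, rule d)
  moreover have "\<phi> (2 * pi) * EE (- n) (2 * pi) = \<phi> 0 * EE (- n) 0"
    using smooth_periodic_period[OF assms, of 0] EE_period[of "- n" 0] by simp
  ultimately have 0: "integral {0..2 * pi} (\<lambda>x. (\<i> * of_int (- n)) * (\<phi> x * EE (- n) x) + vderiv \<phi> x * EE (- n) x) = 0"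
    by (simp add: integral_unique mult_ac)
  have i1: "(\<lambda>x. \<phi> x * EE (- n) x) integrable_on {0..2 * pi}" "(\<lambda>x. vderiv \<phi> x * EE (- n) x) integrable_on {0..2 * pi}"
    by (intro integrable_Fc continuous_smooth_periodic smooth_periodic_vderiv assms)+
  have "integral {0..2 * pi} (\<lambda>x. (\<i> * of_int (- n)) * (\<phi> x * EE (- n) x) + vderiv \<phi> x * EE (- n) x)
     = integral {0..2 * pi} (\<lambda>x. (\<i> * of_int (- n)) * (\<phi> x * EE (- n) x)) + integral {0..2 * pi} (\<lambda>x. vderiv \<phi> x * EE (- n) x)"
    by (rule Henstock_Kurzweil_Integration.integral_add[OF integrable_on_mult_right[OF i1(1)] i1(2)])
  also have "integral {0..2 * pi} (\<lambda>x. (\<i> * of_int (- n)) * (\<phi> x * EE (- n) x)) = (\<i> * of_int (- n)) * integral {0..2 * pi} (\<lambda>x. \<phi> x * EE (- n) x)"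
    by (rule integral_mult_right)
  finally have "integral {0..2 * pi} (\<lambda>x. vderiv \<phi> x * EE (- n) x) = \<i> * of_int n * integral {0..2 * pi} (\<lambda>x. \<phi> x * EE (- n) x)"
    using 0 by (simp add: algebra_simps)
  then show ?thesis by (simp add: Fc_def)
qed

lemma norm_Fc_le:
  assumes c: "continuous_on UNIV \<phi>" and M: "\<And>x. cmod (\<phi> x) \<le> M"
  shows "cmod (Fc \<phi> n) \<le> M"
proof -
  have M0: "0 \<le> M" using M[of 0] norm_ge_zero order_trans by blast
  have "((\<lambda>x. \<phi> x * EE (- n) x) has_integral integral {0..2 * pi} (\<lambda>x. \<phi> x * EE (- n) x)) (cbox 0 (2 * pi))"
    using integrable_integral[OF integrable_Fc[OF c, of "- n"]] by simp
  from has_integral_bound[OF M0 this] have "cmod (integral {0..2 * pi} (\<lambda>x. \<phi> x * EE (- n) x)) \<le> M * (2 * pi)"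
    using M by (simp add: norm_mult)
  then show ?thesis by (simp add: Fc_def norm_divide field_simps)
qed

lemma smooth_periodic_period_int:
  assumes "\<phi> \<in> smooth_periodic"
  shows "\<phi> (x + of_int k * (2 * pi)) = \<phi> x"
proof (induction k rule: int_induct[where k = 0])
  case (step1 i)
  then show ?case using smooth_periodic_period[OF assms, of "x + of_int i * (2 * pi)"] by (simp add: algebra_simps)
next
  case (step2 i)
  then show ?case using smooth_periodic_period[OF assms, of "x + of_int (i - 1) * (2 * pi)"] by (simp add: algebra_simps)
qed simp

lemma smooth_periodic_bounded:
  assumes "\<phi> \<in> smooth_periodic"
  obtains M where "\<And>x. cmod (\<phi> x) \<le> M"
proof -
  have "bounded (\<phi> ` {0..2 * pi})"
    by (intro compact_imp_bounded compact_continuous_image continuous_smooth_periodic assms) auto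
  then obtain M where M: "\<And>x. x \<in> {0..2 * pi} \<Longrightarrow> cmod (\<phi> x) \<le> M"
    unfolding bounded_iff by blast
  note per = smooth_periodic_period_int[OF assms]
  have "cmod (\<phi> x) \<le> M" for x
  proof -
    define k where "k = \<lfloor>x / (2 * pi)\<rfloor>"
    have "of_int k \<le> x / (2 * pi)" "x / (2 * pi) < of_int k + 1" unfolding k_def by linarith+
    then have "x - of_int k * (2 * pi) \<in> {0..2 * pi}" by (auto simp: field_simps)
    from M[OF this] show ?thesis using per[of "x - of_int k * (2 * pi)" k] by simp
  qed
  then show ?thesis by (rule that)
qed

text \<open>Two derivatives give decay of second order, which is summable. The 4 compares the
  squared bracket with the square of \<open>n\<close> for nonzero \<open>n\<close>.\<close>

lemma norm_Fc_le_jb: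
  assumes \<phi>: "\<phi> \<in> smooth_periodic" and M: "\<And>x. cmod (\<phi> x) \<le> M" "\<And>x. cmod (vderiv (vderiv \<phi>) x) \<le> M"
  shows "cmod (Fc \<phi> n) \<le> 4 * M * jb (of_int n) powr (- 2)"
proof -
  have M0: "0 \<le> M" using M(1)[of 0] norm_ge_zero order_trans by blast
  have j: "jb (of_int n) powr (- 2) = 1 / (1 + \<bar>of_int n\<bar>)\<^sup>2"
    using powr_realpow[of "jb (of_int n)" 2] by (simp add: jb_def powr_minus_divide)
  show ?thesis
  proof (cases "n = 0")
    case True
    have "cmod (Fc \<phi> n) \<le> M" by (rule norm_Fc_le[OF continuous_smooth_periodic[OF \<phi>] M(1)])
    then show ?thesis using True M0 by (simp add: jb_def)
  next
    case False
    have "cmod (Fc (vderiv (vderiv \<phi>)) n) \<le> M"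
      by (intro norm_Fc_le continuous_smooth_periodic smooth_periodic_vderiv \<phi> M)
    then have "(of_int n)\<^sup>2 * cmod (Fc \<phi> n) \<le> M"
      by (simp add: Fc_vderiv smooth_periodic_vderiv \<phi> norm_mult power2_eq_square flip: abs_mult)
    moreover have "(1 + \<bar>of_int n :: real\<bar>)\<^sup>2 \<le> 4 * (of_int n)\<^sup>2"
    proof -
      have "1 \<le> \<bar>of_int n :: real\<bar>" using False by (simp flip: of_int_abs)
      then have "(1 + \<bar>of_int n :: real\<bar>)\<^sup>2 \<le> (2 * \<bar>of_int n\<bar>)\<^sup>2" by (intro power_mono) auto
      then show ?thesis by (simp add: power_mult_distrib)
    qed
    ultimately have "(1 + \<bar>of_int n :: real\<bar>)\<^sup>2 * cmod (Fc \<phi> n) \<le> 4 * M"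
      using mult_right_mono[of "(1 + \<bar>of_int n :: real\<bar>)\<^sup>2" "4 * (of_int n)\<^sup>2" "cmod (Fc \<phi> n)"] by simp
    moreover have "0 < (1 + \<bar>of_int n :: real\<bar>)\<^sup>2" by (intro zero_less_power) (simp add: add_pos_nonneg)
    ultimately show ?thesis unfolding j by (simp add: field_simps)
  qed
qed

text \<open>The mean square distance between \<open>h\<close> and its finite Fourier sum is
  nonnegative; expanding it, the mixed term and the square of the sum both produce the same quantity
  \<open>Q\<close>.\<close>

lemma bessel:
  assumes c: "continuous_on UNIV h" and "finite A"
  shows "(\<Sum>n\<in>A. (cmod (Fc h n))\<^sup>2) \<le> integral {0..2 * pi} (\<lambda>x. (cmod (h x))\<^sup>2) / (2 * pi)"
proof -
  define S where "S = (\<lambda>x. \<Sum>n\<in>A. Fc h n * EE n x)"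
  have cS: "continuous_on UNIV S" unfolding S_def by (intro continuous_intros)
  have I: "(\<lambda>x. f x) integrable_on {0..2 * pi}" if "continuous_on UNIV f" for f :: "real \<Rightarrow> complex"
    by (intro integrable_continuous_interval continuous_on_subset[OF that]) auto
  have ccnj: "continuous_on UNIV (\<lambda>x. cnj (f x))" if "continuous_on UNIV f" for f :: "real \<Rightarrow> complex"
    using that by (intro continuous_intros)
  define Q where "Q = (\<Sum>n\<in>A. (cmod (Fc h n))\<^sup>2)"
  have pair: "integral {0..2 * pi} (\<lambda>x. f x * cnj (S x)) = complex_of_real (2 * pi) * (\<Sum>n\<in>A. cnj (Fc h n) * Fc f n)"
    if f: "continuous_on UNIV f" for f
  proof -
    have "f x * cnj (S x) = (\<Sum>n\<in>A. cnj (Fc h n) * (f x * EE (- n) x))" for x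
      unfolding S_def cnj_sum complex_cnj_mult cnj_EE sum_distrib_left by (intro sum.cong refl) (rule mult.left_commute)
    then have "integral {0..2 * pi} (\<lambda>x. f x * cnj (S x)) = integral {0..2 * pi} (\<lambda>x. \<Sum>n\<in>A. cnj (Fc h n) * (f x * EE (- n) x))"
      by simp
    also have "\<dots> = (\<Sum>n\<in>A. integral {0..2 * pi} (\<lambda>x. cnj (Fc h n) * (f x * EE (- n) x)))"
      by (rule Henstock_Kurzweil_Integration.integral_sum[OF \<open>finite A\<close>]) (intro integrable_on_mult_right integrable_Fc f)
    also have "\<dots> = (\<Sum>n\<in>A. complex_of_real (2 * pi) * (cnj (Fc h n) * Fc f n))"
      unfolding integral_mult_right integral_Fc by (intro sum.cong refl) (rule mult.left_commute)
    finally show ?thesis unfolding sum_distrib_left .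
  qed
  have Q: "(\<Sum>n\<in>A. cnj (Fc h n) * Fc h n) = complex_of_real Q"
    unfolding Q_def of_real_sum by (intro sum.cong refl) (simp only: complex_norm_square mult.commute)
  have hS: "integral {0..2 * pi} (\<lambda>x. h x * cnj (S x)) = complex_of_real (2 * pi * Q)"
    unfolding pair[OF c] Q by simp
  have SS: "integral {0..2 * pi} (\<lambda>x. S x * cnj (S x)) = complex_of_real (2 * pi * Q)"
  proof -
    have "Fc S n = Fc h n" if "n \<in> A" for n
    proof -
      have "integral {0..2 * pi} (\<lambda>x. S x * EE (- n) x) = integral {0..2 * pi} (\<lambda>x. \<Sum>m\<in>A. Fc h m * EE (m + - n) x)"
        unfolding S_def sum_distrib_right mult.assoc EE_mult ..
      also have "\<dots> = (\<Sum>m\<in>A. integral {0..2 * pi} (\<lambda>x. Fc h m * EE (m + - n) x))"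
        by (rule Henstock_Kurzweil_Integration.integral_sum[OF \<open>finite A\<close>]) (intro integrable_on_mult_right I continuous_EE)
      also have "\<dots> = (\<Sum>m\<in>A. if m = n then Fc h n * complex_of_real (2 * pi) else 0)"
        unfolding integral_mult_right integral_EE by (intro sum.cong) auto
      also have "\<dots> = Fc h n * complex_of_real (2 * pi)" using that \<open>finite A\<close> by simp
      finally show ?thesis by (simp add: Fc_def[of S])
    qed
    then have "(\<Sum>n\<in>A. cnj (Fc h n) * Fc S n) = complex_of_real Q"
      unfolding Q[symmetric] by (intro sum.cong refl) simp
    then show ?thesis unfolding pair[OF cS] by simp
  qed
  have i: "(\<lambda>x. (cmod (f x))\<^sup>2) integrable_on {0..2 * pi}" "(\<lambda>x. Re (h x * cnj (f x))) integrable_on {0..2 * pi}" if "continuous_on UNIV f" for f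
    using continuous_on_subset[OF that, of "{0..2 * pi}"] continuous_on_subset[OF c, of "{0..2 * pi}"]
    by (auto intro!: integrable_continuous_interval continuous_intros)
  have Re_int: "integral {0..2 * pi} (\<lambda>x. Re (f x)) = Re (integral {0..2 * pi} f)" if "continuous_on UNIV f" for f
    using integral_linear[OF I[OF that] bounded_linear_Re] by (simp add: comp_def)
  have "0 \<le> integral {0..2 * pi} (\<lambda>x. (cmod (h x - S x))\<^sup>2)"
    by (rule Henstock_Kurzweil_Integration.integral_nonneg) (auto intro!: i continuous_intros c cS)
  also have "integral {0..2 * pi} (\<lambda>x. (cmod (h x - S x))\<^sup>2) = integral {0..2 * pi} (\<lambda>x. (cmod (h x))\<^sup>2 + ((cmod (S x))\<^sup>2 - 2 * Re (h x * cnj (S x))))"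
    by (rule arg_cong[where f = "integral {0..2 * pi}"]) (rule ext, unfold cmod_power2, simp add: power2_eq_square algebra_simps)
  also have "\<dots> = integral {0..2 * pi} (\<lambda>x. (cmod (h x))\<^sup>2) + (integral {0..2 * pi} (\<lambda>x. (cmod (S x))\<^sup>2) - 2 * integral {0..2 * pi} (\<lambda>x. Re (h x * cnj (S x))))"
    unfolding integral_mult_right[symmetric]
    by (subst Henstock_Kurzweil_Integration.integral_add[OF i(1)[OF c] integrable_diff[OF i(1)[OF cS] integrable_on_mult_right[OF i(2)[OF cS]]]],
      subst Henstock_Kurzweil_Integration.integral_diff[OF i(1)[OF cS] integrable_on_mult_right[OF i(2)[OF cS]]], rule refl)
  also have "integral {0..2 * pi} (\<lambda>x. (cmod (S x))\<^sup>2) = 2 * pi * Q"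
  proof -
    have "(\<lambda>x. (cmod (S x))\<^sup>2) = (\<lambda>x. Re (S x * cnj (S x)))" by (rule ext, unfold cmod_power2, simp add: power2_eq_square)
    then have "integral {0..2 * pi} (\<lambda>x. (cmod (S x))\<^sup>2) = Re (integral {0..2 * pi} (\<lambda>x. S x * cnj (S x)))"
      using Re_int[OF continuous_on_mult[OF cS ccnj[OF cS]]] by simp
    then show ?thesis unfolding SS by simp
  qed
  also have "integral {0..2 * pi} (\<lambda>x. Re (h x * cnj (S x))) = 2 * pi * Q"
    unfolding Re_int[OF continuous_on_mult[OF c ccnj[OF cS]]] hS by simp
  finally show ?thesis unfolding Q_def[symmetric] by (simp add: field_simps)
qed

text \<open>Riemann-Lebesgue: by Bessel's inequality the squares form a convergent series along any
  sequence of distinct frequencies. Continuity of \<open>h\<close> is enough, which matters for the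
  quotient in \<open>fterm_sums\<close>.\<close>

lemma Fc_tendsto_0:
  assumes c: "continuous_on UNIV h" and inj: "inj g"
  shows "(\<lambda>k :: nat. Fc h (g k)) \<longlonglongrightarrow> 0"
proof -
  have "summable (\<lambda>k. (cmod (Fc h (g k)))\<^sup>2)"
  proof (rule summableI_nonneg_bounded)
    fix N
    have "(\<Sum>k<N. (cmod (Fc h (g k)))\<^sup>2) = (\<Sum>n\<in>g ` {..<N}. (cmod (Fc h n))\<^sup>2)"
      by (rule sum.reindex[symmetric, unfolded comp_def]) (rule inj_on_subset[OF inj subset_UNIV])
    also have "\<dots> \<le> integral {0..2 * pi} (\<lambda>x. (cmod (h x))\<^sup>2) / (2 * pi)"
      by (rule bessel[OF c]) simp
    finally show "(\<Sum>k<N. (cmod (Fc h (g k)))\<^sup>2) \<le> \<dots>" .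
  qed simp
  then have "(\<lambda>k. sqrt ((cmod (Fc h (g k)))\<^sup>2)) \<longlonglongrightarrow> sqrt 0"
    by (intro tendsto_real_sqrt summable_LIMSEQ_zero)
  then show ?thesis by (simp add: tendsto_norm_zero_iff)
qed

section \<open>Symmetric partial sums of Fourier series\<close>

definition fterm :: "(real \<Rightarrow> complex) \<Rightarrow> nat \<Rightarrow> real \<Rightarrow> complex" where
  "fterm \<phi> i x = (if i = 0 then Fc \<phi> 0 else Fc \<phi> (int i) * EE (int i) x + Fc \<phi> (- int i) * EE (- int i) x)"

lemma vector_derivative_quotient:
  fixes f :: "real \<Rightarrow> complex"
  assumes "(f has_vector_derivative D) (at y)"
  shows "((\<lambda>z. (f z - f y) / of_real (z - y)) \<longlongrightarrow> D) (at y)"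
proof -
  have "((\<lambda>z. norm ((f z - f y) - (z - y) *\<^sub>R D) / norm (z - y)) \<longlongrightarrow> 0) (at y)"
    using assms unfolding has_vector_derivative_def has_derivative_iff_norm by blast
  then have "((\<lambda>z. norm ((f z - f y) / of_real (z - y) - D)) \<longlongrightarrow> 0) (at y)"
  proof (rule Lim_transform_eventually)
    show "\<forall>\<^sub>F z in at y. norm ((f z - f y) - (z - y) *\<^sub>R D) / norm (z - y) = norm ((f z - f y) / of_real (z - y) - D)"
      unfolding eventually_at_filter
    proof (intro always_eventually allI impI)
      fix z assume "z \<noteq> y"
      then have "(f z - f y) / of_real (z - y) - D = ((f z - f y) - (z - y) *\<^sub>R D) / of_real (z - y)"
        by (simp add: scaleR_conv_of_real diff_divide_distrib)
      then show "norm ((f z - f y) - (z - y) *\<^sub>R D) / norm (z - y) = norm ((f z - f y) / of_real (z - y) - D)"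
        by (simp only: norm_divide norm_of_real real_norm_def)
    qed
  qed
  then show ?thesis by (simp only: tendsto_norm_zero_iff Lim_null[symmetric])
qed

lemma EE_1_eq_imp:
  assumes "\<phi> \<in> smooth_periodic" "EE 1 y = EE 1 x"
  shows "\<phi> y = \<phi> x"
proof -
  obtain k :: int where "\<i> * of_int 1 * of_real y = \<i> * of_int 1 * of_real x + (of_int (2 * k) * pi) * \<i>"
    using assms(2) unfolding EE_def exp_eq by blast
  from arg_cong[where f = Im, OF this] have "y = x + of_int k * (2 * pi)" by simp
  then show ?thesis using smooth_periodic_period_int[OF assms(1)] by simp
qed

text \<open>Chernoff's argument: dividing \<open>\<phi> - \<phi> x\<close> by \<open>EE 1 - EE 1 x\<close> turns the partial sums at \<open>x\<close> into telescoping ones.\<close>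

lemma fterm_sums:
  assumes \<phi>: "\<phi> \<in> smooth_periodic"
  shows "(\<lambda>i. fterm \<phi> i x) sums \<phi> x"
proof -
  define h where "h = (\<lambda>y. if EE 1 y = EE 1 x then vderiv \<phi> y / (\<i> * EE 1 y) else (\<phi> y - \<phi> x) / (EE 1 y - EE 1 x))"
  have hmul: "\<phi> y - \<phi> x = h y * (EE 1 y - EE 1 x)" for y
  proof (cases "EE 1 y = EE 1 x")
    case True
    from EE_1_eq_imp[OF \<phi> this] True show ?thesis by simp
  qed (simp add: h_def)
  have cont: "isCont h y" for y
  proof (cases "EE 1 y = EE 1 x")
    case False
    have "open {z. EE 1 z \<noteq> EE 1 x}"
      by (intro open_Collect_neq continuous_EE continuous_intros)
    then have "\<forall>\<^sub>F z in nhds y. EE 1 z \<noteq> EE 1 x"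
      using False eventually_nhds_in_open[of "{z. EE 1 z \<noteq> EE 1 x}" y] by simp
    then have ev: "\<forall>\<^sub>F z in nhds y. h z = (\<phi> z - \<phi> x) / (EE 1 z - EE 1 x)"
      by eventually_elim (simp add: h_def)
    have "isCont \<phi> y" "isCont (EE 1) y"
      using continuous_smooth_periodic[OF \<phi>, of UNIV] continuous_EE[of UNIV 1] by (auto simp: continuous_on_eq_continuous_at)
    then have "isCont (\<lambda>z. (\<phi> z - \<phi> x) / (EE 1 z - EE 1 x)) y"
      using False by (intro continuous_intros) auto
    then show ?thesis using isCont_cong[OF ev] by simp
  next
    case True
    \<comment> \<open>A quotient of two difference quotients: its limit is the ratio of the
      derivatives, since the derivative of \<open>EE 1\<close> never vanishes.\<close>
    have d1: "((\<lambda>z. (\<phi> z - \<phi> y) / of_real (z - y)) \<longlongrightarrow> vderiv \<phi> y) (at y)"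
      by (rule vector_derivative_quotient[OF smooth_periodic_deriv[OF \<phi>]])
    have "(EE 1 has_vector_derivative \<i> * EE 1 y) (at y)"
      using has_vector_derivative_EE[of 1 1 y] by simp
    note d2 = vector_derivative_quotient[OF this]
    have nz: "\<i> * EE 1 y \<noteq> 0" by simp
    from tendsto_divide[OF d1 d2 nz]
    have "((\<lambda>z. ((\<phi> z - \<phi> y) / of_real (z - y)) / ((EE 1 z - EE 1 y) / of_real (z - y))) \<longlongrightarrow> h y) (at y)"
      using True by (simp add: h_def)
    moreover have "\<forall>\<^sub>F z in at y. ((\<phi> z - \<phi> y) / of_real (z - y)) / ((EE 1 z - EE 1 y) / of_real (z - y)) = h z"
      using tendsto_imp_eventually_ne[OF d2 nz]
    proof eventually_elim
      case (elim z)
      then have "EE 1 z \<noteq> EE 1 y" "z \<noteq> y" by auto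
      then show ?case unfolding h_def EE_1_eq_imp[OF \<phi> True, symmetric] True[symmetric] by simp
    qed
    ultimately have "(h \<longlongrightarrow> h y) (at y)"
      by (rule Lim_transform_eventually)
    then show ?thesis by (simp add: isCont_def)
  qed
  then have ch: "continuous_on UNIV h" by (simp add: continuous_at_imp_continuous_on)
  \<comment> \<open>Multiplying the relation for the coefficients by \<open>EE n x\<close> absorbs
    the factor \<open>EE 1 x\<close> into the index shift, so consecutive terms cancel.\<close>
  define a where "a = (\<lambda>n. EE (n + 1) x * Fc h n)"
  have Fc_rel: "EE n x * Fc \<phi> n = (if n = 0 then \<phi> x else 0) + a (n - 1) - a n" for n
  proof -
    have i: "(\<lambda>y. h y * EE m y) integrable_on {0..2 * pi}" for m by (rule integrable_Fc[OF ch])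
    have e: "\<phi> y * EE (- n) y = \<phi> x * EE (- n) y + (h y * EE (- (n - 1)) y - EE 1 x * (h y * EE (- n) y))" for y
    proof -
      have "(\<phi> y - \<phi> x) * EE (- n) y = h y * (EE 1 y - EE 1 x) * EE (- n) y" by (simp only: hmul)
      then have "\<phi> y * EE (- n) y = \<phi> x * EE (- n) y + (h y * (EE 1 y * EE (- n) y) - EE 1 x * (h y * EE (- n) y))"
        by (simp add: algebra_simps)
      then show ?thesis by (simp add: EE_mult)
    qed
    have iE: "EE m integrable_on {0..2 * pi}" for m by (rule integrable_continuous_interval[OF continuous_EE])
    have "integral {0..2 * pi} (\<lambda>y. \<phi> y * EE (- n) y)
       = integral {0..2 * pi} (\<lambda>y. \<phi> x * EE (- n) y) + (integral {0..2 * pi} (\<lambda>y. h y * EE (- (n - 1)) y) - integral {0..2 * pi} (\<lambda>y. EE 1 x * (h y * EE (- n) y)))"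
      unfolding e
      by (subst Henstock_Kurzweil_Integration.integral_add[OF integrable_on_mult_right[OF iE] integrable_diff[OF i integrable_on_mult_right[OF i]]],
        subst Henstock_Kurzweil_Integration.integral_diff[OF i integrable_on_mult_right[OF i]], rule refl)
    also have "\<dots> = \<phi> x * (if n = 0 then 2 * pi else 0) + (integral {0..2 * pi} (\<lambda>y. h y * EE (- (n - 1)) y) - EE 1 x * integral {0..2 * pi} (\<lambda>y. h y * EE (- n) y))"
      by (simp only: integral_mult_right integral_EE neg_equal_0_iff_equal)
    finally have "Fc \<phi> n = (if n = 0 then \<phi> x else 0) + Fc h (n - 1) - EE 1 x * Fc h n"
    proof -
      assume *: "integral {0..2 * pi} (\<lambda>y. \<phi> y * EE (- n) y) = \<phi> x * (if n = 0 then 2 * pi else 0) +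
        (integral {0..2 * pi} (\<lambda>y. h y * EE (- (n - 1)) y) - EE 1 x * integral {0..2 * pi} (\<lambda>y. h y * EE (- n) y))"
      have "complex_of_real (2 * pi) * Fc \<phi> n = complex_of_real (2 * pi) * ((if n = 0 then \<phi> x else 0) + Fc h (n - 1) - EE 1 x * Fc h n)"
        using * unfolding integral_Fc by (simp add: algebra_simps)
      then show ?thesis by (simp only: mult_cancel_left) simp
    qed
    then have "EE n x * Fc \<phi> n = EE n x * (if n = 0 then \<phi> x else 0) + EE n x * Fc h (n - 1) - (EE n x * EE 1 x) * Fc h n"
      by (simp only: right_diff_distrib distrib_left mult.assoc)
    then show ?thesis by (auto simp: a_def EE_mult EE_0)
  qed
  \<comment> \<open>Only the two end terms survive, and they vanish in the limit by
    Riemann-Lebesgue.\<close>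
  have partial: "(\<Sum>i<Suc N. fterm \<phi> i x) = \<phi> x + a (- 1 - int N) - a (int N)" for N
  proof (induction N)
    case 0
    show ?case using Fc_rel[of 0] by (simp add: fterm_def EE_0)
  next
    case (Suc N)
    have "fterm \<phi> (Suc N) x = EE (int (Suc N)) x * Fc \<phi> (int (Suc N)) + EE (- int (Suc N)) x * Fc \<phi> (- int (Suc N))"
      by (simp add: fterm_def mult.commute)
    also have "\<dots> = (a (int N) - a (int (Suc N))) + (a (- 1 - int (Suc N)) - a (- 1 - int N))"
      unfolding Fc_rel by (simp add: algebra_simps)
    finally show ?case using Suc by (simp only: sum.lessThan_Suc[of _ "Suc N"]) simp
  qed
  have lim: "(\<lambda>k. a (g k)) \<longlonglongrightarrow> 0" if "inj g" for g :: "nat \<Rightarrow> int"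
  proof -
    have "(\<lambda>k. norm (Fc h (g k))) \<longlonglongrightarrow> 0" by (rule tendsto_norm_zero[OF Fc_tendsto_0[OF ch that]])
    then have "(\<lambda>k. norm (a (g k))) \<longlonglongrightarrow> 0" by (simp add: a_def norm_mult)
    then show ?thesis by (simp add: tendsto_norm_zero_iff)
  qed
  have "(\<lambda>N. \<phi> x + a (- 1 - int N) - a (int N)) \<longlonglongrightarrow> \<phi> x + 0 - 0"
    by (intro tendsto_intros lim) (auto simp: inj_on_def)
  then have "(\<lambda>N. \<Sum>i<Suc N. fterm \<phi> i x) \<longlonglongrightarrow> \<phi> x"
    unfolding partial by simp
  then show ?thesis
    unfolding sums_def by (rule LIMSEQ_imp_Suc)
qed

text \<open>The decay of the coefficients gives uniform convergence by the M-test; pointwise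
  convergence identifies the limit.\<close>

lemma fterm_uniform_limit:
  assumes \<phi>: "\<phi> \<in> smooth_periodic"
  shows "uniform_limit UNIV (\<lambda>N x. \<Sum>i<N. fterm \<phi> i x) \<phi> sequentially"
proof -
  obtain M1 where M1: "\<And>x. cmod (\<phi> x) \<le> M1" using smooth_periodic_bounded[OF \<phi>] by blast
  obtain M2 where M2: "\<And>x. cmod (vderiv (vderiv \<phi>) x) \<le> M2"
    using smooth_periodic_bounded[OF smooth_periodic_vderiv[OF smooth_periodic_vderiv[OF \<phi>]]] by blast
  define M where "M = max M1 M2"
  have B: "cmod (Fc \<phi> n) \<le> 4 * M * jb (of_int n) powr (- 2)" for n
    by (rule norm_Fc_le_jb[OF \<phi>]) (use M1 M2 in \<open>auto simp: M_def intro: max.coboundedI1 max.coboundedI2\<close>)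
  have bound: "norm (fterm \<phi> i x) \<le> 8 * M * jb (of_nat i) powr (- 2)" for i x
  proof (cases "i = 0")
    case True
    have "0 \<le> M" using order_trans[OF norm_ge_zero M1[of 0]] by (simp add: M_def le_max_iff_disj)
    then show ?thesis using True B[of 0] by (simp add: fterm_def jb_def)
  next
    case False
    have "norm (fterm \<phi> i x) \<le> cmod (Fc \<phi> (int i)) + cmod (Fc \<phi> (- int i))"
      using False norm_triangle_ineq[of "Fc \<phi> (int i) * EE (int i) x" "Fc \<phi> (- int i) * EE (- int i) x"]
      by (simp add: fterm_def norm_mult)
    then show ?thesis using B[of "int i"] B[of "- int i"] by simp
  qed
  have summ: "summable (\<lambda>i :: nat. 8 * M * jb (of_nat i) powr (- 2))"
  proof (rule summable_mult)
    have "summable (\<lambda>m. of_nat (Suc m) powr (- 2) :: real)"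
      using summable_real_powr_iff[of "- 2"] by (subst summable_Suc_iff) simp
    then show "summable (\<lambda>m :: nat. jb (of_nat m) powr (- 2))" by (simp add: jb_def)
  qed
  have "uniform_limit UNIV (\<lambda>N x. \<Sum>i<N. fterm \<phi> i x) (\<lambda>x. suminf (\<lambda>i. fterm \<phi> i x)) sequentially"
    by (rule Weierstrass_m_test[OF bound summ])
  moreover have "(\<lambda>x. suminf (\<lambda>i. fterm \<phi> i x)) = \<phi>"
    using sums_unique[OF fterm_sums[OF \<phi>]] by (simp add: fun_eq_iff)
  ultimately show ?thesis by simp
qed

lemma fterm_eq:
  "fterm \<phi> i = (if i = 0 then (\<lambda>x. Fc \<phi> 0 * EE 0 x) else (\<lambda>x. Fc \<phi> (int i) * EE (int i) x + Fc \<phi> (- int i) * EE (- int i) x))"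
  by (auto simp: fterm_def fun_eq_iff EE_0)

lemma smooth_periodic_zero: "(\<lambda>x. 0) \<in> smooth_periodic"
proof (rule smooth_periodicI)
  have "(vderiv ^^ k) (\<lambda>x. 0) = (\<lambda>x. 0)" for k
    by (induction k) (auto intro: vderiv_eqI)
  then show "((vderiv ^^ k) (\<lambda>x. 0) has_vector_derivative 0) (at x)" for k x by simp
qed simp

lemma smooth_periodic_cmult: "\<phi> \<in> smooth_periodic \<Longrightarrow> (\<lambda>x. c * \<phi> x) \<in> smooth_periodic"
  using smooth_periodic_lincomb[OF _ smooth_periodic_zero, of \<phi> c] by simp

lemma smooth_periodic_fterm: "fterm \<phi> i \<in> smooth_periodic"
    unfolding fterm_eq using smooth_periodic_cmult[OF smooth_periodic_EE]
    smooth_periodic_lincomb[OF smooth_periodic_EE smooth_periodic_cmult[OF smooth_periodic_EE]]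
  by (cases "i = 0") (simp_all only: if_True if_False refl)

lemma vderiv_fterm:
  assumes "\<phi> \<in> smooth_periodic"
  shows "vderiv (fterm \<phi> i) = fterm (vderiv \<phi>) i"
proof (rule vderiv_eqI)
  fix x
  show "(fterm \<phi> i has_vector_derivative fterm (vderiv \<phi>) i x) (at x)"
  proof (cases "i = 0")
    case True
    then show ?thesis using has_vector_derivative_EE[of "Fc \<phi> 0" 0 x] by (simp add: fterm_eq Fc_vderiv[OF assms])
  next
    case False
    have "((\<lambda>x. Fc \<phi> (int i) * EE (int i) x + Fc \<phi> (- int i) * EE (- int i) x) has_vector_derivative
       (Fc \<phi> (int i) * (\<i> * of_int (int i))) * EE (int i) x + (Fc \<phi> (- int i) * (\<i> * of_int (- int i))) * EE (- int i) x) (at x)"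
      by (intro has_vector_derivative_add has_vector_derivative_EE)
    then show ?thesis using False by (simp add: fterm_eq Fc_vderiv[OF assms] mult_ac)
  qed
qed

lemma partial_sums:
  assumes \<phi>: "\<phi> \<in> smooth_periodic"
  shows "(\<lambda>x. \<Sum>i<N. fterm \<phi> i x) \<in> smooth_periodic"
    and "(vderiv ^^ k) (\<lambda>x. \<Sum>i<N. fterm \<phi> i x) = (\<lambda>x. \<Sum>i<N. fterm ((vderiv ^^ k) \<phi>) i x)"
proof -
  have S: "(\<lambda>x. \<Sum>i<N. fterm \<psi> i x) \<in> smooth_periodic" for \<psi>
  proof (induction N)
    case (Suc N)
    then show ?case using smooth_periodic_lincomb[OF Suc smooth_periodic_fterm[of \<psi> N], of 1] by simp
  qed (simp add: smooth_periodic_zero)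
  then show "(\<lambda>x. \<Sum>i<N. fterm \<phi> i x) \<in> smooth_periodic" .
  show "(vderiv ^^ k) (\<lambda>x. \<Sum>i<N. fterm \<phi> i x) = (\<lambda>x. \<Sum>i<N. fterm ((vderiv ^^ k) \<phi>) i x)"
  proof (induction k)
    case (Suc k)
    have "vderiv (\<lambda>x. \<Sum>i<N. fterm ((vderiv ^^ k) \<phi>) i x) = (\<lambda>x. \<Sum>i<N. fterm (vderiv ((vderiv ^^ k) \<phi>)) i x)"
    proof (rule vderiv_eqI)
      show "((\<lambda>x. \<Sum>i<N. fterm ((vderiv ^^ k) \<phi>) i x) has_vector_derivative (\<Sum>i<N. fterm (vderiv ((vderiv ^^ k) \<phi>)) i x)) (at x)" for x
        unfolding vderiv_fterm[OF smooth_periodic_vderivs[OF \<phi>], symmetric]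
        by (intro has_vector_derivative_sum smooth_periodic_deriv smooth_periodic_fterm)
    qed
    then show ?case using Suc by simp
  qed simp
qed

section \<open>Distributions and their Fourier coefficients\<close>

lemma distribution_lin:
  assumes "distribution D" "\<phi> \<in> smooth_periodic" "\<psi> \<in> smooth_periodic"
  shows "D (\<lambda>x. c * \<phi> x + \<psi> x) = c * D \<phi> + D \<psi>"
  using assms unfolding distribution_def by blast

lemma distribution_zero: "distribution D \<Longrightarrow> D (\<lambda>x. 0) = 0"
  using distribution_lin[of D "\<lambda>x. 0" "\<lambda>x. 0" 1] smooth_periodic_zero by simp

lemma distribution_cmult: "distribution D \<Longrightarrow> \<phi> \<in> smooth_periodic \<Longrightarrow> D (\<lambda>x. c * \<phi> x) = c * D \<phi>"
  using distribution_lin[of D \<phi> "\<lambda>x. 0" c] smooth_periodic_zero distribution_zero by simp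

text \<open>Derivatives of the partial sums are the partial sums of the derivatives, so uniform
  convergence holds for each of the finitely many derivatives in the continuity bound.\<close>

lemma distribution_partial_sums:
  assumes "distribution D" "\<phi> \<in> smooth_periodic" "e > 0"
  shows "\<forall>\<^sub>F N in sequentially. cmod (D \<phi> - D (\<lambda>x. \<Sum>i<N. fterm \<phi> i x)) \<le> e"
proof -
  obtain C K where CK: "\<And>\<psi> M. \<psi> \<in> smooth_periodic \<Longrightarrow> \<forall>k\<le>K. \<forall>x. norm ((vderiv ^^ k) \<psi> x) \<le> M \<Longrightarrow> norm (D \<psi>) \<le> C * M"
    using assms(1) unfolding distribution_def by blast
  \<comment> \<open>The continuity constant may be 0 or negative, hence its absolute value plus
    1.\<close>
  define M where "M = e / (\<bar>C\<bar> + 1)"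
  have M: "M > 0" using assms(3) by (simp add: M_def)
  have CM: "C * M \<le> e"
  proof -
    have "C * M \<le> (\<bar>C\<bar> + 1) * M" using M by (intro mult_right_mono) auto
    also have "\<dots> = e" by (simp add: M_def)
    finally show ?thesis .
  qed
  have "\<forall>\<^sub>F N in sequentially. \<forall>k\<in>{..K}. \<forall>x. dist (\<Sum>i<N. fterm ((vderiv ^^ k) \<phi>) i x) ((vderiv ^^ k) \<phi> x) < M"
    using fterm_uniform_limit[OF smooth_periodic_vderivs[OF assms(2)]] M
    by (intro eventually_ball_finite) (auto simp: uniform_limit_iff)
  then show ?thesis
  proof eventually_elim
    case (elim N)
    define S where "S = (\<lambda>x. \<Sum>i<N. fterm \<phi> i x)"
    have S: "S \<in> smooth_periodic" unfolding S_def by (rule partial_sums(1)[OF assms(2)])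
    have "norm (D (\<lambda>x. (- 1) * S x + \<phi> x)) \<le> C * M"
    proof (rule CK)
      show "(\<lambda>x. (- 1) * S x + \<phi> x) \<in> smooth_periodic" by (rule smooth_periodic_lincomb[OF S assms(2)])
      have "norm ((- 1) * (vderiv ^^ k) S x + (vderiv ^^ k) \<phi> x) \<le> M" if "k \<le> K" for k x
        using elim that unfolding S_def partial_sums(2)[OF assms(2)]
        by (auto simp: dist_norm norm_minus_commute intro: less_imp_le)
      then show "\<forall>k\<le>K. \<forall>x. norm ((vderiv ^^ k) (\<lambda>x. (- 1) * S x + \<phi> x) x) \<le> M"
        unfolding vderivs_lincomb[OF S assms(2)] by blast
    qed
    then have "norm (- D S + D \<phi>) \<le> e"
      using CM unfolding distribution_lin[OF assms(1) S assms(2)] by simp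
    then show ?case by (simp add: S_def)
  qed
qed

text \<open>Trigonometric polynomials are dense in the test functions, so a distribution is
  determined by its values on the exponentials.\<close>

lemma distribution_eqI:
  assumes D: "distribution D" "distribution E" and eq: "\<And>n. D (EE n) = E (EE n)" and \<phi>: "\<phi> \<in> smooth_periodic"
  shows "D \<phi> = E \<phi>"
proof -
  have f: "F (fterm \<phi> i) = (if i = 0 then Fc \<phi> 0 * F (EE 0) else Fc \<phi> (int i) * F (EE (int i)) + Fc \<phi> (- int i) * F (EE (- int i)))"
    if "distribution F" for F i
    unfolding fterm_eq
    by (simp add: distribution_lin[OF that smooth_periodic_EE smooth_periodic_cmult[OF smooth_periodic_EE]] distribution_cmult[OF that smooth_periodic_EE])
  have partial: "D (\<lambda>x. \<Sum>i<N. fterm \<phi> i x) = E (\<lambda>x. \<Sum>i<N. fterm \<phi> i x)" for N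
  proof (induction N)
    case 0
    then show ?case using D by (simp add: distribution_zero)
  next
    case (Suc N)
    have "F (\<lambda>x. \<Sum>i<Suc N. fterm \<phi> i x) = F (\<lambda>x. \<Sum>i<N. fterm \<phi> i x) + F (fterm \<phi> N)" if "distribution F" for F
      using distribution_lin[OF that partial_sums(1)[OF \<phi>] smooth_periodic_fterm, of 1] by simp
    from this[OF D(1)] this[OF D(2)] show ?case by (simp only: f[OF D(1)] f[OF D(2)] eq Suc)
  qed
  have "cmod (D \<phi> - E \<phi>) \<le> e" if "e > 0" for e
  proof -
    have "e / 2 > 0" using that by simp
    have "\<forall>\<^sub>F N in sequentially. cmod (D \<phi> - D (\<lambda>x. \<Sum>i<N. fterm \<phi> i x)) \<le> e / 2 \<and> cmod (E \<phi> - E (\<lambda>x. \<Sum>i<N. fterm \<phi> i x)) \<le> e / 2"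
      by (intro eventually_conj distribution_partial_sums D \<phi> \<open>e / 2 > 0\<close>)
    then obtain N where "cmod (D \<phi> - D (\<lambda>x. \<Sum>i<N. fterm \<phi> i x)) \<le> e / 2" "cmod (E \<phi> - E (\<lambda>x. \<Sum>i<N. fterm \<phi> i x)) \<le> e / 2"
      unfolding eventually_sequentially by blast
    then show ?thesis
      unfolding partial using norm_triangle_ineq4[of "D \<phi> - E (\<lambda>x. \<Sum>i<N. fterm \<phi> i x)" "E \<phi> - E (\<lambda>x. \<Sum>i<N. fterm \<phi> i x)"] by simp
  qed
  then have "cmod (D \<phi> - E \<phi>) \<le> 0" by (rule field_le_epsilon) simp
  then show ?thesis by simp
qed

lemma distribution_pairing: "distribution (pairing f)"
  using pairing[of f] by simp

lemma fcoeff_EE: "fcoeff f n = pairing f (EE (- n)) / (2 * of_real pi)"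
proof -
  have "(\<lambda>x. exp (- \<i> * of_int n * of_real x)) = EE (- n)" by (auto simp: EE_def)
  then show ?thesis by (simp add: fcoeff_def)
qed

theorem pdist_eqI:
  assumes "\<And>n. fcoeff f n = fcoeff g n"
  shows "f = g"
proof -
  have "pairing f (EE n) = pairing g (EE n)" for n
    using assms[of "- n"] by (simp add: fcoeff_EE)
  then have "pairing f \<phi> = pairing g \<phi>" if "\<phi> \<in> smooth_periodic" for \<phi>
    by (rule distribution_eqI[OF distribution_pairing distribution_pairing _ that])
  moreover have "pairing h \<phi> = 0" if "\<phi> \<notin> smooth_periodic" for h \<phi>
    using distribution_pairing[of h] that unfolding distribution_def by blast
  ultimately have "pairing f \<phi> = pairing g \<phi>" for \<phi> by metis
  then have "pairing f = pairing g" by (rule ext)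
  then show ?thesis by (simp add: pairing_inject)
qed

lemma fcoeff_minus: "fcoeff (f - g) n = fcoeff f n - fcoeff g n"
  by (simp add: fcoeff_def minus_pdist.rep_eq diff_divide_distrib)

lemma vderivs_cnj:
  assumes "\<phi> \<in> smooth_periodic"
  shows "(vderiv ^^ k) (\<lambda>x. cnj (\<phi> x)) = (\<lambda>x. cnj ((vderiv ^^ k) \<phi> x))"
proof (induction k)
  case (Suc k)
  have "vderiv (\<lambda>x. cnj ((vderiv ^^ k) \<phi> x)) = (\<lambda>x. cnj (vderiv ((vderiv ^^ k) \<phi>) x))"
    by (rule vderiv_eqI) (intro has_vector_derivative_cnj smooth_periodic_deriv smooth_periodic_vderivs assms)
  then show ?case using Suc by simp
qed simp

lemma smooth_periodic_cnj:
  assumes "\<phi> \<in> smooth_periodic"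
  shows "(\<lambda>x. cnj (\<phi> x)) \<in> smooth_periodic"
proof (rule smooth_periodicI)
  show "((vderiv ^^ k) (\<lambda>x. cnj (\<phi> x)) has_vector_derivative cnj (vderiv ((vderiv ^^ k) \<phi>) x)) (at x)" for k x
    unfolding vderivs_cnj[OF assms]
    by (intro has_vector_derivative_cnj smooth_periodic_deriv smooth_periodic_vderivs assms)
qed (simp add: smooth_periodic_period[OF assms])

lemma real_valued_iff: "real_valued f \<longleftrightarrow> (\<forall>n. fcoeff f (- n) = cnj (fcoeff f n))"
proof
  assume r: "real_valued f"
  show "\<forall>n. fcoeff f (- n) = cnj (fcoeff f n)"
  proof
    fix n
    have "pairing f (\<lambda>x. cnj (EE (- n) x)) = cnj (pairing f (EE (- n)))"
      using r smooth_periodic_EE unfolding real_valued_def by blast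
    then show "fcoeff f (- n) = cnj (fcoeff f n)" by (simp add: fcoeff_EE cnj_EE)
  qed
next
  assume c: "\<forall>n. fcoeff f (- n) = cnj (fcoeff f n)"
  \<comment> \<open>The conjugate distribution: it is again a distribution and has the same
    coefficients as \<open>f\<close> under the assumed symmetry, so the two agree.\<close>
  define D where "D = (\<lambda>\<phi>. cnj (pairing f (\<lambda>x. cnj (\<phi> x))))"
  note df = distribution_pairing[of f]
  have cc: "(\<lambda>x. cnj (cnj (\<phi> x))) = \<phi>" for \<phi> :: "real \<Rightarrow> complex" by simp
  have "distribution D"
    unfolding distribution_def
  proof (intro conjI allI impI ballI)
    fix \<phi> :: "real \<Rightarrow> complex" assume "\<phi> \<notin> smooth_periodic"
    then have "(\<lambda>x. cnj (\<phi> x)) \<notin> smooth_periodic" using smooth_periodic_cnj cc by metis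
    then show "D \<phi> = 0" using df by (simp add: D_def distribution_def)
  next
    fix \<phi> \<psi> :: "real \<Rightarrow> complex" and c assume "\<phi> \<in> smooth_periodic" "\<psi> \<in> smooth_periodic"
    then show "D (\<lambda>x. c * \<phi> x + \<psi> x) = c * D \<phi> + D \<psi>"
      using distribution_lin[OF df smooth_periodic_cnj smooth_periodic_cnj, of \<phi> \<psi> "cnj c"] by (simp add: D_def)
  next
    obtain C K where CK: "\<And>\<psi> M. \<psi> \<in> smooth_periodic \<Longrightarrow> \<forall>k\<le>K. \<forall>x. norm ((vderiv ^^ k) \<psi> x) \<le> M \<Longrightarrow> norm (pairing f \<psi>) \<le> C * M"
      using df unfolding distribution_def by blast
    show "\<exists>C N. \<forall>\<phi>\<in>smooth_periodic. \<forall>M. (\<forall>k\<le>N. \<forall>x. norm ((vderiv ^^ k) \<phi> x) \<le> M) \<longrightarrow> norm (D \<phi>) \<le> C * M"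
      by (intro exI[of _ C] exI[of _ K] ballI allI impI) (use CK smooth_periodic_cnj in \<open>auto simp: D_def vderivs_cnj\<close>)
  qed
  moreover have "pairing f (EE n) = D (EE n)" for n
  proof -
    have "pairing f (EE (- (- n))) = cnj (pairing f (EE (- n)))"
      using c[rule_format, of n] by (simp add: fcoeff_EE)
    then show ?thesis by (simp add: D_def cnj_EE)
  qed
  ultimately have eq: "pairing f \<phi> = D \<phi>" if "\<phi> \<in> smooth_periodic" for \<phi>
    using distribution_eqI[OF df] that by blast
  show "real_valued f"
    unfolding real_valued_def
  proof
    fix \<phi> :: "real \<Rightarrow> complex" assume "\<phi> \<in> smooth_periodic"
    then show "pairing f (\<lambda>x. cnj (\<phi> x)) = cnj (pairing f \<phi>)" by (simp add: eq[of \<phi>] D_def)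
  qed
qed

text \<open>The functional is prescribed by Parseval's formula. Bounded coefficients suffice since
  those of a test function are summable, with a bound that uses only its derivatives up to order
  2.\<close>

theorem pdist_of_coeffs:
  assumes C: "\<And>n. cmod (c n) \<le> C"
  obtains f where "\<And>n. fcoeff f n = c n"
proof -
  have C0: "C \<ge> 0" using C[of 0] norm_ge_zero order_trans by blast
  define J where "J = (\<lambda>n :: int. jb (of_int n) powr (- 2))"
  have J: "J summable_on UNIV"
  proof -
    have "integrable (count_space UNIV) J"
      unfolding J_def using nn_integral_int_jb_powr_finite[of 2] by (intro integrableI_nonneg) auto
    then have "Infinite_Set_Sum.abs_summable_on J UNIV" by (simp add: abs_summable_on_def)
    then have "(\<lambda>n. norm (J n)) summable_on UNIV" by (simp only: abs_summable_equivalent[symmetric])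
    then show ?thesis by (simp add: J_def)
  qed
  \<comment> \<open>The pairing carries no conjugation, so \<open>c n\<close> meets the coefficient
    at \<open>- n\<close>.\<close>
  define D where "D = (\<lambda>\<phi>. if \<phi> \<in> smooth_periodic then (\<Sum>\<^sub>\<infinity>n. 2 * pi * (c n * Fc \<phi> (- n))) else 0)"
  have b: "norm (2 * pi * (c n * Fc \<phi> (- n))) \<le> (2 * pi * C * 4 * M) * J n"
    if "\<phi> \<in> smooth_periodic" "\<And>x. cmod (\<phi> x) \<le> M" "\<And>x. cmod (vderiv (vderiv \<phi>) x) \<le> M" for \<phi> M n
  proof -
    have "cmod (c n) * cmod (Fc \<phi> (- n)) \<le> C * (4 * M * jb (of_int (- n)) powr (- 2))"
      by (intro mult_mono C norm_Fc_le_jb that C0) auto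
    then have "(2 * pi) * (cmod (c n) * cmod (Fc \<phi> (- n))) \<le> (2 * pi) * (C * (4 * M * J n))"
      by (intro mult_left_mono) (auto simp: J_def)
    then show ?thesis by (simp add: norm_mult mult_ac)
  qed
  have s: "(\<lambda>n. norm (2 * pi * (c n * Fc \<phi> (- n)))) summable_on UNIV" if \<phi>: "\<phi> \<in> smooth_periodic" for \<phi>
  proof -
    obtain M1 where M1: "\<And>x. cmod (\<phi> x) \<le> M1" using smooth_periodic_bounded[OF \<phi>] by blast
    obtain M2 where M2: "\<And>x. cmod (vderiv (vderiv \<phi>) x) \<le> M2"
      using smooth_periodic_bounded[OF smooth_periodic_vderiv[OF smooth_periodic_vderiv[OF \<phi>]]] by blast
    have M: "cmod (\<phi> x) \<le> max M1 M2" "cmod (vderiv (vderiv \<phi>) x) \<le> max M1 M2" for x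
      using M1[of x] M2[of x] by auto
    show ?thesis
    proof (rule Infinite_Sum.abs_summable_on_comparison_test')
      show "(\<lambda>n. (2 * pi * C * 4 * max M1 M2) * J n) summable_on UNIV" by (rule summable_on_cmult_right[OF J])
    qed (rule b[OF \<phi> M])
  qed
  have "distribution D"
    unfolding distribution_def
  proof (intro conjI allI impI ballI)
    fix \<phi> :: "real \<Rightarrow> complex" assume "\<phi> \<notin> smooth_periodic"
    then show "D \<phi> = 0" by (simp add: D_def)
  next
    fix \<phi> \<psi> :: "real \<Rightarrow> complex" and d assume \<phi>\<psi>: "\<phi> \<in> smooth_periodic" "\<psi> \<in> smooth_periodic"
    have F: "Fc (\<lambda>x. d * \<phi> x + \<psi> x) n = d * Fc \<phi> n + Fc \<psi> n" for n
    proof -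
      have i: "(\<lambda>x. \<phi> x * EE (- n) x) integrable_on {0..2 * pi}" "(\<lambda>x. \<psi> x * EE (- n) x) integrable_on {0..2 * pi}"
        by (intro integrable_Fc continuous_smooth_periodic \<phi>\<psi>)+
      have "integral {0..2 * pi} (\<lambda>x. (d * \<phi> x + \<psi> x) * EE (- n) x) = integral {0..2 * pi} (\<lambda>x. d * (\<phi> x * EE (- n) x) + \<psi> x * EE (- n) x)"
        by (simp add: algebra_simps)
      also have "\<dots> = d * integral {0..2 * pi} (\<lambda>x. \<phi> x * EE (- n) x) + integral {0..2 * pi} (\<lambda>x. \<psi> x * EE (- n) x)"
        by (simp only: Henstock_Kurzweil_Integration.integral_add[OF integrable_on_mult_right[OF i(1)] i(2)] integral_mult_right)
      finally show ?thesis by (simp add: Fc_def add_divide_distrib)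
    qed
    have "(\<Sum>\<^sub>\<infinity>n. 2 * pi * (c n * Fc (\<lambda>x. d * \<phi> x + \<psi> x) (- n))) = (\<Sum>\<^sub>\<infinity>n. d * (2 * pi * (c n * Fc \<phi> (- n))) + 2 * pi * (c n * Fc \<psi> (- n)))"
      unfolding F by (intro infsum_cong) (simp add: algebra_simps)
    also have "\<dots> = (\<Sum>\<^sub>\<infinity>n. d * (2 * pi * (c n * Fc \<phi> (- n)))) + (\<Sum>\<^sub>\<infinity>n. 2 * pi * (c n * Fc \<psi> (- n)))"
      by (rule infsum_add[OF summable_on_cmult_right[OF abs_summable_summable[OF s[OF \<phi>\<psi>(1)]]] abs_summable_summable[OF s[OF \<phi>\<psi>(2)]]])
    also have "(\<Sum>\<^sub>\<infinity>n. d * (2 * pi * (c n * Fc \<phi> (- n)))) = d * (\<Sum>\<^sub>\<infinity>n. 2 * pi * (c n * Fc \<phi> (- n)))"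
      by (rule infsum_cmult_right')
    finally show "D (\<lambda>x. d * \<phi> x + \<psi> x) = d * D \<phi> + D \<psi>"
      using \<phi>\<psi> by (simp add: D_def smooth_periodic_lincomb)
  next
    have "norm (D \<phi>) \<le> (2 * pi * C * 4 * infsum J UNIV) * M"
      if "\<phi> \<in> smooth_periodic" "\<forall>k\<le>2. \<forall>x. norm ((vderiv ^^ k) \<phi> x) \<le> M" for \<phi> M
    proof -
      have M: "cmod (\<phi> x) \<le> M" "cmod (vderiv (vderiv \<phi>) x) \<le> M" for x
        using that(2)[rule_format, of 0 x] that(2)[rule_format, of 2 x] by (simp_all add: numeral_2_eq_2)
      have "norm (\<Sum>\<^sub>\<infinity>n. 2 * pi * (c n * Fc \<phi> (- n))) \<le> (\<Sum>\<^sub>\<infinity>n. (2 * pi * C * 4 * M) * J n)"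
        by (rule norm_infsum_le[OF has_sum_infsum[OF abs_summable_summable[OF s[OF that(1)]]]
          has_sum_infsum[OF summable_on_cmult_right[OF J]] b[OF that(1) M]])
      also have "\<dots> = (2 * pi * C * 4 * M) * infsum J UNIV" by (rule infsum_cmult_right')
      finally show ?thesis using that(1) by (simp add: D_def mult_ac)
    qed
    then show "\<exists>C N. \<forall>\<phi>\<in>smooth_periodic. \<forall>M. (\<forall>k\<le>N. \<forall>x. norm ((vderiv ^^ k) \<phi> x) \<le> M) \<longrightarrow> norm (D \<phi>) \<le> C * M"
      by blast
  qed
  then have p: "pairing (Abs_pdist D) = D" by (simp add: Abs_pdist_inverse)
  have "fcoeff (Abs_pdist D) n = c n" for n
  proof -
    have "D (EE (- n)) = (\<Sum>\<^sub>\<infinity>m. 2 * pi * (c m * (if - m = - n then 1 else 0)))"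
      by (simp only: D_def smooth_periodic_EE if_True Fc_EE)
    also have "\<dots> = (\<Sum>\<^sub>\<infinity>m\<in>{n}. 2 * pi * (c m * (if - m = - n then 1 else 0)))"
      by (rule infsum_cong_neutral) auto
    also have "\<dots> = 2 * pi * c n" by simp
    finally show ?thesis by (simp add: fcoeff_EE p)
  qed
  then show ?thesis by (rule that)
qed

section \<open>Well-posedness\<close>

lemma H_norm_eq_Hn: "H_norm r1 r2 f = Hn r1 r2 (fcoeff f)"
  by (simp add: H_norm_def Hn_def l2norm_def ennreal_mult power_mult_distrib ennreal_power[symmetric])

lemma XT_norm_eq: "XT_norm = local_bourgain_norm omega_u"
  by (simp add: XT_norm_def omega_u_def[abs_def])

lemma XgT_norm_eq: "XgT_norm \<gamma> = local_bourgain_norm (omega_v \<gamma>)"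
  by (simp add: XgT_norm_def omega_v_def[abs_def])

lemma U_symbol_eq: "U_symbol t n = iexp (- t * omega_u n)"
proof -
  have "\<i> * of_real t * (dx_symbol n)\<^sup>2 = \<i> * of_real (- t * omega_u n)"
    by (simp add: dx_symbol_def omega_u_def power_mult_distrib)
  then show ?thesis by (simp only: U_symbol_def)
qed

lemma V_symbol_eq: "V_symbol \<gamma> t n = iexp (- t * omega_v \<gamma> n)"
proof -
  have "of_int (sgn n) * (of_int n)\<^sup>2 = (\<bar>of_int n\<bar> * of_int n :: real)"
    by (cases n "0 :: int" rule: linorder_cases) (auto simp: power2_eq_square)
  then have s: "of_int (sgn n) * (of_int n)\<^sup>2 = complex_of_real (\<bar>of_int n\<bar> * of_int n)"
    by (metis of_real_mult of_real_of_int_eq of_real_power)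
  have "- of_real \<gamma> * of_real t * hilbert_symbol n * (dx_symbol n)\<^sup>2 = - \<i> * of_real \<gamma> * of_real t * (of_int (sgn n) * (of_int n)\<^sup>2)"
    by (simp add: dx_symbol_def hilbert_symbol_def power_mult_distrib)
  also have "\<dots> = \<i> * of_real (- t * omega_v \<gamma> n)"
    unfolding s by (simp add: omega_v_def mult_ac)
  finally show ?thesis by (simp only: V_symbol_def)
qed

section \<open>Profiles and Bourgain norms\<close>

lemma nn_integral_weight_eq_nb:
  fixes h :: "real \<Rightarrow> complex"
  assumes [measurable]: "h \<in> borel_measurable borel" and c: "c \<ge> 0"
  shows "(\<integral>\<^sup>+\<tau>. ennreal ((c * jb (\<tau> + w) powr b * norm (2 * pi * h (\<tau> + w)))\<^sup>2) \<partial>lborel) = (ennreal (2 * pi) * (ennreal c * nb b h))\<^sup>2"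
proof -
  let ?G = "\<lambda>x. ennreal (2 * pi * c) * (ennreal (jb x powr b) * ennreal (cmod (h x)))"
  have n: "norm (2 * pi * h x) = 2 * pi * cmod (h x)" for x by (simp add: norm_mult)
  have "ennreal ((c * jb (\<tau> + w) powr b * norm (2 * pi * h (\<tau> + w)))\<^sup>2) = (?G (\<tau> + w))\<^sup>2" for \<tau>
    unfolding n using c by (simp add: ennreal_power ennreal_mult[symmetric] mult_ac)
  then have "(\<integral>\<^sup>+\<tau>. ennreal ((c * jb (\<tau> + w) powr b * norm (2 * pi * h (\<tau> + w)))\<^sup>2) \<partial>lborel) = (l2norm lborel (\<lambda>\<tau>. ?G (\<tau> + w)))\<^sup>2"
    by (simp add: l2norm_def)
  also have "l2norm lborel (\<lambda>\<tau>. ?G (\<tau> + w)) = l2norm lborel ?G"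
    by (rule l2norm_translate) (simp add: jb_def[abs_def])
  also have "\<dots> = ennreal (2 * pi * c) * nb b h"
    unfolding nb_def Nb_def by (rule l2norm_cmult) (simp add: jb_def[abs_def])
  finally show ?thesis using c by (simp add: ennreal_mult mult.assoc)
qed

text \<open>Translation by the dispersion relation turns the weight into the plain modulation
  weight. The factor is the normalization of the Fourier inversion, which \<open>tf\<close>
  omits.\<close>

lemma weighted_norm_eq_X:
  fixes f :: "int \<Rightarrow> real \<Rightarrow> complex"
  assumes "profile f" and F: "\<And>n \<tau>. F n \<tau> = 2 * pi * f n (\<tau> + \<omega> n)"
  shows "weighted_norm \<omega> r1 r2 b F = ennreal (2 * pi) * X r1 r2 b f"
proof -
  note I = nn_integral_weight_eq_nb[OF profile_borel[OF assms(1)]]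
  have "weighted_norm \<omega> r1 r2 b F = l2norm (count_space UNIV) (\<lambda>n. ennreal (2 * pi) * (ennreal (jb (of_int n) powr r1) * nb b (f n)))
      + (SUP n. ennreal (2 * pi) * (ennreal (jb (of_int n) powr r2) * nb b (f n)))"
    by (simp only: weighted_norm_def F I[OF powr_ge_zero] esqrt_square l2norm_def)
  also have "\<dots> = ennreal (2 * pi) * X r1 r2 b f"
    unfolding X_def distrib_left by (subst l2norm_cmult) (simp_all add: SUP_mult_left_ennreal)
  finally show ?thesis .
qed

text \<open>The free evolution is applied again to recover the actual coefficients. Only times in
  [-T, T] are compared, as a local norm determines nothing else.\<close>

definition realizes :: "(int \<Rightarrow> real) \<Rightarrow> real \<Rightarrow> (int \<Rightarrow> real \<Rightarrow> complex) \<Rightarrow> (real \<Rightarrow> pdist) \<Rightarrow> bool" where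
  "realizes \<omega> T f u \<longleftrightarrow> (\<forall>t\<in>{-T..T}. \<forall>n. fcoeff (u t) n = iexp (- t * \<omega> n) * tf f t n)"

lemma integral_shift_iexp:
  fixes h :: "real \<Rightarrow> complex"
  shows "(\<integral>\<tau>. h (\<tau> + w) * iexp (t * \<tau>) \<partial>lborel) = iexp (- t * w) * (\<integral>x. h x * iexp (t * x) \<partial>lborel)"
proof -
  have "(\<integral>x. h x * iexp (t * (x - w)) \<partial>lborel) = (\<integral>\<tau>. h (w + 1 * \<tau>) * iexp (t * (w + 1 * \<tau> - w)) \<partial>lborel)"
    using lborel_integral_real_affine[of 1 "\<lambda>x. h x * iexp (t * (x - w))" w] by simp
  then have "(\<integral>\<tau>. h (\<tau> + w) * iexp (t * \<tau>) \<partial>lborel) = (\<integral>x. h x * iexp (t * (x - w)) \<partial>lborel)"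
    by (simp add: add.commute)
  also have "\<dots> = (\<integral>x. iexp (- t * w) * (h x * iexp (t * x)) \<partial>lborel)"
  proof (rule Bochner_Integration.integral_cong[OF refl])
    fix x
    have "\<i> * of_real (t * (x - w)) = \<i> * of_real (- t * w) + \<i> * of_real (t * x)" by (simp add: algebra_simps)
    then show "h x * iexp (t * (x - w)) = iexp (- t * w) * (h x * iexp (t * x))"
      by (simp only: exp_add mult_ac)
  qed
  also have "\<dots> = iexp (- t * w) * (\<integral>x. h x * iexp (t * x) \<partial>lborel)"
    by (rule integral_mult_right_zero)
  finally show ?thesis .
qed

text \<open>A finite infimum is undercut by some extension with a finite norm; any such extension
  will do, and no minimizer is required.\<close>

lemma profile_of_local_bourgain_norm:
  assumes "local_bourgain_norm \<omega> r1 r2 b T u < \<infinity>"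
  obtains f where "profile f" "X r1 r2 b f < \<infinity>" "realizes \<omega> T f u"
proof -
  obtain w F where w: "\<And>t. t \<in> {-T..T} \<Longrightarrow> w t = u t" and F: "has_spacetime_fourier w F" "weighted_norm \<omega> r1 r2 b F < \<infinity>"
    using assms unfolding local_bourgain_norm_def bourgain_norm_def INF_less_iff by blast
  define f where "f = (\<lambda>n x. F n (x - \<omega> n) / (2 * pi))"
  have Ff: "F n \<tau> = 2 * pi * f n (\<tau> + \<omega> n)" for n \<tau> by (simp add: f_def)
  have [measurable]: "F n \<in> borel_measurable borel" for n
    using F(1) borel_measurable_integrable unfolding has_spacetime_fourier_def by fastforce
  have p: "profile f" unfolding profile_def f_def by measurable
  have "ennreal (2 * pi) * X r1 r2 b f < \<infinity>" using F(2) unfolding weighted_norm_eq_X[OF p Ff] .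
  then have "X r1 r2 b f < \<infinity>" by (auto simp: ennreal_mult_less_top)
  moreover have "realizes \<omega> T f u"
    unfolding realizes_def
  proof (intro ballI allI)
    fix t n assume t: "t \<in> {-T..T}"
    have "fcoeff (u t) n = (LINT \<tau>|lborel. F n \<tau> * iexp (t * \<tau>)) / (2 * of_real pi)"
      using F(1) w[OF t] unfolding has_spacetime_fourier_def by metis
    also have "(LINT \<tau>|lborel. F n \<tau> * iexp (t * \<tau>)) = (LINT \<tau>|lborel. (2 * pi) * (f n (\<tau> + \<omega> n) * iexp (t * \<tau>)))"
      by (simp only: Ff mult.assoc)
    also have "\<dots> = (2 * pi) * (iexp (- t * \<omega> n) * tf f t n)"
      unfolding tf_def integral_shift_iexp[symmetric] by (rule integral_mult_right_zero)
    finally show "fcoeff (u t) n = iexp (- t * \<omega> n) * tf f t n" by simp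
  qed
  ultimately show ?thesis using that p by blast
qed

text \<open>For \<open>r2 \<ge> 0\<close> the supremum part of the norm bounds the coefficients
  uniformly in frequency and time, so at each time they are those of a distribution.\<close>

lemma path_of_profile:
  assumes b: "b > 1/2" and r2: "r2 \<ge> 0" and f: "profile f" "X r1 r2 b f < \<infinity>"
  obtains w where "\<And>T. realizes \<omega> T f w" "bourgain_norm \<omega> r1 r2 b w \<le> ennreal (2 * pi) * X r1 r2 b f"
proof -
  have int: "integrable lborel (f n)" for n
    by (rule integrable_of_nb[OF b profile_borel[OF f(1)] nb_finite[OF f(2)]])
  obtain C where C: "C > 0" "\<And>f r1 r2 t n. profile f \<Longrightarrow> ennreal (cmod (tf f t n)) \<le> ennreal (C * jb (of_int n) powr (- r2)) * X r1 r2 b f"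
    using tf_bound[OF b] by blast
  obtain K where K: "K \<ge> 0" "X r1 r2 b f = ennreal K"
    using f(2) by (cases "X r1 r2 b f") auto
  have bd: "cmod (iexp (- t * \<omega> n) * tf f t n) \<le> C * K" for t n
  proof -
    have "jb (of_int n) powr (- r2) \<le> jb (of_int n) powr 0" using r2 by (intro powr_mono) auto
    then have "C * jb (of_int n) powr (- r2) \<le> C" using C(1) jb_ge_1[of "of_int n"] by (simp add: mult_le_cancel_left1)
    then have "ennreal (C * jb (of_int n) powr (- r2)) * X r1 r2 b f \<le> ennreal C * ennreal K"
      unfolding K(2) by (intro mult_right_mono ennreal_leI) auto
    also have "\<dots> = ennreal (C * K)" using C(1) K(1) by (simp add: ennreal_mult)
    finally have "ennreal (cmod (tf f t n)) \<le> ennreal (C * K)" using C(2)[OF f(1)] order_trans by blast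
    then have "cmod (tf f t n) \<le> C * K" using C(1) K(1) by (simp add: ennreal_le_iff)
    then show ?thesis by (simp only: norm_mult cmod_iexp mult_1_left)
  qed
  have "\<forall>t. \<exists>w. \<forall>n. fcoeff w n = iexp (- t * \<omega> n) * tf f t n"
  proof
    fix t
    obtain w where "\<And>n. fcoeff w n = iexp (- t * \<omega> n) * tf f t n"
      using pdist_of_coeffs[of "\<lambda>n. iexp (- t * \<omega> n) * tf f t n", OF bd] by blast
    then show "\<exists>w. \<forall>n. fcoeff w n = iexp (- t * \<omega> n) * tf f t n" by blast
  qed
  then obtain w where w: "\<And>t n. fcoeff (w t) n = iexp (- t * \<omega> n) * tf f t n" by metis
  define F where "F = (\<lambda>n \<tau>. 2 * pi * f n (\<tau> + \<omega> n))"
  have "has_spacetime_fourier w F"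
    unfolding has_spacetime_fourier_def
  proof (intro conjI allI)
    fix n
    have "integrable lborel (\<lambda>\<tau>. f n (\<omega> n + 1 * \<tau>))" by (rule lborel_integrable_real_affine[OF int]) simp
    then show "integrable lborel (F n)" unfolding F_def by (simp add: add.commute)
  next
    fix t n
    have "(LINT \<tau>|lborel. F n \<tau> * iexp (t * \<tau>)) = (LINT \<tau>|lborel. (2 * pi) * (f n (\<tau> + \<omega> n) * iexp (t * \<tau>)))"
      by (simp only: F_def mult.assoc)
    also have "\<dots> = (2 * pi) * (iexp (- t * \<omega> n) * tf f t n)"
      unfolding tf_def integral_shift_iexp[symmetric] by (rule integral_mult_right_zero)
    finally show "fcoeff (w t) n = (LINT \<tau>|lborel. F n \<tau> * iexp (t * \<tau>)) / (2 * of_real pi)"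
      by (simp add: w)
  qed
  then have "bourgain_norm \<omega> r1 r2 b w \<le> weighted_norm \<omega> r1 r2 b F"
    unfolding bourgain_norm_def by (intro INF_lower) simp
  then have "bourgain_norm \<omega> r1 r2 b w \<le> ennreal (2 * pi) * X r1 r2 b f"
    using weighted_norm_eq_X[OF f(1), of F \<omega>] by (simp add: F_def)
  moreover have "realizes \<omega> T f w" for T by (simp only: realizes_def w) simp
  ultimately show ?thesis using that by blast
qed

text \<open>The path of the profile is defined for all times and agrees with \<open>u\<close> on
  [-T, T] because distributions are determined by their coefficients; hence it is an admissible
  extension.\<close>

lemma local_bourgain_norm_le_X:
  assumes b: "b > 1/2" and r2: "r2 \<ge> 0" and f: "profile f" "X r1 r2 b f < \<infinity>" and u: "realizes \<omega> T f u"
  shows "local_bourgain_norm \<omega> r1 r2 b T u \<le> ennreal (2 * pi) * X r1 r2 b f"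
proof -
  obtain w where w: "\<And>T. realizes \<omega> T f w" "bourgain_norm \<omega> r1 r2 b w \<le> ennreal (2 * pi) * X r1 r2 b f"
    using path_of_profile[OF assms(1-4)] by metis
  have "w t = u t" if "t \<in> {-T..T}" for t
    by (rule pdist_eqI) (use w(1)[of T] u that in \<open>simp add: realizes_def\<close>)
  then have "local_bourgain_norm \<omega> r1 r2 b T u \<le> bourgain_norm \<omega> r1 r2 b w"
    unfolding local_bourgain_norm_def by (intro INF_lower) simp
  then show ?thesis using w(2) by (rule order_trans)
qed

section \<open>The Duhamel equations in terms of profiles\<close>

lemma conv_conj_coeff: "conv a (conj_coeff a) (- n) = cnj (conv a (conj_coeff a) n)"
proof -
  have "conv a (conj_coeff a) (- n) = (\<Sum>\<^sub>\<infinity>k. a (- n - (k - n)) * cnj (a (- (k - n))))"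
    unfolding conv_def conj_coeff_def
    by (rule infsum_reindex_bij_betw[symmetric]) (rule bij_betwI[where g = "\<lambda>k. k + n"], auto)
  also have "\<dots> = (\<Sum>\<^sub>\<infinity>k. cnj (a (n - k) * conj_coeff a k))"
    by (intro infsum_cong) (simp add: conj_coeff_def)
  also have "\<dots> = cnj (conv a (conj_coeff a) n)" unfolding conv_def by (rule infsum_cnj)
  finally show ?thesis .
qed

lemma interval_integrable_cong_Icc:
  fixes h k :: "real \<Rightarrow> complex"
  assumes "\<And>s. s \<in> {-T..T} \<Longrightarrow> h s = k s" "t \<in> {-T..T}"
  shows "interval_lebesgue_integrable lborel (ereal 0) (ereal t) h \<longleftrightarrow> interval_lebesgue_integrable lborel (ereal 0) (ereal t) k"
proof -
  have "set_integrable lborel A h \<longleftrightarrow> set_integrable lborel A k" if "A \<subseteq> {-T..T}" for A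
    by (rule set_integrable_cong) (use that assms(1) in auto)
  then show ?thesis unfolding interval_lebesgue_integrable_def using assms(2) by (simp add: subset_iff)
qed

lemma interval_integral_cnj:
  fixes h :: "real \<Rightarrow> complex"
  shows "(LBINT s=a..b. cnj (h s)) = cnj (LBINT s=a..b. h s)"
proof -
  have "r *\<^sub>R cnj z = cnj (r *\<^sub>R z)" for r z by (simp add: complex_eq_iff)
  then show ?thesis
    by (simp only: interval_lebesgue_integral_def set_lebesgue_integral_def Bochner_Integration.integral_cnj complex_cnj_minus if_distrib[of cnj])
qed

text \<open>The propagator from \<open>s\<close> to \<open>t\<close> meets the free evolution up to
  \<open>s\<close> contained in the nonlinear term; their product no longer depends on
  \<open>s\<close> and leaves the integral.\<close>

lemma duhamel_profile:
  fixes N q :: "real \<Rightarrow> complex"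
  assumes N: "\<And>s. s \<in> {-T..T} \<Longrightarrow> N s = iexp (- s * w) * q s" and q: "continuous_on UNIV q"
    and t: "t \<in> {-T..T}"
  shows "interval_lebesgue_integrable lborel (ereal 0) (ereal t) (\<lambda>s. iexp (- (t - s) * w) * N s)"
    and "(LBINT s=ereal 0..ereal t. iexp (- (t - s) * w) * N s) = iexp (- t * w) * (LBINT s=ereal 0..ereal t. q s)"
proof -
  have eq: "iexp (- (t - s) * w) * N s = iexp (- t * w) * q s" if "s \<in> {-T..T}" for s
  proof -
    have "\<i> * of_real (- t * w) = \<i> * of_real (- (t - s) * w) + \<i> * of_real (- s * w)" by (simp add: algebra_simps)
    then show ?thesis unfolding N[OF that] by (simp only: exp_add mult.assoc)
  qed
  show "interval_lebesgue_integrable lborel (ereal 0) (ereal t) (\<lambda>s. iexp (- (t - s) * w) * N s)"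
    by (subst interval_integrable_cong_Icc[OF eq t]) (auto intro!: interval_integrable_continuous continuous_intros q)
  show "(LBINT s=ereal 0..ereal t. iexp (- (t - s) * w) * N s) = iexp (- t * w) * (LBINT s=ereal 0..ereal t. q s)"
    by (rule trans[OF interval_integral_cong_Icc[OF eq t] interval_lebesgue_integral_mult_right])
qed

context sbo
begin

abbreviation "sol \<equiv> SBO_solution \<alpha> \<beta> \<gamma> s1 s2 b"

lemma continuous_osc_u:
  assumes "profile f" "profile g" "XU f < \<infinity>" "XV g < \<infinity>"
  shows "continuous_on A (osc (phase_u \<gamma>) f g n)"
  by (rule continuous_osc[OF interaction_u[OF assms]])

lemma continuous_osc_v:
  assumes "profile f" "XU f < \<infinity>"
  shows "continuous_on A (osc (phase_v \<gamma>) f (conj_profile f) n)"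
  by (rule continuous_osc[OF interaction_v[OF assms(1,1,2,2)]])

lemma conv_u:
  assumes fg: "profile f" "profile g" "XU f < \<infinity>" "XV g < \<infinity>"
    and u: "realizes omega_u T f u" and v: "realizes (omega_v \<gamma>) T g v" and s: "s \<in> {-T..T}"
  shows "conv_summable (fcoeff (u s)) (fcoeff (v s))"
    and "conv (fcoeff (u s)) (fcoeff (v s)) n = iexp (- s * omega_u n) * osc (phase_u \<gamma>) f g n s"
proof -
  have e: "fcoeff (u s) = (\<lambda>m. iexp (- s * omega_u m) * tf f s m)"
    "fcoeff (v s) = (\<lambda>m. iexp (- s * omega_v \<gamma> m) * tf g s m)"
    using u v s by (auto simp: realizes_def fun_eq_iff)
  note i = interaction_u[OF fg] integrable_of_X[OF fg(1,3)] integrable_of_X[OF fg(2,4)] phase_u_eq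
  show "conv_summable (fcoeff (u s)) (fcoeff (v s))"
    unfolding conv_summable_def e by (intro allI conv_profiles_summable[where \<Psi> = "phase_u \<gamma>" and \<omega> = omega_u] i)
  show "conv (fcoeff (u s)) (fcoeff (v s)) n = iexp (- s * omega_u n) * osc (phase_u \<gamma>) f g n s"
    unfolding e by (intro conv_profiles i)
qed

lemma conv_v:
  assumes f: "profile f" "XU f < \<infinity>"
    and u: "realizes omega_u T f u" and s: "s \<in> {-T..T}"
  shows "conv_summable (fcoeff (u s)) (conj_coeff (fcoeff (u s)))"
    and "conv (fcoeff (u s)) (conj_coeff (fcoeff (u s))) n = iexp (- s * omega_v \<gamma> n) * osc (phase_v \<gamma>) f (conj_profile f) n s"
proof -
  have e: "fcoeff (u s) = (\<lambda>m. iexp (- s * omega_u m) * tf f s m)"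
    using u s by (auto simp: realizes_def fun_eq_iff)
  have o: "omega_u (- m) = omega_u m" for m by (simp add: omega_u_def)
  have "cnj (iexp r) = iexp (- r)" for r by (simp add: exp_cnj)
  moreover have "- (- s * r) = - s * - r" for r by simp
  ultimately have c: "conj_coeff (fcoeff (u s)) = (\<lambda>m. iexp (- s * - omega_u m) * tf (conj_profile f) s m)"
    unfolding e fun_eq_iff conj_coeff_def complex_cnj_mult tf_conj_profile o by (simp only:) simp
  have "X s1 s2 b (conj_profile f) < \<infinity>" using X_conj_profile[OF f(1)] f(2) by simp
  note i = interaction_v[OF f(1,1,2,2)] integrable_of_X[OF f] integrable_of_X[OF profile_conj[OF f(1)] this] phase_v_eq
  show "conv_summable (fcoeff (u s)) (conj_coeff (fcoeff (u s)))"
    unfolding c unfolding conv_summable_def e by (intro allI conv_profiles_summable[where \<Psi> = "phase_v \<gamma>" and \<omega> = "omega_v \<gamma>" and ?\<omega>1.0 = omega_u and ?\<omega>2.0 = "\<lambda>k. - omega_u k"] i)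
  show "conv (fcoeff (u s)) (conj_coeff (fcoeff (u s))) n = iexp (- s * omega_v \<gamma> n) * osc (phase_v \<gamma>) f (conj_profile f) n s"
    unfolding c unfolding e by (intro conv_profiles[where ?\<omega>2.0 = "\<lambda>k. - omega_u k"] i)
qed

text \<open>The summability and integrability clauses of the Duhamel equations hold automatically
  for realized profiles, so only the identities remain, and there the unimodular factor of the free
  evolution cancels.\<close>

lemma duhamel_iff_psol:
  assumes fg: "profile f" "profile g" "XU f < \<infinity>" "XV g < \<infinity>"
    and u: "realizes omega_u T f u" and v: "realizes (omega_v \<gamma>) T g v"
  shows "duhamel_u \<alpha> T u0 u v \<and> duhamel_v \<beta> \<gamma> T v0 u v \<longleftrightarrow> psol T (fcoeff u0) (fcoeff v0) f g"
proof -
  have U: "interval_lebesgue_integrable lborel (ereal 0) (ereal t) (\<lambda>t'. U_symbol (t - t') n * conv (fcoeff (u t')) (fcoeff (v t')) n) \<and>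
      (fcoeff (u t) n = U_symbol t n * fcoeff u0 n
          - \<i> * of_real \<alpha> * (LBINT t'=ereal 0..ereal t. U_symbol (t - t') n * conv (fcoeff (u t')) (fcoeff (v t')) n) \<longleftrightarrow>
        tf f t n = fcoeff u0 n + (- \<i> * of_real \<alpha>) * (LBINT s=ereal 0..ereal t. osc (phase_u \<gamma>) f g n s))"
    if t: "t \<in> {-T..T}" for t n
  proof
    note D = duhamel_profile[OF conv_u(2)[OF fg u v] continuous_osc_u[OF fg] t, of n]
    show "interval_lebesgue_integrable lborel (ereal 0) (ereal t) (\<lambda>t'. U_symbol (t - t') n * conv (fcoeff (u t')) (fcoeff (v t')) n)"
      unfolding U_symbol_eq by (rule D(1))
    have I: "(LBINT t'=ereal 0..ereal t. U_symbol (t - t') n * conv (fcoeff (u t')) (fcoeff (v t')) n)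
       = U_symbol t n * (LBINT s=ereal 0..ereal t. osc (phase_u \<gamma>) f g n s)"
      unfolding U_symbol_eq by (rule D(2))
    have "U_symbol t n * fcoeff u0 n - \<i> * of_real \<alpha> * (LBINT t'=ereal 0..ereal t. U_symbol (t - t') n * conv (fcoeff (u t')) (fcoeff (v t')) n)
      = iexp (- t * omega_u n) * (fcoeff u0 n + (- \<i> * of_real \<alpha>) * (LBINT s=ereal 0..ereal t. osc (phase_u \<gamma>) f g n s))"
      unfolding I by (simp add: U_symbol_eq algebra_simps)
    moreover have "fcoeff (u t) n = iexp (- t * omega_u n) * tf f t n" using u t by (simp only: realizes_def)
    ultimately show "fcoeff (u t) n = U_symbol t n * fcoeff u0 n
          - \<i> * of_real \<alpha> * (LBINT t'=ereal 0..ereal t. U_symbol (t - t') n * conv (fcoeff (u t')) (fcoeff (v t')) n) \<longleftrightarrow>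
        tf f t n = fcoeff u0 n + (- \<i> * of_real \<alpha>) * (LBINT s=ereal 0..ereal t. osc (phase_u \<gamma>) f g n s)"
      by (simp only: mult_cancel_left exp_not_eq_zero) simp
  qed
  have V: "interval_lebesgue_integrable lborel (ereal 0) (ereal t) (\<lambda>t'. V_symbol \<gamma> (t - t') n * (dx_symbol n * conv (fcoeff (u t')) (conj_coeff (fcoeff (u t'))) n)) \<and>
      (fcoeff (v t) n = V_symbol \<gamma> t n * fcoeff v0 n
          + of_real \<beta> * (LBINT t'=ereal 0..ereal t. V_symbol \<gamma> (t - t') n * (dx_symbol n * conv (fcoeff (u t')) (conj_coeff (fcoeff (u t'))) n)) \<longleftrightarrow>
        tf g t n = fcoeff v0 n + ((of_real \<beta> * \<i>) * of_int n) * (LBINT s=ereal 0..ereal t. osc (phase_v \<gamma>) f (conj_profile f) n s))"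
    if t: "t \<in> {-T..T}" for t n
  proof
    have N: "dx_symbol n * conv (fcoeff (u s)) (conj_coeff (fcoeff (u s))) n
       = iexp (- s * omega_v \<gamma> n) * (dx_symbol n * osc (phase_v \<gamma>) f (conj_profile f) n s)" if "s \<in> {-T..T}" for s
      unfolding conv_v(2)[OF fg(1,3) u that] by (rule mult.left_commute)
    note D = duhamel_profile[OF N continuous_on_mult[OF continuous_on_const continuous_osc_v[OF fg(1,3)]] t]
    show "interval_lebesgue_integrable lborel (ereal 0) (ereal t) (\<lambda>t'. V_symbol \<gamma> (t - t') n * (dx_symbol n * conv (fcoeff (u t')) (conj_coeff (fcoeff (u t'))) n))"
      unfolding V_symbol_eq by (rule D(1))
    have "(LBINT t'=ereal 0..ereal t. V_symbol \<gamma> (t - t') n * (dx_symbol n * conv (fcoeff (u t')) (conj_coeff (fcoeff (u t'))) n))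
       = V_symbol \<gamma> t n * (LBINT s=ereal 0..ereal t. dx_symbol n * osc (phase_v \<gamma>) f (conj_profile f) n s)"
      unfolding V_symbol_eq by (rule D(2))
    note I = this[unfolded interval_lebesgue_integral_mult_right]
    have "V_symbol \<gamma> t n * fcoeff v0 n
          + of_real \<beta> * (LBINT t'=ereal 0..ereal t. V_symbol \<gamma> (t - t') n * (dx_symbol n * conv (fcoeff (u t')) (conj_coeff (fcoeff (u t'))) n))
      = iexp (- t * omega_v \<gamma> n) * (fcoeff v0 n + ((of_real \<beta> * \<i>) * of_int n) * (LBINT s=ereal 0..ereal t. osc (phase_v \<gamma>) f (conj_profile f) n s))"
      unfolding I by (simp add: V_symbol_eq dx_symbol_def algebra_simps)
    moreover have "fcoeff (v t) n = iexp (- t * omega_v \<gamma> n) * tf g t n" using v t by (simp only: realizes_def)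
    ultimately show "fcoeff (v t) n = V_symbol \<gamma> t n * fcoeff v0 n
          + of_real \<beta> * (LBINT t'=ereal 0..ereal t. V_symbol \<gamma> (t - t') n * (dx_symbol n * conv (fcoeff (u t')) (conj_coeff (fcoeff (u t'))) n)) \<longleftrightarrow>
        tf g t n = fcoeff v0 n + ((of_real \<beta> * \<i>) * of_int n) * (LBINT s=ereal 0..ereal t. osc (phase_v \<gamma>) f (conj_profile f) n s)"
      by (simp only: mult_cancel_left exp_not_eq_zero) simp
  qed
  show ?thesis
    unfolding duhamel_u_def duhamel_v_def psol_def
    using U V conv_u(1)[OF fg u v] conv_v(1)[OF fg(1,3) u] fg by blast
qed

text \<open>Reality is read off the Duhamel formula: the squared modulus of \<open>u\<close> is
  real, the dispersion relation of \<open>v\<close> is odd in the frequency, and the derivative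
  respects the symmetry of the coefficients.\<close>

lemma real_valued_psol:
  assumes s: "psol T (fcoeff u0) (fcoeff v0) f g" and v0: "real_valued v0" and v: "realizes (omega_v \<gamma>) T g v" and t: "t \<in> {-T..T}"
  shows "real_valued (v t)"
proof -
  note p = psolD[OF s]
  \<comment> \<open>A path for all times, built from \<open>f\<close> alone, so that the symmetry of
    the convolution is available at every \<open>s\<close> and not just on [-T, T].\<close>
  obtain w where w: "\<And>T. realizes omega_u T f w"
    using path_of_profile[OF b(1) _ p(1,3)] s2 by (metis less_eq_real_def less_trans zero_less_divide_iff zero_less_numeral)
  have o: "omega_v \<gamma> (- n) = - omega_v \<gamma> n" for n by (simp add: omega_v_def)
  have cn: "cnj (iexp r) = iexp (- r)" for r by (simp add: exp_cnj)
  have osc: "osc (phase_v \<gamma>) f (conj_profile f) (- n) s = cnj (osc (phase_v \<gamma>) f (conj_profile f) n s)" for n s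
  proof -
    have s: "s \<in> {-\<bar>s\<bar>..\<bar>s\<bar>}" by auto
    note c = conv_v(2)[OF p(1,3) w s]
    have "iexp (- s * - omega_v \<gamma> n) * osc (phase_v \<gamma>) f (conj_profile f) (- n) s = cnj (iexp (- s * omega_v \<gamma> n) * osc (phase_v \<gamma>) f (conj_profile f) n s)"
      using conv_conj_coeff[of "fcoeff (w s)" n] unfolding c o .
    also have "\<dots> = iexp (- s * - omega_v \<gamma> n) * cnj (osc (phase_v \<gamma>) f (conj_profile f) n s)"
      by (simp only: complex_cnj_mult cn) simp
    finally show ?thesis by (simp only: mult_cancel_left exp_not_eq_zero) simp
  qed
  have "fcoeff (v t) (- n) = cnj (fcoeff (v t) n)" for n
  proof -
    have "tf g t (- n) = cnj (tf g t n)"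
      using v0 unfolding p(6)[OF t] osc interval_integral_cnj real_valued_iff by simp
    moreover have "fcoeff (v t) m = iexp (- t * omega_v \<gamma> m) * tf g t m" for m
      using v t by (simp only: realizes_def)
    ultimately show ?thesis by (simp only: complex_cnj_mult cn o) simp
  qed
  then show ?thesis by (simp add: real_valued_iff)
qed

lemma sol_profiles:
  assumes "sol T u0 v0 u v"
  obtains f g where "psol T (fcoeff u0) (fcoeff v0) f g" "realizes omega_u T f u" "realizes (omega_v \<gamma>) T g v"
proof -
  obtain f where f: "profile f" "XU f < \<infinity>" "realizes omega_u T f u"
    using assms profile_of_local_bourgain_norm[of "omega_u" s1 s2 b T u thesis]
    unfolding SBO_solution_def XT_norm_eq by blast
  obtain g where g: "profile g" "XV g < \<infinity>" "realizes (omega_v \<gamma>) T g v"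
    using assms profile_of_local_bourgain_norm[of "omega_v \<gamma>" "s1 - 1/2" "s2 - 1/2" b T v thesis]
    unfolding SBO_solution_def XgT_norm_eq by blast
  have "psol T (fcoeff u0) (fcoeff v0) f g"
    using assms duhamel_iff_psol[OF f(1) g(1) f(2) g(2) f(3) g(3)] unfolding SBO_solution_def by blast
  then show ?thesis using that f(3) g(3) by blast
qed

lemma XT_le:
  assumes "profile f" "XU f < \<infinity>" "realizes omega_u T f u"
  shows "XT_norm s1 s2 b T u \<le> ennreal (2 * pi) * XU f"
  unfolding XT_norm_eq
  using s2 by (intro local_bourgain_norm_le_X b assms) simp

lemma XgT_le:
  assumes "profile g" "XV g < \<infinity>" "realizes (omega_v \<gamma>) T g v"
  shows "XgT_norm \<gamma> (s1 - 1/2) (s2 - 1/2) b T v \<le> ennreal (2 * pi) * XV g"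
  unfolding XgT_norm_eq
  using s2 by (intro local_bourgain_norm_le_X b assms) simp

lemma sol_of_psol:
  assumes s: "psol T (fcoeff u0) (fcoeff v0) f g" and v0: "real_valued v0"
    and r: "realizes omega_u T f u" "realizes (omega_v \<gamma>) T g v"
  shows "sol T u0 v0 u v"
proof -
  note p = psolD[OF s]
  have "XT_norm s1 s2 b T u < \<infinity>" "XgT_norm \<gamma> (s1 - 1/2) (s2 - 1/2) b T v < \<infinity>"
    using XT_le[OF p(1,3) r(1)] XgT_le[OF p(2,4) r(2)] p(3,4)
    by (auto intro: le_less_trans simp: ennreal_mult_less_top)
  then show ?thesis
    unfolding SBO_solution_def
    using duhamel_iff_psol[OF p(1-4) r] s real_valued_psol[OF s v0 r(2)] by blast
qed

lemma data_norm_eq: "data_norm s1 s2 u0 v0 = HU (fcoeff u0) + HV (fcoeff v0)"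
  by (simp add: data_norm_def H_norm_eq_Hn)

lemma sol_unique:
  assumes "T > 0" "sol T u0 v0 u v" "sol T u0 v0 u' v'" "t \<in> {-T..T}"
  shows "u' t = u t \<and> v' t = v t"
proof -
  obtain f g where fg: "psol T (fcoeff u0) (fcoeff v0) f g" "realizes omega_u T f u" "realizes (omega_v \<gamma>) T g v"
    using sol_profiles[OF assms(2)] by blast
  obtain f' g' where fg': "psol T (fcoeff u0) (fcoeff v0) f' g'" "realizes omega_u T f' u'" "realizes (omega_v \<gamma>) T g' v'"
    using sol_profiles[OF assms(3)] by blast
  note eq = global_uniqueness[OF assms(1) fg(1) fg'(1) assms(4)]
  show ?thesis
    using eq fg(2,3) fg'(2,3) assms(4) by (auto intro!: pdist_eqI simp: realizes_def)
qed

theorem locally_well_posed: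
  assumes R: "R > 0"
  shows "\<exists>T>0.
      (\<forall>u0 v0. real_valued v0 \<and> data_norm s1 s2 u0 v0 \<le> ennreal R \<longrightarrow>
        (\<exists>u v. sol T u0 v0 u v \<and>
          (\<forall>u' v'. sol T u0 v0 u' v' \<longrightarrow> (\<forall>t\<in>{-T..T}. u' t = u t \<and> v' t = v t)))) \<and>
      (\<forall>u0 v0 u v. real_valued v0 \<and> data_norm s1 s2 u0 v0 \<le> ennreal R \<and> sol T u0 v0 u v \<longrightarrow>
        (\<forall>\<epsilon>>0. \<exists>\<delta>>0. \<forall>u0' v0' u' v'.
          real_valued v0' \<and> data_norm s1 s2 u0' v0' \<le> ennreal R \<and> sol T u0' v0' u' v' \<and>
          data_norm s1 s2 (u0' - u0) (v0' - v0) < ennreal \<delta> \<longrightarrow>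
          XT_norm s1 s2 b T (\<lambda>t. u' t - u t) +
            XgT_norm \<gamma> (s1 - 1/2) (s2 - 1/2) b T (\<lambda>t. v' t - v t) < ennreal \<epsilon>))"
proof -
  \<comment> \<open>Twice the bound for the free evolution, since \<open>Phi_bound\<close> reserves
    half of the ball for the data.\<close>
  define \<rho> where "\<rho> = 2 * (LL * R)"
  have \<rho>: "\<rho> > 0" using LL(1) R by (simp add: \<rho>_def)
  \<comment> \<open>The time depends on the data only through \<open>R\<close>; it is common to
    existence, uniqueness and continuity.\<close>
  obtain T where T: "0 < T" "T \<le> 1" and sm: "6 * (CB * T powr (9/16 - b)) * \<rho> \<le> 1"
    using small_time[OF \<rho>] by (metis order_refl)
  have fp: "\<exists>f g. profile f \<and> profile g \<and> XU f + XV g \<le> ennreal \<rho> \<and>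
      XU (pdiff (PU T (fcoeff u0) f g) f) = 0 \<and> XV (pdiff (PV T (fcoeff v0) f) g) = 0 \<and>
      psol T (fcoeff u0) (fcoeff v0) f g"
    if "data_norm s1 s2 u0 v0 \<le> ennreal R" for u0 v0
  proof -
    have "ennreal LL * (HU (fcoeff u0) + HV (fcoeff v0)) \<le> ennreal LL * ennreal R"
      using that unfolding data_norm_eq by (rule mult_left_mono) simp
    also have "\<dots> = ennreal (\<rho> / 2)" using LL(1) R by (simp add: \<rho>_def ennreal_mult)
    finally have data: "ennreal LL * (HU (fcoeff u0) + HV (fcoeff v0)) \<le> ennreal (\<rho> / 2)" .
    obtain f g where fg: "profile f" "profile g" "XU f + XV g \<le> ennreal \<rho>"
      "XU (pdiff (PU T (fcoeff u0) f g) f) = 0" "XV (pdiff (PV T (fcoeff v0) f) g) = 0"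
      by (rule fixed_point[OF T \<rho> sm data])
    have "XU f + XV g < \<infinity>" using fg(3) by (rule le_less_trans) simp
    then have "XU f < \<infinity>" "XV g < \<infinity>" by (auto simp: ennreal_add_less_top)
    with fg fixed_point_psol[OF T fg(1,2) _ _ fg(4,5)] show ?thesis by blast
  qed
  \<comment> \<open>By uniqueness every solution, of whatever size, is realized by any profiles
    solving the equations with its data, in particular by the small fixed point. This extends the
    Lipschitz bound to all solutions.\<close>
  have sol_realizes: "realizes omega_u T f u \<and> realizes (omega_v \<gamma>) T g v"
    if s: "sol T u0 v0 u v" and s': "psol T (fcoeff u0) (fcoeff v0) f g" for u0 v0 u v f g
  proof -
    obtain f' g' where fg': "psol T (fcoeff u0) (fcoeff v0) f' g'" "realizes omega_u T f' u" "realizes (omega_v \<gamma>) T g' v"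
      using sol_profiles[OF s] by blast
    with global_uniqueness[OF T(1) s' fg'(1)] show ?thesis by (simp add: realizes_def)
  qed
  have ex: "\<exists>u v. sol T u0 v0 u v" if v0: "real_valued v0" and R: "data_norm s1 s2 u0 v0 \<le> ennreal R" for u0 v0
  proof -
    obtain f g where s: "psol T (fcoeff u0) (fcoeff v0) f g" using fp[OF R] by blast
    note p = psolD[OF s]
    have "0 \<le> s2" "0 \<le> s2 - 1/2" using s2 by auto
    obtain u where u: "\<And>T. realizes omega_u T f u" using path_of_profile[OF b(1) \<open>0 \<le> s2\<close> p(1,3)] by metis
    obtain v where v: "\<And>T. realizes (omega_v \<gamma>) T g v" using path_of_profile[OF b(1) \<open>0 \<le> s2 - 1/2\<close> p(2,4)] by metis
    show ?thesis using sol_of_psol[OF s v0 u v] by blast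
  qed
  \<comment> \<open>The factor \<open>2 * pi\<close> passes from profiles to Bourgain norms, and
    \<open>2 * LL\<close> is the Lipschitz constant of the fixed point.\<close>
  define K where "K = 2 * pi * (2 * LL)"
  have K: "K > 0" using LL(1) by (simp add: K_def)
  have lip: "XT_norm s1 s2 b T (\<lambda>t. u' t - u t) + XgT_norm \<gamma> (s1 - 1/2) (s2 - 1/2) b T (\<lambda>t. v' t - v t)
      \<le> ennreal K * data_norm s1 s2 (u0' - u0) (v0' - v0)"
    if d: "data_norm s1 s2 u0 v0 \<le> ennreal R" "data_norm s1 s2 u0' v0' \<le> ennreal R"
      and s: "sol T u0 v0 u v" "sol T u0' v0' u' v'" for u0 v0 u v u0' v0' u' v'
  proof -
    obtain f g where fg: "profile f" "profile g" "XU f + XV g \<le> ennreal \<rho>"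
      "XU (pdiff (PU T (fcoeff u0) f g) f) = 0" "XV (pdiff (PV T (fcoeff v0) f) g) = 0"
      "psol T (fcoeff u0) (fcoeff v0) f g" using fp[OF d(1)] by blast
    obtain f' g' where fg': "profile f'" "profile g'" "XU f' + XV g' \<le> ennreal \<rho>"
      "XU (pdiff (PU T (fcoeff u0') f' g') f') = 0" "XV (pdiff (PV T (fcoeff v0') f') g') = 0"
      "psol T (fcoeff u0') (fcoeff v0') f' g'" using fp[OF d(2)] by blast
    note p = psolD[OF fg(6)] and p' = psolD[OF fg'(6)]
    have fin: "XU (pdiff f' f) < \<infinity>" "XV (pdiff g' g) < \<infinity>"
      using p(3,4) p'(3,4) le_less_trans[OF X_pdiff_le[OF p'(1) p(1)]] le_less_trans[OF X_pdiff_le[OF p'(2) p(2)]]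
      by (auto simp: ennreal_add_less_top)
    have tfd: "tf (pdiff f' f) t n = tf f' t n - tf f t n" "tf (pdiff g' g) t n = tf g' t n - tf g t n" for t n
      by (rule tf_diff[OF integrable_of_X[OF p'(1,3)] integrable_of_X[OF p(1,3)]],
        rule tf_diff[OF integrable_of_X[OF p'(2,4)] integrable_of_X[OF p(2,4)]])
    have r: "realizes omega_u T (pdiff f' f) (\<lambda>t. u' t - u t)" "realizes (omega_v \<gamma>) T (pdiff g' g) (\<lambda>t. v' t - v t)"
      using sol_realizes[OF s(1) fg(6)] sol_realizes[OF s(2) fg'(6)]
      by (simp_all add: realizes_def fcoeff_minus tfd right_diff_distrib)
    have "XT_norm s1 s2 b T (\<lambda>t. u' t - u t) + XgT_norm \<gamma> (s1 - 1/2) (s2 - 1/2) b T (\<lambda>t. v' t - v t)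
      \<le> ennreal (2 * pi) * XU (pdiff f' f) + ennreal (2 * pi) * XV (pdiff g' g)"
      by (intro add_mono XT_le XgT_le r fin profile_pdiff p p')
    also have "\<dots> = ennreal (2 * pi) * (XU (pdiff f' f) + XV (pdiff g' g))" by (rule distrib_left[symmetric])
    also have "\<dots> \<le> ennreal (2 * pi) * (2 * (ennreal LL * (HU (\<lambda>n. fcoeff u0' n - fcoeff u0 n) + HV (\<lambda>n. fcoeff v0' n - fcoeff v0 n))))"
      by (intro mult_left_mono fixed_point_lipschitz[OF T \<rho> sm fg'(1,2) fg(1,2) fg'(3) fg(3) fg'(4,5) fg(4,5)]) simp
    also have "\<dots> = ennreal K * data_norm s1 s2 (u0' - u0) (v0' - v0)"
    proof -
      have "ennreal K = ennreal (2 * pi) * ennreal (2 * LL)" unfolding K_def using LL(1) by (intro ennreal_mult) auto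
      also have "ennreal (2 * LL) = 2 * ennreal LL" using LL(1) by (simp add: ennreal_mult)
      finally have "ennreal K = ennreal (2 * pi) * (2 * ennreal LL)" .
      moreover have "fcoeff (x - y) = (\<lambda>n. fcoeff x n - fcoeff y n)" for x y by (simp add: fun_eq_iff fcoeff_minus)
      ultimately show ?thesis unfolding data_norm_eq by (simp only: mult.assoc)
    qed
    finally show ?thesis .
  qed
  show ?thesis
  proof (rule exI[of _ T], intro conjI allI impI T)
    fix u0 v0 assume "real_valued v0 \<and> data_norm s1 s2 u0 v0 \<le> ennreal R"
    then obtain u v where "sol T u0 v0 u v" using ex by blast
    then show "\<exists>u v. sol T u0 v0 u v \<and> (\<forall>u' v'. sol T u0 v0 u' v' \<longrightarrow> (\<forall>t\<in>{-T..T}. u' t = u t \<and> v' t = v t))"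
      using sol_unique[OF T(1)] by blast
  next
    fix u0 v0 u v and \<epsilon> :: real
    assume h: "real_valued v0 \<and> data_norm s1 s2 u0 v0 \<le> ennreal R \<and> sol T u0 v0 u v" and \<epsilon>: "\<epsilon> > 0"
    have "XT_norm s1 s2 b T (\<lambda>t. u' t - u t) + XgT_norm \<gamma> (s1 - 1/2) (s2 - 1/2) b T (\<lambda>t. v' t - v t) < ennreal \<epsilon>"
      if h': "real_valued v0' \<and> data_norm s1 s2 u0' v0' \<le> ennreal R \<and> sol T u0' v0' u' v' \<and>
          data_norm s1 s2 (u0' - u0) (v0' - v0) < ennreal (\<epsilon> / (2 * K))" for u0' v0' u' v'
    proof -
      have "XT_norm s1 s2 b T (\<lambda>t. u' t - u t) + XgT_norm \<gamma> (s1 - 1/2) (s2 - 1/2) b T (\<lambda>t. v' t - v t)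
        \<le> ennreal K * data_norm s1 s2 (u0' - u0) (v0' - v0)" using h h' by (intro lip) auto
      also have "\<dots> \<le> ennreal K * ennreal (\<epsilon> / (2 * K))" using h' by (intro mult_left_mono) auto
      also have "\<dots> = ennreal (\<epsilon> / 2)" using K \<epsilon> by (simp add: ennreal_mult[symmetric])
      also have "\<dots> < ennreal \<epsilon>" using \<epsilon> by (intro ennreal_lessI) auto
      finally show ?thesis .
    qed
    moreover have "\<epsilon> / (2 * K) > 0" using \<epsilon> K by simp
    ultimately show "\<exists>\<delta>>0. \<forall>u0' v0' u' v'.
          real_valued v0' \<and> data_norm s1 s2 u0' v0' \<le> ennreal R \<and> sol T u0' v0' u' v' \<and>
          data_norm s1 s2 (u0' - u0) (v0' - v0) < ennreal \<delta> \<longrightarrow>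
          XT_norm s1 s2 b T (\<lambda>t. u' t - u t) + XgT_norm \<gamma> (s1 - 1/2) (s2 - 1/2) b T (\<lambda>t. v' t - v t) < ennreal \<epsilon>"
      by blast
  qed
qed

end

theorem theorem1p2:
  fixes \<alpha> \<beta> \<gamma> :: real
  assumes "\<alpha> \<noteq> 0" and "\<beta> \<noteq> 0" and "\<gamma> \<noteq> 0" and "\<bar>\<gamma>\<bar> \<noteq> 1"
  shows "\<exists>\<eta>>0. \<forall>s1 s2 :: real.
    1/2 - \<eta> < s1 \<and> s1 < 1/2 \<and> 1 - \<eta> < s2 \<and> 1/2 < s2 \<and> s2 < 1 \<and> s2 < 2 * s1 \<longrightarrow>
    SBO_locally_well_posed \<alpha> \<beta> \<gamma> s1 s2"
\<comment> \<open>With this witness the condition \<open>1 - \<eta> < s2\<close> is the bound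
  \<open>31/32 < s2\<close> of the locale.\<close>
proof (intro exI[of _ "1/32"] conjI allI impI)
  fix s1 s2 :: real
  assume s: "1/2 - 1/32 < s1 \<and> s1 < 1/2 \<and> 1 - 1/32 < s2 \<and> 1/2 < s2 \<and> s2 < 1 \<and> s2 < 2 * s1"
  have "sbo \<gamma> s1 s2 b" if "1/2 < b" "b < 9/16" for b
    using assms(4) s that by unfold_locales auto
  then show "SBO_locally_well_posed \<alpha> \<beta> \<gamma> s1 s2"
    unfolding SBO_locally_well_posed_def
    by (intro exI[of _ "9/16"] conjI allI impI sbo.locally_well_posed) auto
qed simp

end
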